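(* The finite set of vertices $\{[\mathrm{Fil}_\lambda V]\;:\;\lambda\in\,]0,+\infty]\}$ is contained in an apartment of $\mathcal I(V)$. More precisely, this set is contained in a quarter with apex $[\mathrm{Fil}_\infty V]$ in an apartment. It is also connected (as a set of vertices of the simplicial complex $\mathcal I(V)$).
   Context: $F/\mathbb{Q}_p$ is a finite extension, $\mathcal O=\mathcal O_F$, $\pi$ a uniformizer. $K$ is an algebraically closed field containing $F$, complete for a valuation $v:K\to\mathbb{R}\cup\{+\infty\}$ extending the valuation of $F$ normalized by $v(\pi)=1$. $H$ is a $\pi$-divisible $\mathcal O$-module over $\mathrm{Spec}(\mathcal O_K)$ of dimension $1$ and $\mathcal O$-height $n$ ($\mathcal O$ acting on the Lie algebra through $\mathcal O\to\mathcal O_K$), whose special fibre is formal; $\widehat H$ is the associated formal group. An isomorphism of pointed formal schemes $\widehat H\simeq\mathrm{Spf}(\mathcal O_K[[T]])$ identifies $\widehat H(\mathcal O_K)$ with $\{a\in\mathcal O_K: v(a)>0\}$; for $y\in\widehat H(\mathcal O_K)$, $v(y)$ is the valuation of its coordinate (independent of the choice; $v(0)=+\infty$). $V=V_p(H)$ is the rational Tate module, an $n$-dimensional $F$-vector space, identified with sequences $(x_i)_{i\in\mathbb Z}$, $x_i\in\widehat H(\mathcal O_K)$, $\pi x_{i+1}=x_i$, $x_i=0$ for $i\ll0$. Put $v((x_i)_i)=v(x_0)\in\,]0,+\infty]$ and, for $\lambda\in\,]0,+\infty]$, $\mathrm{Fil}_\lambda V=\{x\in V: v(x)\ge\lambda\}$.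 These are $\mathcal O$-lattices in $V$, and $\mathrm{Fil}_\infty V=T_p(H)$. $\mathcal I(V)$ is the building of $\mathrm{PGL}(V)$: vertices are homothety classes $[\Lambda]$ of lattices of $V$; simplices are finite sets of vertices having representatives with $\pi\Lambda_1\subsetneq\Lambda_d\subsetneq\dots\subsetneq\Lambda_1$. The apartment attached to a basis $(e_1,\dots,e_n)$ of $V$ is the subcomplex with vertices $[\langle\pi^{a_1}e_1,\dots,\pi^{a_n}e_n\rangle]$, $a\in\mathbb Z^n$. A quarter with apex $[\Lambda_0]$ has as vertices $\{[\langle\pi^{a_1}e_1,\dots,\pi^{a_n}e_n\rangle]: a_1\le\dots\le a_n\}$ for some basis $(e_1,\dots,e_n)$ of $\Lambda_0$. *)

theory Defs
  imports
    "HOL-Library.Extended_Real"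
    "HOL-Library.FuncSet"
    "HOL-Computational_Algebra.Computational_Algebra"
    "HOL-Algebra.Module"
begin

section \<open>Valued fields\<close>

definition valuation :: "('k::field \<Rightarrow> ereal) \<Rightarrow> bool" where
  "valuation v \<longleftrightarrow>
     (\<forall>x. v x \<noteq> -\<infinity>) \<and> (\<forall>x. v x = \<infinity> \<longleftrightarrow> x = 0) \<and>
     (\<forall>x y. v (x * y) = v x + v y) \<and> (\<forall>x y. min (v x) (v y) \<le> v (x + y))"

definition val_ring :: "('k::field \<Rightarrow> ereal) \<Rightarrow> 'k set" where
  "val_ring v = {x. 0 \<le> v x}"

definition val_ideal :: "('k::field \<Rightarrow> ereal) \<Rightarrow> 'k set" where
  "val_ideal v = {x. 0 < v x}"

definition val_lim :: "('k::field \<Rightarrow> ereal) \<Rightarrow> (nat \<Rightarrow> 'k) \<Rightarrow> 'k \<Rightarrow> bool" where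
  "val_lim v X l \<longleftrightarrow> (\<forall>M::real. \<exists>N. \<forall>k\<ge>N. ereal M \<le> v (X k - l))"

definition val_Cauchy :: "('k::field \<Rightarrow> ereal) \<Rightarrow> (nat \<Rightarrow> 'k) \<Rightarrow> bool" where
  "val_Cauchy v X \<longleftrightarrow> (\<forall>M::real. \<exists>N. \<forall>j\<ge>N. \<forall>k\<ge>N. ereal M \<le> v (X j - X k))"

definition val_complete :: "('k::field \<Rightarrow> ereal) \<Rightarrow> bool" where
  "val_complete v \<longleftrightarrow> (\<forall>X. val_Cauchy v X \<longrightarrow> (\<exists>l. val_lim v X l))"

text \<open>
  If \<open>v\<close> is complete and \<open>0 < v p\<close>, then \<open>v\<close> restricts to a multiple of the \<open>p\<close>-adic
  valuation on the prime field, whose closure is therefore a copy of \<open>\<rat>\<^sub>p\<close>.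
\<close>

definition p_adic_closure :: "('k::field_char_0 \<Rightarrow> ereal) \<Rightarrow> 'k set" where
  "p_adic_closure v = {l. \<exists>X. range X \<subseteq> \<rat> \<and> val_lim v X l}"

definition is_subfield :: "'k::field set \<Rightarrow> bool" where
  "is_subfield F \<longleftrightarrow> 0 \<in> F \<and> 1 \<in> F \<and>
     (\<forall>x\<in>F. \<forall>y\<in>F. x + y \<in> F \<and> x * y \<in> F) \<and> (\<forall>x\<in>F. - x \<in> F \<and> inverse x \<in> F)"

definition p_adic_subfield :: "nat \<Rightarrow> ('k::field_char_0 \<Rightarrow> ereal) \<Rightarrow> 'k set \<Rightarrow> bool" where
  "p_adic_subfield p v F \<longleftrightarrow>
     prime p \<and> 0 < v (of_nat p) \<and> is_subfield F \<and> p_adic_closure v \<subseteq> F \<and>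
     (\<exists>B. finite B \<and> B \<subseteq> F \<and>
        (\<forall>x\<in>F. \<exists>c. (\<forall>b\<in>B. c b \<in> p_adic_closure v) \<and> x = (\<Sum>b\<in>B. c b * b)))"

text \<open>\<open>\<pi>\<close> is a uniformizer of \<open>F\<close> and \<open>v\<close> is normalized by \<open>v \<pi> = 1\<close>.\<close>

definition normalized_uniformizer :: "('k::field \<Rightarrow> ereal) \<Rightarrow> 'k set \<Rightarrow> 'k \<Rightarrow> bool" where
  "normalized_uniformizer v F \<pi> \<longleftrightarrow>
     \<pi> \<in> F \<and> v \<pi> = 1 \<and> (\<forall>x\<in>F. x \<noteq> 0 \<longrightarrow> (\<exists>m::int. v x = ereal (of_int m)))"

definition residue_card :: "('k::field \<Rightarrow> ereal) \<Rightarrow> 'k set \<Rightarrow> nat" where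
  "residue_card v F =
     card ((\<lambda>x. {y \<in> F \<inter> val_ring v. y - x \<in> val_ideal v}) ` (F \<inter> val_ring v))"


section \<open>Finite locally free commutative group schemes\<close>

text \<open>
  Over the local ring \<open>R = \<O>\<^sub>K\<close> a finite locally free algebra is free, so after the choice of
  a basis it is \<open>R\<^sup>d\<close>, whose elements are coordinate functions supported on \<open>{..<d}\<close>.
  An element of its tensor square is a \<open>d \<times> d\<close> matrix: \<open>P\<close> stands for the sum of the
  \<open>P i j \<cdot> (b\<^sub>i \<otimes> b\<^sub>j)\<close>.
\<close>

type_synonym 'k coords = "nat \<Rightarrow> 'k"

definition free_mod :: "'k::field set \<Rightarrow> nat \<Rightarrow> 'k coords set" where
  "free_mod R d = {x. (\<forall>i<d. x i \<in> R) \<and> (\<forall>i\<ge>d. x i = 0)}"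

definition bvec :: "nat \<Rightarrow> 'k::field coords" where
  "bvec i = (\<lambda>j. if j = i then 1 else 0)"

definition linear_form :: "'k::field set \<Rightarrow> nat \<Rightarrow> ('k coords \<Rightarrow> 'k) \<Rightarrow> bool" where
  "linear_form R d f \<longleftrightarrow>
     (\<forall>x\<in>free_mod R d. \<forall>y\<in>free_mod R d. f (\<lambda>i. x i + y i) = f x + f y) \<and>
     (\<forall>c\<in>R. \<forall>x\<in>free_mod R d. f (\<lambda>i. c * x i) = c * f x)"

record 'k hopf =
  rk :: nat
  hmul :: "'k coords \<Rightarrow> 'k coords \<Rightarrow> 'k coords"
  hone :: "'k coords"
  comul :: "'k coords \<Rightarrow> nat \<Rightarrow> nat \<Rightarrow> 'k"
  counit :: "'k coords \<Rightarrow> 'k"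
  antipode :: "'k coords \<Rightarrow> 'k coords"

abbreviation elts :: "'k::field set \<Rightarrow> 'k hopf \<Rightarrow> 'k coords set" where
  "elts R A \<equiv> free_mod R (rk A)"

definition tensor_mul :: "'k::field hopf \<Rightarrow> (nat \<Rightarrow> nat \<Rightarrow> 'k) \<Rightarrow> (nat \<Rightarrow> nat \<Rightarrow> 'k) \<Rightarrow> nat \<Rightarrow> nat \<Rightarrow> 'k" where
  "tensor_mul A P Q = (\<lambda>j k. \<Sum>a<rk A. \<Sum>b<rk A. \<Sum>a'<rk A. \<Sum>b'<rk A.
     P a b * Q a' b' * hmul A (bvec a) (bvec a') j * hmul A (bvec b) (bvec b') k)"

definition comm_algebra :: "'k::field set \<Rightarrow> 'k hopf \<Rightarrow> bool" where
  "comm_algebra R A \<longleftrightarrow>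
     hone A \<in> elts R A \<and>
     (\<forall>x\<in>elts R A. \<forall>y\<in>elts R A. hmul A x y \<in> elts R A) \<and>
     (\<forall>x\<in>elts R A. \<forall>j. linear_form R (rk A) (\<lambda>y. hmul A x y j)) \<and>
     (\<forall>x\<in>elts R A. \<forall>y\<in>elts R A. hmul A x y = hmul A y x) \<and>
     (\<forall>x\<in>elts R A. \<forall>y\<in>elts R A. \<forall>z\<in>elts R A.
        hmul A (hmul A x y) z = hmul A x (hmul A y z)) \<and>
     (\<forall>x\<in>elts R A. hmul A (hone A) x = x)"

definition finite_comm_group_scheme :: "'k::field set \<Rightarrow> 'k hopf \<Rightarrow> bool" where
  "finite_comm_group_scheme R A \<longleftrightarrow>
     comm_algebra R A \<and>
     \<comment> \<open>comultiplication and counit are algebra homomorphisms\<close>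
     (\<forall>x\<in>elts R A. \<forall>j<rk A. \<forall>k<rk A. comul A x j k \<in> R) \<and>
     (\<forall>j<rk A. \<forall>k<rk A. linear_form R (rk A) (\<lambda>x. comul A x j k)) \<and>
     (\<forall>j<rk A. \<forall>k<rk A. comul A (hone A) j k = hone A j * hone A k) \<and>
     (\<forall>x\<in>elts R A. \<forall>y\<in>elts R A. \<forall>j<rk A. \<forall>k<rk A.
        comul A (hmul A x y) j k = tensor_mul A (comul A x) (comul A y) j k) \<and>
     (\<forall>x\<in>elts R A. counit A x \<in> R) \<and>
     linear_form R (rk A) (counit A) \<and>
     counit A (hone A) = 1 \<and>
     (\<forall>x\<in>elts R A. \<forall>y\<in>elts R A. counit A (hmul A x y) = counit A x * counit A y) \<and>
     \<comment> \<open>coassociativity, cocommutativity, counit law\<close>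
     (\<forall>x\<in>elts R A. \<forall>j<rk A. \<forall>k<rk A. \<forall>l<rk A.
        (\<Sum>i<rk A. comul A x i l * comul A (bvec i) j k) =
        (\<Sum>i<rk A. comul A x j i * comul A (bvec i) k l)) \<and>
     (\<forall>x\<in>elts R A. \<forall>j<rk A. \<forall>k<rk A. comul A x j k = comul A x k j) \<and>
     (\<forall>x\<in>elts R A. \<forall>k<rk A. (\<Sum>j<rk A. comul A x j k * counit A (bvec j)) = x k) \<and>
     \<comment> \<open>antipode law\<close>
     (\<forall>x\<in>elts R A. antipode A x \<in> elts R A) \<and>
     (\<forall>j. linear_form R (rk A) (\<lambda>x. antipode A x j)) \<and>
     (\<forall>x\<in>elts R A. \<forall>l<rk A.
        (\<Sum>j<rk A. \<Sum>k<rk A. comul A x j k * hmul A (antipode A (bvec j)) (bvec k) l) =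
        counit A x * hone A l)"

text \<open>A homomorphism of Hopf algebras \<open>A \<rightarrow> B\<close>, i.e. of group schemes \<open>Spec B \<rightarrow> Spec A\<close>.\<close>

definition hopf_hom :: "'k::field set \<Rightarrow> 'k hopf \<Rightarrow> 'k hopf \<Rightarrow> ('k coords \<Rightarrow> 'k coords) \<Rightarrow> bool" where
  "hopf_hom R A B f \<longleftrightarrow>
     (\<forall>x\<in>elts R A. f x \<in> elts R B) \<and>
     (\<forall>j. linear_form R (rk A) (\<lambda>x. f x j)) \<and>
     f (hone A) = hone B \<and>
     (\<forall>x\<in>elts R A. \<forall>y\<in>elts R A. f (hmul A x y) = hmul B (f x) (f y)) \<and>
     (\<forall>x\<in>elts R A. counit B (f x) = counit A x) \<and>
     (\<forall>x\<in>elts R A. \<forall>j<rk B. \<forall>k<rk B.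
        comul B (f x) j k =
          (\<Sum>a<rk A. \<Sum>b<rk A. comul A x a b * f (bvec a) j * f (bvec b) k))"

definition hopf_ideal_gen :: "'k::field set \<Rightarrow> 'k hopf \<Rightarrow> 'k coords set \<Rightarrow> 'k coords set" where
  "hopf_ideal_gen R A S = \<Inter> {J. S \<subseteq> J \<and> J \<subseteq> elts R A \<and> (\<lambda>i. 0) \<in> J \<and>
     (\<forall>x\<in>J. \<forall>y\<in>J. (\<lambda>i. x i + y i) \<in> J) \<and> (\<forall>a\<in>elts R A. \<forall>x\<in>J. hmul A a x \<in> J)}"

definition aug_ideal :: "'k::field set \<Rightarrow> 'k hopf \<Rightarrow> 'k coords set" where
  "aug_ideal R A = {x \<in> elts R A. counit A x = 0}"

definition aug_ideal_sq :: "'k::field set \<Rightarrow> 'k hopf \<Rightarrow> 'k coords set" where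
  "aug_ideal_sq R A = hopf_ideal_gen R A {hmul A x y | x y. x \<in> aug_ideal R A \<and> y \<in> aug_ideal R A}"


section \<open>\<open>\<pi>\<close>-divisible \<open>\<O>\<close>-modules\<close>

text \<open>
  \<open>level H i\<close> is the Hopf algebra of \<open>H[\<pi>\<^sup>i]\<close>, \<open>restr H i\<close> is the restriction of functions
  from \<open>H[\<pi>\<^sup>i\<^sup>+\<^sup>1]\<close> to \<open>H[\<pi>\<^sup>i]\<close>, and \<open>act H i a\<close> is the comorphism of multiplication by
  \<open>a \<in> \<O>\<close> on \<open>H[\<pi>\<^sup>i]\<close>.
\<close>

record 'k pi_div =
  level :: "nat \<Rightarrow> 'k hopf"
  restr :: "nat \<Rightarrow> 'k coords \<Rightarrow> 'k coords"
  act :: "nat \<Rightarrow> 'k \<Rightarrow> 'k coords \<Rightarrow> 'k coords"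

text \<open>
  Tate's description of a divisible group, with \<open>\<pi>\<close> in place of \<open>p\<close>: \<open>H[\<pi>\<^sup>i]\<close> has order
  \<open>q\<^sup>n\<^sup>i\<close>, and \<open>H[\<pi>\<^sup>i]\<close> is the scheme-theoretic kernel of \<open>\<pi>\<^sup>i\<close> on \<open>H[\<pi>\<^sup>i\<^sup>+\<^sup>1]\<close>.
\<close>

definition pi_divisible_module ::
    "('k::field \<Rightarrow> ereal) \<Rightarrow> 'k set \<Rightarrow> 'k \<Rightarrow> nat \<Rightarrow> 'k pi_div \<Rightarrow> bool" where
  "pi_divisible_module v F \<pi> n H \<longleftrightarrow>
     (let R = val_ring v; OF = F \<inter> val_ring v in
      (\<forall>i. finite_comm_group_scheme R (level H i) \<and>
           rk (level H i) = residue_card v F ^ (n * i)) \<and>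
      (\<forall>i. hopf_hom R (level H (Suc i)) (level H i) (restr H i) \<and>
           restr H i ` elts R (level H (Suc i)) = elts R (level H i) \<and>
           {x \<in> elts R (level H (Suc i)). restr H i x = (\<lambda>j. 0)} =
             hopf_ideal_gen R (level H (Suc i))
               (act H (Suc i) (\<pi> ^ i) ` aug_ideal R (level H (Suc i)))) \<and>
      (\<forall>i. \<forall>a\<in>OF. hopf_hom R (level H i) (level H i) (act H i a)) \<and>
      (\<forall>i. \<forall>a\<in>OF. \<forall>x\<in>elts R (level H (Suc i)).
           restr H i (act H (Suc i) a x) = act H i a (restr H i x)) \<and>
      (\<forall>i. \<forall>x\<in>elts R (level H i). act H i 1 x = x) \<and>
      (\<forall>i. \<forall>a\<in>OF. \<forall>b\<in>OF. \<forall>x\<in>elts R (level H i).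
           act H i (a * b) x = act H i a (act H i b x)) \<and>
      (\<forall>i. \<forall>a\<in>OF. \<forall>b\<in>OF. \<forall>x\<in>elts R (level H i). \<forall>l<rk (level H i).
           act H i (a + b) x l =
             (\<Sum>j<rk (level H i). \<Sum>k<rk (level H i). comul (level H i) x j k *
                hmul (level H i) (act H i a (bvec j)) (act H i b (bvec k)) l)))"

text \<open>
  The cotangent space \<open>\<omega>\<^sub>H\<close> is the limit of the \<open>I\<^sub>i/I\<^sub>i\<^sup>2\<close>, \<open>I\<^sub>i\<close> being the augmentation ideal
  of \<open>H[\<pi>\<^sup>i]\<close>. Its elements are given by representatives; \<open>H\<close> has dimension \<open>d\<close> if
  it is free of rank \<open>d\<close>.
\<close>

definition cotangent_reps :: "('k::field \<Rightarrow> ereal) \<Rightarrow> 'k pi_div \<Rightarrow> (nat \<Rightarrow> 'k coords) set" where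
  "cotangent_reps v H = {w. \<forall>i. w i \<in> aug_ideal (val_ring v) (level H i) \<and>
     (\<lambda>l. restr H i (w (Suc i)) l - w i l) \<in> aug_ideal_sq (val_ring v) (level H i)}"

definition pi_div_dimension :: "('k::field \<Rightarrow> ereal) \<Rightarrow> 'k pi_div \<Rightarrow> nat \<Rightarrow> bool" where
  "pi_div_dimension v H d \<longleftrightarrow>
     (\<exists>w. (\<forall>r<d. w r \<in> cotangent_reps v H) \<and>
        (\<forall>a\<in>cotangent_reps v H. \<exists>!c. c \<in> {..<d} \<rightarrow>\<^sub>E val_ring v \<and>
           (\<forall>i. (\<lambda>l. a i l - (\<Sum>r<d. c r * w r i l)) \<in> aug_ideal_sq (val_ring v) (level H i))))"

text \<open>\<open>\<O>\<close> acts on the cotangent spaces, dually on the Lie algebra, through \<open>\<O> \<rightarrow> \<O>\<^sub>K\<close>.\<close>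

definition natural_Lie_action :: "('k::field \<Rightarrow> ereal) \<Rightarrow> 'k set \<Rightarrow> 'k pi_div \<Rightarrow> bool" where
  "natural_Lie_action v F H \<longleftrightarrow>
     (\<forall>i. \<forall>a\<in>F \<inter> val_ring v. \<forall>x\<in>aug_ideal (val_ring v) (level H i).
        (\<lambda>l. act H i a x l - a * x l) \<in> aug_ideal_sq (val_ring v) (level H i))"

text \<open>The special fibre is formal: its unit section is a nil-immersion on each \<open>H[\<pi>\<^sup>i]\<close>.\<close>

definition formal_special_fibre :: "('k::field \<Rightarrow> ereal) \<Rightarrow> 'k pi_div \<Rightarrow> bool" where
  "formal_special_fibre v H \<longleftrightarrow>
     (\<forall>i. \<forall>x\<in>aug_ideal (val_ring v) (level H i).
        \<exists>N. \<forall>l. (hmul (level H i) x ^^ N) (hone (level H i)) l \<in> val_ideal v)"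


section \<open>The associated formal group\<close>

text \<open>
  The formal group of \<open>H\<close> is \<open>Spf\<close> of the limit of the algebras of the \<open>H[\<pi>\<^sup>i]\<close>, whose
  topology is the limit of their \<open>\<pi>\<close>-adic topologies.
\<close>

definition formal_ring :: "('k::field \<Rightarrow> ereal) \<Rightarrow> 'k pi_div \<Rightarrow> (nat \<Rightarrow> 'k coords) set" where
  "formal_ring v H = {\<alpha>. \<forall>i. \<alpha> i \<in> elts (val_ring v) (level H i) \<and> restr H i (\<alpha> (Suc i)) = \<alpha> i}"

definition integral_fps :: "('k::field \<Rightarrow> ereal) \<Rightarrow> 'k fps set" where
  "integral_fps v = {f. \<forall>j. fps_nth f j \<in> val_ring v}"

text \<open>
  A coordinate is an isomorphism of \<open>\<O>\<^sub>K[[T]]\<close> (with its \<open>(\<pi>,T)\<close>-adic topology) with the ring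
  of the formal group, as augmented topological \<open>\<O>\<^sub>K\<close>-algebras.
\<close>

definition formal_coordinate ::
    "('k::field \<Rightarrow> ereal) \<Rightarrow> 'k pi_div \<Rightarrow> ('k fps \<Rightarrow> nat \<Rightarrow> 'k coords) \<Rightarrow> bool" where
  "formal_coordinate v H \<phi> \<longleftrightarrow>
     bij_betw \<phi> (integral_fps v) (formal_ring v H) \<and>
     (\<forall>f\<in>integral_fps v. \<forall>g\<in>integral_fps v.
        \<phi> (f + g) = (\<lambda>i l. \<phi> f i l + \<phi> g i l) \<and>
        \<phi> (f * g) = (\<lambda>i. hmul (level H i) (\<phi> f i) (\<phi> g i))) \<and>
     (\<forall>c\<in>val_ring v. \<phi> (fps_const c) = (\<lambda>i l. c * hone (level H i) l)) \<and>
     (\<forall>f\<in>integral_fps v. \<forall>i. counit (level H i) (\<phi> f i) = fps_nth f 0) \<and>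
     (\<forall>i m. \<exists>N::nat. \<forall>f\<in>integral_fps v.
        (\<forall>j<N. ereal (real N) \<le> v (fps_nth f j)) \<longrightarrow> (\<forall>l. ereal (real m) \<le> v (\<phi> f i l))) \<and>
     (\<forall>N. \<exists>i m::nat. \<forall>f\<in>integral_fps v.
        (\<forall>l. ereal (real m) \<le> v (\<phi> f i l)) \<longrightarrow> (\<forall>j<N. ereal (real N) \<le> v (fps_nth f j)))"

text \<open>An \<open>\<O>\<^sub>K\<close>-point of the formal group is a continuous homomorphism to \<open>\<O>\<^sub>K\<close>.\<close>

type_synonym 'k fpoint = "(nat \<Rightarrow> 'k coords) \<Rightarrow> 'k"

definition formal_points :: "('k::field \<Rightarrow> ereal) \<Rightarrow> 'k pi_div \<Rightarrow> 'k fpoint set" where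
  "formal_points v H = {x \<in> formal_ring v H \<rightarrow>\<^sub>E val_ring v.
     (\<forall>\<alpha>\<in>formal_ring v H. \<forall>\<beta>\<in>formal_ring v H.
        x (\<lambda>i l. \<alpha> i l + \<beta> i l) = x \<alpha> + x \<beta> \<and>
        x (\<lambda>i. hmul (level H i) (\<alpha> i) (\<beta> i)) = x \<alpha> * x \<beta>) \<and>
     (\<forall>c\<in>val_ring v. x (\<lambda>i l. c * hone (level H i) l) = c) \<and>
     (\<forall>M::nat. \<exists>i m::nat. \<forall>\<alpha>\<in>formal_ring v H.
        (\<forall>l. ereal (real m) \<le> v (\<alpha> i l)) \<longrightarrow> ereal (real M) \<le> v (x \<alpha>))}"

definition fpoint_zero :: "('k::field \<Rightarrow> ereal) \<Rightarrow> 'k pi_div \<Rightarrow> 'k fpoint" where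
  "fpoint_zero v H = (\<lambda>\<alpha>\<in>formal_ring v H. counit (level H 0) (\<alpha> 0))"

text \<open>
  \<open>x + y\<close> is the composite of the comultiplication with \<open>x \<otimes> y\<close>. Modulo a power of \<open>\<pi>\<close> the
  points \<open>x\<close> and \<open>y\<close> factor through \<open>level H i\<close> for \<open>i\<close> large, so they may be evaluated on lifts
  \<open>E j\<close> of the basis vectors of \<open>level H i\<close>.
\<close>

definition fpoint_add :: "('k::field \<Rightarrow> ereal) \<Rightarrow> 'k pi_div \<Rightarrow> 'k fpoint \<Rightarrow> 'k fpoint \<Rightarrow> 'k fpoint" where
  "fpoint_add v H x y = (\<lambda>\<alpha>\<in>formal_ring v H. THE c. \<forall>M::nat. \<exists>i0. \<forall>i\<ge>i0. \<forall>E.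
     (\<forall>j<rk (level H i). E j \<in> formal_ring v H \<and> E j i = bvec j) \<longrightarrow>
     ereal (real M) \<le> v (c - (\<Sum>j<rk (level H i). \<Sum>k<rk (level H i).
       comul (level H i) (\<alpha> i) j k * x (E j) * y (E k))))"

definition fpoint_act :: "('k::field \<Rightarrow> ereal) \<Rightarrow> 'k pi_div \<Rightarrow> 'k \<Rightarrow> 'k fpoint \<Rightarrow> 'k fpoint" where
  "fpoint_act v H a x = (\<lambda>\<alpha>\<in>formal_ring v H. x (\<lambda>i. act H i a (\<alpha> i)))"


section \<open>The rational Tate module\<close>

text \<open>
  Since \<open>\<pi> x\<^sub>i\<^sub>+\<^sub>1 = x\<^sub>i\<close>, an element \<open>c = \<pi>\<^sup>-\<^sup>m a\<close> of \<open>F\<close> with \<open>a \<in> \<O>\<close> acts by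
  \<open>(c x)\<^sub>i = a x\<^sub>i\<^sub>+\<^sub>m\<close>; this does not depend on \<open>m\<close>. The fields \<open>mult\<close> and \<open>one\<close> are irrelevant.
\<close>

definition rational_Tate_module ::
    "('k::field \<Rightarrow> ereal) \<Rightarrow> 'k \<Rightarrow> 'k pi_div \<Rightarrow> ('k, int \<Rightarrow> 'k fpoint) module" where
  "rational_Tate_module v \<pi> H =
    \<lparr> carrier = {x. (\<forall>i. x i \<in> formal_points v H) \<and>
                    (\<forall>i. fpoint_act v H \<pi> (x (i + 1)) = x i) \<and>
                    (\<exists>N. \<forall>i\<le>N. x i = fpoint_zero v H)},
      mult = undefined,
      one = undefined,
      zero = (\<lambda>i. fpoint_zero v H),
      add = (\<lambda>x y i. fpoint_add v H (x i) (y i)),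
      smult = (\<lambda>c x i. let m = (LEAST m::nat. \<pi> ^ m * c \<in> val_ring v)
                       in fpoint_act v H (\<pi> ^ m * c) (x (i + int m))) \<rparr>"

definition Tate_fil ::
    "('k::field \<Rightarrow> ereal) \<Rightarrow> 'k \<Rightarrow> 'k pi_div \<Rightarrow> ('k fps \<Rightarrow> nat \<Rightarrow> 'k coords) \<Rightarrow> ereal \<Rightarrow>
     (int \<Rightarrow> 'k fpoint) set" where
  "Tate_fil v \<pi> H \<phi> r =
     {x \<in> carrier (rational_Tate_module v \<pi> H). r \<le> v (x 0 (\<phi> fps_X))}"


section \<open>The building of \<open>PGL(V)\<close>\<close>

text \<open>
  Here \<open>V\<close> is an \<open>n\<close>-dimensional \<open>F\<close>-vector space and \<open>OF\<close> the ring of integers of \<open>F\<close>.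
\<close>

definition vs_basis :: "'k set \<Rightarrow> ('k, 'a) module \<Rightarrow> nat \<Rightarrow> (nat \<Rightarrow> 'a) \<Rightarrow> bool" where
  "vs_basis F V n e \<longleftrightarrow>
     e \<in> {..<n} \<rightarrow> carrier V \<and>
     (\<forall>x\<in>carrier V. \<exists>!c. c \<in> {..<n} \<rightarrow>\<^sub>E F \<and> x = (\<Oplus>\<^bsub>V\<^esub>i\<in>{..<n}. c i \<odot>\<^bsub>V\<^esub> e i))"

definition int_span :: "'k set \<Rightarrow> ('k, 'a) module \<Rightarrow> nat \<Rightarrow> (nat \<Rightarrow> 'a) \<Rightarrow> 'a set" where
  "int_span OF V n e = {(\<Oplus>\<^bsub>V\<^esub>i\<in>{..<n}. c i \<odot>\<^bsub>V\<^esub> e i) | c. c \<in> {..<n} \<rightarrow> OF}"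

definition lattice_basis :: "'k set \<Rightarrow> 'k set \<Rightarrow> ('k, 'a) module \<Rightarrow> nat \<Rightarrow> 'a set \<Rightarrow> (nat \<Rightarrow> 'a) \<Rightarrow> bool" where
  "lattice_basis F OF V n \<Lambda> e \<longleftrightarrow> vs_basis F V n e \<and> \<Lambda> = int_span OF V n e"

definition is_lattice :: "'k set \<Rightarrow> 'k set \<Rightarrow> ('k, 'a) module \<Rightarrow> nat \<Rightarrow> 'a set \<Rightarrow> bool" where
  "is_lattice F OF V n \<Lambda> \<longleftrightarrow> (\<exists>e. lattice_basis F OF V n \<Lambda> e)"

definition homothety_class :: "'k::field set \<Rightarrow> ('k, 'a) module \<Rightarrow> 'a set \<Rightarrow> 'a set set" where
  "homothety_class F V \<Lambda> = {(\<lambda>x. c \<odot>\<^bsub>V\<^esub> x) ` \<Lambda> | c. c \<in> F \<and> c \<noteq> 0}"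

definition building_vertices :: "'k::field set \<Rightarrow> 'k set \<Rightarrow> ('k, 'a) module \<Rightarrow> nat \<Rightarrow> 'a set set set" where
  "building_vertices F OF V n = {homothety_class F V \<Lambda> | \<Lambda>. is_lattice F OF V n \<Lambda>}"

definition building_simplex ::
    "'k::field set \<Rightarrow> 'k set \<Rightarrow> 'k \<Rightarrow> ('k, 'a) module \<Rightarrow> nat \<Rightarrow> 'a set set set \<Rightarrow> bool" where
  "building_simplex F OF \<pi> V n \<sigma> \<longleftrightarrow>
     (\<exists>d\<ge>1. \<exists>\<Lambda>::nat \<Rightarrow> 'a set.
        (\<forall>i\<in>{1..d}. is_lattice F OF V n (\<Lambda> i)) \<and>
        (\<forall>i\<in>{1..<d}. \<Lambda> (Suc i) \<subset> \<Lambda> i) \<and>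
        (\<lambda>x. \<pi> \<odot>\<^bsub>V\<^esub> x) ` \<Lambda> 1 \<subset> \<Lambda> d \<and>
        \<sigma> = (\<lambda>i. homothety_class F V (\<Lambda> i)) ` {1..d})"

definition basis_vertex ::
    "'k::field set \<Rightarrow> 'k set \<Rightarrow> 'k \<Rightarrow> ('k, 'a) module \<Rightarrow> nat \<Rightarrow> (nat \<Rightarrow> 'a) \<Rightarrow> (nat \<Rightarrow> int) \<Rightarrow> 'a set set" where
  "basis_vertex F OF \<pi> V n e a =
     homothety_class F V (int_span OF V n (\<lambda>i. (\<pi> powi a i) \<odot>\<^bsub>V\<^esub> e i))"

text \<open>Apartments and quarters are represented by their sets of vertices.\<close>

definition is_apartment ::
    "'k::field set \<Rightarrow> 'k set \<Rightarrow> 'k \<Rightarrow> ('k, 'a) module \<Rightarrow> nat \<Rightarrow> 'a set set set \<Rightarrow> bool" where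
  "is_apartment F OF \<pi> V n \<A> \<longleftrightarrow>
     (\<exists>e. vs_basis F V n e \<and> \<A> = {basis_vertex F OF \<pi> V n e a | a. True})"

definition is_quarter ::
    "'k::field set \<Rightarrow> 'k set \<Rightarrow> 'k \<Rightarrow> ('k, 'a) module \<Rightarrow> nat \<Rightarrow> 'a set set \<Rightarrow> 'a set set set \<Rightarrow> bool" where
  "is_quarter F OF \<pi> V n apex Q \<longleftrightarrow>
     (\<exists>\<Lambda>0 e. apex = homothety_class F V \<Lambda>0 \<and> lattice_basis F OF V n \<Lambda>0 e \<and>
        Q = {basis_vertex F OF \<pi> V n e a | a. \<forall>i j. i \<le> j \<and> j < n \<longrightarrow> a i \<le> a j})"

text \<open>Connected: any two vertices of \<open>S\<close> are joined by an edge path with vertices in \<open>S\<close>.\<close>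

definition connected_vertices ::
    "'k::field set \<Rightarrow> 'k set \<Rightarrow> 'k \<Rightarrow> ('k, 'a) module \<Rightarrow> nat \<Rightarrow> 'a set set set \<Rightarrow> bool" where
  "connected_vertices F OF \<pi> V n S \<longleftrightarrow>
     (\<forall>s\<in>S. \<forall>t\<in>S. (s, t) \<in> {(a, b). a \<in> S \<and> b \<in> S \<and> building_simplex F OF \<pi> V n {a, b}}\<^sup>*)"

end

theory Submission
  imports Defs "HOL-Library.Function_Algebras"
begin

text \<open>
  The level \<open>i\<close> algebra \<open>A\<^sub>i\<close> is generated by the coordinate \<open>T\<close>, hence is \<open>R[T]/(P\<^sub>i)\<close> with \<open>P\<^sub>i\<close> monic of
  degree \<open>q\<^sup>n\<^sup>i\<close>. The polynomial \<open>P\<^sub>i\<close> is separable: a tangent vector at a point can be translated to the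
  origin, where \<open>\<pi>\<^sup>i = 0\<close> acts on it as multiplication by the scalar \<open>\<pi>\<^sup>i\<close>. So the \<open>\<pi>\<^sup>i\<close>-torsion points
  correspond to the \<open>q\<^sup>n\<^sup>i\<close> roots of \<open>P\<^sub>i\<close>.

  Since \<open>[\<pi>](T)\<close> and \<open>P\<^sub>1(T)\<close> generate the same ideal, \<open>v(\<pi> x)\<close> is the sum of the \<open>v(x - s)\<close>
  over \<open>s \<in> H[\<pi>]\<close>. A preimage \<open>x\<close> of \<open>y\<close> under \<open>\<pi>\<close> with \<open>v(x)\<close> maximal satisfies \<open>v(x - s) = min(v(x), v(s))\<close>,
  hence \<open>v(y) = g(v(x))\<close> with \<open>g(r) = \<Sum>\<^sub>s min(r, v(s))\<close>, which is strictly increasing. Choose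
  a basis of \<open>H[\<pi>]\<close> over the residue field greedily, each vector of maximal valuation outside the span of the
  previous ones, and lift it successively to preimages of maximal valuation. This gives a
  basis \<open>e\<^sub>1, \<dots>, e\<^sub>n\<close> of the Tate module for which \<open>v(\<Sum>\<^sub>i c\<^sub>i e\<^sub>i)\<close> is the minimum of the \<open>v(c\<^sub>i e\<^sub>i)\<close>
  and \<open>v(\<pi>\<^sup>-\<^sup>k e\<^sub>i)\<close> decreases with \<open>i\<close>. So each \<open>Fil\<^sub>\<lambda>\<close> is spanned by some \<open>\<pi>\<^sup>-\<^sup>a\<^sup>(\<^sup>i\<^sup>) e\<^sub>i\<close> with \<open>a\<close> decreasing.
\<close>

subsection \<open>Preliminaries\<close>

text \<open>Points of the formal group are continuous homomorphisms, and their sum is defined by a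
  limit. The entries of an element of \<open>V\<close> are torsion, since the sequence vanishes at
  very negative indices, and on torsion points the law becomes algebraic at a finite level; so only
  the torsion module \<open>M\<close> is studied. The maximal ideal of \<open>R\<close> is not
  finitely generated, so the classical Nakayama argument is replaced by approximation in powers of
  one element of positive valuation, chosen to dominate finitely many error terms. Two facts on
  \<open>g\<close> carry the splitting of the valuation over the basis from level k to level k + 1:
  \<open>g (w x)\<close> is at most \<open>w\<close> of \<pi> x, with equality exactly for preimages
  of maximal valuation, and \<open>g\<close> is strictly increasing. Terms surviving \<pi> are
  compared after multiplication by it; the others add up to a \<pi>-torsion point, governed by the
  greedy choice. Coordinates on \<open>V\<close> are limits of coordinates at the levels; they stay
  in F because F is closed in K. Finiteness of the vertex set also comes from \<open>g\<close>: for
  small r, \<open>Fil (g r)\<close> is \<pi> times \<open>Fil r\<close>.\<close>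

lemma sum_fun_apply: "(\<Sum>x\<in>A. f x) i = (\<Sum>x\<in>A. f x i)" for f :: "'a \<Rightarrow> 'b \<Rightarrow> 'c::comm_monoid_add"
  by (induction A rule: infinite_finite_induct) auto

lemma fps_of_poly_X: "fps_of_poly [:0, 1:] = fps_X"
  by (rule fps_ext) (auto simp: coeff_pCons fps_X_def split: nat.splits)

text \<open>Scalars are taken in the whole field so that \<open>level_degree_eq\<close> can compare
  two families spanning one level by their dimension over K.\<close>

interpretation fun_space: vector_space "\<lambda>(c::'a::field) (x::nat \<Rightarrow> 'a) i. c * x i"
  by unfold_locales (auto simp: algebra_simps fun_eq_iff)

text \<open>Split off one root a, leaving q. As a is a simple root of p, it is not a root of q, and
  a double root of q would be a double root of p.\<close>

lemma separable_monic_prod_roots: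
  fixes p :: "'a::{alg_closed_field} poly"
  assumes "lead_coeff p = 1" "\<And>a. poly p a = 0 \<Longrightarrow> poly (pderiv p) a \<noteq> 0"
  shows "p = (\<Prod>a\<in>{a. poly p a = 0}. [:- a, 1:])" "card {a. poly p a = 0} = degree p"
proof -
  have "p = (\<Prod>a\<in>{a. poly p a = 0}. [:- a, 1:]) \<and> card {a. poly p a = 0} = degree p"
    using assms
  proof (induction "degree p" arbitrary: p)
    case 0
    then have "p = 1" by (metis degree_0_id lead_coeff_pCons(2) one_pCons of_nat_1 degree_eq_zeroE)
    then show ?case by simp
  next
    case (Suc m)
    then obtain a where a: "poly p a = 0" using alg_closed_imp_poly_has_root[of p] by auto
    then obtain q where q: "p = [:- a, 1:] * q" using poly_eq_0_iff_dvd by blast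
    have q0: "q \<noteq> 0" using q Suc.hyps(2) by auto
    have deg: "degree p = Suc (degree q)" unfolding q using q0 by (subst degree_mult_eq) auto
    have lead: "lead_coeff q = 1" using Suc.prems(1) unfolding q lead_coeff_mult by simp
    have pd: "poly (pderiv p) b = poly q b + (b - a) * poly (pderiv q) b" for b
    proof -
      have "pderiv p = [:- a, 1:] * pderiv q + q * pderiv [:- a, 1:]" unfolding q by (rule pderiv_mult)
      moreover have "pderiv [:- a, 1:] = 1" by (simp add: pderiv_pCons)
      ultimately show ?thesis by (simp only: poly_add poly_mult mult_1_right) (simp add: algebra_simps)
    qed
    have sep: "poly (pderiv q) b \<noteq> 0" if "poly q b = 0" for b
      using Suc.prems(2)[of b] that pd[of b] by (auto simp: q)
    have IH: "q = (\<Prod>a\<in>{a. poly q a = 0}. [:- a, 1:])" "card {a. poly q a = 0} = degree q"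
      using Suc.hyps(1)[OF _ lead sep] deg Suc.hyps(2) by auto
    have qa: "poly q a \<noteq> 0" using Suc.prems(2)[OF a] pd[of a] by simp
    have roots: "{b. poly p b = 0} = insert a {b. poly q b = 0}" by (auto simp: q)
    have fin: "finite {b. poly q b = 0}" using q0 by (rule poly_roots_finite)
    show ?case unfolding roots using fin qa IH deg q by simp
  qed
  then show "p = (\<Prod>a\<in>{a. poly p a = 0}. [:- a, 1:])" "card {a. poly p a = 0} = degree p" by auto
qed

lemma sum_swap2: "(\<Sum>j\<in>A. \<Sum>l\<in>B. \<Sum>a\<in>C. G j l a) = (\<Sum>a\<in>C. \<Sum>j\<in>A. \<Sum>l\<in>B. G j l a)"
  for G :: "_ \<Rightarrow> _ \<Rightarrow> _ \<Rightarrow> 'x::comm_monoid_add"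
proof -
  have "(\<Sum>j\<in>A. \<Sum>l\<in>B. \<Sum>a\<in>C. G j l a) = (\<Sum>j\<in>A. \<Sum>a\<in>C. \<Sum>l\<in>B. G j l a)"
    by (rule sum.cong[OF refl], rule sum.swap)
  then show ?thesis by (simp add: sum.swap[of _ C A])
qed

subsection \<open>Valued fields\<close>

locale valued_field =
  fixes v :: "'k::field \<Rightarrow> ereal"
  assumes valuation: "valuation v"
begin

abbreviation R :: "'k set" where "R \<equiv> val_ring v"
abbreviation \<mm> :: "'k set" where "\<mm> \<equiv> val_ideal v"

lemma v_not_MInfty [simp]: "v x \<noteq> - \<infinity>"
  and v_eq_PInfty_iff [simp]: "v x = \<infinity> \<longleftrightarrow> x = 0"
  and v_mult: "v (x * y) = v x + v y"
  and v_add: "min (v x) (v y) \<le> v (x + y)"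
  using valuation unfolding valuation_def by blast+

lemma v_0 [simp]: "v 0 = \<infinity>" by simp

lemma v_real: "x \<noteq> 0 \<Longrightarrow> \<exists>r. v x = ereal r"
  by (cases "v x") auto

lemma v_1 [simp]: "v 1 = 0"
proof -
  obtain r where r: "v 1 = ereal r" using v_real[of 1] by auto
  have "v 1 = v 1 + v 1" using v_mult[of 1 1] by simp
  with r show ?thesis by simp
qed

lemma v_minus_1 [simp]: "v (- 1) = 0"
proof -
  obtain r where r: "v (-1) = ereal r" using v_real[of "-1"] by auto
  have "v 1 = v (-1) + v (-1)" using v_mult[of "-1" "-1"] by simp
  with r show ?thesis by simp
qed

lemma v_minus [simp]: "v (- x) = v x"
  using v_mult[of "-1" x] by simp

lemma v_diff_commute: "v (x - y) = v (y - x)"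
  using v_minus[of "x - y"] by simp

lemma v_add_ge: "r \<le> v x \<Longrightarrow> r \<le> v y \<Longrightarrow> r \<le> v (x + y)"
  using v_add[of x y] by (meson min.boundedI order_trans)

lemma v_add_gt: "r < v x \<Longrightarrow> r < v y \<Longrightarrow> r < v (x + y)"
  using v_add[of x y] by (metis less_le_trans min_less_iff_conj)

lemma v_diff_ge: "r \<le> v x \<Longrightarrow> r \<le> v y \<Longrightarrow> r \<le> v (x - y)"
  using v_add_ge[of r x "- y"] by simp

lemma v_diff_gt: "r < v x \<Longrightarrow> r < v y \<Longrightarrow> r < v (x - y)"
  using v_add_gt[of r x "- y"] by simp

lemma v_sum_ge: "(\<And>i. i \<in> A \<Longrightarrow> r \<le> v (f i)) \<Longrightarrow> r \<le> v (sum f A)"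
  by (induction A rule: infinite_finite_induct) (auto intro: v_add_ge)

lemma v_mult_ge: "r \<le> v x \<Longrightarrow> 0 \<le> v y \<Longrightarrow> r \<le> v (x * y)"
  unfolding v_mult using add_mono[of r "v x" 0 "v y"] by simp

lemma v_mult_ge': "0 \<le> v x \<Longrightarrow> r \<le> v y \<Longrightarrow> r \<le> v (x * y)"
  using v_mult_ge[of r y x] by (simp add: mult.commute)

lemma v_prod: "finite A \<Longrightarrow> v (\<Prod>a\<in>A. f a) = (\<Sum>a\<in>A. v (f a))"
  by (induction A rule: finite_induct) (auto simp: v_mult)

lemma v_power: "v (x ^ m) = ereal (real m) * v x"
proof (induction m)
  case (Suc m)
  show ?case
  proof (cases "x = 0")
    case False
    then obtain r where "v x = ereal r" using v_real by blast
    then show ?thesis using Suc by (simp add: v_mult algebra_simps)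
  qed simp
qed simp

lemma v_inverse: "x \<noteq> 0 \<Longrightarrow> v (inverse x) = - v x"
proof -
  assume x: "x \<noteq> 0"
  obtain r s where rs: "v x = ereal r" "v (inverse x) = ereal s" using v_real x by (metis inverse_nonzero_iff_nonzero)
  have "v (x * inverse x) = 0" using x by simp
  then show ?thesis using rs by (simp add: v_mult)
qed

lemma v_divide: "y \<noteq> 0 \<Longrightarrow> v (x / y) = v x - v y"
  by (simp add: divide_inverse v_mult v_inverse minus_ereal_def)

lemma v_div_ge_0: "y \<noteq> 0 \<Longrightarrow> v y \<le> v x \<Longrightarrow> 0 \<le> v (x / y)"
  using v_real[of y] by (cases "v x") (auto simp: v_divide)

lemma R_iff: "x \<in> R \<longleftrightarrow> 0 \<le> v x" by (simp add: val_ring_def)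
lemma \<mm>_iff: "x \<in> \<mm> \<longleftrightarrow> 0 < v x" by (simp add: val_ideal_def)

lemma R_0 [simp, intro]: "0 \<in> R" and R_1 [simp, intro]: "1 \<in> R"
  and R_add [intro]: "x \<in> R \<Longrightarrow> y \<in> R \<Longrightarrow> x + y \<in> R"
  and R_diff [intro]: "x \<in> R \<Longrightarrow> y \<in> R \<Longrightarrow> x - y \<in> R"
  and R_minus [intro]: "x \<in> R \<Longrightarrow> - x \<in> R"
  and R_mult [intro]: "x \<in> R \<Longrightarrow> y \<in> R \<Longrightarrow> x * y \<in> R"
  by (auto simp: R_iff v_mult intro: v_add_ge v_diff_ge)

lemma R_sum [intro]: "(\<And>i. i \<in> A \<Longrightarrow> f i \<in> R) \<Longrightarrow> sum f A \<in> R"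
  by (auto simp: R_iff intro: v_sum_ge)

lemma R_power [intro]: "x \<in> R \<Longrightarrow> x ^ m \<in> R"
  by (induction m) auto

lemma \<mm>_0 [simp, intro]: "0 \<in> \<mm>" and \<mm>_R: "x \<in> \<mm> \<Longrightarrow> x \<in> R"
  and \<mm>_add [intro]: "x \<in> \<mm> \<Longrightarrow> y \<in> \<mm> \<Longrightarrow> x + y \<in> \<mm>"
  and \<mm>_diff [intro]: "x \<in> \<mm> \<Longrightarrow> y \<in> \<mm> \<Longrightarrow> x - y \<in> \<mm>"
  and \<mm>_minus [intro]: "x \<in> \<mm> \<Longrightarrow> - x \<in> \<mm>"
  and \<mm>_mult: "x \<in> \<mm> \<Longrightarrow> y \<in> R \<Longrightarrow> x * y \<in> \<mm>"
  and \<mm>_mult': "x \<in> R \<Longrightarrow> y \<in> \<mm> \<Longrightarrow> x * y \<in> \<mm>"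
  by (auto simp: \<mm>_iff R_iff v_mult intro: v_add_gt v_diff_gt add_pos_nonneg add_nonneg_pos)

lemma \<mm>_sum [intro]: "(\<And>i. i \<in> A \<Longrightarrow> f i \<in> \<mm>) \<Longrightarrow> sum f A \<in> \<mm>"
  by (induction A rule: infinite_finite_induct) auto

lemma R_unit: "x \<in> R \<Longrightarrow> x \<notin> \<mm> \<Longrightarrow> x \<noteq> 0 \<and> inverse x \<in> R \<and> v x = 0"
proof -
  assume "x \<in> R" "x \<notin> \<mm>"
  then have "v x = 0" by (simp add: R_iff \<mm>_iff)
  moreover from this have "x \<noteq> 0" by auto
  ultimately show "x \<noteq> 0 \<and> inverse x \<in> R \<and> v x = 0" by (simp add: R_iff v_inverse)
qed

lemma \<mm>_powerD: "x ^ N \<in> \<mm> \<Longrightarrow> x \<in> \<mm>"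
  by (cases "v x") (auto simp: \<mm>_iff v_power zero_less_mult_iff)

subsection \<open>Polynomials over the valuation ring\<close>

definition Rpoly :: "'k poly set" where
  "Rpoly = {f. \<forall>j. coeff f j \<in> R}"

lemma Rpoly_0 [simp, intro]: "0 \<in> Rpoly" and Rpoly_1 [simp, intro]: "1 \<in> Rpoly"
  and Rpoly_add [intro]: "f \<in> Rpoly \<Longrightarrow> g \<in> Rpoly \<Longrightarrow> f + g \<in> Rpoly"
  and Rpoly_diff [intro]: "f \<in> Rpoly \<Longrightarrow> g \<in> Rpoly \<Longrightarrow> f - g \<in> Rpoly"
  and Rpoly_minus [intro]: "f \<in> Rpoly \<Longrightarrow> - f \<in> Rpoly"
  and Rpoly_mult [intro]: "f \<in> Rpoly \<Longrightarrow> g \<in> Rpoly \<Longrightarrow> f * g \<in> Rpoly"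
  and Rpoly_smult [intro]: "c \<in> R \<Longrightarrow> f \<in> Rpoly \<Longrightarrow> Polynomial.smult c f \<in> Rpoly"
  and Rpoly_monom [intro]: "c \<in> R \<Longrightarrow> monom c j \<in> Rpoly"
  and Rpoly_const [intro]: "c \<in> R \<Longrightarrow> [:c:] \<in> Rpoly"
  and Rpoly_pCons [intro]: "c \<in> R \<Longrightarrow> f \<in> Rpoly \<Longrightarrow> pCons c f \<in> Rpoly"
  by (auto simp: Rpoly_def coeff_mult one_pCons coeff_pCons split: nat.splits)

lemma Rpoly_sum [intro]: "(\<And>i. i \<in> A \<Longrightarrow> f i \<in> Rpoly) \<Longrightarrow> sum f A \<in> Rpoly"
  by (induction A rule: infinite_finite_induct) auto

lemma poly_R: "f \<in> Rpoly \<Longrightarrow> a \<in> R \<Longrightarrow> poly f a \<in> R"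
  unfolding poly_altdef by (intro R_sum R_mult R_power) (auto simp: Rpoly_def)

lemma Rpoly_div_monic:
  assumes P: "P \<in> Rpoly" "lead_coeff P = 1" and f: "f \<in> Rpoly"
  shows "\<exists>g\<in>Rpoly. \<exists>r\<in>Rpoly. f = P * g + r \<and> (r = 0 \<or> degree r < degree P)"
  using f
proof (induction "degree f" arbitrary: f rule: less_induct)
  case less
  show ?case
  proof (cases "f = 0 \<or> degree f < degree P")
    case True
    then show ?thesis using less.prems by (intro bexI[of _ 0] bexI[of _ f]) auto
  next
    case False
    define h where "h = monom (lead_coeff f) (degree f - degree P)"
    have h: "h \<in> Rpoly" unfolding h_def using less.prems by (auto simp: Rpoly_def)
    have P0: "P \<noteq> 0" using P by auto
    have lh: "lead_coeff h = lead_coeff f" "degree h = degree f - degree P" "h \<noteq> 0"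
      using False by (auto simp: h_def degree_monom_eq)
    have dPh: "degree (P * h) = degree f" using False P0 lh by (simp add: degree_mult_eq)
    have lPh: "lead_coeff (P * h) = lead_coeff f" using P lh by (simp only: lead_coeff_mult mult_1)
    define f' where "f' = f - P * h"
    have f': "f' \<in> Rpoly" using h P less.prems by (auto simp: f'_def)
    show ?thesis
    \<comment> \<open>Cancelling the leading term of a constant does not lower its degree; but then
      P = 1 and f itself is the quotient.\<close>
    proof (cases "degree f = 0")
      case True
      then have "degree P = 0" using False by simp
      then have "P = 1" using P by (metis degree_0_id lead_coeff_pCons(2) one_pCons of_nat_1)
      then show ?thesis using less.prems by (intro bexI[of _ f] bexI[of _ 0]) auto
    next
      case nz: False
      have "degree f' < degree f"
      proof -
        have "degree f' \<le> degree f" using dPh by (simp add: f'_def degree_diff_le)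
        moreover have "coeff f' (degree f) = 0" using lPh dPh by (simp add: f'_def)
        ultimately show ?thesis using nz
          by (metis le_neq_implies_less leading_coeff_0_iff degree_0)
      qed
      from less.hyps[OF this f'] obtain g r where
        "g \<in> Rpoly" "r \<in> Rpoly" "f' = P * g + r" "r = 0 \<or> degree r < degree P" by blast
      then show ?thesis using h
        by (intro bexI[of _ "g + h"] bexI[of _ r]) (auto simp: f'_def algebra_simps)
    qed
  qed
qed

lemma root_diff: "f \<in> Rpoly \<Longrightarrow> a \<in> R \<Longrightarrow> b \<in> R \<Longrightarrow> \<exists>r\<in>R. poly f a - poly f b = (a - b) * r"
proof (induction f)
  case (pCons c f)
  then have "f \<in> Rpoly" by (auto simp: Rpoly_def coeff_pCons split: nat.splits)
  then obtain r where r: "r \<in> R" "poly f a - poly f b = (a - b) * r" using pCons by blast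
  have "poly (pCons c f) a - poly (pCons c f) b = (a - b) * (poly f a + b * r)"
  proof -
    have *: "poly f b = poly f a - (a - b) * r" using r(2) by (simp add: algebra_simps)
    show ?thesis unfolding poly_pCons * by (simp add: algebra_simps)
  qed
  moreover have "poly f a + b * r \<in> R" using r pCons.prems \<open>f \<in> Rpoly\<close> poly_R by auto
  ultimately show ?case by blast
qed auto

text \<open>Polynomials over R do not expand distances. Through \<open>v_ev_diff\<close> this makes
  translations by torsion points non-expanding.\<close>

lemma v_poly_diff: "f \<in> Rpoly \<Longrightarrow> a \<in> R \<Longrightarrow> b \<in> R \<Longrightarrow> v (a - b) \<le> v (poly f a - poly f b)"
  using root_diff[of f a b] by (auto simp: R_iff intro: v_mult_ge)

text \<open>If a root a were outside R, its inverse b would have positive valuation, and multiplying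
  the equation by the power of b of exponent \<open>degree P\<close> would write 1 as an element of
  the maximal ideal.\<close>

lemma monic_root_in_R:
  assumes P: "P \<in> Rpoly" "lead_coeff P = 1" and a: "poly P a = 0"
  shows "a \<in> R"
proof (rule ccontr)
  assume "a \<notin> R"
  then have va: "v a < 0" by (simp add: R_iff)
  then have a0: "a \<noteq> 0" by auto
  define b where "b = inverse a"
  have b: "b \<in> \<mm>" using va a0 by (simp add: \<mm>_iff b_def v_inverse)
  let ?d = "degree P"
  have d: "?d > 0" using P(2) a by (metis degree_eq_zeroE gr0I lead_coeff_pCons(2) poly_pCons
        mult_zero_right add.right_neutral poly_0 zero_neq_one)
  have "0 = b ^ ?d * poly P a" using a by simp
  also have "\<dots> = (\<Sum>j\<le>?d. coeff P j * b ^ (?d - j))"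
    unfolding poly_altdef sum_distrib_left
  proof (rule sum.cong[OF refl])
    fix j assume "j \<in> {..?d}"
    then have "b ^ ?d = b ^ (?d - j) * b ^ j" by (simp flip: power_add)
    moreover have "b ^ j * a ^ j = 1" using a0 by (simp add: b_def flip: power_mult_distrib)
    ultimately show "b ^ ?d * (coeff P j * a ^ j) = coeff P j * b ^ (?d - j)"
      by (simp add: algebra_simps)
  qed
  also have "\<dots> = (\<Sum>j<?d. coeff P j * b ^ (?d - j)) + 1"
    using P(2) by (simp add: lessThan_Suc_atMost[symmetric])
  finally have "1 = - (\<Sum>j<?d. coeff P j * b ^ (?d - j))" by (simp add: eq_neg_iff_add_eq_0 add.commute)
  moreover have "(\<Sum>j<?d. coeff P j * b ^ (?d - j)) \<in> \<mm>"
  proof (intro \<mm>_sum \<mm>_mult')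
    fix j assume "j \<in> {..<?d}"
    then obtain e where e: "?d - j = Suc e" by (metis Suc_diff_Suc lessThan_iff)
    show "b ^ (?d - j) \<in> \<mm>" unfolding e power_Suc using b by (intro \<mm>_mult) (auto simp: \<mm>_R)
  qed (use P in \<open>auto simp: Rpoly_def\<close>)
  ultimately have "(1::'k) \<in> \<mm>" by (metis \<mm>_minus)
  then show False by (simp add: \<mm>_iff)
qed

subsection \<open>Limits\<close>

lemma v_ge_all_imp_0: "(\<And>M::nat. ereal (real M) \<le> v x) \<Longrightarrow> x = 0"
proof (rule ccontr)
  assume *: "\<And>M::nat. ereal (real M) \<le> v x" and "x \<noteq> 0"
  then obtain r where "v x = ereal r" using v_real by blast
  with * show False by (metis ereal_less_eq(3) linorder_not_less reals_Archimedean2)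
qed

lemma val_lim_unique: "val_lim v X l \<Longrightarrow> val_lim v X l' \<Longrightarrow> l = l'"
proof -
  assume l: "val_lim v X l" and l': "val_lim v X l'"
  have "l' - l = 0"
  proof (rule v_ge_all_imp_0)
    fix M :: nat
    obtain N N' where N: "\<forall>k\<ge>N. ereal M \<le> v (X k - l)" "\<forall>k\<ge>N'. ereal M \<le> v (X k - l')"
      using l l' unfolding val_lim_def by meson
    have "ereal M \<le> v (X (max N N') - l)" "ereal M \<le> v (X (max N N') - l')"
      using N by auto
    then show "ereal (real M) \<le> v (l' - l)"
      using v_diff_ge[of "ereal M" "X (max N N') - l" "X (max N N') - l'"] by simp
  qed
  then show ?thesis by simp
qed

lemma val_lim_const [intro]: "val_lim v (\<lambda>_. c) c"
  by (auto simp: val_lim_def)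

lemma val_lim_add: "val_lim v X l \<Longrightarrow> val_lim v Y m \<Longrightarrow> val_lim v (\<lambda>k. X k + Y k) (l + m)"
  unfolding val_lim_def
proof
  fix M :: real
  assume "\<forall>M::real. \<exists>N. \<forall>k\<ge>N. ereal M \<le> v (X k - l)" "\<forall>M::real. \<exists>N. \<forall>k\<ge>N. ereal M \<le> v (Y k - m)"
  then obtain N N' where N: "\<forall>k\<ge>N. ereal M \<le> v (X k - l)" "\<forall>k\<ge>N'. ereal M \<le> v (Y k - m)" by meson
  have "ereal M \<le> v (X k + Y k - (l + m))" if "k \<ge> max N N'" for k
    using N v_add_ge[of "ereal M" "X k - l" "Y k - m"] that by (simp add: algebra_simps)
  then show "\<exists>N. \<forall>k\<ge>N. ereal M \<le> v (X k + Y k - (l + m))" by blast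
qed

lemma val_lim_mult_const: "val_lim v X l \<Longrightarrow> val_lim v (\<lambda>k. X k * c) (l * c)"
proof (cases "c = 0")
  case False
  assume X: "val_lim v X l"
  obtain r where r: "v c = ereal r" using v_real False by blast
  show ?thesis unfolding val_lim_def
  proof
    fix M :: real
    obtain N where N: "\<forall>k\<ge>N. ereal (M - r) \<le> v (X k - l)" using X unfolding val_lim_def by blast
    have "ereal M \<le> v (X k * c - l * c)" if "k \<ge> N" for k
    proof -
      have "ereal M \<le> v (X k - l) + ereal r"
        using N that by (metis add_right_mono diff_add_cancel plus_ereal.simps(1))
      also have "\<dots> = v (X k * c - l * c)" using r v_mult[of "X k - l" c] by (simp add: algebra_simps)
      finally show ?thesis .
    qed
    then show "\<exists>N. \<forall>k\<ge>N. ereal M \<le> v (X k * c - l * c)" by blast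
  qed
qed auto

lemma val_lim_bound: "val_lim v X l \<Longrightarrow> (\<And>k. k \<ge> N \<Longrightarrow> ereal M \<le> v (X k - c)) \<Longrightarrow> ereal M \<le> v (l - c)"
proof -
  assume X: "val_lim v X l" and b: "\<And>k. k \<ge> N \<Longrightarrow> ereal M \<le> v (X k - c)"
  obtain N' where N': "\<forall>k\<ge>N'. ereal M \<le> v (X k - l)" using X unfolding val_lim_def by blast
  show ?thesis using v_diff_ge[of "ereal M" "X (max N N') - c" "X (max N N') - l"] b[of "max N N'"] N' by auto
qed

lemma R_closed: "val_lim v X l \<Longrightarrow> (\<And>k. X k \<in> R) \<Longrightarrow> l \<in> R"
  using val_lim_bound[of X l 0 0 0] by (simp add: R_iff zero_ereal_def)

lemma val_lim_imp_Cauchy: "val_lim v X l \<Longrightarrow> val_Cauchy v X"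
  unfolding val_Cauchy_def
proof
  fix M :: real assume "val_lim v X l"
  then obtain N where N: "\<forall>k\<ge>N. ereal M \<le> v (X k - l)" unfolding val_lim_def by blast
  have "ereal M \<le> v (X j - X k)" if "j \<ge> N" "k \<ge> N" for j k
    using v_diff_ge[of "ereal M" "X j - l" "X k - l"] N that by auto
  then show "\<exists>N. \<forall>j\<ge>N. \<forall>k\<ge>N. ereal M \<le> v (X j - X k)" by blast
qed

lemma val_lim_v_eventually:
  assumes "val_lim v X l" "l \<noteq> 0" shows "\<exists>N. \<forall>k\<ge>N. v (X k) = v l"
proof -
  obtain r where r: "v l = ereal r" using v_real assms(2) by blast
  obtain N where N: "\<forall>k\<ge>N. ereal (r + 1) \<le> v (X k - l)" using assms unfolding val_lim_def by blast
  have "v (X k) = v l" if "k \<ge> N" for k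
  proof -
    have lt: "v l < v (X k - l)"
      using N that r by (metis ereal_less_eq(3) less_add_one linorder_not_le order_trans)
    have 1: "v l \<le> v (X k)" using v_add_ge[of "v l" "X k - l" l] lt by auto
    have 2: "v (X k) \<le> v l"
    proof (rule ccontr)
      assume "\<not> v (X k) \<le> v l"
      then have "v l < v l" using v_diff_gt[of "v l" "X k" "X k - l"] lt
        by (simp only: not_le diff_diff_eq2 add_diff_cancel_left')
      then show False by simp
    qed
    show ?thesis using 1 2 by simp
  qed
  then show ?thesis by blast
qed

lemma val_lim_inverse:
  assumes X: "val_lim v X l" and l: "l \<noteq> 0" shows "val_lim v (\<lambda>k. inverse (X k)) (inverse l)"
  unfolding val_lim_def
proof
  fix M :: real
  obtain r where r: "v l = ereal r" using v_real l by blast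
  obtain N where N: "\<forall>k\<ge>N. v (X k) = v l" using val_lim_v_eventually[OF assms] by blast
  \<comment> \<open>The difference of the inverses of x and l is (l - x) / (x l), so inverting costs
    2 r once v x = v l = r.\<close>
  obtain N' where N': "\<forall>k\<ge>N'. ereal (M + 2 * r) \<le> v (X k - l)" using X unfolding val_lim_def by blast
  have "ereal M \<le> v (inverse (X k) - inverse l)" if k: "k \<ge> max N N'" for k
  proof -
    have Xk: "X k \<noteq> 0" "v (X k) = ereal r" using N r k l by (auto simp flip: v_eq_PInfty_iff)
    have "inverse (X k) - inverse l = - (X k - l) * inverse (X k) * inverse l"
      using Xk l by (simp add: field_simps)
    then have eq: "v (inverse (X k) - inverse l) = v (X k - l) + - ereal r + - ereal r"
      using Xk r l by (simp only: v_mult v_minus v_inverse not_False_eq_True)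
    have "ereal (M + 2 * r) \<le> v (X k - l)" using N' k by auto
    then show ?thesis unfolding eq by (cases "v (X k - l)") auto
  qed
  then show "\<exists>N. \<forall>k\<ge>N. ereal M \<le> v (inverse (X k) - inverse l)" by blast
qed

lemma val_CauchyI_Suc:
  assumes "\<And>k. ereal (real k * r) \<le> v (X (Suc k) - X k)" "r > 0"
  shows "val_Cauchy v X"
proof -
  have *: "ereal (real k * r) \<le> v (X (k + m) - X k)" for k m
  proof (induction m)
    case (Suc m)
    have "real k * r \<le> real (k + m) * r" using assms(2) by simp
    then have "ereal (real k * r) \<le> v (X (Suc (k + m)) - X (k + m))"
      using assms(1)[of "k + m"] by (meson ereal_less_eq(3) order_trans)
    from v_add_ge[OF this Suc] show ?case by simp
  qed simp
  show ?thesis unfolding val_Cauchy_def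
  proof
    fix M :: real
    obtain N where N: "real N > M / r" using reals_Archimedean2 by blast
    then have NM: "M \<le> real N * r" using assms(2) by (simp add: field_simps)
    have "ereal M \<le> v (X j - X k)" if "j \<ge> N" "k \<ge> N" for j k
    proof -
      have "ereal (real N * r) \<le> v (X j - X N)" "ereal (real N * r) \<le> v (X k - X N)"
        using *[of N "j - N"] *[of N "k - N"] that by auto
      from v_diff_ge[OF this] show ?thesis using NM by (simp add: order_trans[of "ereal M" "ereal (real N * r)"])
    qed
    then show "\<exists>N. \<forall>j\<ge>N. \<forall>k\<ge>N. ereal M \<le> v (X j - X k)" by blast
  qed
qed

lemma val_lim_telescope:
  assumes step: "\<And>k. ereal (real k * r) \<le> v (X (Suc k) - X k)" and r: "0 \<le> r" and lim: "val_lim v X l"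
  shows "ereal (real k * r) \<le> v (l - X k)"
proof (rule val_lim_bound[OF lim])
  fix m assume "m \<ge> k"
  then show "ereal (real k * r) \<le> v (X m - X k)"
  proof (induction m rule: dec_induct)
    case (step m)
    have "real k * r \<le> real m * r" using step.hyps r by (simp add: mult_right_mono)
    then have "ereal (real k * r) \<le> v (X (Suc m) - X m)"
      using assms(1)[of m] by (meson ereal_less_eq(3) order_trans)
    from v_add_ge[OF this step.IH] show ?case by simp
  qed simp
qed

end

locale complete_valued_field = valued_field v for v :: "'k::field_char_0 \<Rightarrow> ereal" +
  assumes complete: "val_complete v"
begin

section \<open>Finite-dimensional spaces over the closure of the prime field are closed\<close>

abbreviation Qp :: "'k set" where "Qp \<equiv> p_adic_closure v"

definition lim_closed :: "'k set \<Rightarrow> bool" where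
  "lim_closed W \<longleftrightarrow> (\<forall>X l. range X \<subseteq> W \<longrightarrow> val_lim v X l \<longrightarrow> l \<in> W)"

lemma Rats_Qp: "x \<in> \<rat> \<Longrightarrow> x \<in> Qp"
  unfolding p_adic_closure_def by (intro CollectI exI[of _ "\<lambda>_. x"]) auto

text \<open>Diagonal choice: replace the k-th term by a rational number whose distance from it has
  valuation at least k.\<close>

lemma Qp_closed: "lim_closed Qp"
  unfolding lim_closed_def
proof (intro allI impI)
  fix X l assume X: "range X \<subseteq> Qp" "val_lim v X l"
  have "\<exists>y\<in>\<rat>. ereal (real k) \<le> v (y - X k)" for k
  proof -
    have "X k \<in> Qp" using X by blast
    then obtain Y where "range Y \<subseteq> \<rat>" "val_lim v Y (X k)" unfolding p_adic_closure_def by blast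
    then show ?thesis unfolding val_lim_def by (metis range_subsetD order_refl)
  qed
  then obtain y where y: "\<And>k. y k \<in> \<rat>" "\<And>k. ereal (real k) \<le> v (y k - X k)" by metis
  have "val_lim v y l" unfolding val_lim_def
  proof
    fix M :: real
    obtain N where N: "\<forall>k\<ge>N. ereal M \<le> v (X k - l)" using X unfolding val_lim_def by blast
    obtain N' where N': "real N' \<ge> M" using real_arch_simple by blast
    have "ereal M \<le> v (y k - l)" if k: "k \<ge> max N N'" for k
    proof -
      have "ereal M \<le> ereal (real k)" using N' k by auto
      then have "ereal M \<le> v (y k - X k)" using y(2) by (rule order_trans)
      from v_add_ge[OF this, of "X k - l"] N k show ?thesis by simp
    qed
    then show "\<exists>N. \<forall>k\<ge>N. ereal M \<le> v (y k - l)" by blast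
  qed
  then show "l \<in> Qp" using y(1) unfolding p_adic_closure_def by blast
qed

lemma Qp_add: assumes "x \<in> Qp" "y \<in> Qp" shows "x + y \<in> Qp"
proof -
  obtain X Y where "range X \<subseteq> \<rat>" "val_lim v X x" "range Y \<subseteq> \<rat>" "val_lim v Y y"
    using assms unfolding p_adic_closure_def by blast
  then have "range (\<lambda>k. X k + Y k) \<subseteq> \<rat>" "val_lim v (\<lambda>k. X k + Y k) (x + y)"
    by (auto simp: image_subset_iff intro!: val_lim_add Rats_add)
  then show ?thesis unfolding p_adic_closure_def by blast
qed

text \<open>One factor at a time is sent to its limit, so that only multiplication by constants has
  to be continuous.\<close>

lemma Qp_mult: assumes "x \<in> Qp" "y \<in> Qp" shows "x * y \<in> Qp"
proof -
  obtain X Y where X: "range X \<subseteq> \<rat>" "val_lim v X x" and Y: "range Y \<subseteq> \<rat>" "val_lim v Y y"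
    using assms unfolding p_adic_closure_def by blast
  have "X k * y \<in> Qp" for k
  proof -
    have "range (\<lambda>j. Y j * X k) \<subseteq> \<rat>" using X Y by (auto simp: image_subset_iff intro!: Rats_mult)
    moreover have "val_lim v (\<lambda>j. Y j * X k) (X k * y)"
      using val_lim_mult_const[OF Y(2), of "X k"] by (simp add: mult.commute)
    ultimately show ?thesis unfolding p_adic_closure_def by blast
  qed
  then have "range (\<lambda>k. X k * y) \<subseteq> Qp" by blast
  then show ?thesis using Qp_closed val_lim_mult_const[OF X(2)] unfolding lim_closed_def by blast
qed

lemma Qp_minus: "x \<in> Qp \<Longrightarrow> - x \<in> Qp"
  using Qp_mult[OF Rats_Qp[of "-1"]] by simp

lemma Qp_inverse: assumes "x \<in> Qp" shows "inverse x \<in> Qp"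
proof (cases "x = 0")
  case False
  obtain X where X: "range X \<subseteq> \<rat>" "val_lim v X x" using assms unfolding p_adic_closure_def by blast
  have "range (\<lambda>k. inverse (X k)) \<subseteq> \<rat>" using X(1) by auto
  then show ?thesis using val_lim_inverse[OF X(2) False] unfolding p_adic_closure_def by blast
qed (simp add: Rats_Qp)

definition Qp_span :: "'k set \<Rightarrow> 'k set" where
  "Qp_span B = {\<Sum>b\<in>B. c b * b | c. \<forall>b\<in>B. c b \<in> Qp}"

lemma Qp_span_add: "x \<in> Qp_span B \<Longrightarrow> y \<in> Qp_span B \<Longrightarrow> x + y \<in> Qp_span B"
proof -
  assume "x \<in> Qp_span B" "y \<in> Qp_span B"
  then obtain c d where "\<forall>b\<in>B. c b \<in> Qp" "x = (\<Sum>b\<in>B. c b * b)" "\<forall>b\<in>B. d b \<in> Qp" "y = (\<Sum>b\<in>B. d b * b)"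
    unfolding Qp_span_def by blast
  then show ?thesis unfolding Qp_span_def
    by (intro CollectI exI[of _ "\<lambda>b. c b + d b"]) (auto simp: Qp_add sum.distrib ring_distribs)
qed

lemma Qp_span_mult: "x \<in> Qp \<Longrightarrow> y \<in> Qp_span B \<Longrightarrow> x * y \<in> Qp_span B"
proof -
  assume x: "x \<in> Qp" and "y \<in> Qp_span B"
  then obtain d where "\<forall>b\<in>B. d b \<in> Qp" "y = (\<Sum>b\<in>B. d b * b)"
    unfolding Qp_span_def by blast
  then show ?thesis unfolding Qp_span_def using x
    by (intro CollectI exI[of _ "\<lambda>b. x * d b"]) (auto simp: Qp_mult sum_distrib_left mult.assoc)
qed

lemma Qp_span_diff: "x \<in> Qp_span B \<Longrightarrow> y \<in> Qp_span B \<Longrightarrow> x - y \<in> Qp_span B"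
  using Qp_span_add[of x B "- 1 * y"] Qp_span_mult[of "-1" y B] Rats_Qp[of "-1"] by simp

text \<open>
  The distance from \<open>b\<close> to a closed subspace not containing it is positive, so the
  coefficients of \<open>b\<close> in a Cauchy sequence form a Cauchy sequence.
\<close>

lemma Qp_span_closed: "finite B \<Longrightarrow> lim_closed (Qp_span B)"
proof (induction B rule: finite_induct)
  case empty
  have "l = 0" if "val_lim v (\<lambda>_. 0) l" for l using that val_lim_unique by blast
  moreover have "X = (\<lambda>_. 0)" if "range X \<subseteq> {0}" for X :: "nat \<Rightarrow> 'k" using that by auto
  ultimately show ?case unfolding lim_closed_def Qp_span_def by auto
next
  case (insert b B)
  have span: "x \<in> Qp_span (insert b B) \<longleftrightarrow> (\<exists>c\<in>Qp. x - c * b \<in> Qp_span B)" for x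
  proof
    assume "x \<in> Qp_span (insert b B)"
    then obtain c where c: "\<forall>b\<in>insert b B. c b \<in> Qp" "x = (\<Sum>b\<in>insert b B. c b * b)"
      unfolding Qp_span_def by blast
    then have "x - c b * b = (\<Sum>b\<in>B. c b * b)" using insert.hyps by simp
    then show "\<exists>c\<in>Qp. x - c * b \<in> Qp_span B" using c(1) unfolding Qp_span_def by blast
  next
    assume "\<exists>c\<in>Qp. x - c * b \<in> Qp_span B"
    then obtain c d where c: "c \<in> Qp" "\<forall>b\<in>B. d b \<in> Qp" "x - c * b = (\<Sum>b\<in>B. d b * b)"
      unfolding Qp_span_def by blast
    have "x = (\<Sum>a\<in>insert b B. (d(b := c)) a * a)"
    proof -
      have "(\<Sum>a\<in>B. (d(b := c)) a * a) = (\<Sum>b\<in>B. d b * b)"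
        using insert.hyps by (intro sum.cong) auto
      then show ?thesis using c(3) insert.hyps by (simp add: algebra_simps)
    qed
    moreover have "\<forall>a\<in>insert b B. (d(b := c)) a \<in> Qp" using c by auto
    ultimately show "x \<in> Qp_span (insert b B)" unfolding Qp_span_def by blast
  qed
  show ?case
  proof (cases "b \<in> Qp_span B")
    case True
    have "Qp_span (insert b B) = Qp_span B"
    proof (intro equalityI subsetI)
      fix x assume "x \<in> Qp_span (insert b B)"
      then obtain c where "c \<in> Qp" "x - c * b \<in> Qp_span B" using span by blast
      then show "x \<in> Qp_span B" using Qp_span_add[OF _ Qp_span_mult[OF _ True]] by fastforce
    next
      fix x assume "x \<in> Qp_span B"
      then show "x \<in> Qp_span (insert b B)" unfolding span using Rats_Qp[of 0] by (intro bexI[of _ 0]) auto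
    qed
    then show ?thesis using insert.IH by simp
  next
    case False
    have "\<exists>M::nat. \<forall>w\<in>Qp_span B. v (b - w) \<le> ereal (real M)"
    proof (rule ccontr)
      assume "\<not> ?thesis"
      then have "\<forall>M. \<exists>w\<in>Qp_span B. ereal (real M) \<le> v (b - w)" by (meson linear)
      then obtain w where w: "\<And>M::nat. w M \<in> Qp_span B" "\<And>M. ereal (real M) \<le> v (b - w M)" by metis
      have "val_lim v w b" unfolding val_lim_def
      proof
        fix M :: real
        obtain N where N: "real N \<ge> M" using real_arch_simple by blast
        have "ereal M \<le> v (w k - b)" if "k \<ge> N" for k
          using w(2)[of k] N that
          by (simp add: v_diff_commute[of "w k"] order_trans[of "ereal M" "ereal (real k)"])
        then show "\<exists>N. \<forall>k\<ge>N. ereal M \<le> v (w k - b)" by blast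
      qed
      then show False using w(1) insert.IH False unfolding lim_closed_def by blast
    qed
    then obtain M :: nat where M: "\<And>w. w \<in> Qp_span B \<Longrightarrow> v (b - w) \<le> ereal (real M)" by blast
    \<comment> \<open>Dividing by c turns the bound M on the distance from b to the span into a
      bound for c b; applied to differences of terms of X it shows that their coefficients at b form
      a Cauchy sequence.\<close>
    have key: "v (c * b + w) \<le> v c + ereal (real M)" if c: "c \<in> Qp" and w: "w \<in> Qp_span B" for c w
    proof (cases "c = 0")
      case nz: False
      have "- (inverse c * w) \<in> Qp_span B"
        using Qp_span_mult[OF Qp_minus[OF Qp_inverse[OF c]] w] by simp
      from M[OF this] have "v (b + inverse c * w) \<le> ereal (real M)" by simp
      moreover have "c * b + w = c * (b + inverse c * w)" using nz by (simp add: algebra_simps)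
      ultimately show ?thesis by (simp only: v_mult add_left_mono)
    qed simp
    show ?thesis unfolding lim_closed_def
    proof (intro allI impI)
      fix X l assume X: "range X \<subseteq> Qp_span (insert b B)" and lim: "val_lim v X l"
      have "\<exists>c\<in>Qp. X k - c * b \<in> Qp_span B" for k using X span by blast
      then obtain c where c: "\<And>k. c k \<in> Qp" "\<And>k. X k - c k * b \<in> Qp_span B" by metis
      have "val_Cauchy v c" unfolding val_Cauchy_def
      proof
        fix L :: real
        obtain N where N: "\<forall>j\<ge>N. \<forall>k\<ge>N. ereal (L + real M) \<le> v (X j - X k)"
          using val_lim_imp_Cauchy[OF lim] unfolding val_Cauchy_def by blast
        have "ereal L \<le> v (c j - c k)" if "j \<ge> N" "k \<ge> N" for j k
        proof -
          have "c j - c k \<in> Qp" using Qp_add[OF c(1) Qp_minus[OF c(1)]] by simp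
          moreover have "(X j - c j * b) - (X k - c k * b) \<in> Qp_span B" using c(2) Qp_span_diff by blast
          ultimately have "v ((c j - c k) * b + ((X j - c j * b) - (X k - c k * b))) \<le> v (c j - c k) + ereal (real M)"
            by (rule key)
          then have "v (X j - X k) \<le> v (c j - c k) + ereal (real M)" by (simp add: algebra_simps)
          moreover have "ereal (L + real M) \<le> v (X j - X k)" using N that by blast
          ultimately have "ereal (L + real M) \<le> v (c j - c k) + ereal (real M)" by (rule order_trans[rotated])
          then show ?thesis by (cases "v (c j - c k)") auto
        qed
        then show "\<exists>N. \<forall>j\<ge>N. \<forall>k\<ge>N. ereal L \<le> v (c j - c k)" by blast
      qed
      then obtain a where a: "val_lim v c a" using complete unfolding val_complete_def by blast
      have "a \<in> Qp" using a c(1) Qp_closed unfolding lim_closed_def by blast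
      have "val_lim v (\<lambda>k. X k + c k * (- b)) (l + a * (- b))"
        by (intro val_lim_add lim val_lim_mult_const a)
      then have "l - a * b \<in> Qp_span B"
        using c(2) insert.IH unfolding lim_closed_def by (auto dest!: spec[of _ "\<lambda>k. X k + c k * (- b)"])
      then show "l \<in> Qp_span (insert b B)" using \<open>a \<in> Qp\<close> span by blast
    qed
  qed
qed

text \<open>F is the span of a finite set over a complete field. This keeps in F the limits that
  define coordinates on the rational Tate module in \<open>lcV_surj\<close>.\<close>

lemma p_adic_subfield_closed:
  assumes "p_adic_subfield p v F" shows "lim_closed F"
proof -
  obtain B where B: "finite B" "B \<subseteq> F" "\<forall>x\<in>F. \<exists>c. (\<forall>b\<in>B. c b \<in> Qp) \<and> x = (\<Sum>b\<in>B. c b * b)"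
    using assms unfolding p_adic_subfield_def by blast
  have F: "is_subfield F" "Qp \<subseteq> F" using assms unfolding p_adic_subfield_def by auto
  have "(\<Sum>b\<in>B. c b * b) \<in> F" if "\<forall>b\<in>B. c b \<in> Qp" for c
    using B(1) B(2) that
  proof (induction B rule: finite_induct)
    case empty then show ?case using F unfolding is_subfield_def by simp
  next
    case (insert b B)
    then show ?case using F unfolding is_subfield_def by (simp add: subset_iff)
  qed
  then have "F = Qp_span B" using B(3) unfolding Qp_span_def by fast
  then show ?thesis using Qp_span_closed[OF B(1)] by simp
qed

end

locale formal_module = complete_valued_field v
  for v :: "'k::{alg_closed_field, field_char_0} \<Rightarrow> ereal" +
  fixes F :: "'k set" and \<pi> :: 'k and p n :: nat and H :: "'k pi_div"
    and \<phi> :: "'k fps \<Rightarrow> nat \<Rightarrow> 'k coords"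
  assumes subfield: "p_adic_subfield p v F"
    and uniformizer: "normalized_uniformizer v F \<pi>"
    and pi_div: "pi_divisible_module v F \<pi> n H"
    and Lie: "natural_Lie_action v F H"
    and formal: "formal_special_fibre v H"
    and coordinate: "formal_coordinate v H \<phi>"
begin

abbreviation OF :: "'k set" where "OF \<equiv> F \<inter> R"
abbreviation L :: "nat \<Rightarrow> 'k hopf" where "L k \<equiv> level H k"
abbreviation d :: "nat \<Rightarrow> nat" where "d k \<equiv> rk (L k)"
abbreviation E :: "nat \<Rightarrow> 'k coords set" where "E k \<equiv> free_mod R (d k)"
abbreviation mul where "mul k \<equiv> hmul (L k)"
abbreviation FR where "FR \<equiv> formal_ring v H"

lemma free_mod_R: "x \<in> free_mod R m \<Longrightarrow> x i \<in> R"
  unfolding free_mod_def by (cases "i < m") auto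

lemma free_mod_add [intro]: "x \<in> free_mod R m \<Longrightarrow> y \<in> free_mod R m \<Longrightarrow> (\<lambda>i. x i + y i) \<in> free_mod R m"
  and free_mod_diff [intro]: "x \<in> free_mod R m \<Longrightarrow> y \<in> free_mod R m \<Longrightarrow> (\<lambda>i. x i - y i) \<in> free_mod R m"
  and free_mod_scale [intro]: "c \<in> R \<Longrightarrow> x \<in> free_mod R m \<Longrightarrow> (\<lambda>i. c * x i) \<in> free_mod R m"
  and free_mod_minus [intro]: "x \<in> free_mod R m \<Longrightarrow> (\<lambda>i. - x i) \<in> free_mod R m"
  and free_mod_0 [simp, intro]: "(\<lambda>i. 0) \<in> free_mod R m"
  and free_mod_bvec [intro]: "j < m \<Longrightarrow> bvec j \<in> free_mod R m"
  by (auto simp: free_mod_def bvec_def)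

lemma free_mod_sum [intro]:
  "(\<And>a. a \<in> A \<Longrightarrow> f a \<in> free_mod R m) \<Longrightarrow> (\<lambda>i. \<Sum>a\<in>A. f a i) \<in> free_mod R m"
  by (auto simp: free_mod_def)

lemma free_mod_expand: "x \<in> free_mod R m \<Longrightarrow> x = (\<lambda>i. \<Sum>j<m. x j * bvec j i)"
proof
  fix i assume "x \<in> free_mod R m"
  have "(\<Sum>j<m. x j * bvec j i) = (\<Sum>j<m. if j = i then x i else 0)"
    by (intro sum.cong) (auto simp: bvec_def)
  also have "\<dots> = x i" using \<open>x \<in> _\<close> by (auto simp: free_mod_def)
  finally show "x i = (\<Sum>j<m. x j * bvec j i)" by simp
qed

lemma linear_form_add: "linear_form R m f \<Longrightarrow> x \<in> free_mod R m \<Longrightarrow> y \<in> free_mod R m \<Longrightarrow>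
    f (\<lambda>i. x i + y i) = f x + f y"
  and linear_form_scale: "linear_form R m f \<Longrightarrow> c \<in> R \<Longrightarrow> x \<in> free_mod R m \<Longrightarrow>
    f (\<lambda>i. c * x i) = c * f x"
  by (auto simp: linear_form_def)

lemma linear_form_0: "linear_form R m f \<Longrightarrow> f (\<lambda>i. 0) = 0"
  using linear_form_scale[of m f 0 "\<lambda>i. 0"] by simp

lemma linear_form_diff: "linear_form R m f \<Longrightarrow> x \<in> free_mod R m \<Longrightarrow> y \<in> free_mod R m \<Longrightarrow>
    f (\<lambda>i. x i - y i) = f x - f y"
  using linear_form_add[of m f x "\<lambda>i. (-1) * y i"] linear_form_scale[of m f "-1" y] by (auto simp: R_minus free_mod_minus)

lemma linear_form_sum:
  assumes "linear_form R m f" "finite A" "\<And>a. a \<in> A \<Longrightarrow> g a \<in> free_mod R m"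
  shows "f (\<lambda>i. \<Sum>a\<in>A. g a i) = (\<Sum>a\<in>A. f (g a))"
  using assms(2,3)
proof (induction A rule: finite_induct)
  case (insert a A)
  then show ?case using linear_form_add[OF assms(1), of "g a" "\<lambda>i. \<Sum>a\<in>A. g a i"] by auto
qed (simp add: linear_form_0[OF assms(1)])

lemma linear_form_expand:
  assumes "linear_form R m f" "x \<in> free_mod R m"
  shows "f x = (\<Sum>j<m. x j * f (bvec j))"
proof -
  have "f x = f (\<lambda>i. \<Sum>j<m. x j * bvec j i)" using free_mod_expand[OF assms(2)] by simp
  also have "\<dots> = (\<Sum>j<m. f (\<lambda>i. x j * bvec j i))"
    using assms by (intro linear_form_sum) (auto intro: free_mod_R)
  also have "\<dots> = (\<Sum>j<m. x j * f (bvec j))"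
    using assms by (intro sum.cong) (auto intro!: linear_form_scale free_mod_R)
  finally show ?thesis .
qed

subsection \<open>The levels of a \<open>\<pi>\<close>-divisible module\<close>

lemma pi_F: "\<pi> \<in> F" and v_pi [simp]: "v \<pi> = 1"
  and v_F_int: "x \<in> F \<Longrightarrow> x \<noteq> 0 \<Longrightarrow> \<exists>m::int. v x = ereal (of_int m)"
  using uniformizer unfolding normalized_uniformizer_def by auto

lemma pi_0 [simp]: "\<pi> \<noteq> 0" using v_pi by force

lemma is_subfield: "is_subfield F" using subfield unfolding p_adic_subfield_def by blast

lemma F_0 [simp, intro]: "0 \<in> F" and F_1 [simp, intro]: "1 \<in> F"
  and F_add [intro]: "x \<in> F \<Longrightarrow> y \<in> F \<Longrightarrow> x + y \<in> F"
  and F_mult [intro]: "x \<in> F \<Longrightarrow> y \<in> F \<Longrightarrow> x * y \<in> F"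
  and F_minus [intro]: "x \<in> F \<Longrightarrow> - x \<in> F"
  and F_inverse [intro]: "x \<in> F \<Longrightarrow> inverse x \<in> F"
  using is_subfield unfolding is_subfield_def by auto

lemma pi_OF [simp, intro]: "\<pi> \<in> OF" using pi_F by (simp add: R_iff)

lemma OF_0 [simp, intro]: "0 \<in> OF" and OF_1 [simp, intro]: "1 \<in> OF"
  and OF_add [intro]: "x \<in> OF \<Longrightarrow> y \<in> OF \<Longrightarrow> x + y \<in> OF"
  and OF_mult [intro]: "x \<in> OF \<Longrightarrow> y \<in> OF \<Longrightarrow> x * y \<in> OF"
  and OF_minus [intro]: "x \<in> OF \<Longrightarrow> - x \<in> OF"
  by auto

lemma OF_power [intro]: "x \<in> OF \<Longrightarrow> x ^ k \<in> OF"
  by (induction k) auto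

lemma level_scheme: "finite_comm_group_scheme R (L k)" and d_eq: "d k = residue_card v F ^ (n * k)"
  using pi_div unfolding pi_divisible_module_def Let_def by blast+

lemma level_algebra: "comm_algebra R (L k)"
  using level_scheme unfolding finite_comm_group_scheme_def by blast

lemma hone_E [simp, intro]: "hone (L k) \<in> E k"
  and mul_E [intro]: "x \<in> E k \<Longrightarrow> y \<in> E k \<Longrightarrow> mul k x y \<in> E k"
  and mul_linear: "x \<in> E k \<Longrightarrow> linear_form R (d k) (\<lambda>y. mul k x y j)"
  and mul_commute: "x \<in> E k \<Longrightarrow> y \<in> E k \<Longrightarrow> mul k x y = mul k y x"
  and mul_one: "x \<in> E k \<Longrightarrow> mul k (hone (L k)) x = x"
  using level_algebra[of k] unfolding comm_algebra_def by blast+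

lemmas level_conj = level_scheme[unfolded finite_comm_group_scheme_def]

lemmas comul_R = level_conj[THEN conjunct2, THEN conjunct1, rule_format]
  and comul_linear = level_conj[THEN conjunct2, THEN conjunct2, THEN conjunct1, rule_format]
  and comul_one = level_conj[THEN conjunct2, THEN conjunct2, THEN conjunct2, THEN conjunct1, rule_format]
  and comul_mul = level_conj[THEN conjunct2, THEN conjunct2, THEN conjunct2, THEN conjunct2, THEN conjunct1, rule_format]
  and counit_R = level_conj[THEN conjunct2, THEN conjunct2, THEN conjunct2, THEN conjunct2, THEN conjunct2, THEN conjunct1, rule_format]
  and counit_linear = level_conj[THEN conjunct2, THEN conjunct2, THEN conjunct2, THEN conjunct2, THEN conjunct2, THEN conjunct2, THEN conjunct1, rule_format]
  and counit_one = level_conj[THEN conjunct2, THEN conjunct2, THEN conjunct2, THEN conjunct2, THEN conjunct2, THEN conjunct2, THEN conjunct2, THEN conjunct1, rule_format]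
  and counit_mul = level_conj[THEN conjunct2, THEN conjunct2, THEN conjunct2, THEN conjunct2, THEN conjunct2, THEN conjunct2, THEN conjunct2, THEN conjunct2, THEN conjunct1, rule_format]
  and coassoc = level_conj[THEN conjunct2, THEN conjunct2, THEN conjunct2, THEN conjunct2, THEN conjunct2, THEN conjunct2, THEN conjunct2, THEN conjunct2, THEN conjunct2, THEN conjunct1, rule_format]
  and cocomm = level_conj[THEN conjunct2, THEN conjunct2, THEN conjunct2, THEN conjunct2, THEN conjunct2, THEN conjunct2, THEN conjunct2, THEN conjunct2, THEN conjunct2, THEN conjunct2, THEN conjunct1, rule_format]
  and counit_law = level_conj[THEN conjunct2, THEN conjunct2, THEN conjunct2, THEN conjunct2, THEN conjunct2, THEN conjunct2, THEN conjunct2, THEN conjunct2, THEN conjunct2, THEN conjunct2, THEN conjunct2, THEN conjunct1, rule_format]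

lemmas pi_div_conj = pi_div[unfolded pi_divisible_module_def Let_def]

lemmas restr_conj = pi_div_conj[THEN conjunct2, THEN conjunct1, rule_format]

lemmas restr_hom = restr_conj[THEN conjunct1]
  and restr_surj = restr_conj[THEN conjunct2, THEN conjunct1]
  and restr_ker = restr_conj[THEN conjunct2, THEN conjunct2]
  and act_hom = pi_div_conj[THEN conjunct2, THEN conjunct2, THEN conjunct1, rule_format]
  and restr_act = pi_div_conj[THEN conjunct2, THEN conjunct2, THEN conjunct2, THEN conjunct1, rule_format]
  and act_1 = pi_div_conj[THEN conjunct2, THEN conjunct2, THEN conjunct2, THEN conjunct2, THEN conjunct1, rule_format]
  and act_mult = pi_div_conj[THEN conjunct2, THEN conjunct2, THEN conjunct2, THEN conjunct2, THEN conjunct2, THEN conjunct1, rule_format]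
  and act_add = pi_div_conj[THEN conjunct2, THEN conjunct2, THEN conjunct2, THEN conjunct2, THEN conjunct2, THEN conjunct2, rule_format]

lemma hopf_hom_E: "hopf_hom R A B f \<Longrightarrow> x \<in> elts R A \<Longrightarrow> f x \<in> elts R B"
  and hopf_hom_linear: "hopf_hom R A B f \<Longrightarrow> linear_form R (rk A) (\<lambda>x. f x j)"
  and hopf_hom_one: "hopf_hom R A B f \<Longrightarrow> f (hone A) = hone B"
  and hopf_hom_mul: "hopf_hom R A B f \<Longrightarrow> x \<in> elts R A \<Longrightarrow> y \<in> elts R A \<Longrightarrow> f (hmul A x y) = hmul B (f x) (f y)"
  and hopf_hom_counit: "hopf_hom R A B f \<Longrightarrow> x \<in> elts R A \<Longrightarrow> counit B (f x) = counit A x"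
  and hopf_hom_comul: "hopf_hom R A B f \<Longrightarrow> x \<in> elts R A \<Longrightarrow> i < rk B \<Longrightarrow> j < rk B \<Longrightarrow>
        comul B (f x) i j = (\<Sum>a<rk A. \<Sum>b<rk A. comul A x a b * f (bvec a) i * f (bvec b) j)"
  unfolding hopf_hom_def by blast+

lemmas restr_E = hopf_hom_E[OF restr_hom]
lemmas act_E = hopf_hom_E[OF act_hom]

lemma hopf_hom_diff: "hopf_hom R A B f \<Longrightarrow> x \<in> elts R A \<Longrightarrow> y \<in> elts R A \<Longrightarrow>
   f (\<lambda>i. x i - y i) = (\<lambda>i. f x i - f y i)"
  using linear_form_diff[OF hopf_hom_linear] by blast

lemma hopf_hom_add: "hopf_hom R A B f \<Longrightarrow> x \<in> elts R A \<Longrightarrow> y \<in> elts R A \<Longrightarrow>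
   f (\<lambda>i. x i + y i) = (\<lambda>i. f x i + f y i)"
  using linear_form_add[OF hopf_hom_linear] by blast

lemma hopf_hom_scale: "hopf_hom R A B f \<Longrightarrow> c \<in> R \<Longrightarrow> x \<in> elts R A \<Longrightarrow>
   f (\<lambda>i. c * x i) = (\<lambda>i. c * f x i)"
  using linear_form_scale[OF hopf_hom_linear] by blast

lemma hopf_hom_0: "hopf_hom R A B f \<Longrightarrow> f (\<lambda>i. 0) = (\<lambda>i. 0)"
  using linear_form_0[OF hopf_hom_linear] by blast

lemma mul_scale: "x \<in> E k \<Longrightarrow> y \<in> E k \<Longrightarrow> c \<in> R \<Longrightarrow>
    mul k x (\<lambda>i. c * y i) = (\<lambda>i. c * mul k x y i)"
  using linear_form_scale[OF mul_linear] by blast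

subsection \<open>The coordinate\<close>

abbreviation IF :: "'k fps set" where "IF \<equiv> integral_fps v"

lemmas coordinate_conj = coordinate[unfolded formal_coordinate_def]

lemmas phi_bij = coordinate_conj[THEN conjunct1]
  and phi_ring = coordinate_conj[THEN conjunct2, THEN conjunct1, rule_format]
  and phi_const_fun = coordinate_conj[THEN conjunct2, THEN conjunct2, THEN conjunct1, rule_format]
  and counit_phi = coordinate_conj[THEN conjunct2, THEN conjunct2, THEN conjunct2, THEN conjunct1, rule_format]

lemma phi_add: "f \<in> IF \<Longrightarrow> g \<in> IF \<Longrightarrow> \<phi> (f + g) k l = \<phi> f k l + \<phi> g k l"
  and phi_mult: "f \<in> IF \<Longrightarrow> g \<in> IF \<Longrightarrow> \<phi> (f * g) k = mul k (\<phi> f k) (\<phi> g k)"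
  and phi_const: "c \<in> R \<Longrightarrow> \<phi> (fps_const c) k l = c * hone (L k) l"
  by (simp_all add: phi_ring phi_const_fun)

lemma phi_FR: "f \<in> IF \<Longrightarrow> \<phi> f \<in> FR"
  using phi_bij bij_betwE by blast

lemma phi_E [intro]: "f \<in> IF \<Longrightarrow> \<phi> f k \<in> E k"
  using phi_FR unfolding formal_ring_def by blast

lemma restr_phi: "f \<in> IF \<Longrightarrow> restr H k (\<phi> f (Suc k)) = \<phi> f k"
  using phi_FR unfolding formal_ring_def by blast

lemma FR_E: "\<alpha> \<in> FR \<Longrightarrow> \<alpha> k \<in> E k" and FR_restr: "\<alpha> \<in> FR \<Longrightarrow> restr H k (\<alpha> (Suc k)) = \<alpha> k"
  unfolding formal_ring_def by auto

lemma FR_phi: "\<alpha> \<in> FR \<Longrightarrow> \<exists>f\<in>IF. \<alpha> = \<phi> f"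
  using phi_bij unfolding bij_betw_def by blast

text \<open>Below level k the family is forced by restriction; above it, preimages are chosen one
  level at a time, which is possible because restriction is surjective.\<close>

lemma FR_lift:
  assumes "x \<in> E k" shows "\<exists>\<alpha>\<in>FR. \<alpha> k = x"
proof -
  define dn where "dn = rec_nat x (\<lambda>j y. restr H (k - Suc j) y)"
  have dn: "dn 0 = x" "\<And>j. dn (Suc j) = restr H (k - Suc j) (dn j)" by (simp_all add: dn_def)
  have dnE: "j \<le> k \<Longrightarrow> dn j \<in> E (k - j)" for j
  proof (induction j)
    case (Suc j)
    then have "dn j \<in> E (Suc (k - Suc j))" by (simp add: Suc_diff_Suc)
    then show ?case using restr_E dn by simp
  qed (simp add: dn assms)
  have "\<exists>up. \<forall>j. (up j \<in> E (k + j) \<and> (j = 0 \<longrightarrow> up j = x)) \<and> restr H (k + j) (up (Suc j)) = up j"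
  proof (rule dependent_nat_choice)
    show "\<exists>y. y \<in> E (k + 0) \<and> (0 = 0 \<longrightarrow> y = x)" using assms by auto
  next
    fix y j assume "y \<in> E (k + j) \<and> (j = 0 \<longrightarrow> y = x)"
    then have "y \<in> restr H (k + j) ` E (Suc (k + j))" by (simp add: restr_surj)
    then obtain z where "y = restr H (k + j) z" "z \<in> E (Suc (k + j))" by (rule imageE)
    then show "\<exists>z. (z \<in> E (k + Suc j) \<and> (Suc j = 0 \<longrightarrow> z = x)) \<and> restr H (k + j) z = y" by auto
  qed
  then obtain up where up: "\<And>j. up j \<in> E (k + j)" "up 0 = x" "\<And>j. restr H (k + j) (up (Suc j)) = up j"
    by blast
  define \<alpha> where "\<alpha> i = (if i \<le> k then dn (k - i) else up (i - k))" for i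
  have "\<alpha> i \<in> E i" for i using dnE[of "k - i"] up(1)[of "i - k"] by (auto simp: \<alpha>_def)
  moreover have "restr H i (\<alpha> (Suc i)) = \<alpha> i" for i
  proof (cases "Suc i \<le> k")
    case True
    then have "k - i = Suc (k - Suc i)" by simp
    then have "dn (k - i) = restr H (k - Suc (k - Suc i)) (dn (k - Suc i))" using dn(2) by metis
    then show ?thesis using True by (simp add: \<alpha>_def)
  next
    case False
    then have *: "Suc i - k = Suc (i - k)" "k + (i - k) = i" by auto
    have "\<alpha> (Suc i) = up (Suc (i - k))" unfolding *(1)[symmetric] using False by (auto simp: \<alpha>_def)
    moreover have "\<alpha> i = up (i - k)" using False dn up by (auto simp: \<alpha>_def)
    ultimately show ?thesis using up(3)[of "i - k"] * by simp
  qed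
  ultimately have "\<alpha> \<in> FR" by (simp add: formal_ring_def)
  moreover have "\<alpha> k = x" by (simp add: \<alpha>_def dn)
  ultimately show ?thesis by blast
qed

lemma phi_surj: "x \<in> E k \<Longrightarrow> \<exists>f\<in>IF. \<phi> f k = x"
  using FR_lift FR_phi by metis

text \<open>The polynomial \<open>f\<close> evaluated at the coordinate, in the algebra of level \<open>k\<close>.\<close>

definition th :: "nat \<Rightarrow> 'k poly \<Rightarrow> 'k coords" where
  "th k f = \<phi> (fps_of_poly f) k"

lemma Rpoly_IF: "f \<in> Rpoly \<Longrightarrow> fps_of_poly f \<in> IF"
  by (simp add: integral_fps_def Rpoly_def)

lemma IF_iff: "f \<in> IF \<longleftrightarrow> (\<forall>j. fps_nth f j \<in> R)" by (simp add: integral_fps_def)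

lemma th_E [intro]: "f \<in> Rpoly \<Longrightarrow> th k f \<in> E k"
  unfolding th_def using Rpoly_IF by blast

lemma th_R [intro]: "f \<in> Rpoly \<Longrightarrow> th k f l \<in> R"
  using free_mod_R th_E by blast

lemma th_monom_R [intro]: "th k (monom 1 j) l \<in> R"
  by (intro th_R Rpoly_monom) simp

lemma th_add: "f \<in> Rpoly \<Longrightarrow> g \<in> Rpoly \<Longrightarrow> th k (f + g) l = th k f l + th k g l"
  unfolding th_def using Rpoly_IF phi_add by (simp add: fps_of_poly_add)

lemma th_mult: "f \<in> Rpoly \<Longrightarrow> g \<in> Rpoly \<Longrightarrow> th k (f * g) = mul k (th k f) (th k g)"
  unfolding th_def using Rpoly_IF phi_mult by (simp add: fps_of_poly_mult)

lemma th_const: "c \<in> R \<Longrightarrow> th k [:c:] l = c * hone (L k) l"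
  unfolding th_def using phi_const by (simp add: fps_of_poly_const)

lemma th_1: "th k 1 = hone (L k)"
  using th_const[of 1 k] by (auto simp: one_pCons)

lemma th_smult: "c \<in> R \<Longrightarrow> f \<in> Rpoly \<Longrightarrow> th k (Polynomial.smult c f) l = c * th k f l"
proof -
  assume *: "c \<in> R" "f \<in> Rpoly"
  have "th k (Polynomial.smult c f) = th k (f * [:c:])" by simp
  also have "\<dots> = mul k (th k f) (\<lambda>l. c * hone (L k) l)"
    using * th_const by (subst th_mult) (auto intro!: arg_cong[of _ _ "mul k (th k f)"])
  also have "\<dots> = (\<lambda>l. c * mul k (th k f) (hone (L k)) l)"
    using * by (intro mul_scale) auto
  also have "mul k (th k f) (hone (L k)) = th k f" using * mul_one mul_commute th_E hone_E by metis
  finally show ?thesis by simp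
qed

lemma th_0: "th k 0 l = 0"
  using th_smult[of 0 0 k l] by simp

lemma th_diff: "f \<in> Rpoly \<Longrightarrow> g \<in> Rpoly \<Longrightarrow> th k (f - g) l = th k f l - th k g l"
  using th_add[OF Rpoly_diff, of f g g k l] by auto

lemma th_sum: "finite A \<Longrightarrow> (\<And>a. a \<in> A \<Longrightarrow> f a \<in> Rpoly) \<Longrightarrow> th k (\<Sum>a\<in>A. f a) l = (\<Sum>a\<in>A. th k (f a) l)"
proof (induction A rule: finite_induct)
  case (insert a A)
  then show ?case by (simp add: th_add Rpoly_sum)
qed (simp add: th_0)

lemma restr_th: "f \<in> Rpoly \<Longrightarrow> restr H k (th (Suc k) f) = th k f"
  unfolding th_def by (rule restr_phi[OF Rpoly_IF])

lemma counit_th: "f \<in> Rpoly \<Longrightarrow> counit (L k) (th k f) = poly f 0"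
  unfolding th_def by (simp add: counit_phi[OF Rpoly_IF] poly_0_coeff_0)

abbreviation t :: "nat \<Rightarrow> 'k coords" where "t k \<equiv> th k [:0, 1:]"

lemma t_eq: "t k = \<phi> fps_X k"
  by (simp add: th_def fps_of_poly_X)

lemma X_Rpoly [simp, intro]: "[:0, 1:] \<in> Rpoly" by (intro Rpoly_pCons) auto

lemma th_monom_sum: "f \<in> Rpoly \<Longrightarrow> th k f l = (\<Sum>j\<le>degree f. coeff f j * th k (monom 1 j) l)"
proof -
  assume f: "f \<in> Rpoly"
  have "th k f l = th k (\<Sum>j\<le>degree f. monom (coeff f j) j) l" by (simp add: poly_as_sum_of_monoms)
  also have "\<dots> = (\<Sum>j\<le>degree f. th k (monom (coeff f j) j) l)"
    using f by (intro th_sum) (auto simp: Rpoly_def)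
  also have "\<dots> = (\<Sum>j\<le>degree f. coeff f j * th k (monom 1 j) l)"
  proof (rule sum.cong[OF refl])
    fix j
    have "monom (coeff f j) j = Polynomial.smult (coeff f j) (monom 1 j)" by (simp add: smult_monom)
    then show "th k (monom (coeff f j) j) l = coeff f j * th k (monom 1 j) l"
      using f by (simp only: th_smult Rpoly_monom R_1) (simp add: Rpoly_def th_smult Rpoly_monom)
  qed
  finally show ?thesis .
qed

lemma th_v_ge: "f \<in> Rpoly \<Longrightarrow> (\<And>j. r \<le> v (coeff f j)) \<Longrightarrow> r \<le> v (th k f l)"
  unfolding th_monom_sum
  by (intro v_sum_ge v_mult_ge) (auto simp flip: R_iff)

subsection \<open>Each level is generated by the coordinate\<close>

text \<open>Vanishing on the special fibre. The algebra is free over R, so membership in the ideal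
  generated by the maximal ideal is read off the coordinates.\<close>

definition mA :: "'k coords \<Rightarrow> bool" where "mA x \<longleftrightarrow> (\<forall>l. x l \<in> \<mm>)"

lemma mA_mul: "x \<in> E k \<Longrightarrow> mA x \<Longrightarrow> y \<in> E k \<Longrightarrow> mA (mul k y x)"
  unfolding mA_def
proof
  fix l assume *: "x \<in> E k" "\<forall>l. x l \<in> \<mm>" "y \<in> E k"
  have "mul k y x l = (\<Sum>j<d k. x j * mul k y (bvec j) l)"
    by (rule linear_form_expand[OF mul_linear]) (use * in auto)
  also have "\<dots> \<in> \<mm>" using * by (intro \<mm>_sum \<mm>_mult) (auto intro!: free_mod_R[of _ "d k"])
  finally show "mul k y x l \<in> \<mm>" .
qed

lemma th_mA: "f \<in> Rpoly \<Longrightarrow> (\<And>j. coeff f j \<in> \<mm>) \<Longrightarrow> mA (th k f)"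
  unfolding mA_def th_monom_sum
  by (auto intro!: \<mm>_sum \<mm>_mult)

text \<open>The coordinate lies in the augmentation ideal, whose elements are nilpotent on the
  special fibre because that fibre is formal.\<close>

lemma t_nilpotent: "\<exists>N. mA (th k (monom 1 N))"
proof -
  have "t k \<in> aug_ideal R (L k)"
    unfolding aug_ideal_def using counit_th[of "[:0,1:]" k] by auto
  then obtain N where N: "\<forall>l. (mul k (t k) ^^ N) (hone (L k)) l \<in> \<mm>"
    using formal unfolding formal_special_fibre_def by blast
  have "(mul k (t k) ^^ N) (hone (L k)) = th k (monom 1 N)" for N
  proof (induction N)
    case (Suc N)
    have "monom 1 (Suc N) = [:0, 1:] * monom (1::'k) N" by (simp add: monom_Suc)
    then show ?case using Suc by (simp only: th_mult X_Rpoly Rpoly_monom R_1 funpow.simps o_apply)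
  qed (simp add: th_1)
  then show ?thesis using N unfolding mA_def by auto
qed


section \<open>Powers of the coordinate form a basis of each level\<close>

lemma \<mm>_finite_bound:
  assumes "finite S" "S \<subseteq> \<mm>" shows "\<exists>c\<in>\<mm>. c \<noteq> 0 \<and> (\<forall>x\<in>S. v c \<le> v x)"
  using assms
proof (induction S rule: finite_induct)
  case empty
  then show ?case by (intro bexI[of _ \<pi>]) (auto simp: \<mm>_iff)
next
  case (insert x S)
  then obtain c where c: "c \<in> \<mm>" "c \<noteq> 0" "\<forall>x\<in>S. v c \<le> v x" by blast
  show ?case
  proof (cases "v c \<le> v x")
    case True then show ?thesis using c by blast
  next
    case False
    then have "v x \<le> v c" "x \<noteq> 0" by auto
    then show ?thesis using insert.prems c(3) by (intro bexI[of _ x]) (auto intro: order_trans)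
  qed
qed

text \<open>Polynomials of degree below D. The bound is put on coefficients because
  \<open>degree 0 = 0\<close> would exclude the zero polynomial when D = 0.\<close>

definition Pless :: "nat \<Rightarrow> 'k poly set" where
  "Pless D = {r \<in> Rpoly. \<forall>j\<ge>D. coeff r j = 0}"

lemma Pless_0 [simp, intro]: "0 \<in> Pless D"
  and Pless_add: "r \<in> Pless D \<Longrightarrow> s \<in> Pless D \<Longrightarrow> r + s \<in> Pless D"
  and Pless_smult: "c \<in> R \<Longrightarrow> r \<in> Pless D \<Longrightarrow> Polynomial.smult c r \<in> Pless D"
  and Pless_Rpoly: "r \<in> Pless D \<Longrightarrow> r \<in> Rpoly"
  by (auto simp: Pless_def)

lemma Pless_sum: "(\<And>i. i \<in> A \<Longrightarrow> f i \<in> Pless D) \<Longrightarrow> sum f A \<in> Pless D"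
  by (induction A rule: infinite_finite_induct) (auto intro: Pless_add)

lemma PlessI: "r \<in> Rpoly \<Longrightarrow> r = 0 \<or> degree r < D \<Longrightarrow> r \<in> Pless D"
  by (auto simp: Pless_def intro: coeff_eq_0)

lemma Pless_sum_monom: "r \<in> Pless D \<Longrightarrow> r = (\<Sum>j<D. monom (coeff r j) j)"
  by (auto simp: poly_eq_iff coeff_sum Pless_def not_less)

lemma sum_monom_Pless: "(\<And>j. j < D \<Longrightarrow> c j \<in> R) \<Longrightarrow> (\<Sum>j<D. monom (c j) j) \<in> Pless D"
  and coeff_sum_monom: "coeff (\<Sum>j<D. monom (c j) j) i = (if i < D then c i else 0)"
  by (auto simp: Pless_def coeff_sum intro!: Rpoly_sum Rpoly_monom)

lemma th_monom: "c \<in> R \<Longrightarrow> th k (monom c j) l = c * th k (monom 1 j) l"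
  using th_smult[of c "monom 1 j" k l] by (simp add: smult_monom Rpoly_monom)

text \<open>D is the degree of the minimal polynomial of the coordinate on the special fibre,
  expressed by monic lifts over R. That it equals the rank is proved in
  \<open>level_degree_eq\<close>.\<close>

definition level_degree :: "nat \<Rightarrow> nat \<Rightarrow> bool" where
  "level_degree k D \<longleftrightarrow> (\<exists>Q\<in>Rpoly. lead_coeff Q = 1 \<and> degree Q = D \<and> mA (th k Q)) \<and>
     (\<forall>Q\<in>Rpoly. lead_coeff Q = 1 \<longrightarrow> mA (th k Q) \<longrightarrow> D \<le> degree Q)"

lemma ex_level_degree: "\<exists>D. level_degree k D"
proof -
  let ?P = "\<lambda>D. \<exists>Q\<in>Rpoly. lead_coeff Q = 1 \<and> degree Q = D \<and> mA (th k Q)"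
  obtain N where N: "mA (th k (monom 1 N))" using t_nilpotent by blast
  then have "?P N" by (intro bexI[of _ "monom 1 N"]) (auto simp: degree_monom_eq)
  then have "?P (LEAST D. ?P D)" by (rule LeastI)
  moreover have "(LEAST D. ?P D) \<le> degree Q" if "Q \<in> Rpoly" "lead_coeff Q = 1" "mA (th k Q)" for Q
    using that by (intro Least_le) blast
  ultimately show ?thesis unfolding level_degree_def by blast
qed

text \<open>Every element of the level comes from a power series. Its tail is a multiple of a power
  of the coordinate that vanishes on the special fibre, and the remaining polynomial is reduced by
  division by the monic Q.\<close>

lemma spans_mod_mA:
  assumes D: "level_degree k D" and x: "x \<in> E k"
  shows "\<exists>r\<in>Pless D. mA (\<lambda>l. x l - th k r l)"
proof -
  obtain Q where Q: "Q \<in> Rpoly" "lead_coeff Q = 1" "degree Q = D" "mA (th k Q)"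
    using D unfolding level_degree_def by blast
  obtain N where N: "mA (th k (monom 1 N))" using t_nilpotent by blast
  obtain f where f: "f \<in> IF" "\<phi> f k = x" using phi_surj x by blast
  define g where "g = (\<Sum>j<N. monom (fps_nth f j) j)"
  define h where "h = fps_shift N f"
  have h: "h \<in> IF" using f by (auto simp: h_def IF_iff)
  have g: "g \<in> Rpoly" unfolding g_def using f by (intro Pless_Rpoly[of _ N] sum_monom_Pless) (auto simp: IF_iff)
  have "f = fps_of_poly g + fps_of_poly (monom 1 N) * h"
  proof (rule fps_ext)
    fix j
    show "fps_nth f j = fps_nth (fps_of_poly g + fps_of_poly (monom 1 N) * h) j"
      by (auto simp: g_def h_def coeff_sum_monom fps_of_poly_monom fps_X_power_mult_nth)
  qed
  then have "x = (\<lambda>l. \<phi> (fps_of_poly g) k l + \<phi> (fps_of_poly (monom 1 N) * h) k l)"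
    using f(2) h g by (auto intro!: phi_add Rpoly_IF simp: IF_iff)
      (metis (no_types, lifting) phi_add IF_iff Rpoly_IF Rpoly_monom R_1 fps_mult_nth R_sum R_mult)
  then have x_eq: "x = (\<lambda>l. th k g l + mul k (th k (monom 1 N)) (\<phi> h k) l)"
    using phi_mult[OF Rpoly_IF[OF Rpoly_monom[OF R_1]] h] by (simp add: th_def)
  have m1: "mA (mul k (th k (monom 1 N)) (\<phi> h k))"
    using mA_mul[OF _ N, of k "\<phi> h k"] phi_E[OF h] mul_commute[OF phi_E[OF h] th_E[OF Rpoly_monom[OF R_1]]]
    by (simp add: th_E Rpoly_monom)
  obtain q r where qr: "q \<in> Rpoly" "r \<in> Rpoly" "g = Q * q + r" "r = 0 \<or> degree r < degree Q"
    using Rpoly_div_monic[OF Q(1,2) g] by blast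
  have m2: "mA (mul k (th k Q) (th k q))"
    using mA_mul[OF th_E[OF Q(1)] Q(4) th_E[OF qr(1)]] mul_commute[OF th_E[OF qr(1)] th_E[OF Q(1)]] by simp
  have "th k g l = mul k (th k Q) (th k q) l + th k r l" for l
    using qr Q(1) th_mult by (simp add: th_add Rpoly_mult)
  then have "mA (\<lambda>l. x l - th k r l)"
    unfolding x_eq using m1 m2 by (auto simp: mA_def)
  then show ?thesis using PlessI[OF qr(2)] qr(4) Q(3) by blast
qed

text \<open>Otherwise scale the highest coefficient outside the maximal ideal to 1 and drop the
  terms above it, which vanish on the special fibre. The result is a monic polynomial of degree
  below D vanishing there, against the minimality of D.\<close>

lemma mA_Pless:
  assumes D: "level_degree k D" and r: "r \<in> Pless D" and m: "mA (th k r)"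
  shows "coeff r j \<in> \<mm>"
proof (rule ccontr)
  assume j: "coeff r j \<notin> \<mm>"
  define S where "S = {j. coeff r j \<notin> \<mm>}"
  have S: "finite S" "S \<noteq> {}"
    using j by (auto simp: S_def intro!: finite_subset[of _ "{..degree r}"] le_degree)
  define e where "e = Max S"
  have e: "coeff r e \<notin> \<mm>" "\<And>i. i > e \<Longrightarrow> coeff r i \<in> \<mm>"
    using Max_in[OF S] Max_ge[OF S(1)] by (fastforce simp: S_def e_def)+
  have eD: "e < D" using e(1) r by (cases "e < D") (auto simp: Pless_def)
  have rR: "r \<in> Rpoly" using r by (rule Pless_Rpoly)
  have re: "coeff r e \<in> R" using rR by (auto simp: Rpoly_def)
  define u where "u = inverse (coeff r e)"
  have u: "u \<in> R" "u * coeff r e = 1" using R_unit[OF re e(1)] by (auto simp: u_def)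
  define q where "q = poly_cutoff (Suc e) (Polynomial.smult u r)"
  have q: "q \<in> Rpoly" using rR u(1) by (auto simp: q_def Rpoly_def coeff_poly_cutoff)
  have deg: "degree q = e"
    using u(2) by (intro antisym degree_le le_degree) (auto simp: q_def coeff_poly_cutoff)
  have lead: "lead_coeff q = 1" using u(2) by (simp add: deg) (simp add: q_def coeff_poly_cutoff)
  have "mA (th k (Polynomial.smult u r - q))"
  proof (rule th_mA)
    show "Polynomial.smult u r - q \<in> Rpoly" using q rR u by blast
    show "coeff (Polynomial.smult u r - q) i \<in> \<mm>" for i
      using e(2)[of i] u(1) by (auto simp: q_def coeff_poly_cutoff intro: \<mm>_mult')
  qed
  moreover have "th k q l = u * th k r l - th k (Polynomial.smult u r - q) l" for l
    using q rR u by (simp add: th_diff Rpoly_smult th_smult)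
  ultimately have "mA (th k q)" using m u(1) by (auto simp: mA_def intro!: \<mm>_mult')
  then have "D \<le> degree q" using D q lead unfolding level_degree_def by blast
  then show False using deg eD by simp
qed

text \<open>Low powers of the coordinate are orthonormal for the sup norm: dividing by a coefficient
  of least valuation leaves a coefficient 1, so by \<open>mA_Pless\<close> some coordinate of the
  image is a unit.\<close>

lemma Pless_orthonormal:
  assumes D: "level_degree k D" and r: "r \<in> Pless D" and r0: "r \<noteq> 0"
  obtains l i where "coeff r i \<noteq> 0" "\<And>j. v (coeff r i) \<le> v (coeff r j)" "v (th k r l) \<le> v (coeff r i)"
proof -
  have rR: "r \<in> Rpoly" using r by (rule Pless_Rpoly)
  have "\<exists>i\<in>{..degree r}. \<forall>j\<in>{..degree r}. v (coeff r i) \<le> v (coeff r j)"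
    using ex_min_if_finite[of "(\<lambda>i. v (coeff r i)) ` {..degree r}"] by (fastforce simp: not_less)
  then obtain i where i: "i \<le> degree r" "\<And>j. j \<le> degree r \<Longrightarrow> v (coeff r i) \<le> v (coeff r j)" by auto
  have min: "v (coeff r i) \<le> v (coeff r j)" for j
    using i(2)[of j] by (cases "j \<le> degree r") (auto simp: coeff_eq_0)
  have i0: "coeff r i \<noteq> 0" using i(2)[of "degree r"] r0 by auto
  define c where "c = coeff r i"
  define s where "s = Polynomial.smult (1 / c) r"
  have s: "s \<in> Pless D"
    using r min i0 v_div_ge_0[of c] by (auto simp: s_def Pless_def Rpoly_def R_iff c_def)
  have rs: "r = Polynomial.smult c s" using i0 by (simp add: s_def c_def)
  have "coeff s i = 1" using i0 by (simp add: s_def c_def)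
  then have "coeff s i \<notin> \<mm>" by (simp add: \<mm>_iff)
  then have "\<not> mA (th k s)" using mA_Pless[OF D s] by blast
  then obtain l where "\<not> 0 < v (th k s l)" by (auto simp: mA_def \<mm>_iff)
  then have l: "v (th k s l) \<le> 0" by simp
  have "c \<in> R" using rR by (auto simp: c_def Rpoly_def)
  then have "th k r l = c * th k s l" using rs th_smult[OF _ Pless_Rpoly[OF s]] by simp
  then have "v (th k r l) \<le> v c" using add_left_mono[OF l, of "v c"] by (simp add: v_mult)
  then show ?thesis using that i0 min by (simp add: c_def)
qed

lemma Pless_inj:
  assumes "level_degree k D" "r \<in> Pless D" "\<And>l. th k r l = 0" shows "r = 0"
  using Pless_orthonormal[OF assms(1,2)] assms(3) by fastforce

text \<open>Nakayama's lemma for the complete ring \<open>R\<close>, by successive approximation.\<close>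

lemma Pless_surj:
  assumes D: "level_degree k D" and x: "x \<in> E k"
  shows "\<exists>r\<in>Pless D. th k r = x"
proof -
  have "\<forall>i<d k. \<exists>r\<in>Pless D. mA (\<lambda>l. bvec i l - th k r l)" using spans_mod_mA[OF D] by blast
  then obtain rb where rb: "\<And>i. i < d k \<Longrightarrow> rb i \<in> Pless D" "\<And>i. i < d k \<Longrightarrow> mA (\<lambda>l. bvec i l - th k (rb i) l)"
    by metis
  have "(\<lambda>(i, l). bvec i l - th k (rb i) l) ` ({..<d k} \<times> {..<d k}) \<subseteq> \<mm>"
    using rb(2) by (auto simp: mA_def)
  \<comment> \<open>One c divides the errors of all basis vectors. By linearity every x is then a
    polynomial in the coordinate plus c times an element of the level, and iterating gives a series
    in powers of c.\<close>
  from \<mm>_finite_bound[OF _ this] obtain c where c: "c \<in> \<mm>" "c \<noteq> 0"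
    "\<forall>i<d k. \<forall>l<d k. v c \<le> v (bvec i l - th k (rb i) l)" by auto
  have step: "\<exists>r y. r \<in> Pless D \<and> y \<in> E k \<and> x = (\<lambda>l. th k r l + c * y l)" if x: "x \<in> E k" for x
  proof -
    define r where "r = (\<Sum>i<d k. Polynomial.smult (x i) (rb i))"
    have r: "r \<in> Pless D"
      unfolding r_def using rb(1) by (intro Pless_sum Pless_smult free_mod_R[OF x]) auto
    have *: "x l - th k r l = (\<Sum>i<d k. x i * (bvec i l - th k (rb i) l))" for l
    proof -
      have "th k r l = (\<Sum>i<d k. x i * th k (rb i) l)"
        unfolding r_def using Pless_Rpoly[OF rb(1)]
        by (subst th_sum) (auto intro!: sum.cong th_smult Rpoly_smult free_mod_R[OF x])
      moreover have "x l = (\<Sum>i<d k. x i * bvec i l)" using free_mod_expand[OF x] by metis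
      ultimately show ?thesis by (simp add: right_diff_distrib sum_subtractf)
    qed
    have vx: "v c \<le> v (x l - th k r l)" if "l < d k" for l
      unfolding * using c(3) that x by (intro v_sum_ge v_mult_ge') (auto simp flip: R_iff intro: free_mod_R)
    define y where "y l = (x l - th k r l) / c" for l
    have "y \<in> E k" using vx v_div_ge_0[OF c(2)] x th_E[OF Pless_Rpoly[OF r]]
      by (auto simp: y_def free_mod_def R_iff)
    moreover have "x = (\<lambda>l. th k r l + c * y l)" using c(2) by (simp add: y_def)
    ultimately show ?thesis using r by blast
  qed
  define Q where "Q x p \<longleftrightarrow> fst p \<in> Pless D \<and> snd p \<in> E k \<and> (\<forall>l. x l = th k (fst p) l + c * snd p l)" for x p
  have "\<exists>p. Q x p" if x: "x \<in> E k" for x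
  proof -
    obtain r y where "r \<in> Pless D" "y \<in> E k" "x = (\<lambda>l. th k r l + c * y l)" using step[OF x] by blast
    then show ?thesis by (intro exI[of _ "(r, y)"]) (simp add: Q_def)
  qed
  then obtain pr where pr: "\<And>x. x \<in> E k \<Longrightarrow> Q x (pr x)" by metis
  define rr nx where "rr x = fst (pr x)" and "nx x = snd (pr x)" for x
  have st: "\<And>x. x \<in> E k \<Longrightarrow> rr x \<in> Pless D" "\<And>x. x \<in> E k \<Longrightarrow> nx x \<in> E k"
    "\<And>x l. x \<in> E k \<Longrightarrow> x l = th k (rr x) l + c * nx x l"
    using pr by (auto simp: Q_def rr_def nx_def)
  define xs where "xs K = (nx ^^ K) x" for K
  have xs: "xs K \<in> E k" for K by (induction K) (auto simp: xs_def x st(2))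
  have xsS: "xs (Suc K) = nx (xs K)" for K by (simp add: xs_def)
  define s where "s K = (\<Sum>j<K. Polynomial.smult (c ^ j) (rr (xs j)))" for K
  have cR: "c \<in> R" "\<And>K. c ^ K \<in> R" using c \<mm>_R by auto
  have s: "s K \<in> Pless D" for K
    unfolding s_def by (intro Pless_sum Pless_smult st(1) xs cR)
  have xsK: "x l = th k (s K) l + c ^ K * xs K l" for K l
  proof (induction K)
    case 0 then show ?case by (simp add: s_def th_0 xs_def)
  next
    case (Suc K)
    have "xs K l = th k (rr (xs K)) l + c * xs (Suc K) l" unfolding xsS by (rule st(3)[OF xs])
    moreover have "th k (s (Suc K)) l = th k (s K) l + c ^ K * th k (rr (xs K)) l"
      unfolding s_def by (simp add: th_add Rpoly_sum Rpoly_smult cR Pless_Rpoly[OF st(1)[OF xs]] th_smult)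
    ultimately show ?case using Suc by (simp add: algebra_simps)
  qed
  obtain \<rho> where \<rho>: "v c = ereal \<rho>" using v_real c(2) by blast
  have \<rho>0: "\<rho> > 0" using c(1) \<rho> by (simp add: \<mm>_iff)
  have vcK: "v (c ^ K) = ereal (real K * \<rho>)" for K by (simp add: v_power \<rho>)
  have diff: "ereal (real K * \<rho>) \<le> v (coeff (s (Suc K)) j - coeff (s K) j)" for K j
  proof -
    have "coeff (s (Suc K)) j - coeff (s K) j = c ^ K * coeff (rr (xs K)) j" by (simp add: s_def)
    moreover have "coeff (rr (xs K)) j \<in> R" using st(1)[OF xs] by (auto simp: Pless_def Rpoly_def)
    ultimately show ?thesis using v_mult_ge[of "v (c ^ K)" "c ^ K" "coeff (rr (xs K)) j"] by (simp add: vcK R_iff)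
  qed
  have "\<exists>l. val_lim v (\<lambda>K. coeff (s K) j) l" for j
  proof -
    have "val_Cauchy v (\<lambda>K. coeff (s K) j)" by (rule val_CauchyI_Suc[of \<rho>]) (use diff \<rho>0 in auto)
    then show ?thesis using complete unfolding val_complete_def by blast
  qed
  then obtain lim where lim: "\<And>j. val_lim v (\<lambda>K. coeff (s K) j) (lim j)" by metis
  have limR: "lim j \<in> R" for j using R_closed[OF lim] s by (auto simp: Pless_def Rpoly_def)
  have limK: "ereal (real K * \<rho>) \<le> v (lim j - coeff (s K) j)" for K j
    by (rule val_lim_telescope[OF diff _ lim]) (use \<rho>0 in simp)
  define r where "r = (\<Sum>j<D. monom (lim j) j)"
  have r: "r \<in> Pless D" unfolding r_def by (rule sum_monom_Pless) (rule limR)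
  have "th k r l - x l = 0" for l
  proof (rule v_ge_all_imp_0)
    fix M :: nat
    obtain K :: nat where "real K > real M / \<rho>" using reals_Archimedean2 by blast
    then have KM: "real M \<le> real K * \<rho>" using \<rho>0 by (simp add: field_simps)
    have "ereal (real K * \<rho>) \<le> v (th k (r - s K) l)"
    proof (rule th_v_ge)
      show "r - s K \<in> Rpoly" using r s Pless_Rpoly by blast
      show "ereal (real K * \<rho>) \<le> v (coeff (r - s K) j)" for j
        using limK[of K j] s[of K] by (auto simp: r_def coeff_sum_monom Pless_def)
    qed
    moreover have "ereal (real K * \<rho>) \<le> v (c ^ K * xs K l)"
      using v_mult_ge[of "v (c ^ K)" "c ^ K" "xs K l"] free_mod_R[OF xs] by (simp add: vcK R_iff)
    ultimately have "ereal (real K * \<rho>) \<le> v (th k (r - s K) l - c ^ K * xs K l)" by (rule v_diff_ge)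
    moreover have "th k (r - s K) l - c ^ K * xs K l = th k r l - x l"
      using xsK[of l K] th_diff[OF Pless_Rpoly[OF r] Pless_Rpoly[OF s]] by simp
    ultimately show "ereal (real M) \<le> v (th k r l - x l)" using KM
      by (metis ereal_less_eq(3) order_trans)
  qed
  then have "th k r = x" by (auto simp: fun_eq_iff)
  then show ?thesis using r by blast
qed

text \<open>The standard basis and the first D powers of the coordinate span each other over R and
  are both independent over K, so they have the same number of elements.\<close>

lemma level_degree_eq:
  assumes D: "level_degree k D" shows "D = d k"
proof -
  let ?B1 = "bvec ` {..<d k} :: 'k coords set" and ?B2 = "(\<lambda>j. th k (monom 1 j)) ` {..<D}"
  have inj1: "inj_on (bvec :: nat \<Rightarrow> 'k coords) {..<d k}"
    by (rule inj_onI) (metis bvec_def one_neq_zero)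
  have inj2: "inj_on (\<lambda>j. th k (monom 1 j)) {..<D}"
  proof (rule inj_onI)
    fix i j assume ij: "i \<in> {..<D}" "j \<in> {..<D}" "th k (monom 1 i) = th k (monom 1 j)"
    have "monom 1 i - monom 1 j \<in> Pless D" using ij by (auto simp: Pless_def intro!: Rpoly_diff Rpoly_monom)
    moreover have "th k (monom 1 i - monom 1 j) l = 0" for l
      using ij by (simp add: th_diff Rpoly_monom)
    ultimately have "monom (1::'k) i - monom 1 j = 0" using Pless_inj[OF D] by blast
    then show "i = j" by (simp add: monom_eq_iff')
  qed
  have ind1: "fun_space.independent ?B1"
  proof (rule fun_space.independent_if_scalars_zero)
    fix f and x :: "'k coords"
    assume z: "(\<Sum>x\<in>?B1. (\<lambda>i. f x * x i)) = 0" and x: "x \<in> ?B1"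
    then obtain i where i: "i < d k" "x = bvec i" by auto
    have "0 = (\<Sum>x\<in>?B1. (\<lambda>i. f x * x i)) i" using z by simp
    also have "\<dots> = (\<Sum>j<d k. f (bvec j) * bvec j i)"
      unfolding sum_fun_apply using sum.reindex[OF inj1] by simp
    also have "\<dots> = (\<Sum>j<d k. if j = i then f (bvec i) else 0)"
      by (intro sum.cong) (auto simp: bvec_def)
    also have "\<dots> = f x" using i by simp
    finally show "f x = 0" by simp
  qed simp
  have ind2: "fun_space.independent ?B2"
  proof (rule fun_space.independent_if_scalars_zero)
    fix f and x :: "'k coords"
    assume z: "(\<Sum>x\<in>?B2. (\<lambda>i. f x * x i)) = 0" and x: "x \<in> ?B2"
    define u where "u j = f (th k (monom 1 j))" for j
    have u0: "(\<Sum>j<D. u j * th k (monom 1 j) l) = 0" for l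
      using fun_cong[OF z, of l] unfolding sum_fun_apply u_def by (simp add: sum.reindex[OF inj2])
    obtain j where j: "j < D" "x = th k (monom 1 j)" using x by auto
    \<comment> \<open>A relation over K is divided by a coefficient of least valuation: it becomes a
      relation over R with a coefficient 1, excluded by \<open>Pless_inj\<close>.\<close>
    have "\<exists>i\<in>{..<D}. \<forall>j\<in>{..<D}. v (u i) \<le> v (u j)"
      using ex_min_if_finite[of "(\<lambda>i. v (u i)) ` {..<D}"] j(1) by (fastforce simp: not_less)
    then obtain i where i: "i < D" "\<And>j. j < D \<Longrightarrow> v (u i) \<le> v (u j)" by auto
    show "f x = 0"
    proof (rule ccontr)
      assume "f x \<noteq> 0"
      then have ui: "u i \<noteq> 0" using i(2)[OF j(1)] j by (auto simp: u_def)
      define r where "r = (\<Sum>j<D. monom (u j / u i) j)"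
      have uR: "u j / u i \<in> R" if "j < D" for j using that i v_div_ge_0[OF ui] by (simp add: R_iff)
      have r: "r \<in> Pless D" unfolding r_def using uR by (rule sum_monom_Pless)
      have "th k r l = (\<Sum>j<D. u j * th k (monom 1 j) l) / u i" for l
      proof -
        have "th k r l = (\<Sum>j<D. th k (monom (u j / u i) j) l)"
          unfolding r_def by (rule th_sum) (use uR in \<open>auto intro: Rpoly_monom\<close>)
        also have "\<dots> = (\<Sum>j<D. u j / u i * th k (monom 1 j) l)"
          by (rule sum.cong[OF refl], rule th_monom) (use uR in auto)
        finally show ?thesis by (simp add: sum_divide_distrib)
      qed
      then have "r = 0" using Pless_inj[OF D r] u0 by simp
      moreover have "coeff r i = 1" using i(1) ui by (simp add: r_def coeff_sum_monom)
      ultimately show False by simp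
    qed
  qed simp
  have E1: "x \<in> fun_space.span ?B1" if x: "x \<in> E k" for x
  proof -
    have "x = (\<Sum>j<d k. (\<lambda>i. x j * bvec j i))"
    proof
      fix i show "x i = (\<Sum>j<d k. (\<lambda>i. x j * bvec j i)) i"
        unfolding sum_fun_apply by (rule fun_cong[OF free_mod_expand[OF x]])
    qed
    also have "\<dots> \<in> fun_space.span ?B1"
    proof (rule fun_space.span_sum)
      fix j assume "j \<in> {..<d k}"
      then show "(\<lambda>i. x j * bvec j i) \<in> fun_space.span ?B1"
        using fun_space.span_scale[OF fun_space.span_base, of "bvec j" ?B1 "x j"] by blast
    qed
    finally show ?thesis .
  qed
  have E2: "x \<in> fun_space.span ?B2" if x: "x \<in> E k" for x
  proof -
    obtain r where r: "r \<in> Pless D" "th k r = x" using Pless_surj[OF D x] by blast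
    have "x l = (\<Sum>j<D. coeff r j * th k (monom 1 j) l)" for l
    proof -
      have "x l = th k (\<Sum>j<D. monom (coeff r j) j) l" using r Pless_sum_monom by metis
      also have "\<dots> = (\<Sum>j<D. coeff r j * th k (monom 1 j) l)"
        using r(1) by (subst th_sum) (auto intro!: sum.cong Rpoly_monom th_monom simp: Pless_def Rpoly_def)
      finally show ?thesis .
    qed
    then have "x = (\<Sum>j<D. (\<lambda>i. coeff r j * th k (monom 1 j) i))"
      by (auto simp: fun_eq_iff sum_fun_apply)
    also have "\<dots> \<in> fun_space.span ?B2"
    proof (rule fun_space.span_sum)
      fix j assume "j \<in> {..<D}"
      then show "(\<lambda>i. coeff r j * th k (monom 1 j) i) \<in> fun_space.span ?B2"
        using fun_space.span_scale[OF fun_space.span_base, of "th k (monom 1 j)" ?B2 "coeff r j"] by blast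
    qed
    finally show ?thesis .
  qed
  have "?B2 \<subseteq> fun_space.span ?B1" "?B1 \<subseteq> fun_space.span ?B2"
    using th_E[OF Rpoly_monom[OF R_1]] by (auto intro!: E1 E2)
  then have "card ?B2 \<le> card ?B1" "card ?B1 \<le> card ?B2"
    using fun_space.independent_span_bound[OF _ ind2, of ?B1] fun_space.independent_span_bound[OF _ ind1, of ?B2]
    by auto
  then show ?thesis using card_image[OF inj1] card_image[OF inj2] by simp
qed

text \<open>Writing the power of exponent \<open>d k\<close> of the coordinate through the lower
  powers gives P. Independence of the lower powers forces the remainder modulo P of any polynomial
  killed at the coordinate to be zero.\<close>

lemma ex_level_poly:
  "\<exists>P\<in>Rpoly. lead_coeff P = 1 \<and> degree P = d k \<and> (\<forall>f\<in>Rpoly. th k f = (\<lambda>l. 0) \<longleftrightarrow> (\<exists>g\<in>Rpoly. f = P * g))"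
proof -
  have D: "level_degree k (d k)" using ex_level_degree level_degree_eq by blast
  obtain r where r: "r \<in> Pless (d k)" "th k r = th k (monom 1 (d k))"
    using Pless_surj[OF D] th_E[OF Rpoly_monom[OF R_1]] by blast
  define P where "P = monom 1 (d k) - r"
  have P: "P \<in> Rpoly" using r Pless_Rpoly by (auto simp: P_def)
  have deg: "degree P = d k" using r(1) by (intro antisym degree_le le_degree) (auto simp: P_def Pless_def)
  have lead: "lead_coeff P = 1" using r(1) by (simp add: deg) (simp add: P_def Pless_def)
  have thP: "th k P = (\<lambda>l. 0)" unfolding P_def using r Pless_Rpoly
    by (auto simp: th_diff Rpoly_monom fun_eq_iff)
  have "th k f = (\<lambda>l. 0) \<longleftrightarrow> (\<exists>g\<in>Rpoly. f = P * g)" if f: "f \<in> Rpoly" for f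
  proof
    assume z: "th k f = (\<lambda>l. 0)"
    obtain g r where gr: "g \<in> Rpoly" "r \<in> Rpoly" "f = P * g + r" "r = 0 \<or> degree r < degree P"
      using Rpoly_div_monic[OF P lead f] by blast
    have "mul k (th k P) (th k g) = mul k (th k g) (\<lambda>l. 0)"
      unfolding thP[symmetric] by (rule mul_commute[OF th_E[OF P] th_E[OF gr(1)]])
    then have "mul k (th k P) (th k g) = (\<lambda>l. 0)"
      using linear_form_0[OF mul_linear[OF th_E[OF gr(1)]]] by auto
    then have "th k r l = 0" for l
      using z gr P by (metis add.left_neutral th_add th_mult Rpoly_mult)
    then have "r = 0" using gr(4) deg by (intro Pless_inj[OF D PlessI[OF gr(2)]]) auto
    then show "\<exists>g\<in>Rpoly. f = P * g" using gr by auto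
  next
    assume "\<exists>g\<in>Rpoly. f = P * g"
    then obtain g where g: "g \<in> Rpoly" "f = P * g" by blast
    have "th k f = mul k (th k g) (\<lambda>l. 0)"
      unfolding thP[symmetric] g(2) th_mult[OF P g(1)] by (rule mul_commute[OF th_E[OF P] th_E[OF g(1)]])
    then show "th k f = (\<lambda>l. 0)" using linear_form_0[OF mul_linear[OF th_E[OF g(1)]]] by auto
  qed
  then show ?thesis using P lead deg by blast
qed

lemma th_surj: "x \<in> E k \<Longrightarrow> \<exists>f\<in>Rpoly. th k f = x"
proof -
  obtain D where "level_degree k D" using ex_level_degree by blast
  then show "x \<in> E k \<Longrightarrow> \<exists>f\<in>Rpoly. th k f = x" using Pless_surj Pless_Rpoly by blast
qed


subsection \<open>Homomorphisms to \<open>R\<close> and roots\<close>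

definition level_poly :: "nat \<Rightarrow> 'k poly" where
  "level_poly k = (SOME P. P \<in> Rpoly \<and> lead_coeff P = 1 \<and> degree P = d k \<and>
     (\<forall>f\<in>Rpoly. th k f = (\<lambda>l. 0) \<longleftrightarrow> (\<exists>g\<in>Rpoly. f = P * g)))"

lemma level_poly: "level_poly k \<in> Rpoly \<and> lead_coeff (level_poly k) = 1 \<and> degree (level_poly k) = d k \<and>
     (\<forall>f\<in>Rpoly. th k f = (\<lambda>l. 0) \<longleftrightarrow> (\<exists>g\<in>Rpoly. f = level_poly k * g))"
  unfolding level_poly_def by (rule someI_ex) (use ex_level_poly[of k] in blast)

lemmas level_poly_Rpoly = level_poly[THEN conjunct1] and level_poly_monic = level_poly[THEN conjunct2, THEN conjunct1]
  and degree_level_poly = level_poly[THEN conjunct2, THEN conjunct2, THEN conjunct1]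
  and th_eq_0_iff = level_poly[THEN conjunct2, THEN conjunct2, THEN conjunct2, rule_format]

definition roots :: "nat \<Rightarrow> 'k set" where "roots k = {a. poly (level_poly k) a = 0}"

lemma roots_R: "a \<in> roots k \<Longrightarrow> a \<in> R"
  using monic_root_in_R[OF level_poly_Rpoly level_poly_monic] by (auto simp: roots_def)

lemma th_eq_poly_eq:
  assumes "a \<in> roots k" "f \<in> Rpoly" "g \<in> Rpoly" "th k f = th k g"
  shows "poly f a = poly g a"
proof -
  have "th k (f - g) = (\<lambda>l. 0)" using assms by (auto simp: th_diff fun_eq_iff)
  then obtain h where "f - g = level_poly k * h" using th_eq_0_iff[of "f - g" k] assms(2,3) by blast
  then have "poly (f - g) a = 0" using assms(1) by (simp add: roots_def)
  then show ?thesis by simp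
qed

definition lift :: "nat \<Rightarrow> 'k coords \<Rightarrow> 'k poly" where
  "lift k x = (SOME f. f \<in> Rpoly \<and> th k f = x)"

lemma lift: "x \<in> E k \<Longrightarrow> lift k x \<in> Rpoly" and th_lift: "x \<in> E k \<Longrightarrow> th k (lift k x) = x"
proof -
  assume "x \<in> E k"
  then have "lift k x \<in> Rpoly \<and> th k (lift k x) = x"
    unfolding lift_def by (intro someI_ex[of "\<lambda>f. f \<in> Rpoly \<and> th k f = x"]) (use th_surj in blast)
  then show "lift k x \<in> Rpoly" "th k (lift k x) = x" by auto
qed

text \<open>The point of level k with coordinate a. The choice made by \<open>lift\<close> is
  harmless exactly because a is a root, see \<open>th_eq_poly_eq\<close>.\<close>

definition ev :: "nat \<Rightarrow> 'k \<Rightarrow> 'k coords \<Rightarrow> 'k" where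
  "ev k a x = poly (lift k x) a"

lemma ev_th: "a \<in> roots k \<Longrightarrow> f \<in> Rpoly \<Longrightarrow> ev k a (th k f) = poly f a"
  unfolding ev_def by (rule th_eq_poly_eq) (auto simp: lift th_lift th_E)

definition ahom :: "nat \<Rightarrow> ('k coords \<Rightarrow> 'k) \<Rightarrow> bool" where
  "ahom k \<chi> \<longleftrightarrow> linear_form R (d k) \<chi> \<and> (\<forall>x\<in>E k. \<chi> x \<in> R) \<and> \<chi> (hone (L k)) = 1 \<and>
     (\<forall>x\<in>E k. \<forall>y\<in>E k. \<chi> (mul k x y) = \<chi> x * \<chi> y)"

lemma ahom_linear: "ahom k \<chi> \<Longrightarrow> linear_form R (d k) \<chi>"
  and ahom_R: "ahom k \<chi> \<Longrightarrow> x \<in> E k \<Longrightarrow> \<chi> x \<in> R"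
  and ahom_one: "ahom k \<chi> \<Longrightarrow> \<chi> (hone (L k)) = 1"
  and ahom_mul: "ahom k \<chi> \<Longrightarrow> x \<in> E k \<Longrightarrow> y \<in> E k \<Longrightarrow> \<chi> (mul k x y) = \<chi> x * \<chi> y"
  by (auto simp: ahom_def)

lemma linear_formI_th:
  assumes "\<And>f g. f \<in> Rpoly \<Longrightarrow> g \<in> Rpoly \<Longrightarrow> \<chi> (th k (f + g)) = \<chi> (th k f) + \<chi> (th k g)"
    and "\<And>c f. c \<in> R \<Longrightarrow> f \<in> Rpoly \<Longrightarrow> \<chi> (th k (Polynomial.smult c f)) = c * \<chi> (th k f)"
  shows "linear_form R (d k) \<chi>"
  unfolding linear_form_def
proof (intro conjI ballI)
  fix x y assume "x \<in> E k" "y \<in> E k"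
  then obtain f g where fg: "f \<in> Rpoly" "x = th k f" "g \<in> Rpoly" "y = th k g" using th_surj by metis
  then have "(\<lambda>i. x i + y i) = th k (f + g)" by (auto simp: th_add)
  then show "\<chi> (\<lambda>i. x i + y i) = \<chi> x + \<chi> y" using assms(1) fg by simp
next
  fix c x assume c: "c \<in> R" and "x \<in> E k"
  then obtain f where f: "f \<in> Rpoly" "x = th k f" using th_surj by metis
  then have "(\<lambda>i. c * x i) = th k (Polynomial.smult c f)" using c by (auto simp: th_smult)
  then show "\<chi> (\<lambda>i. c * x i) = c * \<chi> x" using assms(2) c f by simp
qed

lemma ahom_ev: assumes a: "a \<in> roots k" shows "ahom k (ev k a)"
  unfolding ahom_def
proof (intro conjI ballI)
  show "linear_form R (d k) (ev k a)"
    by (rule linear_formI_th) (auto simp: ev_th[OF a] Rpoly_add Rpoly_smult)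
  show "ev k a (hone (L k)) = 1" using ev_th[OF a Rpoly_1] by (simp add: th_1)
  fix x assume "x \<in> E k"
  then obtain f where f: "f \<in> Rpoly" "x = th k f" using th_surj by metis
  show "ev k a x \<in> R" using f by (simp add: ev_th[OF a] poly_R roots_R[OF a])
  fix y assume "y \<in> E k"
  then obtain g where g: "g \<in> Rpoly" "y = th k g" using th_surj by metis
  show "ev k a (mul k x y) = ev k a x * ev k a y"
    using f g ev_th[OF a, of "f * g"] by (simp add: ev_th[OF a] th_mult Rpoly_mult)
qed

lemma th_pCons: "c \<in> R \<Longrightarrow> f \<in> Rpoly \<Longrightarrow> th k (pCons c f) = (\<lambda>l. c * hone (L k) l + mul k (t k) (th k f) l)"
proof
  fix l assume c: "c \<in> R" and f: "f \<in> Rpoly"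
  have "pCons c f = [:c:] + [:0, 1:] * f" by simp
  then have "th k (pCons c f) l = th k ([:c:] + [:0, 1:] * f) l" by simp
  also have "\<dots> = th k [:c:] l + th k ([:0, 1:] * f) l"
    using c f by (intro th_add) auto
  finally show "th k (pCons c f) l = c * hone (L k) l + mul k (t k) (th k f) l"
    using c f by (simp only: th_const th_mult X_Rpoly)
qed

lemma ahom_th:
  assumes \<chi>: "ahom k \<chi>" and f: "f \<in> Rpoly"
  shows "\<chi> (th k f) = poly f (\<chi> (t k))"
  using f
proof (induction f)
  case 0
  have "th k 0 = (\<lambda>l. 0)" by (auto simp: th_0)
  then show ?case using linear_form_0[OF ahom_linear[OF \<chi>]] by simp
next
  case (pCons c f)
  have cf: "c \<in> R" "f \<in> Rpoly" using pCons.prems by (auto simp: Rpoly_def coeff_pCons split: nat.splits)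
  have E: "(\<lambda>l. c * hone (L k) l) \<in> E k" "mul k (t k) (th k f) \<in> E k" using cf by auto
  have "\<chi> (th k (pCons c f)) = \<chi> (\<lambda>l. c * hone (L k) l) + \<chi> (mul k (t k) (th k f))"
    unfolding th_pCons[OF cf] by (rule linear_form_add[OF ahom_linear[OF \<chi>] E])
  also have "\<chi> (\<lambda>l. c * hone (L k) l) = c"
    using linear_form_scale[OF ahom_linear[OF \<chi>] cf(1) hone_E] ahom_one[OF \<chi>] by simp
  also have "\<chi> (mul k (t k) (th k f)) = \<chi> (t k) * \<chi> (th k f)"
    using cf by (intro ahom_mul[OF \<chi>]) auto
  finally show ?case using pCons.IH cf by simp
qed

lemma ahom_root: assumes \<chi>: "ahom k \<chi>" shows "\<chi> (t k) \<in> roots k"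
proof -
  have "th k (level_poly k) = (\<lambda>l. 0)" using th_eq_0_iff[OF level_poly_Rpoly, of k k] Rpoly_1 by (metis mult.right_neutral)
  then have "poly (level_poly k) (\<chi> (t k)) = 0"
    using ahom_th[OF \<chi> level_poly_Rpoly, of k] linear_form_0[OF ahom_linear[OF \<chi>]] by simp
  then show ?thesis by (simp add: roots_def)
qed

lemma ahom_eq_ev: assumes \<chi>: "ahom k \<chi>" and x: "x \<in> E k" shows "\<chi> x = ev k (\<chi> (t k)) x"
proof -
  obtain f where f: "f \<in> Rpoly" "x = th k f" using th_surj x by metis
  then show ?thesis using ahom_th[OF \<chi> f(1)] ev_th[OF ahom_root[OF \<chi>] f(1)] by simp
qed

lemma ahom_mA: assumes \<chi>: "ahom k \<chi>" and x: "x \<in> E k" "mA x" shows "\<chi> x \<in> \<mm>"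
  using linear_form_expand[OF ahom_linear[OF \<chi>] x(1)] x(2)
  by (auto simp: mA_def intro!: \<mm>_sum \<mm>_mult ahom_R[OF \<chi>])

lemma ev_t: "a \<in> roots k \<Longrightarrow> ev k a (t k) = a"
  using ev_th[of a k "[:0, 1:]"] by simp

text \<open>Evaluation at a sends a nilpotent of the special fibre into the maximal ideal, so a
  power of a lies there.\<close>

lemma roots_\<mm>: assumes a: "a \<in> roots k" shows "a \<in> \<mm>"
proof -
  obtain N where N: "mA (th k (monom 1 N))" using t_nilpotent by blast
  have "ev k a (th k (monom 1 N)) \<in> \<mm>" by (rule ahom_mA[OF ahom_ev[OF a] _ N]) (auto intro: th_E Rpoly_monom)
  then have "a ^ N \<in> \<mm>" using ev_th[OF a Rpoly_monom[OF R_1]] by (simp add: poly_monom)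
  then show ?thesis by (rule \<mm>_powerD)
qed

lemma ahom_counit: "ahom k (counit (L k))"
  unfolding ahom_def using counit_linear counit_R counit_one counit_mul by blast

lemma counit_t: "counit (L k) (t k) = 0" using counit_th[OF X_Rpoly] by simp

lemma zero_root: "0 \<in> roots k" using ahom_root[OF ahom_counit] by (simp add: counit_t)

lemma ev_0: "x \<in> E k \<Longrightarrow> ev k 0 x = counit (L k) x"
  using ahom_eq_ev[OF ahom_counit] by (simp add: counit_t)

lemma ahom_comp: assumes f: "hopf_hom R (L k) (L m) f" and \<chi>: "ahom m \<chi>" shows "ahom k (\<lambda>x. \<chi> (f x))"
proof -
  have "linear_form R (d k) (\<lambda>x. \<chi> (f x))"
    unfolding linear_form_def
    using hopf_hom_add[OF f] hopf_hom_scale[OF f] linear_form_add[OF ahom_linear[OF \<chi>]]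
      linear_form_scale[OF ahom_linear[OF \<chi>]] hopf_hom_E[OF f] by simp
  then show ?thesis unfolding ahom_def
    using ahom_R[OF \<chi>] ahom_one[OF \<chi>] ahom_mul[OF \<chi>] hopf_hom_E[OF f] hopf_hom_one[OF f] hopf_hom_mul[OF f] by simp
qed

subsection \<open>Convolution\<close>

text \<open>The tensor product of f and g composed with the comultiplication. On algebra
  homomorphisms it is the group law; keeping f and g arbitrary allows tangent vectors to be
  translated too.\<close>

definition conv :: "nat \<Rightarrow> ('k coords \<Rightarrow> 'k) \<Rightarrow> ('k coords \<Rightarrow> 'k) \<Rightarrow> 'k coords \<Rightarrow> 'k" where
  "conv k f g x = (\<Sum>j<d k. \<Sum>l<d k. comul (L k) x j l * f (bvec j) * g (bvec l))"

lemma conv_cong: "(\<And>x. x \<in> E k \<Longrightarrow> f x = f' x) \<Longrightarrow> (\<And>x. x \<in> E k \<Longrightarrow> g x = g' x) \<Longrightarrow> conv k f g x = conv k f' g' x"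
  unfolding conv_def by (intro sum.cong refl) (simp add: free_mod_bvec)

lemma conv_linear: "linear_form R (d k) (conv k f g)"
  unfolding linear_form_def conv_def
proof (intro conjI ballI)
  fix x y assume "x \<in> E k" "y \<in> E k"
  then show "(\<Sum>j<d k. \<Sum>l<d k. comul (L k) (\<lambda>i. x i + y i) j l * f (bvec j) * g (bvec l)) =
    (\<Sum>j<d k. \<Sum>l<d k. comul (L k) x j l * f (bvec j) * g (bvec l)) +
    (\<Sum>j<d k. \<Sum>l<d k. comul (L k) y j l * f (bvec j) * g (bvec l))"
    unfolding sum.distrib[symmetric]
    by (intro sum.cong refl) (simp add: linear_form_add[OF comul_linear] distrib_right)
next
  fix c x assume "c \<in> R" "x \<in> E k"
  then show "(\<Sum>j<d k. \<Sum>l<d k. comul (L k) (\<lambda>i. c * x i) j l * f (bvec j) * g (bvec l)) =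
    c * (\<Sum>j<d k. \<Sum>l<d k. comul (L k) x j l * f (bvec j) * g (bvec l))"
    unfolding sum_distrib_left
    by (intro sum.cong refl) (simp add: linear_form_scale[OF comul_linear] mult.assoc)
qed

lemma conv_commute: "x \<in> E k \<Longrightarrow> conv k f g x = conv k g f x"
  unfolding conv_def by (subst sum.swap) (auto intro!: sum.cong simp: cocomm mult_ac)

lemma conv_assoc: assumes x: "x \<in> E k" shows "conv k (conv k f g) h x = conv k f (conv k g h) x"
proof -
  let ?A = "{..<d k}"
  let ?D = "comul (L k)"
  have "conv k (conv k f g) h x = (\<Sum>i\<in>?A. \<Sum>l\<in>?A. \<Sum>j\<in>?A. \<Sum>m\<in>?A.
      ?D x i l * ?D (bvec i) j m * (f (bvec j) * g (bvec m) * h (bvec l)))"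
    unfolding conv_def sum_distrib_left sum_distrib_right by (intro sum.cong refl) (simp add: mult_ac)
  also have "\<dots> = (\<Sum>j\<in>?A. \<Sum>i\<in>?A. \<Sum>l\<in>?A. \<Sum>m\<in>?A.
      ?D x i l * ?D (bvec i) j m * (f (bvec j) * g (bvec m) * h (bvec l)))"
    by (rule sum_swap2)
  also have "\<dots> = (\<Sum>j\<in>?A. \<Sum>m\<in>?A. \<Sum>i\<in>?A. \<Sum>l\<in>?A.
      ?D x i l * ?D (bvec i) j m * (f (bvec j) * g (bvec m) * h (bvec l)))"
    by (rule sum.cong[OF refl], rule sum_swap2)
  also have "\<dots> = (\<Sum>j\<in>?A. \<Sum>m\<in>?A. \<Sum>l\<in>?A. \<Sum>i\<in>?A.
      ?D x i l * ?D (bvec i) j m * (f (bvec j) * g (bvec m) * h (bvec l)))"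
    by (rule sum.cong[OF refl], rule sum.cong[OF refl], rule sum.swap)
  also have "\<dots> = (\<Sum>j\<in>?A. \<Sum>m\<in>?A. \<Sum>l\<in>?A. \<Sum>i\<in>?A.
      ?D x j i * ?D (bvec i) m l * (f (bvec j) * g (bvec m) * h (bvec l)))"
  proof (rule sum.cong[OF refl], rule sum.cong[OF refl], rule sum.cong[OF refl])
    fix j m l assume "j \<in> ?A" "m \<in> ?A" "l \<in> ?A"
    then show "(\<Sum>i\<in>?A. ?D x i l * ?D (bvec i) j m * (f (bvec j) * g (bvec m) * h (bvec l))) =
        (\<Sum>i\<in>?A. ?D x j i * ?D (bvec i) m l * (f (bvec j) * g (bvec m) * h (bvec l)))"
      unfolding sum_distrib_right[symmetric] using coassoc[OF x, of j m l] by simp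
  qed
  also have "\<dots> = (\<Sum>j\<in>?A. \<Sum>i\<in>?A. \<Sum>m\<in>?A. \<Sum>l\<in>?A.
      ?D x j i * ?D (bvec i) m l * (f (bvec j) * g (bvec m) * h (bvec l)))"
    by (rule sum.cong[OF refl], rule sum_swap2)
  also have "\<dots> = conv k f (conv k g h) x"
    unfolding conv_def sum_distrib_left sum_distrib_right by (intro sum.cong refl) (simp add: mult_ac)
  finally show ?thesis .
qed

lemma conv_counit:
  assumes f: "linear_form R (d k) f" and x: "x \<in> E k" shows "conv k (counit (L k)) f x = f x"
proof -
  have "conv k (counit (L k)) f x = (\<Sum>l<d k. \<Sum>j<d k. comul (L k) x j l * counit (L k) (bvec j) * f (bvec l))"
    unfolding conv_def by (rule sum.swap)
  also have "\<dots> = (\<Sum>l<d k. x l * f (bvec l))"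
    unfolding sum_distrib_right[symmetric] by (intro sum.cong refl) (simp add: counit_law[OF x])
  also have "\<dots> = f x" using linear_form_expand[OF f x] by simp
  finally show ?thesis .
qed

text \<open>Comultiplication is multiplicative. The products stay inside f and g, unevaluated, so
  that the formula serves both for homomorphisms and for a derivation in place of g.\<close>

lemma conv_mul_expand:
  assumes f: "linear_form R (d k) f" and g: "linear_form R (d k) g" and x: "x \<in> E k" and y: "y \<in> E k"
  shows "conv k f g (mul k x y) = (\<Sum>a<d k. \<Sum>b<d k. \<Sum>a'<d k. \<Sum>b'<d k.
    comul (L k) x a b * comul (L k) y a' b' * f (mul k (bvec a) (bvec a')) * g (mul k (bvec b) (bvec b')))"
proof -
  let ?A = "{..<d k}"
  let ?G = "\<lambda>j l a b a' b'. comul (L k) x a b * comul (L k) y a' b' *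
    (mul k (bvec a) (bvec a') j * f (bvec j)) * (mul k (bvec b) (bvec b') l * g (bvec l))"
  have "conv k f g (mul k x y) = (\<Sum>j\<in>?A. \<Sum>l\<in>?A. \<Sum>a\<in>?A. \<Sum>b\<in>?A. \<Sum>a'\<in>?A. \<Sum>b'\<in>?A. ?G j l a b a' b')"
    unfolding conv_def
  proof (intro sum.cong refl)
    fix j l assume jl: "j \<in> ?A" "l \<in> ?A"
    show "comul (L k) (mul k x y) j l * f (bvec j) * g (bvec l) =
      (\<Sum>a\<in>?A. \<Sum>b\<in>?A. \<Sum>a'\<in>?A. \<Sum>b'\<in>?A. ?G j l a b a' b')"
      using jl unfolding comul_mul[OF x y, of j l, OF jl[unfolded lessThan_iff]] tensor_mul_def sum_distrib_right
      by (intro sum.cong refl) (simp add: mult_ac)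
  qed
  also have "\<dots> = (\<Sum>a\<in>?A. \<Sum>j\<in>?A. \<Sum>l\<in>?A. \<Sum>b\<in>?A. \<Sum>a'\<in>?A. \<Sum>b'\<in>?A. ?G j l a b a' b')"
    by (rule sum_swap2)
  also have "\<dots> = (\<Sum>a\<in>?A. \<Sum>b\<in>?A. \<Sum>j\<in>?A. \<Sum>l\<in>?A. \<Sum>a'\<in>?A. \<Sum>b'\<in>?A. ?G j l a b a' b')"
    by (rule sum.cong[OF refl], rule sum_swap2)
  also have "\<dots> = (\<Sum>a\<in>?A. \<Sum>b\<in>?A. \<Sum>a'\<in>?A. \<Sum>j\<in>?A. \<Sum>l\<in>?A. \<Sum>b'\<in>?A. ?G j l a b a' b')"
    by (rule sum.cong[OF refl], rule sum.cong[OF refl], rule sum_swap2)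
  also have "\<dots> = (\<Sum>a\<in>?A. \<Sum>b\<in>?A. \<Sum>a'\<in>?A. \<Sum>b'\<in>?A. \<Sum>j\<in>?A. \<Sum>l\<in>?A. ?G j l a b a' b')"
    by (rule sum.cong[OF refl], rule sum.cong[OF refl], rule sum.cong[OF refl], rule sum_swap2)
  also have "\<dots> = (\<Sum>a\<in>?A. \<Sum>b\<in>?A. \<Sum>a'\<in>?A. \<Sum>b'\<in>?A.
    comul (L k) x a b * comul (L k) y a' b' * f (mul k (bvec a) (bvec a')) * g (mul k (bvec b) (bvec b')))"
  proof (intro sum.cong refl)
    fix a b a' b' assume *: "a \<in> ?A" "b \<in> ?A" "a' \<in> ?A" "b' \<in> ?A"
    have "f (mul k (bvec a) (bvec a')) = (\<Sum>j\<in>?A. mul k (bvec a) (bvec a') j * f (bvec j))"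
      using * by (intro linear_form_expand[OF f]) auto
    moreover have "g (mul k (bvec b) (bvec b')) = (\<Sum>j\<in>?A. mul k (bvec b) (bvec b') j * g (bvec j))"
      using * by (intro linear_form_expand[OF g]) auto
    ultimately show "(\<Sum>j\<in>?A. \<Sum>l\<in>?A. ?G j l a b a' b') = comul (L k) x a b * comul (L k) y a' b' *
      f (mul k (bvec a) (bvec a')) * g (mul k (bvec b) (bvec b'))"
      by (simp only: sum_distrib_left sum_distrib_right)
        (subst sum.swap, simp add: mult_ac)
  qed
  finally show ?thesis .
qed

lemma conv_prod:
  "(\<Sum>a<d k. \<Sum>b<d k. \<Sum>a'<d k. \<Sum>b'<d k.
     comul (L k) x a b * comul (L k) y a' b' * (f (bvec a) * f' (bvec a')) * (g (bvec b) * g' (bvec b'))) =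
   conv k f g x * conv k f' g' y"
  unfolding conv_def sum_distrib_right
  unfolding sum_distrib_left
  by (intro sum.cong refl) (simp add: mult_ac)

lemma ahom_conv: assumes f: "ahom k f" and g: "ahom k g" shows "ahom k (conv k f g)"
  unfolding ahom_def
proof (intro conjI ballI)
  show "linear_form R (d k) (conv k f g)" by (rule conv_linear)
  show "conv k f g (hone (L k)) = 1"
  proof -
    have "conv k f g (hone (L k)) = (\<Sum>j<d k. hone (L k) j * f (bvec j)) * (\<Sum>l<d k. hone (L k) l * g (bvec l))"
      unfolding conv_def sum_product by (intro sum.cong refl) (simp add: comul_one mult_ac)
    then show ?thesis
      using linear_form_expand[OF ahom_linear[OF f] hone_E] linear_form_expand[OF ahom_linear[OF g] hone_E]
        ahom_one[OF f] ahom_one[OF g] by simp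
  qed
  fix x assume x: "x \<in> E k"
  show "conv k f g x \<in> R"
    unfolding conv_def by (intro R_sum R_mult comul_R[OF x] ahom_R[OF f] ahom_R[OF g]) auto
  fix y assume y: "y \<in> E k"
  show "conv k f g (mul k x y) = conv k f g x * conv k f g y"
    unfolding conv_mul_expand[OF ahom_linear[OF f] ahom_linear[OF g] x y] conv_prod[symmetric]
    by (intro sum.cong refl) (auto simp: ahom_mul[OF f] ahom_mul[OF g] free_mod_bvec)
qed

lemma conv_hopf_hom:
  assumes \<theta>: "hopf_hom R (L k) (L m) \<theta>" and f: "linear_form R (d m) f" and g: "linear_form R (d m) g"
    and x: "x \<in> E k"
  shows "conv m f g (\<theta> x) = conv k (\<lambda>x. f (\<theta> x)) (\<lambda>x. g (\<theta> x)) x"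
proof -
  let ?A = "{..<d k}" and ?B = "{..<d m}"
  let ?G = "\<lambda>j l a b. comul (L k) x a b * (\<theta> (bvec a) j * f (bvec j)) * (\<theta> (bvec b) l * g (bvec l))"
  have "conv m f g (\<theta> x) = (\<Sum>j\<in>?B. \<Sum>l\<in>?B. \<Sum>a\<in>?A. \<Sum>b\<in>?A. ?G j l a b)"
    unfolding conv_def
    by (intro sum.cong refl) (simp add: hopf_hom_comul[OF \<theta> x] sum_distrib_left sum_distrib_right mult_ac)
  also have "\<dots> = (\<Sum>a\<in>?A. \<Sum>j\<in>?B. \<Sum>l\<in>?B. \<Sum>b\<in>?A. ?G j l a b)"
    by (rule sum_swap2)
  also have "\<dots> = (\<Sum>a\<in>?A. \<Sum>b\<in>?A. \<Sum>j\<in>?B. \<Sum>l\<in>?B. ?G j l a b)"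
    by (rule sum.cong[OF refl], rule sum_swap2)
  also have "\<dots> = conv k (\<lambda>x. f (\<theta> x)) (\<lambda>x. g (\<theta> x)) x"
    unfolding conv_def
  proof (intro sum.cong refl)
    fix a b assume *: "a \<in> ?A" "b \<in> ?A"
    have "f (\<theta> (bvec a)) = (\<Sum>j\<in>?B. \<theta> (bvec a) j * f (bvec j))"
      using * by (intro linear_form_expand[OF f] hopf_hom_E[OF \<theta>]) auto
    moreover have "g (\<theta> (bvec b)) = (\<Sum>j\<in>?B. \<theta> (bvec b) j * g (bvec j))"
      using * by (intro linear_form_expand[OF g] hopf_hom_E[OF \<theta>]) auto
    ultimately show "(\<Sum>j\<in>?B. \<Sum>l\<in>?B. ?G j l a b) = comul (L k) x a b * f (\<theta> (bvec a)) * g (\<theta> (bvec b))"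
      by (simp only: sum_distrib_left sum_distrib_right)
        (subst sum.swap, simp add: mult_ac)
  qed
  finally show ?thesis .
qed

subsection \<open>The action\<close>

lemma conv_act_add:
  assumes a: "a \<in> OF" and b: "b \<in> OF" and \<chi>: "ahom k \<chi>" and x: "x \<in> E k"
  shows "\<chi> (act H k (a + b) x) = conv k (\<lambda>x. \<chi> (act H k a x)) (\<lambda>x. \<chi> (act H k b x)) x"
proof -
  let ?A = "{..<d k}"
  have ab: "a + b \<in> OF" using a b by blast
  have "\<chi> (act H k (a + b) x) = (\<Sum>l\<in>?A. act H k (a + b) x l * \<chi> (bvec l))"
    by (rule linear_form_expand[OF ahom_linear[OF \<chi>] act_E[OF ab x]])
  also have "\<dots> = (\<Sum>l\<in>?A. \<Sum>j\<in>?A. \<Sum>m\<in>?A. comul (L k) x j m *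
      (mul k (act H k a (bvec j)) (act H k b (bvec m)) l * \<chi> (bvec l)))"
    by (intro sum.cong refl) (simp add: act_add[OF a b x] sum_distrib_left sum_distrib_right mult_ac)
  also have "\<dots> = (\<Sum>j\<in>?A. \<Sum>m\<in>?A. \<Sum>l\<in>?A. comul (L k) x j m *
      (mul k (act H k a (bvec j)) (act H k b (bvec m)) l * \<chi> (bvec l)))"
    by (rule sum_swap2[symmetric])
  also have "\<dots> = conv k (\<lambda>x. \<chi> (act H k a x)) (\<lambda>x. \<chi> (act H k b x)) x"
    unfolding conv_def
  proof (intro sum.cong refl)
    fix j m assume *: "j \<in> ?A" "m \<in> ?A"
    have E: "act H k a (bvec j) \<in> E k" "act H k b (bvec m) \<in> E k"
      using * a b by (auto intro!: act_E free_mod_bvec)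
    have "\<chi> (act H k a (bvec j)) * \<chi> (act H k b (bvec m)) =
        (\<Sum>l\<in>?A. mul k (act H k a (bvec j)) (act H k b (bvec m)) l * \<chi> (bvec l))"
      unfolding ahom_mul[OF \<chi> E, symmetric]
      by (intro linear_form_expand[OF ahom_linear[OF \<chi>]] mul_E E)
    then show "(\<Sum>l\<in>?A. comul (L k) x j m * (mul k (act H k a (bvec j)) (act H k b (bvec m)) l * \<chi> (bvec l))) =
      comul (L k) x j m * \<chi> (act H k a (bvec j)) * \<chi> (act H k b (bvec m))"
      by (simp add: sum_distrib_left[symmetric] mult.assoc)
  qed
  finally show ?thesis .
qed

text \<open>Lift x to level k + 1: applying \<open>\<pi> ^ k\<close> to the lift lands in the ideal
  that cuts out level k, and restriction kills that ideal.\<close>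

lemma act_pi_power_aug:
  assumes x: "x \<in> E k" "counit (L k) x = 0" shows "act H k (\<pi> ^ k) x = (\<lambda>l. 0)"
proof -
  have pk: "\<pi> ^ k \<in> OF" by (intro OF_power pi_OF)
  have "x \<in> restr H k ` E (Suc k)" using x restr_surj by simp
  then obtain y where y: "x = restr H k y" "y \<in> E (Suc k)" by (rule imageE)
  have "counit (L (Suc k)) y = 0" using hopf_hom_counit[OF restr_hom y(2)] y(1) x(2) by simp
  then have "act H (Suc k) (\<pi> ^ k) y \<in> hopf_ideal_gen R (L (Suc k)) (act H (Suc k) (\<pi> ^ k) ` aug_ideal R (L (Suc k)))"
    using y(2) by (auto simp: hopf_ideal_gen_def aug_ideal_def)
  then have "restr H k (act H (Suc k) (\<pi> ^ k) y) = (\<lambda>l. 0)" unfolding restr_ker[symmetric] by blast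
  then show ?thesis using restr_act[OF pk y(2)] y(1) by simp
qed

lemma act_pi_power:
  assumes x: "x \<in> E k" shows "act H k (\<pi> ^ k) x = (\<lambda>l. counit (L k) x * hone (L k) l)"
proof -
  have pk: "\<pi> ^ k \<in> OF" by (intro OF_power pi_OF)
  note hom = act_hom[OF pk, of k]
  let ?e = "\<lambda>l. counit (L k) x * hone (L k) l"
  have e: "?e \<in> E k" using counit_R[OF x] by blast
  have "counit (L k) ?e = counit (L k) x"
    using linear_form_scale[OF counit_linear counit_R[OF x] hone_E] counit_one by simp
  then have "counit (L k) (\<lambda>l. x l - ?e l) = 0"
    using linear_form_diff[OF counit_linear x e] by simp
  then have "act H k (\<pi> ^ k) (\<lambda>l. x l - ?e l) = (\<lambda>l. 0)" using x e by (intro act_pi_power_aug) auto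
  moreover have "act H k (\<pi> ^ k) (\<lambda>l. x l - ?e l) = (\<lambda>l. act H k (\<pi> ^ k) x l - act H k (\<pi> ^ k) ?e l)"
    by (rule hopf_hom_diff[OF hom x e])
  moreover have "act H k (\<pi> ^ k) ?e = ?e"
    using hopf_hom_scale[OF hom counit_R[OF x] hone_E] hopf_hom_one[OF hom] by simp
  ultimately have "(\<lambda>l. act H k (\<pi> ^ k) x l - ?e l) = (\<lambda>l. 0)" by simp
  then show ?thesis by (simp add: fun_eq_iff)
qed

text \<open>Since 0 is \<open>\<pi> ^ k\<close> times 0, the action of 0 factors through that of
  \<open>\<pi> ^ k\<close>, which is the unit section on level k.\<close>

lemma ahom_act_0: assumes \<chi>: "ahom k \<chi>" and x: "x \<in> E k" shows "\<chi> (act H k 0 x) = counit (L k) x"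
proof -
  have pk: "\<pi> ^ k \<in> OF" by (intro OF_power pi_OF)
  have y: "act H k 0 x \<in> E k" using act_E[OF OF_0 x] .
  have "act H k 0 x = act H k (\<pi> ^ k) (act H k 0 x)" using act_mult[OF pk OF_0 x] by simp
  also have "\<dots> = (\<lambda>l. counit (L k) (act H k 0 x) * hone (L k) l)" by (rule act_pi_power[OF y])
  also have "counit (L k) (act H k 0 x) = counit (L k) x" by (rule hopf_hom_counit[OF act_hom[OF OF_0] x])
  finally have "\<chi> (act H k 0 x) = \<chi> (\<lambda>l. counit (L k) x * hone (L k) l)" by simp
  then show ?thesis
    using linear_form_scale[OF ahom_linear[OF \<chi>] counit_R[OF x] hone_E] ahom_one[OF \<chi>] by simp
qed

text \<open>The inverse of a point is obtained from the action of -1: adding 1 and -1 gives 0, which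
  acts as the unit section.\<close>

lemma conv_inverse:
  assumes \<chi>: "ahom k \<chi>" and x: "x \<in> E k"
  shows "conv k \<chi> (\<lambda>x. \<chi> (act H k (- 1) x)) x = counit (L k) x"
proof -
  have "conv k \<chi> (\<lambda>x. \<chi> (act H k (- 1) x)) x = conv k (\<lambda>x. \<chi> (act H k 1 x)) (\<lambda>x. \<chi> (act H k (- 1) x)) x"
    by (rule conv_cong) (auto simp: act_1)
  also have "\<dots> = \<chi> (act H k (1 + - 1) x)" using conv_act_add[OF OF_1 OF_minus[OF OF_1] \<chi> x] by simp
  also have "\<dots> = counit (L k) x" using ahom_act_0[OF \<chi> x] by simp
  finally show ?thesis .
qed

subsection \<open>The points of each level\<close>

text \<open>
  A double root \<open>a\<close> of \<open>level_poly k\<close> gives a derivation over the point \<open>a\<close>. Translated to the origin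
  it is multiplied by \<open>\<pi>\<^sup>k\<close> by the action of \<open>\<pi>\<^sup>k = 0\<close>, hence vanishes.
\<close>

lemma roots_simple:
  assumes a: "a \<in> roots k" shows "poly (pderiv (level_poly k)) a \<noteq> 0"
proof
  assume dbl: "poly (pderiv (level_poly k)) a = 0"
  define D where "D x = poly (pderiv (lift k x)) a" for x
  have D_th: "D (th k f) = poly (pderiv f) a" if f: "f \<in> Rpoly" for f
  proof -
    let ?g = "lift k (th k f)"
    have g: "?g \<in> Rpoly" "th k ?g = th k f" using f by (auto simp: lift th_lift th_E)
    then have "th k (?g - f) = (\<lambda>l. 0)" using f by (auto simp: th_diff fun_eq_iff)
    then obtain h where h: "?g - f = level_poly k * h" using th_eq_0_iff[of "?g - f" k] g f by blast
    have "poly (pderiv (?g - f)) a = 0"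
      using a dbl unfolding h pderiv_mult by (simp add: roots_def)
    then show ?thesis by (simp add: D_def pderiv_diff)
  qed
  let ?\<chi> = "ev k a" and ?\<psi> = "\<lambda>x. ev k a (act H k (- 1) x)"
  have m1: "- 1 \<in> OF" using OF_1 OF_minus by blast
  note \<chi> = ahom_ev[OF a]
  have \<psi>: "ahom k ?\<psi>" by (rule ahom_comp[OF act_hom[OF m1] \<chi>])
  have D_lin: "linear_form R (d k) D"
    by (rule linear_formI_th) (auto simp: D_th Rpoly_add Rpoly_smult pderiv_add pderiv_smult)
  have D_mul: "D (mul k x y) = ?\<chi> x * D y + D x * ?\<chi> y" if xy: "x \<in> E k" "y \<in> E k" for x y
  proof -
    obtain f g where fg: "f \<in> Rpoly" "x = th k f" "g \<in> Rpoly" "y = th k g" using th_surj xy by metis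
    have "D (mul k x y) = D (th k (f * g))" using fg by (simp add: th_mult)
    also have "\<dots> = poly (f * pderiv g + g * pderiv f) a" using fg by (simp only: D_th Rpoly_mult pderiv_mult)
    finally show ?thesis using fg by (simp add: D_th ev_th[OF a])
  qed
  \<comment> \<open>Translation by the inverse of the point moves the tangent vector D from a to the
    origin.\<close>
  define D' where "D' = conv k ?\<psi> D"
  have D'_lin: "linear_form R (d k) D'" unfolding D'_def by (rule conv_linear)
  \<comment> \<open>At the origin D' is a derivation over the counit, so it vanishes on the square
    of the augmentation ideal.\<close>
  have D'_mul: "D' (mul k x y) = counit (L k) x * D' y + D' x * counit (L k) y" if xy: "x \<in> E k" "y \<in> E k" for x y
  proof -
    have "D' (mul k x y) = conv k ?\<psi> ?\<chi> x * conv k ?\<psi> D y + conv k ?\<psi> D x * conv k ?\<psi> ?\<chi> y"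
      unfolding D'_def conv_mul_expand[OF ahom_linear[OF \<psi>] D_lin xy] conv_prod[symmetric] sum.distrib[symmetric]
      by (intro sum.cong refl)
        (simp add: ahom_mul[OF \<psi>] D_mul free_mod_bvec ring_distribs mult_ac)
    moreover have "conv k ?\<psi> ?\<chi> z = counit (L k) z" if "z \<in> E k" for z
      using conv_inverse[OF \<chi> that] conv_commute[OF that] by metis
    ultimately show ?thesis using xy by (simp add: D'_def)
  qed
  have D'_sq: "D' x = 0" if x: "x \<in> aug_ideal_sq R (L k)" for x
  proof -
    let ?J = "{x \<in> aug_ideal R (L k). D' x = 0}"
    have "?J \<in> {J. {mul k x y | x y. x \<in> aug_ideal R (L k) \<and> y \<in> aug_ideal R (L k)} \<subseteq> J \<and>
        J \<subseteq> E k \<and> (\<lambda>i. 0) \<in> J \<and>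
        (\<forall>x\<in>J. \<forall>y\<in>J. (\<lambda>i. x i + y i) \<in> J) \<and> (\<forall>a\<in>E k. \<forall>x\<in>J. mul k a x \<in> J)}"
      using linear_form_0[OF D'_lin] linear_form_0[OF counit_linear[of k]]
      by (auto simp: aug_ideal_def D'_mul counit_mul mul_E free_mod_add
          linear_form_add[OF D'_lin] linear_form_add[OF counit_linear])
    then have "aug_ideal_sq R (L k) \<subseteq> ?J" unfolding aug_ideal_sq_def hopf_ideal_gen_def by (rule Inter_lower)
    then show ?thesis using x by blast
  qed
  have pk: "\<pi> ^ k \<in> OF" by (intro OF_power pi_OF)
  have D'_aug: "D' x = 0" if x: "x \<in> aug_ideal R (L k)" for x
  proof -
    have xE: "x \<in> E k" and x0: "counit (L k) x = 0" using x by (auto simp: aug_ideal_def)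
    have "(\<lambda>l. act H k (\<pi> ^ k) x l - \<pi> ^ k * x l) \<in> aug_ideal_sq R (L k)"
      using Lie pk x unfolding natural_Lie_action_def by blast
    then have "D' (\<lambda>l. act H k (\<pi> ^ k) x l - \<pi> ^ k * x l) = 0" by (rule D'_sq)
    moreover have "(\<lambda>l. act H k (\<pi> ^ k) x l - \<pi> ^ k * x l) = (\<lambda>l. (- (\<pi> ^ k)) * x l)"
      by (simp add: act_pi_power_aug[OF xE x0])
    ultimately have "- (\<pi> ^ k) * D' x = 0"
      using linear_form_scale[OF D'_lin _ xE, of "- (\<pi> ^ k)"] pk by (auto simp: R_minus)
    then show ?thesis by simp
  qed
  have D'_one: "D' (hone (L k)) = 0"
    using D'_mul[OF hone_E hone_E] mul_one[OF hone_E, of k] by (simp add: counit_one)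
  have D'_0: "D' x = 0" if x: "x \<in> E k" for x
  proof -
    let ?e = "\<lambda>l. counit (L k) x * hone (L k) l"
    have e: "?e \<in> E k" using counit_R[OF x] by blast
    have "counit (L k) ?e = counit (L k) x"
      using linear_form_scale[OF counit_linear counit_R[OF x] hone_E] counit_one by simp
    then have "(\<lambda>l. x l - ?e l) \<in> aug_ideal R (L k)"
      using linear_form_diff[OF counit_linear x e] x e by (auto simp: aug_ideal_def)
    then have "D' (\<lambda>l. x l - ?e l) = 0" by (rule D'_aug)
    moreover have "D' ?e = 0" using linear_form_scale[OF D'_lin counit_R[OF x] hone_E] D'_one by simp
    ultimately show ?thesis using linear_form_diff[OF D'_lin x e] by simp
  qed
  \<comment> \<open>Translating back writes D as the convolution of the point a with D' = 0, whereas
    D takes the coordinate to the derivative of T, which is 1.\<close>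
  have "D (t k) = conv k (counit (L k)) D (t k)" using conv_counit[OF D_lin] th_E[OF X_Rpoly] by simp
  also have "\<dots> = conv k (conv k ?\<chi> ?\<psi>) D (t k)"
    by (rule conv_cong) (auto simp: conv_inverse[OF \<chi>])
  also have "\<dots> = conv k ?\<chi> D' (t k)" unfolding D'_def by (rule conv_assoc) blast
  also have "\<dots> = conv k ?\<chi> (\<lambda>x. 0) (t k)" by (rule conv_cong) (auto simp: D'_0)
  also have "\<dots> = 0" by (simp add: conv_def)
  finally show False using D_th[OF X_Rpoly] by (simp add: pderiv_pCons)
qed

lemma level_poly_prod_roots: "level_poly k = (\<Prod>a\<in>roots k. [:- a, 1:])" and card_roots: "card (roots k) = d k"
  using separable_monic_prod_roots[OF level_poly_monic, of k] roots_simple degree_level_poly[of k] unfolding roots_def by auto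

lemma finite_roots: "finite (roots k)"
proof -
  have "level_poly k \<noteq> 0" using level_poly_monic[of k] by auto
  then show ?thesis unfolding roots_def by (rule poly_roots_finite)
qed

lemma ev_restr:
  assumes "a \<in> roots k" shows "a \<in> roots (Suc k)" and "x \<in> E (Suc k) \<Longrightarrow> ev (Suc k) a x = ev k a (restr H k x)"
proof -
  have h: "ahom (Suc k) (\<lambda>x. ev k a (restr H k x))" by (rule ahom_comp[OF restr_hom ahom_ev[OF assms]])
  have *: "ev k a (restr H k (t (Suc k))) = a" by (simp add: restr_th ev_t[OF assms])
  show "a \<in> roots (Suc k)" using ahom_root[OF h] * by simp
  show "x \<in> E (Suc k) \<Longrightarrow> ev (Suc k) a x = ev k a (restr H k x)" using ahom_eq_ev[OF h] * by simp
qed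

lemma roots_mono: "k \<le> m \<Longrightarrow> roots k \<subseteq> roots m"
  by (rule lift_Suc_mono_le) (use ev_restr(1) in auto)

lemma FR_ev:
  assumes "a \<in> roots k" "k \<le> m" "\<alpha> \<in> FR" shows "ev m a (\<alpha> m) = ev k a (\<alpha> k)"
  using assms(2)
proof (induction m rule: dec_induct)
  case (step m)
  then have "a \<in> roots m" using roots_mono assms(1) by blast
  then show ?case using step assms by (simp add: ev_restr(2) FR_E FR_restr)
qed simp


subsection \<open>Torsion points of the formal group\<close>

abbreviation FP where "FP \<equiv> formal_points v H"

lemma FR_add: "\<alpha> \<in> FR \<Longrightarrow> \<beta> \<in> FR \<Longrightarrow> (\<lambda>i l. \<alpha> i l + \<beta> i l) \<in> FR"
  and FR_mul: "\<alpha> \<in> FR \<Longrightarrow> \<beta> \<in> FR \<Longrightarrow> (\<lambda>i. mul i (\<alpha> i) (\<beta> i)) \<in> FR"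
  and FR_const: "c \<in> R \<Longrightarrow> (\<lambda>i l. c * hone (L i) l) \<in> FR"
  and FR_act: "a \<in> OF \<Longrightarrow> \<alpha> \<in> FR \<Longrightarrow> (\<lambda>i. act H i a (\<alpha> i)) \<in> FR"
  by (simp_all add: formal_ring_def free_mod_add mul_E free_mod_scale act_E hopf_hom_add[OF restr_hom]
      hopf_hom_mul[OF restr_hom] hopf_hom_scale[OF restr_hom] hopf_hom_one[OF restr_hom] restr_act)

lemma FR_scale: assumes "c \<in> R" "\<alpha> \<in> FR" shows "(\<lambda>i l. c * \<alpha> i l) \<in> FR"
  using assms by (simp add: formal_ring_def free_mod_scale hopf_hom_scale[OF restr_hom])

lemma FR_diff: "\<alpha> \<in> FR \<Longrightarrow> \<beta> \<in> FR \<Longrightarrow> (\<lambda>i l. \<alpha> i l - \<beta> i l) \<in> FR"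
  by (simp add: formal_ring_def free_mod_diff hopf_hom_diff[OF restr_hom])

lemma FR_0: "(\<lambda>i l. 0) \<in> FR"
  by (simp add: formal_ring_def hopf_hom_0[OF restr_hom])

lemma FR_eq_below: "\<alpha> \<in> FR \<Longrightarrow> \<beta> \<in> FR \<Longrightarrow> \<alpha> m = \<beta> m \<Longrightarrow> k \<le> m \<Longrightarrow> \<alpha> k = \<beta> k"
proof -
  assume *: "\<alpha> \<in> FR" "\<beta> \<in> FR" "\<alpha> m = \<beta> m" and "k \<le> m"
  show ?thesis using \<open>k \<le> m\<close>
  proof (induction rule: inc_induct)
    case (step i)
    then show ?case using FR_restr[OF *(1), of i] FR_restr[OF *(2), of i] by simp
  qed (use * in simp)
qed

lemmas FP_conj = formal_points_def[of v H, THEN equalityD1, THEN subsetD, THEN CollectD]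

lemma FP_ext: "x \<in> FP \<Longrightarrow> x \<in> FR \<rightarrow>\<^sub>E R"
  and FP_add: "x \<in> FP \<Longrightarrow> \<alpha> \<in> FR \<Longrightarrow> \<beta> \<in> FR \<Longrightarrow> x (\<lambda>i l. \<alpha> i l + \<beta> i l) = x \<alpha> + x \<beta>"
  and FP_mul: "x \<in> FP \<Longrightarrow> \<alpha> \<in> FR \<Longrightarrow> \<beta> \<in> FR \<Longrightarrow> x (\<lambda>i. mul i (\<alpha> i) (\<beta> i)) = x \<alpha> * x \<beta>"
  and FP_const: "x \<in> FP \<Longrightarrow> c \<in> R \<Longrightarrow> x (\<lambda>i l. c * hone (L i) l) = c"
  and FP_continuous: "x \<in> FP \<Longrightarrow> \<exists>i m::nat. \<forall>\<alpha>\<in>FR.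
        (\<forall>l. ereal (real m) \<le> v (\<alpha> i l)) \<longrightarrow> ereal (real M) \<le> v (x \<alpha>)"
  by (drule FP_conj, elim conjE, simp)+

lemma FP_R: "x \<in> FP \<Longrightarrow> \<alpha> \<in> FR \<Longrightarrow> x \<alpha> \<in> R"
  using FP_ext by (auto simp: PiE_iff)

lemma FP_scale:
  assumes x: "x \<in> FP" and c: "c \<in> R" and \<alpha>: "\<alpha> \<in> FR" shows "x (\<lambda>i l. c * \<alpha> i l) = c * x \<alpha>"
proof -
  have "(\<lambda>i. mul i (\<lambda>l. c * hone (L i) l) (\<alpha> i)) = (\<lambda>i l. c * \<alpha> i l)"
  proof
    fix i
    have \<alpha>i: "\<alpha> i \<in> E i" using \<alpha> by (rule FR_E)
    have "mul i (\<lambda>l. c * hone (L i) l) (\<alpha> i) = mul i (\<alpha> i) (\<lambda>l. c * hone (L i) l)"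
      using c \<alpha>i by (intro mul_commute) auto
    also have "\<dots> = (\<lambda>l. c * mul i (\<alpha> i) (hone (L i)) l)" using \<alpha>i c by (intro mul_scale) auto
    also have "mul i (\<alpha> i) (hone (L i)) = \<alpha> i" using mul_commute[OF \<alpha>i hone_E] mul_one[OF \<alpha>i] by simp
    finally show "mul i (\<lambda>l. c * hone (L i) l) (\<alpha> i) = (\<lambda>l. c * \<alpha> i l)" .
  qed
  then show ?thesis using FP_mul[OF x FR_const[OF c] \<alpha>] FP_const[OF x c] by simp
qed

lemma FP_diff:
  assumes x: "x \<in> FP" and \<alpha>: "\<alpha> \<in> FR" and \<beta>: "\<beta> \<in> FR" shows "x (\<lambda>i l. \<alpha> i l - \<beta> i l) = x \<alpha> - x \<beta>"
proof -
  have m1: "- 1 \<in> R" using R_minus[OF R_1] .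
  have "x (\<lambda>i l. \<alpha> i l + (- 1) * \<beta> i l) = x \<alpha> + (- 1) * x \<beta>"
    using FP_add[OF x \<alpha> FR_scale[OF m1 \<beta>]] FP_scale[OF x m1 \<beta>] by simp
  then show ?thesis by simp
qed

definition pt :: "nat \<Rightarrow> 'k \<Rightarrow> 'k fpoint" where
  "pt k a = (\<lambda>\<alpha>\<in>FR. ev k a (\<alpha> k))"

lemma pt_apply: "\<alpha> \<in> FR \<Longrightarrow> pt k a \<alpha> = ev k a (\<alpha> k)"
  by (simp add: pt_def)

lemma pt_le: "a \<in> roots k \<Longrightarrow> k \<le> m \<Longrightarrow> pt m a = pt k a"
  unfolding pt_def by (rule restrict_ext) (rule FR_ev)

lemma pt_FP: assumes a: "a \<in> roots k" shows "pt k a \<in> FP"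
proof -
  note \<chi> = ahom_ev[OF a]
  have "\<exists>i m::nat. \<forall>\<alpha>\<in>FR. (\<forall>l. ereal (real m) \<le> v (\<alpha> i l)) \<longrightarrow> ereal (real M) \<le> v (pt k a \<alpha>)" for M
  proof (intro exI ballI impI)
    fix \<alpha> assume \<alpha>: "\<alpha> \<in> FR" and M: "\<forall>l. ereal (real M) \<le> v (\<alpha> k l)"
    show "ereal (real M) \<le> v (pt k a \<alpha>)"
      unfolding pt_apply[OF \<alpha>] linear_form_expand[OF ahom_linear[OF \<chi>] FR_E[OF \<alpha>]]
      using M by (intro v_sum_ge v_mult_ge) (auto simp flip: R_iff intro!: ahom_R[OF \<chi>])
  qed
  then show ?thesis
    unfolding formal_points_def
    using linear_form_add[OF ahom_linear[OF \<chi>]] linear_form_scale[OF ahom_linear[OF \<chi>] _ hone_E]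
      ahom_one[OF \<chi>] ahom_mul[OF \<chi>]
    by (auto simp: PiE_iff pt_apply FR_add FR_mul FR_const FR_E ahom_R[OF \<chi>]) (simp_all add: pt_def)
qed

abbreviation X\<phi> where "X\<phi> \<equiv> \<phi> fps_X"

lemma X\<phi>_FR [simp, intro]: "X\<phi> \<in> FR"
  by (rule phi_FR) (auto simp: IF_iff fps_X_def)

lemma pt_X: "a \<in> roots k \<Longrightarrow> pt k a X\<phi> = a"
  by (simp add: pt_apply ev_t flip: t_eq)

lemma fpoint_zero_eq: "fpoint_zero v H = pt k 0"
  unfolding fpoint_zero_def pt_def
proof (rule restrict_ext)
  fix \<alpha> assume \<alpha>: "\<alpha> \<in> FR"
  show "counit (L 0) (\<alpha> 0) = ev k 0 (\<alpha> k)"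
    using FR_ev[OF zero_root le0 \<alpha>, of k] ev_0[OF FR_E[OF \<alpha>, of 0]] by simp
qed

definition root_act :: "nat \<Rightarrow> 'k \<Rightarrow> 'k \<Rightarrow> 'k" where "root_act k c a = ev k a (act H k c (t k))"
definition root_add :: "nat \<Rightarrow> 'k \<Rightarrow> 'k \<Rightarrow> 'k" where "root_add k a b = conv k (ev k a) (ev k b) (t k)"

lemma ev_root_act: assumes c: "c \<in> OF" and a: "a \<in> roots k"
  shows "root_act k c a \<in> roots k" and "x \<in> E k \<Longrightarrow> ev k (root_act k c a) x = ev k a (act H k c x)"
  using ahom_root[OF ahom_comp[OF act_hom[OF c] ahom_ev[OF a]]]
    ahom_eq_ev[OF ahom_comp[OF act_hom[OF c] ahom_ev[OF a]]] unfolding root_act_def by auto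

lemma ev_root_add: assumes a: "a \<in> roots k" and b: "b \<in> roots k"
  shows "root_add k a b \<in> roots k" and "x \<in> E k \<Longrightarrow> ev k (root_add k a b) x = conv k (ev k a) (ev k b) x"
  using ahom_root[OF ahom_conv[OF ahom_ev[OF a] ahom_ev[OF b]]]
    ahom_eq_ev[OF ahom_conv[OF ahom_ev[OF a] ahom_ev[OF b]]] unfolding root_add_def by auto

lemma fpoint_act_apply: "c \<in> OF \<Longrightarrow> \<alpha> \<in> FR \<Longrightarrow> fpoint_act v H c x \<alpha> = x (\<lambda>i. act H i c (\<alpha> i))"
  by (simp add: fpoint_act_def)

lemma fpoint_act_pt: assumes c: "c \<in> OF" and a: "a \<in> roots k"
  shows "fpoint_act v H c (pt k a) = pt k (root_act k c a)"
  unfolding fpoint_act_def pt_def[of k "root_act k c a"]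
  by (rule restrict_ext) (simp add: pt_apply FR_act[OF c] ev_root_act[OF c a] FR_E)

lemma conv_level:
  assumes ab: "a \<in> roots k" "b \<in> roots k" and "k \<le> m" and \<alpha>: "\<alpha> \<in> FR"
  shows "conv m (ev m a) (ev m b) (\<alpha> m) = conv k (ev k a) (ev k b) (\<alpha> k)"
  using \<open>k \<le> m\<close>
proof (induction m rule: dec_induct)
  case (step m)
  then have abm: "a \<in> roots m" "b \<in> roots m" using ab roots_mono by blast+
  have "conv (Suc m) (ev (Suc m) a) (ev (Suc m) b) (\<alpha> (Suc m)) =
      conv (Suc m) (\<lambda>x. ev m a (restr H m x)) (\<lambda>x. ev m b (restr H m x)) (\<alpha> (Suc m))"
    by (rule conv_cong) (simp_all add: ev_restr(2) abm)
  also have "\<dots> = conv m (ev m a) (ev m b) (restr H m (\<alpha> (Suc m)))"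
    by (rule conv_hopf_hom[OF restr_hom ahom_linear[OF ahom_ev] ahom_linear[OF ahom_ev], symmetric])
      (use abm FR_E[OF \<alpha>] in auto)
  finally show ?case using step.IH FR_restr[OF \<alpha>] by simp
qed simp

text \<open>For points that factor through level k, the approximations in the limit defining the sum
  do not change from level k on.\<close>

lemma fpoint_add_pt: assumes a: "a \<in> roots k" and b: "b \<in> roots k"
  shows "fpoint_add v H (pt k a) (pt k b) = pt k (root_add k a b)"
  unfolding fpoint_add_def pt_def[of k "root_add k a b"]
proof (rule restrict_ext)
  fix \<alpha> assume \<alpha>: "\<alpha> \<in> FR"
  let ?c = "ev k (root_add k a b) (\<alpha> k)"
  let ?S = "\<lambda>i B. \<Sum>j<d i. \<Sum>l<d i. comul (L i) (\<alpha> i) j l * pt k a (B j) * pt k b (B l)"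
  have S: "?S i B = ?c" if i: "k \<le> i" and B: "\<forall>j<d i. B j \<in> FR \<and> B j i = bvec j" for i B
  proof -
    have "?S i B = conv i (ev i a) (ev i b) (\<alpha> i)"
      unfolding conv_def
      using B FR_ev[OF a i, symmetric] FR_ev[OF b i, symmetric]
      by (intro sum.cong refl) (simp add: pt_apply)
    also have "\<dots> = conv k (ev k a) (ev k b) (\<alpha> k)" by (rule conv_level[OF a b i \<alpha>])
    finally show ?thesis using ev_root_add(2)[OF a b FR_E[OF \<alpha>]] by simp
  qed
  show "(THE c. \<forall>M::nat. \<exists>i0. \<forall>i\<ge>i0. \<forall>B. (\<forall>j<d i. B j \<in> FR \<and> B j i = bvec j) \<longrightarrow>
     ereal (real M) \<le> v (c - ?S i B)) = ?c"
  proof (rule the_equality)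
    show "\<forall>M::nat. \<exists>i0. \<forall>i\<ge>i0. \<forall>B. (\<forall>j<d i. B j \<in> FR \<and> B j i = bvec j) \<longrightarrow>
     ereal (real M) \<le> v (?c - ?S i B)"
    proof (intro allI exI impI)
      fix M :: nat and i B assume "k \<le> i" "\<forall>j<d i. B j \<in> FR \<and> B j i = bvec j"
      then have "?S i B = ?c" by (rule S)
      then show "ereal (real M) \<le> v (?c - ?S i B)" by simp
    qed
  next
    fix c assume c: "\<forall>M::nat. \<exists>i0. \<forall>i\<ge>i0. \<forall>B. (\<forall>j<d i. B j \<in> FR \<and> B j i = bvec j) \<longrightarrow>
     ereal (real M) \<le> v (c - ?S i B)"
    have "c - ?c = 0"
    proof (rule v_ge_all_imp_0)
      fix M :: nat
      obtain i0 where i0: "\<And>i B. i \<ge> i0 \<Longrightarrow> (\<forall>j<d i. B j \<in> FR \<and> B j i = bvec j) \<Longrightarrow>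
        ereal (real M) \<le> v (c - ?S i B)" using c by blast
      let ?i = "max i0 k"
      \<comment> \<open>Lifts of the basis vectors must exist for uniqueness: without them the
        condition on c would hold vacuously.\<close>
      have "\<forall>j. \<exists>\<beta>. j < d ?i \<longrightarrow> \<beta> \<in> FR \<and> \<beta> ?i = bvec j" using FR_lift[OF free_mod_bvec] by blast
      then obtain B where B: "\<forall>j<d ?i. B j \<in> FR \<and> B j ?i = bvec j" by metis
      then show "ereal (real M) \<le> v (c - ?c)" using i0[of ?i B] S[of ?i B] by simp
    qed
    then show "c = ?c" by simp
  qed
qed

section \<open>Torsion points factor through a finite level\<close>

lemma hopf_ideal_gen_least:
  "S \<subseteq> J \<Longrightarrow> J \<subseteq> E m \<Longrightarrow> (\<lambda>i. 0) \<in> J \<Longrightarrow> (\<And>x y. x \<in> J \<Longrightarrow> y \<in> J \<Longrightarrow> (\<lambda>i. x i + y i) \<in> J) \<Longrightarrow>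
    (\<And>a x. a \<in> E m \<Longrightarrow> x \<in> J \<Longrightarrow> mul m a x \<in> J) \<Longrightarrow> hopf_ideal_gen R (L m) S \<subseteq> J"
  unfolding hopf_ideal_gen_def by (rule Inter_lower) blast

lemma hopf_ideal_gen:
  assumes "S \<subseteq> E m"
  shows "S \<subseteq> hopf_ideal_gen R (L m) S" "hopf_ideal_gen R (L m) S \<subseteq> E m"
    "(\<lambda>i. 0) \<in> hopf_ideal_gen R (L m) S"
    "x \<in> hopf_ideal_gen R (L m) S \<Longrightarrow> y \<in> hopf_ideal_gen R (L m) S \<Longrightarrow> (\<lambda>i. x i + y i) \<in> hopf_ideal_gen R (L m) S"
    "a \<in> E m \<Longrightarrow> x \<in> hopf_ideal_gen R (L m) S \<Longrightarrow> mul m a x \<in> hopf_ideal_gen R (L m) S"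
proof -
  show "hopf_ideal_gen R (L m) S \<subseteq> E m"
    by (rule hopf_ideal_gen_least) (use assms in auto)
qed (auto simp: hopf_ideal_gen_def)

abbreviation aug where "aug k \<equiv> aug_ideal R (L k)"

lemma aug_E: "x \<in> aug k \<Longrightarrow> x \<in> E k" and aug_counit: "x \<in> aug k \<Longrightarrow> counit (L k) x = 0"
  by (auto simp: aug_ideal_def)

lemma act_aug: "a \<in> OF \<Longrightarrow> x \<in> aug k \<Longrightarrow> act H k a x \<in> aug k"
  using hopf_hom_counit[OF act_hom] act_E by (auto simp: aug_ideal_def)

lemma restr_aug: assumes "x \<in> aug k" shows "\<exists>y\<in>aug (Suc k). restr H k y = x"
proof -
  have "x \<in> restr H k ` E (Suc k)" using assms restr_surj by (simp add: aug_E)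
  then obtain y where y: "x = restr H k y" "y \<in> E (Suc k)" by (rule imageE)
  then have "y \<in> aug (Suc k)" using hopf_hom_counit[OF restr_hom y(2)] assms by (simp add: aug_ideal_def)
  then show ?thesis using y by blast
qed

lemma pi_power_OF: "\<pi> ^ k \<in> OF" by (intro OF_power pi_OF)

abbreviation Jk where "Jk k m \<equiv> hopf_ideal_gen R (L m) (act H m (\<pi> ^ k) ` aug m)"

lemma Jk_sub: "act H m (\<pi> ^ k) ` aug m \<subseteq> E m"
  using act_E[OF pi_power_OF] aug_E by blast

text \<open>The axioms describe the kernel of restriction by one level only. In the induction the
  element of level m is lifted within the ideal to level m + 1; the error lies in the kernel between
  these two levels, which is contained in the ideal because \<open>\<pi> ^ m\<close> is a multiple
  of \<open>\<pi> ^ k\<close>.\<close>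

lemma kernel_level:
  assumes "\<alpha> \<in> FR" "\<alpha> k = (\<lambda>l. 0)" "k \<le> m" shows "\<alpha> m \<in> Jk k m"
  using assms(3)
proof (induction m rule: dec_induct)
  case base
  then show ?case using assms hopf_ideal_gen(3)[OF Jk_sub] by simp
next
  case (step m)
  note gen = hopf_ideal_gen[OF Jk_sub[of "Suc m" k]]
  have "Jk k m \<subseteq> restr H m ` Jk k (Suc m)"
  proof (rule hopf_ideal_gen_least)
    show "act H m (\<pi> ^ k) ` aug m \<subseteq> restr H m ` Jk k (Suc m)"
    proof
      fix y assume "y \<in> act H m (\<pi> ^ k) ` aug m"
      then obtain x where x: "y = act H m (\<pi> ^ k) x" "x \<in> aug m" by (rule imageE)
      obtain z where z: "z \<in> aug (Suc m)" "restr H m z = x" using restr_aug[OF x(2)] by blast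
      have "y = restr H m (act H (Suc m) (\<pi> ^ k) z)"
        using restr_act[OF pi_power_OF aug_E[OF z(1)]] z x by simp
      moreover have "act H (Suc m) (\<pi> ^ k) z \<in> Jk k (Suc m)" using gen(1) z(1) by blast
      ultimately show "y \<in> restr H m ` Jk k (Suc m)" by (rule image_eqI)
    qed
    show "restr H m ` Jk k (Suc m) \<subseteq> E m" using gen(2) restr_E by blast
    show "(\<lambda>i. 0) \<in> restr H m ` Jk k (Suc m)"
      by (rule image_eqI[OF _ gen(3)]) (simp add: hopf_hom_0[OF restr_hom])
  next
    fix x y assume "x \<in> restr H m ` Jk k (Suc m)" "y \<in> restr H m ` Jk k (Suc m)"
    then obtain x' y' where *: "x' \<in> Jk k (Suc m)" "x = restr H m x'" "y' \<in> Jk k (Suc m)" "y = restr H m y'"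
      by (elim imageE)
    show "(\<lambda>i. x i + y i) \<in> restr H m ` Jk k (Suc m)"
      by (rule image_eqI[OF _ gen(4)[OF *(1,3)]])
        (use * gen(2) in \<open>simp add: hopf_hom_add[OF restr_hom] subsetD\<close>)
  next
    fix a x assume a: "a \<in> E m" and "x \<in> restr H m ` Jk k (Suc m)"
    then obtain x' where x: "x' \<in> Jk k (Suc m)" "x = restr H m x'" by (elim imageE)
    have "a \<in> restr H m ` E (Suc m)" using a restr_surj by simp
    then obtain a' where a': "a = restr H m a'" "a' \<in> E (Suc m)" by (rule imageE)
    show "mul m a x \<in> restr H m ` Jk k (Suc m)"
      by (rule image_eqI[OF _ gen(5)[OF a'(2) x(1)]])
        (use x a' gen(2) in \<open>simp add: hopf_hom_mul[OF restr_hom] subsetD\<close>)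
  qed
  from subsetD[OF this step.IH] obtain \<beta> where \<beta>: "\<alpha> m = restr H m \<beta>" "\<beta> \<in> Jk k (Suc m)" by (rule imageE)
  have \<beta>E: "\<beta> \<in> E (Suc m)" using \<beta>(2) gen(2) by blast
  have \<alpha>E: "\<alpha> (Suc m) \<in> E (Suc m)" using FR_E[OF assms(1)] .
  have "(\<lambda>l. \<alpha> (Suc m) l - \<beta> l) \<in> {x \<in> E (Suc m). restr H m x = (\<lambda>j. 0)}"
    using \<alpha>E \<beta>E \<beta>(1) FR_restr[OF assms(1)] by (simp add: free_mod_diff hopf_hom_diff[OF restr_hom])
  then have ker: "(\<lambda>l. \<alpha> (Suc m) l - \<beta> l) \<in> Jk m (Suc m)" by (simp only: restr_ker)
  have "Jk m (Suc m) \<subseteq> Jk k (Suc m)"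
  proof (rule hopf_ideal_gen_least)
    show "act H (Suc m) (\<pi> ^ m) ` aug (Suc m) \<subseteq> Jk k (Suc m)"
    proof
      fix y assume "y \<in> act H (Suc m) (\<pi> ^ m) ` aug (Suc m)"
      then obtain x where x: "y = act H (Suc m) (\<pi> ^ m) x" "x \<in> aug (Suc m)" by (rule imageE)
      have "\<pi> ^ m = \<pi> ^ k * \<pi> ^ (m - k)" using step.hyps by (simp flip: power_add)
      then have "y = act H (Suc m) (\<pi> ^ k) (act H (Suc m) (\<pi> ^ (m - k)) x)"
        using x act_mult[OF pi_power_OF pi_power_OF aug_E[OF x(2)]] by simp
      then show "y \<in> Jk k (Suc m)" using gen(1) act_aug[OF pi_power_OF x(2)] by blast
    qed
  qed (use gen in auto)
  then have "(\<lambda>l. (\<alpha> (Suc m) l - \<beta> l) + \<beta> l) \<in> Jk k (Suc m)"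
    using ker \<beta>(2) by (intro gen(4)) auto
  then show ?case by simp
qed

text \<open>By continuity, having valuation at least M at x depends only on the component at some
  level i. There the components with a lift satisfying this bound form an ideal; it contains the
  images of \<open>\<pi> ^ k\<close> because x is killed by that power, so
  \<open>kernel_level\<close> applies.\<close>

lemma torsion_factors:
  assumes x: "x \<in> FP" and tor: "fpoint_act v H (\<pi> ^ k) x = fpoint_zero v H"
    and \<alpha>: "\<alpha> \<in> FR" "\<alpha> k = (\<lambda>l. 0)"
  shows "x \<alpha> = 0"
proof (rule v_ge_all_imp_0)
  fix M :: nat
  obtain i m :: nat where im: "\<And>\<beta>. \<beta> \<in> FR \<Longrightarrow> (\<forall>l. ereal (real m) \<le> v (\<beta> i l)) \<Longrightarrow> ereal (real M) \<le> v (x \<beta>)"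
    using FP_continuous[OF x, of M] by blast
  then have im0: "ereal (real M) \<le> v (x \<beta>)" if "\<beta> \<in> FR" "\<beta> i = (\<lambda>l. 0)" for \<beta>
    using that by simp
  have cong: "ereal (real M) \<le> v (x \<beta>)" if "\<beta> \<in> FR" "\<gamma> \<in> FR" "\<beta> i = \<gamma> i" "ereal (real M) \<le> v (x \<gamma>)" for \<beta> \<gamma>
  proof -
    have "ereal (real M) \<le> v (x (\<lambda>i l. \<beta> i l - \<gamma> i l))"
      using that by (intro im0 FR_diff) auto
    then have "ereal (real M) \<le> v (x \<beta> - x \<gamma>)" using FP_diff[OF x that(1,2)] by simp
    from v_add_ge[OF this that(4)] show ?thesis by simp
  qed
  show "ereal (real M) \<le> v (x \<alpha>)"
  proof (cases "k \<le> i")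
    case False
    then have "\<alpha> i = (\<lambda>l. 0)" using FR_eq_below[OF \<alpha>(1) FR_0, of k i] \<alpha>(2) by simp
    then show ?thesis using im0 \<alpha>(1) by blast
  next
    case True
    let ?J = "{y \<in> E i. \<exists>\<beta>\<in>FR. \<beta> i = y \<and> ereal (real M) \<le> v (x \<beta>)}"
    have "Jk k i \<subseteq> ?J"
    proof (rule hopf_ideal_gen_least)
      show "act H i (\<pi> ^ k) ` aug i \<subseteq> ?J"
      proof
        fix y assume "y \<in> act H i (\<pi> ^ k) ` aug i"
        then obtain z where z: "y = act H i (\<pi> ^ k) z" "z \<in> aug i" by (rule imageE)
        obtain \<zeta> where \<zeta>: "\<zeta> \<in> FR" "\<zeta> i = z" using FR_lift aug_E[OF z(2)] by blast
        have "x (\<lambda>j. act H j (\<pi> ^ k) (\<zeta> j)) = fpoint_zero v H \<zeta>"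
          using fpoint_act_apply[OF pi_power_OF \<zeta>(1), of k x] tor by simp
        also have "\<dots> = counit (L i) z"
          using fpoint_zero_eq[of i] pt_apply[OF \<zeta>(1)] ev_0[OF FR_E[OF \<zeta>(1)]] \<zeta>(2) by metis
        finally have "x (\<lambda>j. act H j (\<pi> ^ k) (\<zeta> j)) = 0" using z(2) by (simp add: aug_ideal_def)
        then show "y \<in> ?J"
          using z \<zeta> act_E[OF pi_power_OF aug_E[OF z(2)]] FR_act[OF pi_power_OF \<zeta>(1)]
          by (auto intro!: bexI[of _ "\<lambda>j. act H j (\<pi> ^ k) (\<zeta> j)"])
      qed
      show "(\<lambda>l. 0) \<in> ?J" using FR_0 im0[OF FR_0] by (auto intro!: bexI[of _ "\<lambda>i l. 0"])
    next
      fix y z assume "y \<in> ?J" "z \<in> ?J"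
      then obtain \<beta> \<gamma> where *: "\<beta> \<in> FR" "\<beta> i = y" "ereal (real M) \<le> v (x \<beta>)"
        "\<gamma> \<in> FR" "\<gamma> i = z" "ereal (real M) \<le> v (x \<gamma>)" "y \<in> E i" "z \<in> E i" by blast
      show "(\<lambda>l. y l + z l) \<in> ?J"
        using * by (auto simp: FP_add[OF x] intro!: bexI[of _ "\<lambda>i l. \<beta> i l + \<gamma> i l"] v_add_ge FR_add)
    next
      fix a y assume a: "a \<in> E i" and "y \<in> ?J"
      then obtain \<beta> where *: "\<beta> \<in> FR" "\<beta> i = y" "ereal (real M) \<le> v (x \<beta>)" "y \<in> E i" by blast
      obtain \<gamma> where \<gamma>: "\<gamma> \<in> FR" "\<gamma> i = a" using FR_lift[OF a] by blast
      have "0 \<le> v (x \<gamma>)" using FP_R[OF x \<gamma>(1)] by (simp add: R_iff)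
      then show "mul i a y \<in> ?J"
        using * \<gamma> a by (auto simp: FP_mul[OF x] intro!: bexI[of _ "\<lambda>i. mul i (\<gamma> i) (\<beta> i)"] v_mult_ge' FR_mul)
    qed auto
    then have "\<alpha> i \<in> ?J" using kernel_level[OF \<alpha> True] by blast
    then show ?thesis using cong[OF \<alpha>(1)] by fastforce
  qed
qed

text \<open>By \<open>torsion_factors\<close> the value of x depends only on the component at level
  k, so x induces an algebra homomorphism there, which is evaluation at a root.\<close>

lemma torsion_pt:
  assumes x: "x \<in> FP" and tor: "fpoint_act v H (\<pi> ^ k) x = fpoint_zero v H"
  shows "x X\<phi> \<in> roots k \<and> x = pt k (x X\<phi>)"
proof -
  define li where "li y = (SOME \<alpha>. \<alpha> \<in> FR \<and> \<alpha> k = y)" for y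
  have li: "li y \<in> FR" "li y k = y" if "y \<in> E k" for y
    using someI_ex[of "\<lambda>\<alpha>. \<alpha> \<in> FR \<and> \<alpha> k = y"] FR_lift[OF that] unfolding li_def by blast+
  have eq: "x \<alpha> = x \<beta>" if "\<alpha> \<in> FR" "\<beta> \<in> FR" "\<alpha> k = \<beta> k" for \<alpha> \<beta>
  proof -
    have "x (\<lambda>i l. \<alpha> i l - \<beta> i l) = 0" using that by (intro torsion_factors[OF x tor] FR_diff) auto
    then show ?thesis using FP_diff[OF x that(1,2)] by simp
  qed
  define \<chi> where "\<chi> y = x (li y)" for y
  have x\<chi>: "x \<alpha> = \<chi> (\<alpha> k)" if "\<alpha> \<in> FR" for \<alpha>
    unfolding \<chi>_def using li[OF FR_E[OF that]] that by (intro eq) auto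
  have "ahom k \<chi>"
    unfolding ahom_def linear_form_def
  proof (intro conjI ballI)
    fix y z assume yz: "y \<in> E k" "z \<in> E k"
    have "\<chi> (\<lambda>i. y i + z i) = x (\<lambda>i l. li y i l + li z i l)"
      by (subst x\<chi>) (use li yz in \<open>auto intro!: FR_add\<close>)
    then show "\<chi> (\<lambda>i. y i + z i) = \<chi> y + \<chi> z" using FP_add[OF x] li yz by (simp add: \<chi>_def)
    have "\<chi> (mul k y z) = x (\<lambda>i. mul i (li y i) (li z i))"
      by (subst x\<chi>) (use li yz in \<open>auto intro!: FR_mul\<close>)
    then show "\<chi> (mul k y z) = \<chi> y * \<chi> z" using FP_mul[OF x] li yz by (simp add: \<chi>_def)
  next
    fix c y assume y: "c \<in> R" "y \<in> E k"
    have "\<chi> (\<lambda>i. c * y i) = x (\<lambda>i l. c * li y i l)"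
      by (subst x\<chi>) (use li y in \<open>auto intro!: FR_scale\<close>)
    then show "\<chi> (\<lambda>i. c * y i) = c * \<chi> y" using FP_scale[OF x] li y by (simp add: \<chi>_def)
  next
    fix y assume "y \<in> E k" then show "\<chi> y \<in> R" using FP_R[OF x] li by (simp add: \<chi>_def)
  next
    have "x (\<lambda>i l. 1 * hone (L i) l) = \<chi> (\<lambda>l. 1 * hone (L k) l)" by (rule x\<chi>[OF FR_const]) simp
    then show "\<chi> (hone (L k)) = 1" using FP_const[OF x R_1] by simp
  qed
  note \<chi> = this
  have X: "\<chi> (t k) = x X\<phi>" using x\<chi>[OF X\<phi>_FR] by (simp add: t_eq)
  have "x = pt k (x X\<phi>)"
  proof (rule PiE_ext[OF FP_ext[OF x] FP_ext[OF pt_FP]])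
    show "x X\<phi> \<in> roots k" using ahom_root[OF \<chi>] X by simp
    fix \<alpha> assume \<alpha>: "\<alpha> \<in> FR"
    show "x \<alpha> = pt k (x X\<phi>) \<alpha>"
      using x\<chi>[OF \<alpha>] ahom_eq_ev[OF \<chi> FR_E[OF \<alpha>]] pt_apply[OF \<alpha>] X by simp
  qed
  then show ?thesis using ahom_root[OF \<chi>] X by simp
qed

lemma pt_torsion: assumes a: "a \<in> roots k" shows "fpoint_act v H (\<pi> ^ k) (pt k a) = fpoint_zero v H"
proof -
  have "root_act k (\<pi> ^ k) a = 0"
    unfolding root_act_def using act_pi_power_aug[OF th_E[OF X_Rpoly] counit_t]
      linear_form_0[OF ahom_linear[OF ahom_ev[OF a]]] by simp
  then show ?thesis by (simp add: fpoint_act_pt[OF pi_power_OF a] fpoint_zero_eq[of k])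
qed


subsection \<open>The module of torsion points and its valuation\<close>

definition OFr :: "'k ring" where
  "OFr = \<lparr>carrier = OF, mult = (*), one = 1, zero = 0, add = (+)\<rparr>"

text \<open>Restricting to torsion makes sums computable: any finitely many such points live on a
  common level, where addition is \<open>root_add\<close>.\<close>

definition tors :: "'k fpoint set" where
  "tors = {x \<in> FP. \<exists>k. fpoint_act v H (\<pi> ^ k) x = fpoint_zero v H}"

definition M :: "('k, 'k fpoint) module" where
  "M = \<lparr>carrier = tors, mult = undefined, one = undefined, zero = fpoint_zero v H,
     add = fpoint_add v H, smult = fpoint_act v H\<rparr>"

lemma OFr_simps [simp]: "carrier OFr = OF" "mult OFr = (*)" "one OFr = 1" "zero OFr = 0" "add OFr = (+)"
  by (simp_all add: OFr_def)

lemma M_simps: "carrier M = tors" "zero M = fpoint_zero v H" "add M = fpoint_add v H" "smult M = fpoint_act v H"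
  by (simp_all add: M_def)

abbreviation \<kappa> :: "'k fpoint \<Rightarrow> 'k" where "\<kappa> x \<equiv> x X\<phi>"
abbreviation w :: "'k fpoint \<Rightarrow> ereal" where "w x \<equiv> v (\<kappa> x)"

lemma tors_pt: "a \<in> roots k \<Longrightarrow> pt k a \<in> tors"
  unfolding tors_def using pt_FP pt_torsion by blast

lemma tors_level: "x \<in> tors \<Longrightarrow> \<exists>k. \<forall>m\<ge>k. \<kappa> x \<in> roots m \<and> x = pt m (\<kappa> x)"
proof -
  assume "x \<in> tors"
  then obtain k where "\<kappa> x \<in> roots k" "x = pt k (\<kappa> x)" using torsion_pt by (auto simp: tors_def)
  then have "\<kappa> x \<in> roots m \<and> x = pt m (\<kappa> x)" if "m \<ge> k" for m
    using that pt_le[of "\<kappa> x" k m] roots_mono[of k m] by auto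
  then show ?thesis by blast
qed

lemma tors_common_level:
  assumes "x \<in> tors" "y \<in> tors" "z \<in> tors"
  shows "\<exists>k\<ge>m. \<kappa> x \<in> roots k \<and> x = pt k (\<kappa> x) \<and> \<kappa> y \<in> roots k \<and> y = pt k (\<kappa> y) \<and> \<kappa> z \<in> roots k \<and> z = pt k (\<kappa> z)"
proof -
  obtain k1 k2 k3 where *: "\<forall>m\<ge>k1. \<kappa> x \<in> roots m \<and> x = pt m (\<kappa> x)"
    "\<forall>m\<ge>k2. \<kappa> y \<in> roots m \<and> y = pt m (\<kappa> y)" "\<forall>m\<ge>k3. \<kappa> z \<in> roots m \<and> z = pt m (\<kappa> z)"
    using tors_level[OF assms(1)] tors_level[OF assms(2)] tors_level[OF assms(3)] by metis
  define k where "k = Max {m, k1, k2, k3}"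
  have "m \<le> k" "k1 \<le> k" "k2 \<le> k" "k3 \<le> k" by (auto simp: k_def)
  with * show ?thesis by blast
qed

lemma tE: "t k \<in> E k" using th_E[OF X_Rpoly] .

lemma root_add_commute: "root_add k a b = root_add k b a"
  unfolding root_add_def by (rule conv_commute[OF tE])

lemma root_add_assoc:
  assumes abc: "a \<in> roots k" "b \<in> roots k" "c \<in> roots k"
  shows "root_add k (root_add k a b) c = root_add k a (root_add k b c)"
proof -
  have "root_add k (root_add k a b) c = conv k (conv k (ev k a) (ev k b)) (ev k c) (t k)"
    unfolding root_add_def[of k "root_add k a b"] by (rule conv_cong) (simp_all add: ev_root_add abc)
  also have "\<dots> = conv k (ev k a) (conv k (ev k b) (ev k c)) (t k)" by (rule conv_assoc[OF tE])
  also have "\<dots> = root_add k a (root_add k b c)"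
    unfolding root_add_def[of k a] by (rule conv_cong) (simp_all add: ev_root_add abc)
  finally show ?thesis .
qed

lemma root_add_0: assumes "a \<in> roots k" shows "root_add k 0 a = a"
proof -
  have "root_add k 0 a = conv k (counit (L k)) (ev k a) (t k)"
    unfolding root_add_def by (rule conv_cong) (simp_all add: ev_0)
  then show ?thesis using conv_counit[OF ahom_linear[OF ahom_ev[OF assms]] tE] ev_t[OF assms] by simp
qed

lemma m1_OF: "- 1 \<in> OF" using OF_1 OF_minus by blast

lemma root_add_inverse: assumes a: "a \<in> roots k" shows "root_add k a (root_act k (- 1) a) = 0"
proof -
  have "root_add k a (root_act k (- 1) a) = conv k (ev k a) (\<lambda>x. ev k a (act H k (- 1) x)) (t k)"
    unfolding root_add_def by (rule conv_cong) (simp_all add: ev_root_act[OF m1_OF a])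
  then show ?thesis using conv_inverse[OF ahom_ev[OF a] tE] counit_t by simp
qed

lemma root_act_root_add: assumes c: "c \<in> OF" and a: "a \<in> roots k" and b: "b \<in> roots k"
  shows "root_act k c (root_add k a b) = root_add k (root_act k c a) (root_act k c b)"
proof -
  have "root_act k c (root_add k a b) = conv k (ev k a) (ev k b) (act H k c (t k))"
    unfolding root_act_def by (rule ev_root_add(2)[OF a b act_E[OF c tE]])
  also have "\<dots> = conv k (\<lambda>x. ev k a (act H k c x)) (\<lambda>x. ev k b (act H k c x)) (t k)"
    by (rule conv_hopf_hom[OF act_hom[OF c] ahom_linear[OF ahom_ev[OF a]] ahom_linear[OF ahom_ev[OF b]] tE])
  also have "\<dots> = root_add k (root_act k c a) (root_act k c b)"
    unfolding root_add_def by (rule conv_cong) (simp_all add: ev_root_act[OF c] a b)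
  finally show ?thesis .
qed

lemma root_act_add: assumes c: "c \<in> OF" "c' \<in> OF" and a: "a \<in> roots k"
  shows "root_act k (c + c') a = root_add k (root_act k c a) (root_act k c' a)"
proof -
  have "root_act k (c + c') a = conv k (\<lambda>x. ev k a (act H k c x)) (\<lambda>x. ev k a (act H k c' x)) (t k)"
    unfolding root_act_def by (rule conv_act_add[OF c ahom_ev[OF a] tE])
  also have "\<dots> = root_add k (root_act k c a) (root_act k c' a)"
    unfolding root_add_def by (rule conv_cong) (simp_all add: ev_root_act[OF c(1) a] ev_root_act[OF c(2) a])
  finally show ?thesis .
qed

lemma root_act_mult: assumes c: "c \<in> OF" "c' \<in> OF" and a: "a \<in> roots k"
  shows "root_act k (c * c') a = root_act k c (root_act k c' a)"
proof -
  have "root_act k (c * c') a = ev k a (act H k c' (act H k c (t k)))"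
    unfolding root_act_def using act_mult[OF c(2,1) tE] by (simp add: mult.commute)
  also have "\<dots> = ev k (root_act k c' a) (act H k c (t k))"
    using ev_root_act(2)[OF c(2) a act_E[OF c(1) tE]] by simp
  finally show ?thesis by (simp add: root_act_def)
qed

lemma root_act_1: "a \<in> roots k \<Longrightarrow> root_act k 1 a = a"
  unfolding root_act_def by (simp add: act_1[OF tE] ev_t)

lemma cring_OFr: "cring OFr"
proof (rule cringI)
  show "abelian_group OFr"
    by (rule abelian_groupI) (auto intro: bexI[of _ "- _"] simp: add_ac)
  show "comm_monoid OFr"
    by (rule comm_monoidI) (auto simp: mult_ac)
qed (auto simp: ring_distribs)

lemma abelian_group_M: "abelian_group M"
proof (rule abelian_groupI)
  fix x y z assume xyz: "x \<in> carrier M" "y \<in> carrier M" "z \<in> carrier M"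
  then obtain k where k: "\<kappa> x \<in> roots k" "x = pt k (\<kappa> x)" "\<kappa> y \<in> roots k" "y = pt k (\<kappa> y)"
    "\<kappa> z \<in> roots k" "z = pt k (\<kappa> z)" using tors_common_level[of x y z] by (auto simp: M_simps)
  note [simp] = ev_root_add(1) fpoint_add_pt
  have "fpoint_add v H (pt k (\<kappa> x)) (pt k (\<kappa> y)) \<in> tors" using k(1,3) by (simp add: tors_pt)
  then show "x \<oplus>\<^bsub>M\<^esub> y \<in> carrier M" using k by (simp add: M_simps)
  have "fpoint_add v H (fpoint_add v H (pt k (\<kappa> x)) (pt k (\<kappa> y))) (pt k (\<kappa> z)) =
    fpoint_add v H (pt k (\<kappa> x)) (fpoint_add v H (pt k (\<kappa> y)) (pt k (\<kappa> z)))" using k(1,3,5) by (simp add: root_add_assoc)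
  then show "x \<oplus>\<^bsub>M\<^esub> y \<oplus>\<^bsub>M\<^esub> z = x \<oplus>\<^bsub>M\<^esub> (y \<oplus>\<^bsub>M\<^esub> z)" using k(2,4,6) by (simp add: M_simps)
  have "fpoint_add v H (pt k (\<kappa> x)) (pt k (\<kappa> y)) = fpoint_add v H (pt k (\<kappa> y)) (pt k (\<kappa> x))"
    using k(1,3,5) by (simp add: root_add_commute)
  then show "x \<oplus>\<^bsub>M\<^esub> y = y \<oplus>\<^bsub>M\<^esub> x" using k(2,4) by (simp add: M_simps)
next
  show "\<zero>\<^bsub>M\<^esub> \<in> carrier M" using tors_pt[OF zero_root, of 0] fpoint_zero_eq[of 0] by (simp add: M_simps)
next
  fix x assume x: "x \<in> carrier M"
  then obtain k where k: "\<kappa> x \<in> roots k" "x = pt k (\<kappa> x)" using tors_level[of x] by (auto simp: M_simps)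
  have "fpoint_add v H (pt k 0) (pt k (\<kappa> x)) = pt k (\<kappa> x)"
    using k(1) by (simp add: fpoint_add_pt zero_root root_add_0)
  then show "\<zero>\<^bsub>M\<^esub> \<oplus>\<^bsub>M\<^esub> x = x" using k(2) fpoint_zero_eq[of k] by (simp add: M_simps)
  let ?y = "pt k (root_act k (- 1) (\<kappa> x))"
  have "fpoint_add v H ?y (pt k (\<kappa> x)) = pt k 0"
    using k(1) root_add_inverse[OF k(1)] by (simp add: fpoint_add_pt ev_root_act(1)[OF m1_OF] root_add_commute[of k _ "\<kappa> x"])
  then have "?y \<oplus>\<^bsub>M\<^esub> x = \<zero>\<^bsub>M\<^esub>" using k(2) fpoint_zero_eq[of k] by (simp add: M_simps)
  moreover have "?y \<in> carrier M" using tors_pt ev_root_act(1)[OF m1_OF k(1)] by (simp add: M_simps)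
  ultimately show "\<exists>y\<in>carrier M. y \<oplus>\<^bsub>M\<^esub> x = \<zero>\<^bsub>M\<^esub>" by blast
qed

lemma module_M: "module OFr M"
proof (rule moduleI[OF cring_OFr abelian_group_M])
  fix a x assume a: "a \<in> carrier OFr" and x: "x \<in> carrier M"
  obtain k where k: "\<kappa> x \<in> roots k" "x = pt k (\<kappa> x)" using x tors_level[of x] by (auto simp: M_simps)
  have a: "a \<in> OF" using a by simp
  note [simp] = ev_root_act(1) fpoint_act_pt fpoint_add_pt ev_root_add(1)
  have "fpoint_act v H a (pt k (\<kappa> x)) \<in> tors" using a k(1) by (simp add: tors_pt del: Int_iff)
  then show "a \<odot>\<^bsub>M\<^esub> x \<in> carrier M" using k(2) by (simp add: M_simps)
  {
    fix b assume "b \<in> carrier OFr"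
    then have b: "b \<in> OF" by simp
    have "fpoint_act v H (a + b) (pt k (\<kappa> x)) =
       fpoint_add v H (fpoint_act v H a (pt k (\<kappa> x))) (fpoint_act v H b (pt k (\<kappa> x)))"
      using a b k(1) OF_add[OF a b] by (simp add: root_act_add del: Int_iff)
    then show "(a \<oplus>\<^bsub>OFr\<^esub> b) \<odot>\<^bsub>M\<^esub> x = a \<odot>\<^bsub>M\<^esub> x \<oplus>\<^bsub>M\<^esub> b \<odot>\<^bsub>M\<^esub> x"
      using k(2) by (simp add: M_simps)
    have "fpoint_act v H (a * b) (pt k (\<kappa> x)) = fpoint_act v H a (fpoint_act v H b (pt k (\<kappa> x)))"
      using a b k(1) OF_mult[OF a b] by (simp add: root_act_mult del: Int_iff)
    then show "(a \<otimes>\<^bsub>OFr\<^esub> b) \<odot>\<^bsub>M\<^esub> x = a \<odot>\<^bsub>M\<^esub> (b \<odot>\<^bsub>M\<^esub> x)"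
      using k(2) by (simp add: M_simps)
  }
  {
    fix y assume y: "y \<in> carrier M"
    obtain k where k: "\<kappa> x \<in> roots k" "x = pt k (\<kappa> x)" "\<kappa> y \<in> roots k" "y = pt k (\<kappa> y)"
      using x y tors_common_level[of x y y] by (auto simp: M_simps)
    have "fpoint_act v H a (fpoint_add v H (pt k (\<kappa> x)) (pt k (\<kappa> y))) =
      fpoint_add v H (fpoint_act v H a (pt k (\<kappa> x))) (fpoint_act v H a (pt k (\<kappa> y)))"
      using a k(1,3) by (simp add: root_act_root_add del: Int_iff)
    then show "a \<odot>\<^bsub>M\<^esub> (x \<oplus>\<^bsub>M\<^esub> y) = a \<odot>\<^bsub>M\<^esub> x \<oplus>\<^bsub>M\<^esub> a \<odot>\<^bsub>M\<^esub> y"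
      using k(2,4) by (simp add: M_simps)
  }
next
  fix x assume x: "x \<in> carrier M"
  obtain k where k: "\<kappa> x \<in> roots k" "x = pt k (\<kappa> x)" using x tors_level[of x] by (auto simp: M_simps)
  have "fpoint_act v H 1 (pt k (\<kappa> x)) = pt k (\<kappa> x)" using k(1) fpoint_act_pt[OF OF_1 k(1)] by (simp add: root_act_1)
  then show "\<one>\<^bsub>OFr\<^esub> \<odot>\<^bsub>M\<^esub> x = x" using k(2) by (simp add: M_simps)
qed

sublocale M: module OFr M by (rule module_M)

section \<open>Torsion layers and the valuation of their points\<close>

definition Mk :: "nat \<Rightarrow> 'k fpoint set" where
  "Mk k = {x \<in> carrier M. \<pi> ^ k \<odot>\<^bsub>M\<^esub> x = \<zero>\<^bsub>M\<^esub>}"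

lemma Mk_eq: "Mk k = pt k ` roots k"
proof
  show "Mk k \<subseteq> pt k ` roots k"
    using torsion_pt by (auto simp: Mk_def M_simps tors_def)
  show "pt k ` roots k \<subseteq> Mk k"
    using pt_torsion tors_pt by (auto simp: Mk_def M_simps)
qed

lemma inj_on_pt: "inj_on (pt k) (roots k)"
  by (rule inj_on_inverseI[of _ "\<lambda>x. \<kappa> x"]) (rule pt_X)

lemma card_Mk: "card (Mk k) = residue_card v F ^ (n * k)"
  unfolding Mk_eq card_image[OF inj_on_pt] card_roots d_eq ..

lemma finite_Mk: "finite (Mk k)"
  unfolding Mk_eq using finite_roots by blast

lemma M_torsion: "x \<in> carrier M \<Longrightarrow> \<exists>k. x \<in> Mk k"
  by (auto simp: Mk_def M_simps tors_def)

lemma MkD: "x \<in> Mk k \<Longrightarrow> \<kappa> x \<in> roots k \<and> x = pt k (\<kappa> x)"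
  unfolding Mk_eq using pt_X by auto

lemma M_common_level:
  assumes "x \<in> carrier M" "y \<in> carrier M" "z \<in> carrier M"
  obtains k where "m \<le> k" "x \<in> Mk k" "y \<in> Mk k" "z \<in> Mk k"
  using tors_common_level[of x y z m] assms unfolding Mk_eq M_simps by (metis image_eqI)

lemma \<kappa>_0 [simp]: "\<kappa> \<zero>\<^bsub>M\<^esub> = 0"
  using pt_X[OF zero_root, of 0] by (simp add: M_simps fpoint_zero_eq[of 0])

lemma \<kappa>_inj: "x \<in> carrier M \<Longrightarrow> y \<in> carrier M \<Longrightarrow> \<kappa> x = \<kappa> y \<Longrightarrow> x = y"
  by (rule M_common_level[of x y y]) (use MkD in metis)+

lemma w_pos: "x \<in> carrier M \<Longrightarrow> 0 < w x"
  using M_torsion MkD roots_\<mm> by (metis \<mm>_iff)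

lemma w_eq_infty_iff: "x \<in> carrier M \<Longrightarrow> w x = \<infinity> \<longleftrightarrow> x = \<zero>\<^bsub>M\<^esub>"
  using \<kappa>_inj[of x "\<zero>\<^bsub>M\<^esub>"] by auto

lemma w_0 [simp]: "w \<zero>\<^bsub>M\<^esub> = \<infinity>" by simp

lemma v_ev_diff:
  assumes "a \<in> roots k" "b \<in> roots k" "x \<in> E k" shows "v (a - b) \<le> v (ev k a x - ev k b x)"
  unfolding ev_def by (rule v_poly_diff) (use assms lift roots_R in auto)

text \<open>The comultiplication has coefficients in R, so translation does not expand distances.
  Applied to a translation and its inverse this gives the isometry \<open>w_diff\<close>.\<close>

lemma \<kappa>_add_diff:
  assumes "x \<in> carrier M" "y \<in> carrier M" "u \<in> carrier M"
  shows "v (\<kappa> x - \<kappa> y) \<le> v (\<kappa> (x \<oplus>\<^bsub>M\<^esub> u) - \<kappa> (y \<oplus>\<^bsub>M\<^esub> u))"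
proof -
  obtain k where k: "x \<in> Mk k" "y \<in> Mk k" "u \<in> Mk k" using M_common_level[OF assms, of 0] by blast
  note x = MkD[OF k(1)] and y = MkD[OF k(2)] and u = MkD[OF k(3)]
  let ?a = "\<kappa> x" and ?b = "\<kappa> y" and ?u = "\<kappa> u"
  have "x \<oplus>\<^bsub>M\<^esub> u = pt k (root_add k ?a ?u)" "y \<oplus>\<^bsub>M\<^esub> u = pt k (root_add k ?b ?u)"
    using fpoint_add_pt x y u by (metis M_simps(3))+
  then have eq: "\<kappa> (x \<oplus>\<^bsub>M\<^esub> u) - \<kappa> (y \<oplus>\<^bsub>M\<^esub> u) = root_add k ?a ?u - root_add k ?b ?u"
    using x y u by (simp add: pt_X ev_root_add)
  have "root_add k ?a ?u - root_add k ?b ?u = (\<Sum>j<d k. \<Sum>l<d k. comul (L k) (t k) j l *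
      ((ev k ?a (bvec j) - ev k ?b (bvec j)) * ev k ?u (bvec l)))"
    unfolding root_add_def conv_def sum_subtractf[symmetric] by (intro sum.cong refl) (simp add: algebra_simps)
  also have "v (?a - ?b) \<le> v \<dots>"
    using x y u by (intro v_sum_ge v_mult_ge' v_mult_ge v_ev_diff)
      (auto simp flip: R_iff intro!: comul_R tE ahom_R[OF ahom_ev])
  finally show ?thesis unfolding eq .
qed

lemma w_add:
  assumes x: "x \<in> carrier M" and y: "y \<in> carrier M" shows "min (w x) (w y) \<le> w (x \<oplus>\<^bsub>M\<^esub> y)"
proof -
  have "w x \<le> v (\<kappa> (x \<oplus>\<^bsub>M\<^esub> y) - \<kappa> y)" using \<kappa>_add_diff[OF x M.M.zero_closed y] x y by simp
  then have "min (w x) (w y) \<le> v ((\<kappa> (x \<oplus>\<^bsub>M\<^esub> y) - \<kappa> y) + \<kappa> y)"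
    by (intro v_add_ge) (auto intro: min.coboundedI1 min.coboundedI2)
  then show ?thesis by simp
qed

lemma w_diff:
  assumes x: "x \<in> carrier M" and y: "y \<in> carrier M" shows "w (x \<ominus>\<^bsub>M\<^esub> y) = v (\<kappa> x - \<kappa> y)"
proof (rule antisym)
  have "x \<ominus>\<^bsub>M\<^esub> y \<oplus>\<^bsub>M\<^esub> y = x" using x y by (simp add: a_minus_def M.M.a_assoc M.M.l_neg)
  then show "w (x \<ominus>\<^bsub>M\<^esub> y) \<le> v (\<kappa> x - \<kappa> y)"
    using \<kappa>_add_diff[of "x \<ominus>\<^bsub>M\<^esub> y" "\<zero>\<^bsub>M\<^esub>" y] x y by simp
  show "v (\<kappa> x - \<kappa> y) \<le> w (x \<ominus>\<^bsub>M\<^esub> y)"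
    using \<kappa>_add_diff[OF x y, of "\<ominus>\<^bsub>M\<^esub> y"] x y by (simp add: a_minus_def M.M.r_neg)
qed

lemma \<kappa>_smult: "c \<in> OF \<Longrightarrow> x \<in> Mk k \<Longrightarrow> \<kappa> (c \<odot>\<^bsub>M\<^esub> x) = root_act k c (\<kappa> x)"
  using MkD fpoint_act_pt pt_X ev_root_act(1) by (metis M_simps(4))

lemma w_smult: assumes c: "c \<in> OF" and x: "x \<in> carrier M" shows "w x \<le> w (c \<odot>\<^bsub>M\<^esub> x)"
proof -
  obtain k where k: "x \<in> Mk k" using M_torsion[OF x] by blast
  have a: "\<kappa> x \<in> roots k" using MkD[OF k] by blast
  have "ev k 0 (act H k c (t k)) = 0"
    using ev_0[OF act_E[OF c tE]] hopf_hom_counit[OF act_hom[OF c] tE] counit_t by simp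
  then show ?thesis
    using v_ev_diff[OF a zero_root act_E[OF c tE]] \<kappa>_smult[OF c k] by (simp add: root_act_def)
qed

text \<open>Multiplication by \<pi> is zero on level 1, so a polynomial representing it in the
  coordinate is a multiple of \<open>level_poly 1\<close>.\<close>

lemma v_level_poly_1_le:
  assumes "a \<in> roots m" "1 \<le> m" shows "v (poly (level_poly 1) a) \<le> v (root_act m \<pi> a)"
proof -
  let ?\<beta> = "\<lambda>i. act H i \<pi> (X\<phi> i)"
  have \<beta>: "?\<beta> \<in> FR" by (rule FR_act[OF pi_OF X\<phi>_FR])
  obtain f where f: "f \<in> Rpoly" "th m f = act H m \<pi> (t m)" using th_surj[OF act_E[OF pi_OF tE]] by metis
  have "th 1 f = ?\<beta> 1"
    unfolding th_def by (rule FR_eq_below[OF phi_FR[OF Rpoly_IF[OF f(1)]] \<beta> _ assms(2)])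
      (use f in \<open>simp add: th_def t_eq\<close>)
  also have "\<dots> = (\<lambda>l. 0)" using act_pi_power_aug[OF tE counit_t, of 1] by (simp add: t_eq)
  finally obtain g where g: "g \<in> Rpoly" "f = level_poly 1 * g" using th_eq_0_iff[OF f(1)] by blast
  have "root_act m \<pi> a = poly f a" using ev_th[OF assms(1) f(1)] f(2) by (simp add: root_act_def)
  also have "\<dots> = poly (level_poly 1) a * poly g a" unfolding g(2) by simp
  finally have "root_act m \<pi> a = poly (level_poly 1) a * poly g a" .
  then show ?thesis using poly_R[OF g(1) roots_R[OF assms(1)]] by (simp add: R_iff v_mult_ge)
qed

text \<open>Conversely \<open>level_poly 1\<close> vanishes on level 1, so by
  \<open>kernel_level\<close> it lies in the ideal generated by the \<pi>-images of augmentation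
  elements. Each such element has constant term 0, hence is divisible by the coordinate, and its
  image is divisible by that of the coordinate.\<close>

lemma v_level_poly_1_ge:
  assumes a: "a \<in> roots m" and m: "1 \<le> m" shows "v (root_act m \<pi> a) \<le> v (poly (level_poly 1) a)"
proof -
  note \<chi> = ahom_ev[OF a]
  let ?J = "{y \<in> E m. v (root_act m \<pi> a) \<le> v (ev m a y)}"
  have th0: "th 1 (level_poly 1) = (\<lambda>l. 0)" using th_eq_0_iff[OF level_poly_Rpoly, of 1 1] Rpoly_1 by (metis mult.right_neutral)
  have "th m (level_poly 1) \<in> Jk 1 m"
    unfolding th_def by (rule kernel_level[OF phi_FR[OF Rpoly_IF[OF level_poly_Rpoly]] _ m]) (use th0 in \<open>simp add: th_def\<close>)
  moreover have "Jk 1 m \<subseteq> ?J"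
  proof (rule hopf_ideal_gen_least)
    show "act H m (\<pi> ^ 1) ` aug m \<subseteq> ?J"
    proof
      fix y assume "y \<in> act H m (\<pi> ^ 1) ` aug m"
      then obtain z where z: "y = act H m \<pi> z" "z \<in> aug m" by auto
      obtain f where f: "f \<in> Rpoly" "z = th m f" using th_surj[OF aug_E[OF z(2)]] by metis
      obtain c g where cg: "f = pCons c g" by (cases f)
      have c: "c = 0" using counit_th[OF f(1), of m] aug_counit[OF z(2)] f(2) cg by simp
      have g: "g \<in> Rpoly" using f(1) cg by (auto simp: Rpoly_def coeff_pCons split: nat.splits)
      have "z = mul m (t m) (th m g)" using th_pCons[OF R_0 g, of m] f(2) cg c by simp
      then have y: "y = mul m (act H m \<pi> (t m)) (act H m \<pi> (th m g))"
        using z(1) hopf_hom_mul[OF act_hom[OF pi_OF] tE th_E[OF g]] by simp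
      have E: "act H m \<pi> (t m) \<in> E m" "act H m \<pi> (th m g) \<in> E m" using act_E[OF pi_OF] tE th_E[OF g] by auto
      have "0 \<le> v (ev m a (act H m \<pi> (th m g)))" using ahom_R[OF \<chi> E(2)] by (simp add: R_iff)
      then have "v (root_act m \<pi> a) \<le> v (ev m a y)"
        unfolding y ahom_mul[OF \<chi> E] root_act_def by (rule v_mult_ge[OF order_refl])
      then show "y \<in> ?J" using y mul_E[OF E] by simp
    qed
    show "(\<lambda>i. 0) \<in> ?J" using linear_form_0[OF ahom_linear[OF \<chi>]] by simp
  next
    fix x y assume "x \<in> ?J" "y \<in> ?J"
    then show "(\<lambda>i. x i + y i) \<in> ?J"
      using linear_form_add[OF ahom_linear[OF \<chi>]] by (auto intro: v_add_ge)
  next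
    fix b x assume "b \<in> E m" "x \<in> ?J"
    then show "mul m b x \<in> ?J" using ahom_R[OF \<chi>] by (auto simp: ahom_mul[OF \<chi>] R_iff intro: v_mult_ge')
  qed auto
  ultimately have "th m (level_poly 1) \<in> ?J" by blast
  then show ?thesis using ev_th[OF a level_poly_Rpoly] by simp
qed

lemma w_pi:
  assumes x: "x \<in> carrier M" shows "w (\<pi> \<odot>\<^bsub>M\<^esub> x) = (\<Sum>s\<in>Mk 1. w (x \<ominus>\<^bsub>M\<^esub> s))"
proof -
  obtain m where m: "1 \<le> m" "x \<in> Mk m" using M_common_level[OF x x x] by metis
  have a: "\<kappa> x \<in> roots m" using MkD[OF m(2)] by blast
  have "w (\<pi> \<odot>\<^bsub>M\<^esub> x) = v (poly (level_poly 1) (\<kappa> x))"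
    using v_level_poly_1_le[OF a m(1)] v_level_poly_1_ge[OF a m(1)] \<kappa>_smult[OF pi_OF m(2)] by simp
  also have "poly (level_poly 1) (\<kappa> x) = (\<Prod>b\<in>roots 1. \<kappa> x - b)"
    by (subst level_poly_prod_roots) (simp add: poly_prod)
  also have "v \<dots> = (\<Sum>b\<in>roots 1. v (\<kappa> x - b))" by (rule v_prod[OF finite_roots])
  also have "\<dots> = (\<Sum>s\<in>Mk 1. w (x \<ominus>\<^bsub>M\<^esub> s))"
    unfolding Mk_eq sum.reindex[OF inj_on_pt] o_def
  proof (rule sum.cong[OF refl])
    fix b assume b: "b \<in> roots 1"
    then have "pt 1 b \<in> carrier M" by (simp add: M_simps tors_pt)
    from w_diff[OF x this] show "v (\<kappa> x - b) = w (x \<ominus>\<^bsub>M\<^esub> pt 1 b)" unfolding pt_X[OF b] by simp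
  qed
  finally show ?thesis .
qed

text \<open>For n = 0 every level has rank 1 and only the root 0, so the coordinate would vanish at
  all levels, against injectivity of \<phi>.\<close>

lemma n_pos: "0 < n"
proof (rule ccontr)
  assume "\<not> 0 < n"
  then have card: "card (roots k) = 1" for k by (simp add: card_roots d_eq)
  have "t k = (\<lambda>l. 0)" for k
  proof -
    obtain b where "roots k = {b}" using card[of k] by (auto simp: card_1_singleton_iff)
    then have "roots k = {0}" using zero_root[of k] by auto
    then have "level_poly k = [:0, 1:]" using level_poly_prod_roots[of k] by simp
    then show ?thesis using th_eq_0_iff[OF level_poly_Rpoly, of k k] Rpoly_1 by (metis mult.right_neutral)
  qed
  moreover have "th k 0 = (\<lambda>l. 0)" for k by (auto simp: th_0)
  ultimately have "X\<phi> = \<phi> 0" by (simp add: t_eq th_def fun_eq_iff)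
  then have "(fps_X :: 'k fps) = 0"
    using phi_bij by (auto simp: bij_betw_def inj_on_def IF_iff fps_X_def)
  then show False by simp
qed


subsection \<open>The residue field\<close>

lemma F_unif: assumes "x \<in> F" "x \<in> \<mm>" obtains y where "y \<in> OF" "x = \<pi> * y"
proof (cases "x = 0")
  case False
  then obtain m :: int where m: "v x = ereal (of_int m)" using v_F_int assms(1) by blast
  with assms(2) have "m \<ge> 1" by (simp add: \<mm>_iff)
  then have "v \<pi> \<le> v x" using m by (simp add: one_ereal_def)
  then have "x / \<pi> \<in> R" using v_div_ge_0[of \<pi> x] by (simp add: R_iff)
  moreover have "x / \<pi> \<in> F" using assms(1) pi_F by (simp add: divide_inverse F_mult F_inverse)
  ultimately show ?thesis using that[of "x / \<pi>"] by simp
qed (use that[of 0] in auto)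

lemma OF_unif: "x \<in> OF \<Longrightarrow> x \<noteq> 0 \<Longrightarrow> \<exists>j::nat. v x = ereal (real j)"
proof -
  assume x: "x \<in> OF" "x \<noteq> 0"
  then obtain m :: int where m: "v x = ereal (of_int m)" using v_F_int by blast
  then have "v x = ereal (real (nat m))" using x by (simp add: R_iff)
  then show ?thesis by blast
qed

lemma OF_unit: assumes "x \<in> OF" "v x = 0" shows "x \<noteq> 0" "inverse x \<in> OF"
proof -
  show "x \<noteq> 0" using assms(2) by auto
  then show "inverse x \<in> OF" using assms by (simp add: R_iff v_inverse F_inverse)
qed

lemma OF_diff: "x \<in> OF \<Longrightarrow> y \<in> OF \<Longrightarrow> x - y \<in> OF"
  using OF_add[of x "- y"] OF_minus[of y] by simp

lemma OF_diff_Pi: "c \<in> A \<rightarrow> OF \<Longrightarrow> c' \<in> A \<rightarrow> OF \<Longrightarrow> (\<lambda>i. c i - c' i) \<in> A \<rightarrow> OF"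
  unfolding Pi_iff using OF_diff by blast

definition cls :: "'k \<Rightarrow> 'k set" where "cls x = {y \<in> OF. y - x \<in> \<mm>}"

lemma residue_card_eq: "residue_card v F = card (cls ` OF)"
  by (simp add: residue_card_def cls_def)

lemma cls_eq_iff: "x \<in> OF \<Longrightarrow> y \<in> OF \<Longrightarrow> cls x = cls y \<longleftrightarrow> x - y \<in> \<mm>"
proof
  assume x: "x \<in> OF" and y: "y \<in> OF" and "cls x = cls y"
  moreover have "x \<in> cls x" using x by (simp add: cls_def)
  ultimately show "x - y \<in> \<mm>" by (simp add: cls_def)
next
  assume "x - y \<in> \<mm>"
  then have "z - x \<in> \<mm> \<longleftrightarrow> z - y \<in> \<mm>" for z
    using \<mm>_add[of "z - x" "x - y"] \<mm>_diff[of "z - y" "x - y"] by auto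
  then show "cls x = cls y" by (simp add: cls_def)
qed

text \<open>\<open>card\<close> would be 0 on an infinite residue field. This is excluded because
  \<open>Mk 1\<close> has q^n elements, n is positive, and the finite set \<open>Mk 1\<close>
  contains zero.\<close>

lemma residue_card_pos: "0 < residue_card v F"
proof -
  have "\<zero>\<^bsub>M\<^esub> \<in> Mk 1"
    using M.smult_r_null[of "\<pi> ^ 1"] pi_power_OF[of 1] by (simp add: Mk_def del: Int_iff)
  then have "card (Mk 1) > 0" using finite_Mk card_gt_0_iff by blast
  then show ?thesis using card_Mk[of 1] n_pos by (cases "residue_card v F") auto
qed

lemma ex_residue_reps:
  obtains Rp where "Rp \<subseteq> OF" "finite Rp" "card Rp = residue_card v F"
    "\<And>x. x \<in> OF \<Longrightarrow> \<exists>r\<in>Rp. x - r \<in> \<mm>" "\<And>r s. r \<in> Rp \<Longrightarrow> s \<in> Rp \<Longrightarrow> r - s \<in> \<mm> \<Longrightarrow> r = s"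
proof -
  obtain Rp where Rp: "Rp \<subseteq> OF" "inj_on cls Rp" "cls ` OF = cls ` Rp"
    using subset_image_inj[of "cls ` OF" cls OF] by auto
  have card: "card Rp = residue_card v F" using Rp by (simp add: residue_card_eq card_image)
  show ?thesis
  proof (rule that[OF Rp(1) _ card])
    show "finite Rp" using card residue_card_pos card_gt_0_iff by fastforce
  next
    fix x assume x: "x \<in> OF"
    then obtain r where r: "r \<in> Rp" "cls x = cls r" using Rp(3) by blast
    then have "x - r \<in> \<mm>" using cls_eq_iff[of x r] x Rp(1) by blast
    then show "\<exists>r\<in>Rp. x - r \<in> \<mm>" using r by blast
  next
    fix r s assume rs: "r \<in> Rp" "s \<in> Rp" "r - s \<in> \<mm>"
    then have "cls r = cls s" using cls_eq_iff[of r s] Rp(1) by blast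
    then show "r = s" using rs Rp(2) by (auto dest: inj_onD)
  qed
qed

subsection \<open>Linear combinations\<close>

definition lc :: "nat set \<Rightarrow> (nat \<Rightarrow> 'k) \<Rightarrow> (nat \<Rightarrow> 'k fpoint) \<Rightarrow> 'k fpoint" where
  "lc A c e = (\<Oplus>\<^bsub>M\<^esub>i\<in>A. c i \<odot>\<^bsub>M\<^esub> e i)"

lemma smult_M [simp]: "c \<in> OF \<Longrightarrow> x \<in> carrier M \<Longrightarrow> c \<odot>\<^bsub>M\<^esub> x \<in> carrier M"
  using M.smult_closed by simp

lemma smult_add: "c \<in> OF \<Longrightarrow> c' \<in> OF \<Longrightarrow> x \<in> carrier M \<Longrightarrow> (c + c') \<odot>\<^bsub>M\<^esub> x = c \<odot>\<^bsub>M\<^esub> x \<oplus>\<^bsub>M\<^esub> c' \<odot>\<^bsub>M\<^esub> x"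
  and smult_add_right: "c \<in> OF \<Longrightarrow> x \<in> carrier M \<Longrightarrow> y \<in> carrier M \<Longrightarrow> c \<odot>\<^bsub>M\<^esub> (x \<oplus>\<^bsub>M\<^esub> y) = c \<odot>\<^bsub>M\<^esub> x \<oplus>\<^bsub>M\<^esub> c \<odot>\<^bsub>M\<^esub> y"
  and smult_mult: "c \<in> OF \<Longrightarrow> c' \<in> OF \<Longrightarrow> x \<in> carrier M \<Longrightarrow> (c * c') \<odot>\<^bsub>M\<^esub> x = c \<odot>\<^bsub>M\<^esub> (c' \<odot>\<^bsub>M\<^esub> x)"
  and smult_1 [simp]: "x \<in> carrier M \<Longrightarrow> 1 \<odot>\<^bsub>M\<^esub> x = x"
  and smult_0 [simp]: "x \<in> carrier M \<Longrightarrow> 0 \<odot>\<^bsub>M\<^esub> x = \<zero>\<^bsub>M\<^esub>"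
  and smult_zero [simp]: "c \<in> OF \<Longrightarrow> c \<odot>\<^bsub>M\<^esub> \<zero>\<^bsub>M\<^esub> = \<zero>\<^bsub>M\<^esub>"
  using M.smult_l_distr[of c c' x] M.smult_r_distr[of c x y] M.smult_assoc1[of c c' x] M.smult_one[of x]
    M.smult_l_null[of x] M.smult_r_null[of c] by auto

lemma smult_m1: "x \<in> carrier M \<Longrightarrow> (- 1) \<odot>\<^bsub>M\<^esub> x = \<ominus>\<^bsub>M\<^esub> x"
proof -
  assume x: "x \<in> carrier M"
  have "(- 1) \<odot>\<^bsub>M\<^esub> x \<oplus>\<^bsub>M\<^esub> x = (- 1 + 1) \<odot>\<^bsub>M\<^esub> x"
    using smult_add[OF m1_OF OF_1 x] x by simp
  then show ?thesis using x M.M.minus_equality[of "(- 1) \<odot>\<^bsub>M\<^esub> x" x] m1_OF by simp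
qed

lemma lc_closed: "c \<in> A \<rightarrow> OF \<Longrightarrow> e \<in> A \<rightarrow> carrier M \<Longrightarrow> lc A c e \<in> carrier M"
  unfolding lc_def by (intro M.M.finsum_closed) (auto simp del: Int_iff simp: Pi_iff)

lemma lc_cong: "(\<And>i. i \<in> A \<Longrightarrow> c i \<odot>\<^bsub>M\<^esub> e i = c' i \<odot>\<^bsub>M\<^esub> e' i) \<Longrightarrow> c' \<in> A \<rightarrow> OF \<Longrightarrow> e' \<in> A \<rightarrow> carrier M \<Longrightarrow>
    lc A c e = lc A c' e'"
  unfolding lc_def by (intro M.M.finsum_cong') (auto simp del: Int_iff simp: Pi_iff)

lemma lc_add: "c \<in> A \<rightarrow> OF \<Longrightarrow> c' \<in> A \<rightarrow> OF \<Longrightarrow> e \<in> A \<rightarrow> carrier M \<Longrightarrow>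
    lc A (\<lambda>i. c i + c' i) e = lc A c e \<oplus>\<^bsub>M\<^esub> lc A c' e"
proof -
  assume *: "c \<in> A \<rightarrow> OF" "c' \<in> A \<rightarrow> OF" "e \<in> A \<rightarrow> carrier M"
  have "lc A (\<lambda>i. c i + c' i) e = (\<Oplus>\<^bsub>M\<^esub>i\<in>A. c i \<odot>\<^bsub>M\<^esub> e i \<oplus>\<^bsub>M\<^esub> c' i \<odot>\<^bsub>M\<^esub> e i)"
    unfolding lc_def by (rule M.M.finsum_cong') (use * in \<open>simp_all add: Pi_iff smult_add del: Int_iff\<close>)
  also have "\<dots> = lc A c e \<oplus>\<^bsub>M\<^esub> lc A c' e"
    unfolding lc_def by (rule M.M.finsum_addf) (use * in \<open>simp_all add: Pi_iff del: Int_iff\<close>)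
  finally show ?thesis .
qed

lemma lc_smult: "finite A \<Longrightarrow> a \<in> OF \<Longrightarrow> c \<in> A \<rightarrow> OF \<Longrightarrow> e \<in> A \<rightarrow> carrier M \<Longrightarrow>
    lc A (\<lambda>i. a * c i) e = a \<odot>\<^bsub>M\<^esub> lc A c e"
proof -
  assume *: "finite A" "a \<in> OF" "c \<in> A \<rightarrow> OF" "e \<in> A \<rightarrow> carrier M"
  have "lc A (\<lambda>i. a * c i) e = (\<Oplus>\<^bsub>M\<^esub>i\<in>A. a \<odot>\<^bsub>M\<^esub> (c i \<odot>\<^bsub>M\<^esub> e i))"
    unfolding lc_def by (rule M.M.finsum_cong') (use * in \<open>simp_all add: Pi_iff smult_mult del: Int_iff\<close>)
  also have "\<dots> = a \<odot>\<^bsub>M\<^esub> lc A c e"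
    unfolding lc_def by (rule M.finsum_smult_ldistr[symmetric]) (use * in \<open>simp_all add: Pi_iff del: Int_iff\<close>)
  finally show ?thesis .
qed

lemma lc_smult': "finite A \<Longrightarrow> a \<in> OF \<Longrightarrow> c \<in> A \<rightarrow> OF \<Longrightarrow> e \<in> A \<rightarrow> carrier M \<Longrightarrow>
    lc A c (\<lambda>i. a \<odot>\<^bsub>M\<^esub> e i) = a \<odot>\<^bsub>M\<^esub> lc A c e"
proof -
  assume *: "finite A" "a \<in> OF" "c \<in> A \<rightarrow> OF" "e \<in> A \<rightarrow> carrier M"
  have "c i \<odot>\<^bsub>M\<^esub> (a \<odot>\<^bsub>M\<^esub> e i) = (a * c i) \<odot>\<^bsub>M\<^esub> e i" if "i \<in> A" for i
    using smult_mult[of "c i" a "e i"] * that by (simp add: Pi_iff mult.commute del: Int_iff)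
  then have "lc A c (\<lambda>i. a \<odot>\<^bsub>M\<^esub> e i) = lc A (\<lambda>i. a * c i) e"
    by (rule lc_cong) (use * OF_mult in \<open>simp_all add: Pi_iff del: Int_iff\<close>)
  then show ?thesis using lc_smult[OF *] by simp
qed

lemma lc_diff: assumes "finite A" "c \<in> A \<rightarrow> OF" "c' \<in> A \<rightarrow> OF" "e \<in> A \<rightarrow> carrier M"
  shows "lc A (\<lambda>i. c i - c' i) e = lc A c e \<ominus>\<^bsub>M\<^esub> lc A c' e"
proof -
  have "lc A (\<lambda>i. c i + (- 1) * c' i) e = lc A c e \<oplus>\<^bsub>M\<^esub> lc A (\<lambda>i. (- 1) * c' i) e"
    using assms m1_OF OF_mult by (intro lc_add) blast+
  also have "lc A (\<lambda>i. (- 1) * c' i) e = \<ominus>\<^bsub>M\<^esub> lc A c' e"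
    using lc_smult[OF assms(1) m1_OF assms(3,4)] smult_m1[OF lc_closed[OF assms(3,4)]] by (rule trans)
  finally show ?thesis by (simp add: a_minus_def)
qed

lemma lc_insert: "finite A \<Longrightarrow> a \<notin> A \<Longrightarrow> c \<in> insert a A \<rightarrow> OF \<Longrightarrow> e \<in> insert a A \<rightarrow> carrier M \<Longrightarrow>
    lc (insert a A) c e = c a \<odot>\<^bsub>M\<^esub> e a \<oplus>\<^bsub>M\<^esub> lc A c e"
  unfolding lc_def by (intro M.M.finsum_insert) (auto simp del: Int_iff simp: Pi_iff)

lemma lc_union: "finite A \<Longrightarrow> finite B \<Longrightarrow> A \<inter> B = {} \<Longrightarrow> c \<in> A \<union> B \<rightarrow> OF \<Longrightarrow> e \<in> A \<union> B \<rightarrow> carrier M \<Longrightarrow>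
    lc (A \<union> B) c e = lc A c e \<oplus>\<^bsub>M\<^esub> lc B c e"
  unfolding lc_def by (intro M.M.finsum_Un_disjoint) (auto simp del: Int_iff simp: Pi_iff)

lemma lc_zero: "(\<And>i. i \<in> A \<Longrightarrow> c i \<odot>\<^bsub>M\<^esub> e i = \<zero>\<^bsub>M\<^esub>) \<Longrightarrow> lc A c e = \<zero>\<^bsub>M\<^esub>"
proof -
  assume "\<And>i. i \<in> A \<Longrightarrow> c i \<odot>\<^bsub>M\<^esub> e i = \<zero>\<^bsub>M\<^esub>"
  then have "lc A c e = (\<Oplus>\<^bsub>M\<^esub>i\<in>A. \<zero>\<^bsub>M\<^esub>)" unfolding lc_def by (intro M.M.finsum_cong') auto
  then show ?thesis by (simp add: M.M.finsum_zero)
qed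

lemma w_add_ge: "r \<le> w x \<Longrightarrow> r \<le> w y \<Longrightarrow> x \<in> carrier M \<Longrightarrow> y \<in> carrier M \<Longrightarrow> r \<le> w (x \<oplus>\<^bsub>M\<^esub> y)"
  using w_add[of x y] by (meson min.boundedI order_trans)

lemma w_lc_ge: "finite A \<Longrightarrow> c \<in> A \<rightarrow> OF \<Longrightarrow> e \<in> A \<rightarrow> carrier M \<Longrightarrow> (\<And>i. i \<in> A \<Longrightarrow> r \<le> w (c i \<odot>\<^bsub>M\<^esub> e i)) \<Longrightarrow>
    r \<le> w (lc A c e)"
proof (induction A rule: finite_induct)
  case empty then show ?case by (simp add: lc_def)
next
  case (insert a A)
  have c: "c a \<in> OF" "c \<in> A \<rightarrow> OF" "e a \<in> carrier M" "e \<in> A \<rightarrow> carrier M" using insert.prems by auto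
  show ?case unfolding lc_insert[OF insert.hyps insert.prems(1,2)]
    using c insert by (intro w_add_ge insert.IH lc_closed smult_M) auto
qed

lemma Mk_M: "x \<in> Mk k \<Longrightarrow> x \<in> carrier M" by (simp add: Mk_def)

lemma Mk_0: "Mk 0 = {\<zero>\<^bsub>M\<^esub>}" by (auto simp: Mk_def)

lemma Mk_zero: "\<zero>\<^bsub>M\<^esub> \<in> Mk k" using pi_power_OF by (simp add: Mk_def del: Int_iff)

lemma Mk_add: "x \<in> Mk k \<Longrightarrow> y \<in> Mk k \<Longrightarrow> x \<oplus>\<^bsub>M\<^esub> y \<in> Mk k"
  using pi_power_OF[of k] by (auto simp: Mk_def smult_add_right simp del: Int_iff)

lemma Mk_smult: assumes c: "c \<in> OF" and x: "x \<in> Mk k" shows "c \<odot>\<^bsub>M\<^esub> x \<in> Mk k"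
proof -
  have xM: "x \<in> carrier M" using x by (rule Mk_M)
  have "\<pi> ^ k \<odot>\<^bsub>M\<^esub> (c \<odot>\<^bsub>M\<^esub> x) = c \<odot>\<^bsub>M\<^esub> (\<pi> ^ k \<odot>\<^bsub>M\<^esub> x)"
    using smult_mult[OF pi_power_OF c xM, of k] smult_mult[OF c pi_power_OF xM, of k] by (simp add: mult.commute)
  then show ?thesis using c x xM by (simp add: Mk_def del: Int_iff)
qed

lemma Mk_diff: "x \<in> Mk k \<Longrightarrow> y \<in> Mk k \<Longrightarrow> x \<ominus>\<^bsub>M\<^esub> y \<in> Mk k"
  using Mk_add[of x k "(- 1) \<odot>\<^bsub>M\<^esub> y"] Mk_smult[OF m1_OF] by (simp add: a_minus_def smult_m1 Mk_M)

lemma lc_Mk: "finite A \<Longrightarrow> c \<in> A \<rightarrow> OF \<Longrightarrow> e \<in> A \<rightarrow> Mk k \<Longrightarrow> lc A c e \<in> Mk k"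
proof (induction A rule: finite_induct)
  case empty then show ?case by (simp add: lc_def Mk_zero)
next
  case (insert a A)
  have e: "e \<in> insert a A \<rightarrow> carrier M" using insert.prems Mk_M by blast
  show ?case unfolding lc_insert[OF insert.hyps insert.prems(1) e]
    using insert by (intro Mk_add Mk_smult insert.IH) auto
qed

text \<open>This makes \<open>Mk 1\<close> a vector space over the residue field;
  \<open>indep\<close> and \<open>lspan\<close> express its linear algebra with coefficients in
  \<open>OF\<close>.\<close>

lemma Mk1_\<mm>: "c \<in> OF \<Longrightarrow> c \<in> \<mm> \<Longrightarrow> x \<in> Mk 1 \<Longrightarrow> c \<odot>\<^bsub>M\<^esub> x = \<zero>\<^bsub>M\<^esub>"
proof -
  assume c: "c \<in> OF" "c \<in> \<mm>" and x: "x \<in> Mk 1"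
  obtain y where y: "y \<in> OF" "c = \<pi> * y" using F_unif[of c] c by blast
  then have "c \<odot>\<^bsub>M\<^esub> x = y \<odot>\<^bsub>M\<^esub> (\<pi> \<odot>\<^bsub>M\<^esub> x)"
    using smult_mult[OF y(1) pi_OF Mk_M[OF x]] by (simp add: mult.commute)
  then show ?thesis using x y(1) by (simp add: Mk_def del: Int_iff)
qed

subsection \<open>A basis of the \<open>\<pi>\<close>-torsion adapted to the filtration\<close>

definition lspan :: "nat \<Rightarrow> (nat \<Rightarrow> 'k fpoint) \<Rightarrow> 'k fpoint set" where
  "lspan j s = {lc {..<j} c s | c. c \<in> {..<j} \<rightarrow> OF}"

definition indep :: "nat \<Rightarrow> (nat \<Rightarrow> 'k fpoint) \<Rightarrow> bool" where
  "indep j s \<longleftrightarrow> s \<in> {..<j} \<rightarrow> Mk 1 \<and>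
     (\<forall>c \<in> {..<j} \<rightarrow> OF. lc {..<j} c s = \<zero>\<^bsub>M\<^esub> \<longrightarrow> (\<forall>i<j. c i \<in> \<mm>))"

lemma lspan_Mk: "s \<in> {..<j} \<rightarrow> Mk 1 \<Longrightarrow> lspan j s \<subseteq> Mk 1"
  using lc_Mk by (auto simp: lspan_def)

text \<open>Tuples of residue representatives parametrize the span: independence separates them, and
  by \<open>Mk1_\<mm>\<close> every coefficient may be replaced by its representative.\<close>

lemma card_lspan:
  assumes "indep j s" shows "card (lspan j s) = residue_card v F ^ j"
proof -
  obtain Rp where Rp: "Rp \<subseteq> OF" "finite Rp" "card Rp = residue_card v F"
    "\<And>x. x \<in> OF \<Longrightarrow> \<exists>r\<in>Rp. x - r \<in> \<mm>" "\<And>r s. r \<in> Rp \<Longrightarrow> s \<in> Rp \<Longrightarrow> r - s \<in> \<mm> \<Longrightarrow> r = s"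
    using ex_residue_reps by blast
  let ?P = "{..<j} \<rightarrow>\<^sub>E Rp"
  have s: "s \<in> {..<j} \<rightarrow> Mk 1" "s \<in> {..<j} \<rightarrow> carrier M" using assms Mk_M by (auto simp: indep_def)
  have P: "c \<in> ?P \<Longrightarrow> c \<in> {..<j} \<rightarrow> OF" for c using Rp(1) by (auto simp: PiE_iff)
  have "inj_on (\<lambda>c. lc {..<j} c s) ?P"
  proof (rule inj_onI)
    fix c c' assume c: "c \<in> ?P" "c' \<in> ?P" "lc {..<j} c s = lc {..<j} c' s"
    have "lc {..<j} (\<lambda>i. c i - c' i) s = \<zero>\<^bsub>M\<^esub>"
      using lc_diff[OF _ P[OF c(1)] P[OF c(2)] s(2)] c(3) lc_closed[OF P[OF c(2)] s(2)]
      by (simp add: a_minus_def M.M.r_neg)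
    moreover have "(\<lambda>i. c i - c' i) \<in> {..<j} \<rightarrow> OF"
      by (rule OF_diff_Pi[OF P[OF c(1)] P[OF c(2)]])
    ultimately have "\<forall>i<j. c i - c' i \<in> \<mm>" using assms by (auto simp: indep_def)
    then have "\<forall>i<j. c i = c' i" using Rp(5) c(1,2) by (auto simp: PiE_iff)
    then show "c = c'" using c(1,2) by (intro PiE_ext) auto
  qed
  moreover have "(\<lambda>c. lc {..<j} c s) ` ?P = lspan j s"
  proof
    show "(\<lambda>c. lc {..<j} c s) ` ?P \<subseteq> lspan j s" using P by (auto simp: lspan_def)
    show "lspan j s \<subseteq> (\<lambda>c. lc {..<j} c s) ` ?P"
    proof
      fix x assume "x \<in> lspan j s"
      then obtain c where c: "c \<in> {..<j} \<rightarrow> OF" "x = lc {..<j} c s" by (auto simp: lspan_def)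
      have "\<forall>i. \<exists>r. i < j \<longrightarrow> r \<in> Rp \<and> c i - r \<in> \<mm>" using Rp(4) c(1) by blast
      then obtain r where r: "\<And>i. i < j \<Longrightarrow> r i \<in> Rp" "\<And>i. i < j \<Longrightarrow> c i - r i \<in> \<mm>" by metis
      define r' where "r' = restrict r {..<j}"
      have r': "r' \<in> ?P" using r(1) by (auto simp: r'_def)
      have "lc {..<j} c s = lc {..<j} r' s"
      proof (rule lc_cong[OF _ P[OF r'] s(2)])
        fix i assume i: "i \<in> {..<j}"
        have ri: "r i \<in> OF" "c i \<in> OF" "s i \<in> Mk 1" using r(1) Rp(1) c(1) s(1) i by auto
        have "c i - r i \<in> OF" using OF_add[OF ri(2) OF_minus[OF ri(1)]] by simp
        then have "(c i - r i) \<odot>\<^bsub>M\<^esub> s i = \<zero>\<^bsub>M\<^esub>" using Mk1_\<mm> r(2) i ri(3) by simp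
        moreover have "c i \<odot>\<^bsub>M\<^esub> s i = ((c i - r i) + r i) \<odot>\<^bsub>M\<^esub> s i" by simp
        ultimately have "c i \<odot>\<^bsub>M\<^esub> s i = r i \<odot>\<^bsub>M\<^esub> s i"
          using smult_add[OF \<open>c i - r i \<in> OF\<close> ri(1) Mk_M[OF ri(3)]] ri Mk_M by (simp del: Int_iff)
        then show "c i \<odot>\<^bsub>M\<^esub> s i = r' i \<odot>\<^bsub>M\<^esub> s i" using i by (simp add: r'_def)
      qed
      then show "x \<in> (\<lambda>c. lc {..<j} c s) ` ?P" using c r' by blast
    qed
  qed
  ultimately have "card (lspan j s) = card ?P" by (metis card_image)
  then show ?thesis using Rp(3) by (simp add: card_PiE)
qed

lemma lc_lessThan_Suc:
  assumes "c \<in> {..<Suc j} \<rightarrow> OF" "s \<in> {..<Suc j} \<rightarrow> carrier M"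
  shows "lc {..<Suc j} c s = c j \<odot>\<^bsub>M\<^esub> s j \<oplus>\<^bsub>M\<^esub> lc {..<j} c s"
  using lc_insert[of "{..<j}" j c s] assms by (simp add: lessThan_Suc)

lemma lc_solve:
  assumes s: "s \<in> {..<Suc j} \<rightarrow> carrier M" and c: "c \<in> {..<Suc j} \<rightarrow> OF" and u: "v (c j) = 0"
    and x: "lc {..<Suc j} c s \<in> lspan j s" shows "s j \<in> lspan j s"
proof -
  let ?u = "inverse (c j)"
  have cj: "c j \<in> OF" "c \<in> {..<j} \<rightarrow> OF" "s j \<in> carrier M" "s \<in> {..<j} \<rightarrow> carrier M" using c s by auto
  have u: "c j \<noteq> 0" "?u \<in> OF" using OF_unit[OF cj(1) u] by auto
  obtain b where b: "b \<in> {..<j} \<rightarrow> OF" "lc {..<Suc j} c s = lc {..<j} b s" using x by (auto simp: lspan_def)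
  have lb: "lc {..<j} b s \<in> carrier M" "lc {..<j} c s \<in> carrier M"
    using lc_closed b(1) cj by blast+
  have "c j \<odot>\<^bsub>M\<^esub> s j = lc {..<j} b s \<ominus>\<^bsub>M\<^esub> lc {..<j} c s"
    using lc_lessThan_Suc[OF c s] b(2) lb cj by (simp add: a_minus_def M.M.a_assoc M.M.r_neg del: Int_iff)
  also have "\<dots> = lc {..<j} (\<lambda>i. b i - c i) s" using lc_diff[OF _ b(1) cj(2,4)] by simp
  finally have "?u \<odot>\<^bsub>M\<^esub> (c j \<odot>\<^bsub>M\<^esub> s j) = ?u \<odot>\<^bsub>M\<^esub> lc {..<j} (\<lambda>i. b i - c i) s" by simp
  moreover have "?u \<odot>\<^bsub>M\<^esub> (c j \<odot>\<^bsub>M\<^esub> s j) = s j" using smult_mult[OF u(2) cj(1,3)] u(1) cj(3) by simp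
  moreover have bc: "(\<lambda>i. b i - c i) \<in> {..<j} \<rightarrow> OF"
    by (rule OF_diff_Pi[OF b(1) cj(2)])
  ultimately have "s j = lc {..<j} (\<lambda>i. ?u * (b i - c i)) s"
    using lc_smult[OF _ u(2) bc cj(4)] by simp
  moreover have "(\<lambda>i. ?u * (b i - c i)) \<in> {..<j} \<rightarrow> OF" using bc u(2) OF_mult by blast
  ultimately show ?thesis unfolding lspan_def by blast
qed

lemma indep_Suc:
  assumes s: "indep j s" and x: "x \<in> Mk 1" "x \<notin> lspan j s" shows "indep (Suc j) (s(j := x))"
  unfolding indep_def
proof (intro conjI ballI impI allI)
  let ?s = "s(j := x)"
  have sM: "s \<in> {..<j} \<rightarrow> Mk 1" using s by (simp add: indep_def)
  then show s'M: "?s \<in> {..<Suc j} \<rightarrow> Mk 1" using x(1) by (auto simp: less_Suc_eq)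
  then have s'C: "?s \<in> {..<Suc j} \<rightarrow> carrier M" using Mk_M by blast
  fix c i assume c: "c \<in> {..<Suc j} \<rightarrow> OF" and z: "lc {..<Suc j} c ?s = \<zero>\<^bsub>M\<^esub>" and i: "i < Suc j"
  have eq: "lc {..<j} b ?s = lc {..<j} b s" if "b \<in> {..<j} \<rightarrow> OF" for b
    using that sM Mk_M by (intro lc_cong) auto
  then have lspan_eq: "lspan j ?s = lspan j s" by (auto simp: lspan_def) metis+
  have cj: "c j \<in> \<mm>"
  proof (rule ccontr)
    assume "c j \<notin> \<mm>"
    moreover have "c j \<in> OF" using c by (simp add: Pi_iff)
    ultimately have "v (c j) = 0" by (simp add: R_iff \<mm>_iff)
    moreover have "\<zero>\<^bsub>M\<^esub> \<in> lspan j ?s"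
    proof -
      have "lc {..<j} (\<lambda>_. 0) ?s = \<zero>\<^bsub>M\<^esub>" using s'C by (intro lc_zero) (simp only: Pi_iff smult_0 lessThan_iff less_SucI)
      then show ?thesis unfolding lspan_def by (intro CollectI exI[of _ "\<lambda>_. 0"]) auto
    qed
    ultimately have "?s j \<in> lspan j ?s" using z by (intro lc_solve[OF s'C c]) simp_all
    then show False using x(2) lspan_eq by simp
  qed
  have cj': "c j \<in> OF" and cc: "c \<in> {..<j} \<rightarrow> OF" using c by auto
  have "c j \<odot>\<^bsub>M\<^esub> ?s j = \<zero>\<^bsub>M\<^esub>" using Mk1_\<mm>[OF cj' cj x(1)] by simp
  moreover have "s \<in> {..<j} \<rightarrow> carrier M" using sM Mk_M by blast
  then have "lc {..<j} c s \<in> carrier M" by (rule lc_closed[OF cc])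
  ultimately have "lc {..<j} c s = \<zero>\<^bsub>M\<^esub>"
    using lc_lessThan_Suc[OF c s'C] z eq[OF cc] by simp
  then have "\<forall>i<j. c i \<in> \<mm>" using s cc by (auto simp: indep_def)
  then show "c i \<in> \<mm>" using cj i by (auto simp: less_Suc_eq)
qed

lemma residue_card_ge_2: "2 \<le> residue_card v F"
proof -
  obtain Rp where Rp: "Rp \<subseteq> OF" "finite Rp" "card Rp = residue_card v F"
    "\<And>x. x \<in> OF \<Longrightarrow> \<exists>r\<in>Rp. x - r \<in> \<mm>" "\<And>r s. r \<in> Rp \<Longrightarrow> s \<in> Rp \<Longrightarrow> r - s \<in> \<mm> \<Longrightarrow> r = s"
    using ex_residue_reps by blast
  obtain r s where rs: "r \<in> Rp" "0 - r \<in> \<mm>" "s \<in> Rp" "1 - s \<in> \<mm>" using Rp(4)[OF OF_0] Rp(4)[OF OF_1] by blast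
  have "r \<noteq> s"
  proof
    assume "r = s"
    then have "(1 - s) - (0 - r) \<in> \<mm>" using rs by blast
    then show False using \<open>r = s\<close> by (simp add: \<mm>_iff)
  qed
  then have "card {r, s} = 2" by simp
  then show ?thesis using card_mono[OF Rp(2), of "{r, s}"] rs Rp(3) by simp
qed

definition greedy :: "nat \<Rightarrow> (nat \<Rightarrow> 'k fpoint) \<Rightarrow> bool" where
  "greedy j s \<longleftrightarrow> indep j s \<and> (\<forall>i<j. \<forall>x\<in>Mk 1. x \<notin> lspan i s \<longrightarrow> w x \<le> w (s i))"

lemma lspan_cong: "(\<And>i. i < j \<Longrightarrow> s i = s' i) \<Longrightarrow> s' \<in> {..<j} \<rightarrow> carrier M \<Longrightarrow> lspan j s = lspan j s'"
proof -
  assume eq: "\<And>i. i < j \<Longrightarrow> s i = s' i" and s': "s' \<in> {..<j} \<rightarrow> carrier M"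
  have "lc {..<j} c s = lc {..<j} c s'" if "c \<in> {..<j} \<rightarrow> OF" for c
    using that s' eq by (intro lc_cong) auto
  then show "lspan j s = lspan j s'" unfolding lspan_def by metis
qed

text \<open>While j < n, the span of j vectors has q^j < q^n elements, so its complement in the
  finite set \<open>Mk 1\<close> is nonempty and has an element of maximal valuation.\<close>

lemma ex_greedy: "j \<le> n \<Longrightarrow> \<exists>s. greedy j s"
proof (induction j)
  case 0
  show ?case by (auto simp: greedy_def indep_def)
next
  case (Suc j)
  then obtain s where s: "greedy j s" by auto
  then have ind: "indep j s" by (simp add: greedy_def)
  then have sM: "s \<in> {..<j} \<rightarrow> Mk 1" by (simp add: indep_def)
  have "card (lspan j s) < card (Mk 1)"
    unfolding card_lspan[OF ind] card_Mk using residue_card_ge_2 Suc.prems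
    by (intro power_strict_increasing) auto
  then have "\<not> Mk 1 \<subseteq> lspan j s"
    using card_mono[OF finite_subset[OF lspan_Mk[OF sM] finite_Mk]] by (meson not_le)
  then have "Mk 1 - lspan j s \<noteq> {}" by blast
  then have "Max (w ` (Mk 1 - lspan j s)) \<in> w ` (Mk 1 - lspan j s)" using finite_Mk by (intro Max_in) auto
  then obtain x where x': "Max (w ` (Mk 1 - lspan j s)) = w x" "x \<in> Mk 1 - lspan j s" by (rule imageE)
  then have x: "x \<in> Mk 1" "x \<notin> lspan j s" "w x = Max (w ` (Mk 1 - lspan j s))" by simp_all
  have max: "w y \<le> w x" if "y \<in> Mk 1" "y \<notin> lspan j s" for y
    unfolding x(3) using that finite_Mk by (intro Max_ge) auto
  let ?s = "s(j := x)"
  have lspan: "lspan i ?s = lspan i s" if "i \<le> j" for i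
  proof (rule lspan_cong)
    have "s l \<in> carrier M" if "l < i" for l using sM \<open>i \<le> j\<close> that by (intro Mk_M[of _ 1]) (simp add: Pi_iff)
    then show "s \<in> {..<i} \<rightarrow> carrier M" by simp
  qed (use that in auto)
  have "greedy (Suc j) ?s"
    unfolding greedy_def
  proof (intro conjI allI impI ballI)
    show "indep (Suc j) ?s" by (rule indep_Suc[OF ind x(1,2)])
    fix i y assume i: "i < Suc j" and y: "y \<in> Mk 1" "y \<notin> lspan i ?s"
    show "w y \<le> w (?s i)"
    proof (cases "i = j")
      case True then show ?thesis using max y lspan by simp
    next
      case False
      then have "i < j" using i by simp
      then show ?thesis using s y lspan[of i] by (simp add: greedy_def)
    qed
  qed
  then show ?case by blast
qed

context
  fixes s assumes s: "greedy n s"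
begin

lemma greedy_indep: "indep n s" using s by (simp add: greedy_def)

lemma greedy_Mk: "s \<in> {..<n} \<rightarrow> Mk 1" using greedy_indep by (simp add: indep_def)

lemma greedy_span: "lspan n s = Mk 1"
proof (rule card_subset_eq[OF finite_Mk lspan_Mk[OF greedy_Mk]])
  show "card (lspan n s) = card (Mk 1)" by (simp add: card_lspan[OF greedy_indep] card_Mk)
qed

lemma greedy_max: "i < n \<Longrightarrow> x \<in> Mk 1 \<Longrightarrow> x \<notin> lspan i s \<Longrightarrow> w x \<le> w (s i)"
  using s by (simp add: greedy_def)

text \<open>Subtracting a combination of the first i vectors, with i at most j, leaves the unit
  coefficient c j untouched, so the difference cannot be a relation.\<close>

lemma greedy_not_in_lspan:
  assumes j: "j < n" and c: "c \<in> {..<n} \<rightarrow> OF" "c j \<notin> \<mm>" "\<And>i. j < i \<Longrightarrow> i < n \<Longrightarrow> c i \<in> \<mm>" and i: "i \<le> j"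
  shows "lc {..<n} c s \<notin> lspan i s"
proof
  assume "lc {..<n} c s \<in> lspan i s"
  then obtain b where b: "b \<in> {..<i} \<rightarrow> OF" "lc {..<n} c s = lc {..<i} b s" by (auto simp: lspan_def)
  define b' where "b' l = (if l < i then b l else 0)" for l
  have b': "b' \<in> {..<n} \<rightarrow> OF" using b(1) by (auto simp: b'_def)
  have sC: "s \<in> {..<n} \<rightarrow> carrier M" using greedy_Mk Mk_M by blast
  have "{..<n} = {..<i} \<union> {i..<n}" using i j by auto
  then have "lc {..<n} b' s = lc {..<i} b' s \<oplus>\<^bsub>M\<^esub> lc {i..<n} b' s"
    using lc_union[of "{..<i}" "{i..<n}" b' s] b' sC by (simp add: ivl_disj_int)
  moreover have "lc {i..<n} b' s = \<zero>\<^bsub>M\<^esub>" using sC by (intro lc_zero) (simp add: b'_def Pi_iff)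
  moreover have "lc {..<i} b' s = lc {..<i} b s"
    using sC i j b(1) by (intro lc_cong) (auto simp: b'_def Pi_iff)
  moreover have "lc {..<i} b s \<in> carrier M" using b(1) sC i j by (intro lc_closed) auto
  ultimately have "lc {..<n} b' s = lc {..<n} c s" using b(2) by simp
  then have "lc {..<n} (\<lambda>l. c l - b' l) s = \<zero>\<^bsub>M\<^esub>"
    using lc_diff[OF _ c(1) b' sC] lc_closed[OF c(1) sC] by (simp add: a_minus_def M.M.r_neg)
  moreover have "(\<lambda>l. c l - b' l) \<in> {..<n} \<rightarrow> OF"
    by (rule OF_diff_Pi[OF c(1) b'])
  ultimately have "c j - b' j \<in> \<mm>" using greedy_indep j by (auto simp: indep_def)
  then show False using c(2) i by (simp add: b'_def)
qed

text \<open>The vector s j was still a candidate when s i was chosen.\<close>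

lemma greedy_decreasing: assumes "i \<le> j" "j < n" shows "w (s j) \<le> w (s i)"
proof (rule greedy_max)
  show "i < n" "s j \<in> Mk 1" using assms greedy_Mk by auto
  define c where "c l = (if l = j then 1 else 0 :: 'k)" for l
  have c: "c \<in> {..<n} \<rightarrow> OF" by (auto simp: c_def)
  have sC: "s \<in> {..<n} \<rightarrow> carrier M" using greedy_Mk Mk_M by blast
  have "{..<n} = insert j ({..<n} - {j})" using assms by auto
  then have "lc {..<n} c s = c j \<odot>\<^bsub>M\<^esub> s j \<oplus>\<^bsub>M\<^esub> lc ({..<n} - {j}) c s"
    using lc_insert[of "{..<n} - {j}" j c s] c sC by auto
  moreover have "lc ({..<n} - {j}) c s = \<zero>\<^bsub>M\<^esub>" using sC by (intro lc_zero) (simp add: c_def Pi_iff)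
  moreover have "s j \<in> carrier M" using sC assms by (simp add: Pi_iff)
  ultimately have "lc {..<n} c s = s j" by (simp add: c_def)
  then show "s j \<notin> lspan i s"
    using greedy_not_in_lspan[OF assms(2) c _ _ assms(1)] by (auto simp: c_def \<mm>_iff)
qed

text \<open>Coefficients in the maximal ideal kill their terms. Let j be the last index with a unit
  coefficient: the combination lies outside the span of the vectors before j, so its valuation is at
  most that of s j, the smallest among the vectors up to j.\<close>

lemma greedy_adapted:
  assumes c: "c \<in> {..<n} \<rightarrow> OF" and r: "r \<le> w (lc {..<n} c s)" and i: "i < n"
  shows "r \<le> w (c i \<odot>\<^bsub>M\<^esub> s i)"
proof (cases "c i \<in> \<mm>")
  case True
  have "c i \<in> OF" "s i \<in> Mk 1" using c i greedy_Mk by (simp_all add: Pi_iff)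
  then show ?thesis using Mk1_\<mm>[of "c i" "s i"] True by simp
next
  case False
  let ?S = "{l. l < n \<and> c l \<notin> \<mm>}"
  have S: "finite ?S" "i \<in> ?S" using False i by auto
  define j where "j = Max ?S"
  have "j \<in> ?S" unfolding j_def using S by (intro Max_in) auto
  then have j: "j < n" "c j \<notin> \<mm>" "i \<le> j" using Max_ge[OF S] by (simp_all add: j_def)
  have "c l \<in> \<mm>" if "j < l" "l < n" for l
  proof (rule ccontr)
    assume "c l \<notin> \<mm>"
    then have "l \<le> j" unfolding j_def using that(2) by (intro Max_ge[OF S(1)]) simp
    then show False using that(1) by simp
  qed
  then have "lc {..<n} c s \<notin> lspan j s" using greedy_not_in_lspan[OF j(1) c j(2)] by blast
  then have "w (lc {..<n} c s) \<le> w (s j)"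
    using greedy_max[OF j(1)] lc_Mk[OF _ c greedy_Mk] by blast
  also have "\<dots> \<le> w (s i)" by (rule greedy_decreasing[OF j(3,1)])
  also have "\<dots> \<le> w (c i \<odot>\<^bsub>M\<^esub> s i)" using c i greedy_Mk Mk_M by (intro w_smult) auto
  finally show ?thesis using r by simp
qed

end


subsection \<open>The rational Tate module\<close>

abbreviation V :: "('k, int \<Rightarrow> 'k fpoint) module" where "V \<equiv> rational_Tate_module v \<pi> H"

lemma fpoint_act_mult:
  assumes x: "x \<in> FP" and a: "a \<in> OF" and b: "b \<in> OF"
  shows "fpoint_act v H (a * b) x = fpoint_act v H a (fpoint_act v H b x)"
  unfolding fpoint_act_def[of v H "a * b"] fpoint_act_def[of v H a]
proof (rule restrict_ext)
  fix \<alpha> assume \<alpha>: "\<alpha> \<in> FR"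
  have "(\<lambda>i. act H i (a * b) (\<alpha> i)) = (\<lambda>i. act H i b (act H i a (\<alpha> i)))"
    using act_mult[OF b a FR_E[OF \<alpha>]] by (auto simp: mult.commute)
  then show "x (\<lambda>i. act H i (a * b) (\<alpha> i)) = fpoint_act v H b x (\<lambda>i. act H i a (\<alpha> i))"
    using fpoint_act_apply[OF b FR_act[OF a \<alpha>]] by simp
qed

lemma fpoint_act_1: assumes x: "x \<in> FP" shows "fpoint_act v H 1 x = x"
proof
  fix \<alpha>
  show "fpoint_act v H 1 x \<alpha> = x \<alpha>"
  proof (cases "\<alpha> \<in> FR")
    case True
    then have "(\<lambda>i. act H i 1 (\<alpha> i)) = \<alpha>" using act_1[OF FR_E[OF True]] by auto
    then show ?thesis using fpoint_act_apply[OF OF_1 True] by simp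
  next
    case False
    then show ?thesis using FP_ext[OF x] by (auto simp: fpoint_act_def PiE_iff extensional_def)
  qed
qed

text \<open>A power of \<pi> shifts a sequence down by its exponent; a large one moves any entry
  into the range where the sequence vanishes, so all entries are torsion.\<close>

lemma V_carrier:
  "x \<in> carrier V \<longleftrightarrow> (\<forall>i. x i \<in> carrier M) \<and> (\<forall>i. \<pi> \<odot>\<^bsub>M\<^esub> x (i + 1) = x i) \<and> (\<exists>N. \<forall>i\<le>N. x i = \<zero>\<^bsub>M\<^esub>)"
proof
  assume "x \<in> carrier V"
  then have x: "\<And>i. x i \<in> FP" "\<And>i. fpoint_act v H \<pi> (x (i + 1)) = x i" and "\<exists>N. \<forall>i\<le>N. x i = fpoint_zero v H"
    by (auto simp: rational_Tate_module_def)
  then obtain N where N: "\<And>i. i \<le> N \<Longrightarrow> x i = fpoint_zero v H" by blast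
  have shift: "fpoint_act v H (\<pi> ^ m) (x i) = x (i - int m)" for m i
  proof (induction m)
    case (Suc m)
    have "fpoint_act v H (\<pi> ^ Suc m) (x i) = fpoint_act v H \<pi> (fpoint_act v H (\<pi> ^ m) (x i))"
      using fpoint_act_mult[OF x(1) pi_OF pi_power_OF] by simp
    also have "\<dots> = x (i - int (Suc m))" using Suc x(2)[of "i - int (Suc m)"] by simp
    finally show ?case .
  qed (simp add: fpoint_act_1 x)
  have "x i \<in> tors" for i
  proof -
    have "fpoint_act v H (\<pi> ^ nat (i - N)) (x i) = fpoint_zero v H" unfolding shift by (rule N) simp
    then show ?thesis using x(1) by (auto simp: tors_def)
  qed
  then show "(\<forall>i. x i \<in> carrier M) \<and> (\<forall>i. \<pi> \<odot>\<^bsub>M\<^esub> x (i + 1) = x i) \<and> (\<exists>N. \<forall>i\<le>N. x i = \<zero>\<^bsub>M\<^esub>)"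
    using x(2) N by (auto simp: M_simps)
qed (auto simp: rational_Tate_module_def M_simps tors_def)

lemma V_carrierI:
  "(\<And>i. x i \<in> carrier M) \<Longrightarrow> (\<And>i. \<pi> \<odot>\<^bsub>M\<^esub> x (i + 1) = x i) \<Longrightarrow> (\<And>i. i \<le> N \<Longrightarrow> x i = \<zero>\<^bsub>M\<^esub>) \<Longrightarrow> x \<in> carrier V"
  unfolding V_carrier by blast

lemma V_M: "x \<in> carrier V \<Longrightarrow> x i \<in> carrier M" and V_pi: "x \<in> carrier V \<Longrightarrow> \<pi> \<odot>\<^bsub>M\<^esub> x (i + 1) = x i"
  unfolding V_carrier by blast+

lemma V_vanish: "x \<in> carrier V \<Longrightarrow> \<exists>N. \<forall>i\<le>N. x i = \<zero>\<^bsub>M\<^esub>"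
  unfolding V_carrier by blast

lemma V_add: "(x \<oplus>\<^bsub>V\<^esub> y) i = x i \<oplus>\<^bsub>M\<^esub> y i" and V_zero: "\<zero>\<^bsub>V\<^esub> i = \<zero>\<^bsub>M\<^esub>"
  by (simp_all add: rational_Tate_module_def M_simps)

lemma V_pi_power: "x \<in> carrier V \<Longrightarrow> \<pi> ^ m \<odot>\<^bsub>M\<^esub> x (i + int m) = x i"
proof (induction m)
  case (Suc m)
  have "\<pi> ^ Suc m \<odot>\<^bsub>M\<^esub> x (i + int (Suc m)) = (\<pi> ^ m * \<pi>) \<odot>\<^bsub>M\<^esub> x ((i + int m) + 1)"
    by (simp add: mult.commute add_ac)
  also have "\<dots> = \<pi> ^ m \<odot>\<^bsub>M\<^esub> (\<pi> \<odot>\<^bsub>M\<^esub> x ((i + int m) + 1))"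
    by (rule smult_mult[OF pi_power_OF pi_OF V_M[OF Suc.prems]])
  finally show ?case using Suc V_pi[OF Suc.prems] by simp
qed (simp add: V_M)

text \<open>The definition takes the least exponent clearing the denominator. A larger one
  multiplies the scalar by a further power of \<pi>, which the shift of the index undoes; freedom in
  m provides common denominators.\<close>

lemma V_smult:
  assumes c: "c \<in> F" and x: "x \<in> carrier V" and m: "\<pi> ^ m * c \<in> R"
  shows "(c \<odot>\<^bsub>V\<^esub> x) i = (\<pi> ^ m * c) \<odot>\<^bsub>M\<^esub> x (i + int m)"
proof -
  define m0 where "m0 = (LEAST m::nat. \<pi> ^ m * c \<in> R)"
  have m0: "\<pi> ^ m0 * c \<in> R" "m0 \<le> m" unfolding m0_def using m by (auto intro: LeastI Least_le)
  have c0: "\<pi> ^ m0 * c \<in> OF" using m0(1) c pi_power_OF[of m0] F_mult by blast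
  have "(c \<odot>\<^bsub>V\<^esub> x) i = (\<pi> ^ m0 * c) \<odot>\<^bsub>M\<^esub> x (i + int m0)"
    by (simp add: rational_Tate_module_def M_simps Let_def m0_def)
  also have "x (i + int m0) = \<pi> ^ (m - m0) \<odot>\<^bsub>M\<^esub> x (i + int m)"
    using V_pi_power[OF x, of "m - m0" "i + int m0"] m0(2) by (simp add: add_ac of_nat_diff)
  also have "(\<pi> ^ m0 * c) \<odot>\<^bsub>M\<^esub> (\<pi> ^ (m - m0) \<odot>\<^bsub>M\<^esub> x (i + int m)) =
      (\<pi> ^ m0 * c * \<pi> ^ (m - m0)) \<odot>\<^bsub>M\<^esub> x (i + int m)"
    by (rule smult_mult[OF c0 pi_power_OF V_M[OF x], symmetric])
  also have "\<pi> ^ m0 * c * \<pi> ^ (m - m0) = \<pi> ^ m * c"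
  proof -
    have "\<pi> ^ m = \<pi> ^ m0 * \<pi> ^ (m - m0)" using m0(2) by (simp flip: power_add)
    then show ?thesis by simp
  qed
  finally show ?thesis .
qed

lemma ex_denominator: assumes c: "c \<in> F" shows "\<exists>m0. \<forall>m\<ge>m0. \<pi> ^ m * c \<in> OF"
proof (cases "c = 0")
  case False
  then obtain z :: int where z: "v c = ereal (of_int z)" using v_F_int c by blast
  have "\<pi> ^ m * c \<in> OF" if m: "m \<ge> nat (- z)" for m
  proof -
    have "0 \<le> real m + of_int z" using m by linarith
    then have "\<pi> ^ m * c \<in> R" by (simp add: R_iff v_mult v_power z)
    then show ?thesis using c pi_power_OF[of m] F_mult by blast
  qed
  then show ?thesis by blast
qed (auto simp del: Int_iff)

lemma ex_common_denominator: assumes "finite S" "S \<subseteq> F" shows "\<exists>m0. \<forall>m\<ge>m0. \<forall>c\<in>S. \<pi> ^ m * c \<in> OF"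
  using assms
proof (induction S rule: finite_induct)
  case (insert c S)
  then obtain m0 m1 where "\<forall>m\<ge>m0. \<pi> ^ m * c \<in> OF" "\<forall>m\<ge>m1. \<forall>c\<in>S. \<pi> ^ m * c \<in> OF"
    using ex_denominator[of c] by blast
  then have "\<forall>m\<ge>max m0 m1. \<forall>c\<in>insert c S. \<pi> ^ m * c \<in> OF" by (simp del: Int_iff)
  then show ?case by blast
qed simp

definition Fr :: "'k ring" where
  "Fr = \<lparr>carrier = F, mult = (*), one = 1, zero = 0, add = (+)\<rparr>"

lemma Fr_simps [simp]: "carrier Fr = F" "mult Fr = (*)" "one Fr = 1" "zero Fr = 0" "add Fr = (+)"
  by (simp_all add: Fr_def)

lemma cring_Fr: "cring Fr"
proof (rule cringI)
  show "abelian_group Fr"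
    by (rule abelian_groupI) (auto intro: bexI[of _ "- _"] simp: add_ac)
  show "comm_monoid Fr"
    by (rule comm_monoidI) (auto simp: mult_ac)
qed (auto simp: ring_distribs)

lemma V_smult_closed: assumes c: "c \<in> F" and x: "x \<in> carrier V" shows "c \<odot>\<^bsub>V\<^esub> x \<in> carrier V"
proof -
  obtain m where m: "\<pi> ^ m * c \<in> OF" using ex_denominator[OF c] by blast
  then have eq: "(c \<odot>\<^bsub>V\<^esub> x) i = (\<pi> ^ m * c) \<odot>\<^bsub>M\<^esub> x (i + int m)" for i using V_smult[OF c x] by simp
  obtain N where N: "\<forall>i\<le>N. x i = \<zero>\<^bsub>M\<^esub>" using V_vanish[OF x] by blast
  show ?thesis
  proof (rule V_carrierI[of _ "N - int m"])
    fix i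
    show "(c \<odot>\<^bsub>V\<^esub> x) i \<in> carrier M" unfolding eq using smult_M[OF m V_M[OF x]] .
    have "\<pi> \<odot>\<^bsub>M\<^esub> ((\<pi> ^ m * c) \<odot>\<^bsub>M\<^esub> x (i + 1 + int m)) = (\<pi> ^ m * c) \<odot>\<^bsub>M\<^esub> (\<pi> \<odot>\<^bsub>M\<^esub> x (i + 1 + int m))"
      using smult_mult[OF pi_OF m V_M[OF x]] smult_mult[OF m pi_OF V_M[OF x]] by (simp add: mult.commute)
    also have "\<pi> \<odot>\<^bsub>M\<^esub> x (i + 1 + int m) = x (i + int m)" using V_pi[OF x, of "i + int m"] by (simp add: add_ac)
    finally show "\<pi> \<odot>\<^bsub>M\<^esub> (c \<odot>\<^bsub>V\<^esub> x) (i + 1) = (c \<odot>\<^bsub>V\<^esub> x) i" unfolding eq .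
    show "i \<le> N - int m \<Longrightarrow> (c \<odot>\<^bsub>V\<^esub> x) i = \<zero>\<^bsub>M\<^esub>" unfolding eq using N smult_zero[OF m] by simp
  qed
qed

lemma V_add_closed: assumes x: "x \<in> carrier V" and y: "y \<in> carrier V" shows "x \<oplus>\<^bsub>V\<^esub> y \<in> carrier V"
proof -
  obtain N N' where N: "\<forall>i\<le>N. x i = \<zero>\<^bsub>M\<^esub>" "\<forall>i\<le>N'. y i = \<zero>\<^bsub>M\<^esub>"
    using V_vanish[OF x] V_vanish[OF y] by blast
  show ?thesis
  proof (rule V_carrierI[of _ "min N N'"])
    fix i
    show "(x \<oplus>\<^bsub>V\<^esub> y) i \<in> carrier M" unfolding V_add using V_M x y by simp
    show "\<pi> \<odot>\<^bsub>M\<^esub> (x \<oplus>\<^bsub>V\<^esub> y) (i + 1) = (x \<oplus>\<^bsub>V\<^esub> y) i"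
      unfolding V_add using smult_add_right[OF pi_OF V_M[OF x] V_M[OF y]] V_pi x y by simp
    show "i \<le> min N N' \<Longrightarrow> (x \<oplus>\<^bsub>V\<^esub> y) i = \<zero>\<^bsub>M\<^esub>" unfolding V_add using N by simp
  qed
qed

lemma abelian_group_V: "abelian_group V"
proof (rule abelian_groupI)
  fix x y z assume x: "x \<in> carrier V" and y: "y \<in> carrier V" and z: "z \<in> carrier V"
  show "x \<oplus>\<^bsub>V\<^esub> y \<in> carrier V" by (rule V_add_closed[OF x y])
  show "x \<oplus>\<^bsub>V\<^esub> y \<oplus>\<^bsub>V\<^esub> z = x \<oplus>\<^bsub>V\<^esub> (y \<oplus>\<^bsub>V\<^esub> z)"
    by (rule ext) (simp add: V_add M.M.a_assoc V_M x y z)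
  show "x \<oplus>\<^bsub>V\<^esub> y = y \<oplus>\<^bsub>V\<^esub> x" by (rule ext) (simp add: V_add M.M.a_comm V_M x y)
next
  show "\<zero>\<^bsub>V\<^esub> \<in> carrier V"
    by (rule V_carrierI[of _ 0]) (simp_all add: V_zero smult_zero[OF pi_OF])
next
  fix x assume x: "x \<in> carrier V"
  show "\<zero>\<^bsub>V\<^esub> \<oplus>\<^bsub>V\<^esub> x = x" by (rule ext) (simp add: V_add V_zero V_M x)
  have "(- 1) \<odot>\<^bsub>V\<^esub> x \<oplus>\<^bsub>V\<^esub> x = \<zero>\<^bsub>V\<^esub>"
  proof
    fix i
    have "((- 1) \<odot>\<^bsub>V\<^esub> x) i = (- 1) \<odot>\<^bsub>M\<^esub> x i" using V_smult[OF _ x, of "- 1" 0 i] m1_OF by simp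
    then show "((- 1) \<odot>\<^bsub>V\<^esub> x \<oplus>\<^bsub>V\<^esub> x) i = \<zero>\<^bsub>V\<^esub> i"
      by (simp add: V_add V_zero smult_m1 V_M x M.M.l_neg)
  qed
  then show "\<exists>y\<in>carrier V. y \<oplus>\<^bsub>V\<^esub> x = \<zero>\<^bsub>V\<^esub>" using V_smult_closed[OF _ x, of "- 1"] m1_OF by blast
qed

lemma module_V: "module Fr V"
proof (rule moduleI[OF cring_Fr abelian_group_V])
  fix a x assume "a \<in> carrier Fr" and x: "x \<in> carrier V"
  then have a: "a \<in> F" by simp
  show "a \<odot>\<^bsub>V\<^esub> x \<in> carrier V" by (rule V_smult_closed[OF a x])
  {
    fix b assume "b \<in> carrier Fr"
    then have b: "b \<in> F" by simp
    obtain m0 where m0: "\<forall>m\<ge>m0. \<forall>c\<in>{a, b}. \<pi> ^ m * c \<in> OF" using ex_common_denominator[of "{a, b}"] a b by auto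
    then have ma: "\<pi> ^ m0 * a \<in> OF" and mb: "\<pi> ^ m0 * b \<in> OF" by auto
    have "\<pi> ^ m0 * (a + b) \<in> R" using ma mb R_add by (simp add: distrib_left)
    then have "((a + b) \<odot>\<^bsub>V\<^esub> x) i = (a \<odot>\<^bsub>V\<^esub> x \<oplus>\<^bsub>V\<^esub> b \<odot>\<^bsub>V\<^esub> x) i" for i
      using ma mb smult_add[OF ma mb V_M[OF x]]
      by (simp add: V_add V_smult[OF F_add[OF a b] x, of m0] V_smult[OF a x, of m0] V_smult[OF b x, of m0] distrib_left)
    then show "(a \<oplus>\<^bsub>Fr\<^esub> b) \<odot>\<^bsub>V\<^esub> x = a \<odot>\<^bsub>V\<^esub> x \<oplus>\<^bsub>V\<^esub> b \<odot>\<^bsub>V\<^esub> x" by (simp add: fun_eq_iff)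
    have "((a * b) \<odot>\<^bsub>V\<^esub> x) i = (a \<odot>\<^bsub>V\<^esub> (b \<odot>\<^bsub>V\<^esub> x)) i" for i
    proof -
      have eq: "\<pi> ^ (m0 + m0) * (a * b) = (\<pi> ^ m0 * a) * (\<pi> ^ m0 * b)" by (simp add: power_add mult_ac)
      have "\<pi> ^ (m0 + m0) * (a * b) \<in> R" unfolding eq using ma mb by blast
      then have "((a * b) \<odot>\<^bsub>V\<^esub> x) i = ((\<pi> ^ m0 * a) * (\<pi> ^ m0 * b)) \<odot>\<^bsub>M\<^esub> x (i + int (m0 + m0))"
        unfolding eq[symmetric] by (rule V_smult[OF F_mult[OF a b] x])
      also have "\<dots> = (\<pi> ^ m0 * a) \<odot>\<^bsub>M\<^esub> ((\<pi> ^ m0 * b) \<odot>\<^bsub>M\<^esub> x (i + int m0 + int m0))"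
        using smult_mult[OF ma mb V_M[OF x]] by (simp add: add_ac)
      also have "\<dots> = (a \<odot>\<^bsub>V\<^esub> (b \<odot>\<^bsub>V\<^esub> x)) i"
        using ma mb V_smult[OF a V_smult_closed[OF b x], of m0 i] V_smult[OF b x, of m0] by simp
      finally show ?thesis .
    qed
    then show "(a \<otimes>\<^bsub>Fr\<^esub> b) \<odot>\<^bsub>V\<^esub> x = a \<odot>\<^bsub>V\<^esub> (b \<odot>\<^bsub>V\<^esub> x)" by (simp add: fun_eq_iff)
  }
  fix y assume y: "y \<in> carrier V"
  obtain m where m: "\<pi> ^ m * a \<in> OF" using ex_denominator[OF a] by blast
  have "(a \<odot>\<^bsub>V\<^esub> (x \<oplus>\<^bsub>V\<^esub> y)) i = (a \<odot>\<^bsub>V\<^esub> x \<oplus>\<^bsub>V\<^esub> a \<odot>\<^bsub>V\<^esub> y) i" for i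
    using m smult_add_right[OF m V_M[OF x] V_M[OF y]]
    by (simp add: V_add V_smult[OF a V_add_closed[OF x y], of m] V_smult[OF a x, of m] V_smult[OF a y, of m])
  then show "a \<odot>\<^bsub>V\<^esub> (x \<oplus>\<^bsub>V\<^esub> y) = a \<odot>\<^bsub>V\<^esub> x \<oplus>\<^bsub>V\<^esub> a \<odot>\<^bsub>V\<^esub> y" by (simp add: fun_eq_iff)
next
  fix x assume x: "x \<in> carrier V"
  have "(1 \<odot>\<^bsub>V\<^esub> x) i = x i" for i using V_smult[OF F_1 x, of 0 i] V_M[OF x] by simp
  then show "\<one>\<^bsub>Fr\<^esub> \<odot>\<^bsub>V\<^esub> x = x" by (simp add: fun_eq_iff)
qed

sublocale V: module Fr V by (rule module_V)

lemma V_finsum_apply: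
  assumes "finite S" "f \<in> S \<rightarrow> carrier V"
  shows "(\<Oplus>\<^bsub>V\<^esub>i\<in>S. f i) j = (\<Oplus>\<^bsub>M\<^esub>i\<in>S. f i j)"
  using assms
proof (induction S rule: finite_induct)
  case empty
  then show ?case by (simp add: V_zero)
next
  case (insert a S)
  then have f: "f a \<in> carrier V" "f \<in> S \<rightarrow> carrier V" by auto
  have fM: "(\<lambda>i. f i j) \<in> S \<rightarrow> carrier M" "f a j \<in> carrier M" using f V_M by auto
  show ?case
    using V.M.finsum_insert[OF insert.hyps f(2,1)] M.M.finsum_insert[OF insert.hyps fM] insert.IH[OF f(2)]
    by (simp add: V_add)
qed


subsection \<open>Division by \<open>\<pi>\<close>\<close>

definition g :: "ereal \<Rightarrow> ereal" where "g r = (\<Sum>s\<in>Mk 1. min r (w s))"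

text \<open>The bounded part of \<open>g\<close>. The zero point contributes r itself, which makes
  \<open>g\<close> strictly increasing; the other summands stay below the finite values
  \<open>w s\<close>, so they can be cancelled in the extended reals.\<close>

definition h :: "ereal \<Rightarrow> ereal" where "h r = (\<Sum>s\<in>Mk 1 - {\<zero>\<^bsub>M\<^esub>}. min r (w s))"

lemma g_eq: "g r = r + h r"
proof -
  have "g r = min r (w \<zero>\<^bsub>M\<^esub>) + h r"
    unfolding g_def h_def using Mk_zero finite_Mk by (intro sum.remove) auto
  then show ?thesis by simp
qed

lemma h_mono: "r \<le> r' \<Longrightarrow> h r \<le> h r'"
  unfolding h_def by (intro sum_mono min.mono order_refl)

lemma h_nonneg: "0 \<le> r \<Longrightarrow> 0 \<le> h r"
  unfolding h_def using w_pos Mk_M by (intro sum_nonneg) (auto intro: less_imp_le)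

lemma h_finite: "h r \<noteq> \<infinity>"
proof
  assume "h r = \<infinity>"
  then obtain s where "s \<in> Mk 1 - {\<zero>\<^bsub>M\<^esub>}" "min r (w s) = \<infinity>" unfolding h_def sum_Pinfty by blast
  then show False using w_eq_infty_iff[of s] Mk_M by (auto simp: min_def split: if_splits)
qed

lemma g_less: assumes "0 \<le> r" "r < r'" shows "g r < g r'"
proof -
  have h: "0 \<le> h r" "h r \<le> h r'" "h r' \<noteq> \<infinity>" using assms h_nonneg h_mono h_finite by auto
  then obtain a b where ab: "h r = ereal a" "h r' = ereal b" "a \<le> b"
    by (cases "h r"; cases "h r'") auto
  show ?thesis unfolding g_eq ab(1,2) using assms ab(3) by (cases r; cases r') auto
qed

lemma g_le_iff: "0 \<le> r \<Longrightarrow> 0 \<le> r' \<Longrightarrow> g r \<le> g r' \<longleftrightarrow> r \<le> r'"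
  using g_less[of r r'] g_less[of r' r] by (metis less_le not_le)

lemma ex_Mk1_nonzero: "\<exists>s\<in>Mk 1. s \<noteq> \<zero>\<^bsub>M\<^esub>"
proof (rule ccontr)
  assume "\<not> ?thesis"
  then have "Mk 1 \<subseteq> {\<zero>\<^bsub>M\<^esub>}" by blast
  then have "card (Mk 1) \<le> 1" using card_mono[of "{\<zero>\<^bsub>M\<^esub>}" "Mk 1"] by simp
  moreover have "residue_card v F ^ 1 \<le> residue_card v F ^ (n * 1)"
    using residue_card_ge_2 n_pos by (intro power_increasing) auto
  ultimately show False using residue_card_ge_2 by (simp add: card_Mk)
qed

lemma h_ge: "s \<in> Mk 1 \<Longrightarrow> s \<noteq> \<zero>\<^bsub>M\<^esub> \<Longrightarrow> 0 \<le> r \<Longrightarrow> min r (w s) \<le> h r"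
  unfolding h_def using w_pos Mk_M finite_Mk
    sum_mono2[of "Mk 1 - {\<zero>\<^bsub>M\<^esub>}" "{s}" "\<lambda>s. min r (w s)"]
  by (auto intro: less_imp_le)

lemma h_pos: assumes "0 < r" shows "0 < h r"
proof -
  obtain s where s: "s \<in> Mk 1" "s \<noteq> \<zero>\<^bsub>M\<^esub>" using ex_Mk1_nonzero by blast
  have "0 < min r (w s)" using assms w_pos[OF Mk_M[OF s(1)]] by simp
  also have "\<dots> \<le> h r" using h_ge[OF s] assms by simp
  finally show ?thesis .
qed

lemma g_pos: "0 < r \<Longrightarrow> 0 < g r"
  unfolding g_eq using h_nonneg[of r] by (intro add_pos_nonneg) auto

lemma w_minus_Mk: assumes x: "x \<in> carrier M" and y: "y \<in> carrier M" shows "min (w x) (w y) \<le> w (x \<ominus>\<^bsub>M\<^esub> y)"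
  unfolding w_diff[OF x y] by (intro v_diff_ge) auto

text \<open>Termwise comparison in \<open>w_pi\<close>. Since \<open>g\<close> is strictly
  increasing, a point attaining equality has maximal valuation among all points with the same
  multiple by \<pi>.\<close>

lemma g_le_w_pi: "x \<in> carrier M \<Longrightarrow> g (w x) \<le> w (\<pi> \<odot>\<^bsub>M\<^esub> x)"
  unfolding w_pi g_def by (intro sum_mono w_minus_Mk) (auto intro: Mk_M)

lemma w_less_w_pi: assumes x: "x \<in> carrier M" "x \<noteq> \<zero>\<^bsub>M\<^esub>" shows "w x < w (\<pi> \<odot>\<^bsub>M\<^esub> x)"
proof -
  obtain r where r: "w x = ereal r" using x w_eq_infty_iff[of x] by (cases "w x") auto
  have "0 < h (w x)" by (rule h_pos[OF w_pos[OF x(1)]])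
  then have "w x < g (w x)" unfolding g_eq using r by (cases "h (w x)") auto
  then show ?thesis using g_le_w_pi[OF x(1)] by simp
qed

lemma pi_smult_Mk: assumes x: "x \<in> Mk (Suc k)" shows "\<pi> \<odot>\<^bsub>M\<^esub> x \<in> Mk k"
proof -
  have xM: "x \<in> carrier M" using x by (rule Mk_M)
  have "\<pi> ^ k \<odot>\<^bsub>M\<^esub> (\<pi> \<odot>\<^bsub>M\<^esub> x) = \<pi> ^ Suc k \<odot>\<^bsub>M\<^esub> x"
    using smult_mult[OF pi_power_OF pi_OF xM, of k] by (simp add: mult.commute)
  then show ?thesis using x xM smult_M[OF pi_OF xM] by (simp add: Mk_def del: Int_iff)
qed

lemma Mk_mono: "Mk k \<subseteq> Mk (Suc k)"
proof
  fix x assume "x \<in> Mk k"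
  then obtain a where a: "x = pt k a" "a \<in> roots k" unfolding Mk_eq by (rule imageE)
  then have "x = pt (Suc k) a" "a \<in> roots (Suc k)" using pt_le[of a k "Suc k"] roots_mono[of k "Suc k"] by auto
  then show "x \<in> Mk (Suc k)" unfolding Mk_eq by (rule image_eqI)
qed

lemma Mk_mono': "k \<le> m \<Longrightarrow> Mk k \<subseteq> Mk m"
  by (rule lift_Suc_mono_le[of Mk, OF Mk_mono])

text \<open>Counting: each fibre embeds into \<open>Mk 1\<close> by subtracting a chosen member
  \<open>sec\<close>, so it has at most q^n elements, and the image of \<open>Mk (Suc k)\<close> has
  at least as many elements as \<open>Mk k\<close>.\<close>

lemma pi_smult_surj: "(\<lambda>x. \<pi> \<odot>\<^bsub>M\<^esub> x) ` Mk (Suc k) = Mk k"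
proof (rule card_subset_eq[OF finite_Mk])
  let ?p = "\<lambda>x. \<pi> \<odot>\<^bsub>M\<^esub> x"
  show sub: "?p ` Mk (Suc k) \<subseteq> Mk k" using pi_smult_Mk by blast
  define sec where "sec = inv_into (Mk (Suc k)) ?p"
  have sec: "sec (?p x) \<in> Mk (Suc k)" "?p (sec (?p x)) = ?p x" if "x \<in> Mk (Suc k)" for x
    using that inv_into_into[of "?p x" ?p "Mk (Suc k)"] f_inv_into_f[of "?p x" ?p "Mk (Suc k)"]
    by (auto simp: sec_def)
  let ?f = "\<lambda>x. (?p x, x \<ominus>\<^bsub>M\<^esub> sec (?p x))"
  have "inj_on ?f (Mk (Suc k))"
  proof (rule inj_onI)
    fix x y assume xy: "x \<in> Mk (Suc k)" "y \<in> Mk (Suc k)" "?f x = ?f y"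
    note conj = iffD1[OF prod.inject xy(3)]
    note 1 = conjunct1[OF conj] and 2 = conjunct2[OF conj]
    have eq: "x \<ominus>\<^bsub>M\<^esub> sec (?p x) = y \<ominus>\<^bsub>M\<^esub> sec (?p x)" using 2 unfolding 1[symmetric] .
    have "x \<in> carrier M" "y \<in> carrier M" "sec (?p x) \<in> carrier M" using xy sec(1)[OF xy(1)] Mk_M by auto
    then show "x = y" using eq by (simp add: a_minus_def)
  qed
  moreover have "?f ` Mk (Suc k) \<subseteq> (?p ` Mk (Suc k)) \<times> Mk 1"
  proof
    fix z assume "z \<in> ?f ` Mk (Suc k)"
    then obtain x where x: "x \<in> Mk (Suc k)" "z = ?f x" by blast
    have c: "x \<in> carrier M" "sec (?p x) \<in> carrier M" using x(1) sec(1) Mk_M by auto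
    have "x \<ominus>\<^bsub>M\<^esub> sec (?p x) \<in> Mk 1"
    proof -
      have "\<pi> \<odot>\<^bsub>M\<^esub> (x \<ominus>\<^bsub>M\<^esub> sec (?p x)) = ?p x \<ominus>\<^bsub>M\<^esub> ?p (sec (?p x))"
        using c smult_add_right[OF pi_OF c(1), of "\<ominus>\<^bsub>M\<^esub> sec (?p x)"] M.smult_r_minus[of \<pi> "sec (?p x)"] pi_OF
        by (simp add: a_minus_def del: Int_iff)
      also have "\<dots> = \<zero>\<^bsub>M\<^esub>"
        unfolding sec(2)[OF x(1)] using smult_M[OF pi_OF c(1)] by (simp add: a_minus_def M.M.r_neg)
      finally show ?thesis using c by (simp add: Mk_def a_minus_def)
    qed
    then show "z \<in> (?p ` Mk (Suc k)) \<times> Mk 1" using x by blast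
  qed
  ultimately have "card (Mk (Suc k)) \<le> card ((?p ` Mk (Suc k)) \<times> Mk 1)"
    using finite_Mk by (intro card_inj_on_le[of ?f]) auto
  then have "residue_card v F ^ (n * k) * residue_card v F ^ n \<le> card (?p ` Mk (Suc k)) * residue_card v F ^ n"
    by (simp add: card_cartesian_product card_Mk power_add mult.commute)
  then have "card (Mk k) \<le> card (?p ` Mk (Suc k))" using residue_card_pos by (simp add: card_Mk)
  moreover have "card (?p ` Mk (Suc k)) \<le> card (Mk k)" using sub by (intro card_mono finite_Mk)
  ultimately show "card (?p ` Mk (Suc k)) = card (Mk k)" by simp
qed

text \<open>
  A preimage \<open>x\<close> of \<open>y\<close> with \<open>w x\<close> maximal works: since \<open>x - s\<close> is again a preimage for
  \<open>\<pi>\<close>-torsion \<open>s\<close>, its valuation is \<open>min (w x) (w s)\<close>.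
\<close>

lemma ex_good_lift:
  assumes y: "y \<in> Mk k" obtains x where "x \<in> Mk (Suc k)" "\<pi> \<odot>\<^bsub>M\<^esub> x = y" "g (w x) = w y"
proof -
  let ?Y = "{x \<in> Mk (Suc k). \<pi> \<odot>\<^bsub>M\<^esub> x = y}"
  have "y \<in> (\<lambda>x. \<pi> \<odot>\<^bsub>M\<^esub> x) ` Mk (Suc k)" using y by (simp only: pi_smult_surj)
  then have "?Y \<noteq> {}" by blast
  moreover have fin: "finite ?Y" using finite_Mk by simp
  ultimately have "Max (w ` ?Y) \<in> w ` ?Y" by (intro Max_in) auto
  then obtain x where x': "Max (w ` ?Y) = w x" "x \<in> ?Y" by (rule imageE)
  have xM: "x \<in> carrier M" using x'(2) Mk_M by blast
  have max: "w z \<le> w x" if "z \<in> ?Y" for z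
    unfolding x'(1)[symmetric] using fin that by (intro Max_ge) auto
  have "w (x \<ominus>\<^bsub>M\<^esub> s) = min (w x) (w s)" if s: "s \<in> Mk 1" for s
  proof (rule antisym)
    have sM: "s \<in> carrier M" using s by (rule Mk_M)
    show "min (w x) (w s) \<le> w (x \<ominus>\<^bsub>M\<^esub> s)" by (rule w_minus_Mk[OF xM sM])
    have "s \<in> Mk (Suc k)" using s Mk_mono'[of 1 "Suc k"] by auto
    then have "x \<ominus>\<^bsub>M\<^esub> s \<in> Mk (Suc k)" using Mk_diff x'(2) by blast
    moreover have "\<pi> \<odot>\<^bsub>M\<^esub> (x \<ominus>\<^bsub>M\<^esub> s) = y"
    proof -
      have "\<pi> \<odot>\<^bsub>M\<^esub> (x \<ominus>\<^bsub>M\<^esub> s) = \<pi> \<odot>\<^bsub>M\<^esub> x \<oplus>\<^bsub>M\<^esub> \<ominus>\<^bsub>M\<^esub> (\<pi> \<odot>\<^bsub>M\<^esub> s)"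
        using smult_add_right[OF pi_OF xM, of "\<ominus>\<^bsub>M\<^esub> s"] M.smult_r_minus[of \<pi> s] pi_OF sM
        by (simp add: a_minus_def del: Int_iff)
      then show ?thesis using s x'(2) smult_M[OF pi_OF xM] by (simp add: Mk_def del: Int_iff)
    qed
    ultimately have le: "w (x \<ominus>\<^bsub>M\<^esub> s) \<le> w x" by (intro max) simp
    moreover have "w (x \<ominus>\<^bsub>M\<^esub> s) \<le> w s"
    proof (rule ccontr)
      assume "\<not> ?thesis"
      \<comment> \<open>Otherwise s, as the difference of x and x - s, would have valuation larger
        than its own.\<close>
      then have lt: "w s < v (\<kappa> x - \<kappa> s)" using w_diff[OF xM sM] by simp
      then have "w s < w x" using le w_diff[OF xM sM] by simp
      from v_diff_gt[OF this lt] show False by simp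
    qed
    ultimately show "w (x \<ominus>\<^bsub>M\<^esub> s) \<le> min (w x) (w s)" by simp
  qed
  then have "g (w x) = w (\<pi> \<odot>\<^bsub>M\<^esub> x)" unfolding w_pi[OF xM] g_def by simp
  then show ?thesis using that x'(2) by auto
qed

text \<open>The points x + s and x have the same multiple by \<pi>, so maximality of x bounds the
  valuation of x + s by that of x; then s is the difference of two points of valuation at least
  r.\<close>

lemma good_split:
  assumes x: "x \<in> carrier M" "g (w x) = w (\<pi> \<odot>\<^bsub>M\<^esub> x)" and s: "s \<in> Mk 1" and r: "r \<le> w (x \<oplus>\<^bsub>M\<^esub> s)"
  shows "r \<le> w x" "r \<le> w s"
proof -
  have sM: "s \<in> carrier M" using s by (rule Mk_M)
  have "\<pi> \<odot>\<^bsub>M\<^esub> (x \<oplus>\<^bsub>M\<^esub> s) = \<pi> \<odot>\<^bsub>M\<^esub> x"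
    using smult_add_right[OF pi_OF x(1) sM] s smult_M[OF pi_OF x(1)] by (simp add: Mk_def del: Int_iff)
  then have "g (w (x \<oplus>\<^bsub>M\<^esub> s)) \<le> g (w x)" using g_le_w_pi[of "x \<oplus>\<^bsub>M\<^esub> s"] x sM by simp
  then have "w (x \<oplus>\<^bsub>M\<^esub> s) \<le> w x"
    using g_le_iff w_pos x(1) sM by (simp add: less_imp_le)
  then show rx: "r \<le> w x" using r by simp
  have "s = (x \<oplus>\<^bsub>M\<^esub> s) \<ominus>\<^bsub>M\<^esub> x" using x(1) sM
    by (simp add: a_minus_def M.M.a_ac M.M.r_neg1 M.M.r_neg)
  then have "min (w (x \<oplus>\<^bsub>M\<^esub> s)) (w x) \<le> w s" using w_minus_Mk[of "x \<oplus>\<^bsub>M\<^esub> s" x] x(1) sM by simp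
  then show "r \<le> w s" using r rx by (meson min.boundedI order_trans)
qed

end

text \<open>Row i is a chain of successive divisions by \<pi> that starts with the greedy vector at
  k = 1. \<open>B_good\<close> is required only for k > 0: at k = 0 the preimage of maximal
  valuation would be zero, not the basis vector.\<close>

locale adapted_basis = formal_module v F \<pi> p n H \<phi>
  for v :: "'k::{alg_closed_field, field_char_0} \<Rightarrow> ereal" and F \<pi> p n H \<phi> +
  fixes B :: "nat \<Rightarrow> nat \<Rightarrow> 'k fpoint"
  assumes B_greedy: "greedy n (\<lambda>i. B i 1)"
    and B_0: "B i 0 = \<zero>\<^bsub>M\<^esub>"
    and B_Mk: "i < n \<Longrightarrow> B i k \<in> Mk k"
    and B_pi: "i < n \<Longrightarrow> \<pi> \<odot>\<^bsub>M\<^esub> B i (Suc k) = B i k"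
    and B_good: "i < n \<Longrightarrow> 0 < k \<Longrightarrow> g (w (B i (Suc k))) = w (B i k)"

lemma (in formal_module) ex_adapted_basis: "\<exists>B. adapted_basis v F \<pi> p n H \<phi> B"
proof -
  obtain s where s: "greedy n s" using ex_greedy by blast
  have "\<exists>b. \<forall>k. (b k \<in> Mk (Suc k) \<and> (k = 0 \<longrightarrow> b k = s i)) \<and>
      (\<pi> \<odot>\<^bsub>M\<^esub> b (Suc k) = b k \<and> g (w (b (Suc k))) = w (b k))" if i: "i < n" for i
  proof (rule dependent_nat_choice)
    show "\<exists>x. x \<in> Mk (Suc 0) \<and> (0 = 0 \<longrightarrow> x = s i)" using greedy_Mk[OF s] i by auto
  next
    fix x k assume "x \<in> Mk (Suc k) \<and> (k = 0 \<longrightarrow> x = s i)"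
    then obtain y where "y \<in> Mk (Suc (Suc k))" "\<pi> \<odot>\<^bsub>M\<^esub> y = x" "g (w y) = w x"
      using ex_good_lift[of x "Suc k"] by blast
    then show "\<exists>y. (y \<in> Mk (Suc (Suc k)) \<and> (Suc k = 0 \<longrightarrow> y = s i)) \<and> \<pi> \<odot>\<^bsub>M\<^esub> y = x \<and> g (w y) = w x" by blast
  qed
  then obtain b where b: "\<And>i k. i < n \<Longrightarrow> b i k \<in> Mk (Suc k)" "\<And>i. i < n \<Longrightarrow> b i 0 = s i"
    "\<And>i k. i < n \<Longrightarrow> \<pi> \<odot>\<^bsub>M\<^esub> b i (Suc k) = b i k" "\<And>i k. i < n \<Longrightarrow> g (w (b i (Suc k))) = w (b i k)"
    by metis
  define B where "B i k = (case k of 0 \<Rightarrow> \<zero>\<^bsub>M\<^esub> | Suc k \<Rightarrow> b i k)" for i k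
  have gr: "greedy n (\<lambda>i. B i 1)"
  proof -
    have sC: "s \<in> {..<n} \<rightarrow> carrier M" using greedy_Mk[OF s] Mk_M by blast
    have lc: "lc {..<j} c (\<lambda>i. B i 1) = lc {..<j} c s" if "j \<le> n" "c \<in> {..<j} \<rightarrow> OF" for j c
      using that sC b(2) by (intro lc_cong) (auto simp: B_def)
    have lspan: "lspan j (\<lambda>i. B i 1) = lspan j s" if "j \<le> n" for j
      using that sC b(2) by (intro lspan_cong) (auto simp: B_def)
    have s1: "(\<lambda>i. B i 1) \<in> {..<n} \<rightarrow> Mk 1" using b(1)[of _ 0] by (auto simp: B_def)
    show ?thesis
      unfolding greedy_def indep_def
    proof (intro conjI ballI impI allI)
      fix c i assume "c \<in> {..<n} \<rightarrow> OF" "lc {..<n} c (\<lambda>i. B i 1) = \<zero>\<^bsub>M\<^esub>" "i < n"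
      then show "c i \<in> \<mm>" using lc[of n c] greedy_indep[OF s] by (simp add: indep_def)
    next
      fix i x assume "i < n" "x \<in> Mk 1" "x \<notin> lspan i (\<lambda>i. B i 1)"
      then show "w x \<le> w (B i 1)" using lspan[of i] greedy_max[OF s] b(2) by (simp add: B_def)
    qed (rule s1)
  qed
  have "adapted_basis v F \<pi> p n H \<phi> B"
  proof
    show "greedy n (\<lambda>i. B i 1)" by (rule gr)
    show "B i 0 = \<zero>\<^bsub>M\<^esub>" for i by (simp add: B_def)
    fix i k assume i: "i < n"
    show "B i k \<in> Mk k" using b(1)[OF i] Mk_zero by (auto simp: B_def split: nat.split)
    show "\<pi> \<odot>\<^bsub>M\<^esub> B i (Suc k) = B i k"
      using b(1)[OF i, of 0] b(3)[OF i] by (cases k) (auto simp: B_def Mk_def)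
    show "0 < k \<Longrightarrow> g (w (B i (Suc k))) = w (B i k)" using b(4)[OF i] by (cases k) (auto simp: B_def)
  qed
  then show ?thesis by blast
qed

context adapted_basis
begin

section \<open>Valuations along the chains of divisions\<close>

abbreviation W :: "nat \<Rightarrow> nat \<Rightarrow> ereal" where "W i k \<equiv> w (B i k)"

lemma B_M: "i < n \<Longrightarrow> B i k \<in> carrier M"
  using B_Mk Mk_M by blast

lemma B_Pi: "(\<lambda>i. B i k) \<in> {..<n} \<rightarrow> carrier M"
  using B_M by blast

lemma B_pi_power: "i < n \<Longrightarrow> \<pi> ^ j \<odot>\<^bsub>M\<^esub> B i (j + k) = B i k"
proof (induction j)
  case (Suc j)
  have "\<pi> ^ Suc j \<odot>\<^bsub>M\<^esub> B i (Suc (j + k)) = (\<pi> ^ j * \<pi>) \<odot>\<^bsub>M\<^esub> B i (Suc (j + k))" by (simp add: mult.commute)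
  also have "\<dots> = \<pi> ^ j \<odot>\<^bsub>M\<^esub> (\<pi> \<odot>\<^bsub>M\<^esub> B i (Suc (j + k)))"
    by (rule smult_mult[OF pi_power_OF pi_OF B_M[OF Suc.prems]])
  finally show ?case using Suc B_pi[OF Suc.prems] by simp
qed (simp add: B_M)

lemma B_1_nonzero: assumes i: "i < n" shows "B i 1 \<noteq> \<zero>\<^bsub>M\<^esub>"
proof
  assume z: "B i 1 = \<zero>\<^bsub>M\<^esub>"
  define c where "c l = (if l = i then 1 else 0 :: 'k)" for l
  have c: "c \<in> {..<n} \<rightarrow> OF" by (auto simp: c_def)
  have "lc {..<n} c (\<lambda>i. B i 1) = \<zero>\<^bsub>M\<^esub>" using z B_M by (intro lc_zero) (auto simp: c_def)
  then have "c i \<in> \<mm>" using greedy_indep[OF B_greedy] c i by (simp add: indep_def)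
  then show False by (simp add: c_def \<mm>_iff)
qed

lemma B_Suc_nonzero: assumes i: "i < n" shows "B i (Suc k) \<noteq> \<zero>\<^bsub>M\<^esub>"
proof
  assume "B i (Suc k) = \<zero>\<^bsub>M\<^esub>"
  then have "B i 1 = \<zero>\<^bsub>M\<^esub>" using B_pi_power[OF i, of k 1] smult_zero[OF pi_power_OF[of k]] by simp
  then show False using B_1_nonzero[OF i] by simp
qed

lemma W_0: "W i 0 = \<infinity>" by (simp add: B_0)

lemma W_pos: "i < n \<Longrightarrow> 0 < W i k" using w_pos B_M by blast

lemma W_Suc_less: "i < n \<Longrightarrow> W i (Suc k) < W i k"
  using w_less_w_pi[OF B_M B_Suc_nonzero, of i k] B_pi by simp

lemma W_antimono: "i < n \<Longrightarrow> k \<le> m \<Longrightarrow> W i m \<le> W i k"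
  using lift_Suc_antimono_le[of "W i" k m] W_Suc_less less_imp_le by blast

text \<open>At k = 1 this is the greedy order; afterwards it persists because both chains satisfy
  the same recursion with the increasing function \<open>g\<close>.\<close>

lemma W_order: assumes "i \<le> j" "j < n" shows "W j k \<le> W i k"
proof (induction k)
  case (Suc k)
  show ?case
  proof (cases "k = 0")
    case True
    then show ?thesis using greedy_decreasing[OF B_greedy assms] by simp
  next
    case False
    then have "g (W j (Suc k)) \<le> g (W i (Suc k))" using Suc B_good assms by simp
    then show ?thesis using g_le_iff W_pos assms by (simp add: less_imp_le)
  qed
qed (simp add: W_0)

text \<open>As long as the valuations stay at least r, each division lowers them by at least
  \<open>min r (w s)\<close> for one fixed nonzero \<pi>-torsion point s. Starting from the finite
  value at k = 1 they would become negative.\<close>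

lemma W_small: assumes i: "i < n" and r: "0 < r" shows "\<exists>k. W i k < r"
proof (rule ccontr)
  assume "\<not> ?thesis"
  then have ge: "r \<le> W i k" for k by (auto simp: not_less)
  obtain s where s: "s \<in> Mk 1" "s \<noteq> \<zero>\<^bsub>M\<^esub>" using ex_Mk1_nonzero by blast
  define \<delta> where "\<delta> = min r (w s)"
  have "w s \<noteq> \<infinity>" using w_eq_infty_iff[OF Mk_M[OF s(1)]] s(2) by simp
  then obtain d where d: "\<delta> = ereal d" "d > 0"
    using r w_pos[OF Mk_M[OF s(1)]] by (cases "\<delta>") (auto simp: \<delta>_def min_def split: if_splits)
  have step: "W i (Suc (Suc k)) + ereal d \<le> W i (Suc k)" for k
  proof -
    have "ereal d \<le> min (W i (Suc (Suc k))) (w s)"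
      unfolding d(1)[symmetric] \<delta>_def using ge by (intro min.mono) auto
    also have "\<dots> \<le> h (W i (Suc (Suc k)))" using h_ge[OF s] W_pos[OF i] less_imp_le by blast
    finally have "W i (Suc (Suc k)) + ereal d \<le> g (W i (Suc (Suc k)))"
      unfolding g_eq by (intro add_left_mono)
    then show ?thesis using B_good[OF i] by simp
  qed
  have sum: "ereal (real k * d) \<le> W i 1" for k
  proof -
    have "W i (Suc k) + ereal (real k * d) \<le> W i 1"
    proof (induction k)
      case (Suc k)
      have "W i (Suc (Suc k)) + ereal (real (Suc k) * d) = (W i (Suc (Suc k)) + ereal d) + ereal (real k * d)"
        by (simp add: add.assoc distrib_right)
      also have "\<dots> \<le> W i (Suc k) + ereal (real k * d)" by (rule add_right_mono[OF step])
      finally show ?case using Suc by simp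
    qed simp
    moreover have "0 \<le> W i (Suc k)" using W_pos[OF i] less_imp_le by blast
    ultimately show ?thesis using add_right_mono[of 0 "W i (Suc k)" "ereal (real k * d)"] by simp
  qed
  have "W i 1 \<noteq> \<infinity>" using w_eq_infty_iff[OF B_M[OF i]] B_1_nonzero[OF i] by simp
  then obtain a where a: "W i 1 = ereal a" using W_pos[OF i, of 1] by (cases "W i 1") auto
  obtain k :: nat where "real k > a / d" using reals_Archimedean2 by blast
  then have "a < real k * d" using d(2) by (simp add: field_simps)
  then show False using sum[of k] a by simp
qed

text \<open>The largest \<open>k\<close> with \<open>r \<le> W i k\<close> (see \<open>le_W_iff\<close>); junk unless \<open>0 < r\<close>.\<close>

definition A :: "nat \<Rightarrow> ereal \<Rightarrow> nat" where "A i r = (LEAST k. W i (Suc k) < r)"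

lemma le_W_iff: assumes i: "i < n" and r: "0 < r" shows "r \<le> W i k \<longleftrightarrow> k \<le> A i r"
proof -
  obtain m where "W i m < r" using W_small[OF i r] by blast
  then have "W i (Suc m) < r" using W_Suc_less[OF i, of m] by simp
  then have A: "W i (Suc (A i r)) < r" unfolding A_def by (rule LeastI)
  show ?thesis
  proof
    assume "r \<le> W i k"
    show "k \<le> A i r"
    proof (rule ccontr)
      assume "\<not> k \<le> A i r"
      then have "W i k \<le> W i (Suc (A i r))" by (intro W_antimono i) simp
      then show False using A \<open>r \<le> W i k\<close> by simp
    qed
  next
    assume k: "k \<le> A i r"
    show "r \<le> W i k"
    proof (cases k)
      case 0 then show ?thesis by (simp add: W_0)
    next
      case (Suc k')
      then have "\<not> W i (Suc k') < r" using k not_less_Least[of k' "\<lambda>k. W i (Suc k) < r"] by (simp add: A_def)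
      then show ?thesis using Suc by simp
    qed
  qed
qed

section \<open>Linear combinations of the division points of one level\<close>

lemma lc_pi: assumes c: "c \<in> {..<n} \<rightarrow> OF"
  shows "\<pi> ^ j \<odot>\<^bsub>M\<^esub> lc {..<n} c (\<lambda>i. B i (j + k)) = lc {..<n} c (\<lambda>i. B i k)"
proof -
  have "\<pi> ^ j \<odot>\<^bsub>M\<^esub> lc {..<n} c (\<lambda>i. B i (j + k)) = lc {..<n} c (\<lambda>i. \<pi> ^ j \<odot>\<^bsub>M\<^esub> B i (j + k))"
    using lc_smult'[OF _ pi_power_OF c B_Pi] by simp
  also have "\<dots> = lc {..<n} c (\<lambda>i. B i k)"
    using c B_Pi by (intro lc_cong) (simp_all add: B_pi_power del: Int_iff)
  finally show ?thesis .
qed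

lemma lc_pi_coeff: assumes c: "c \<in> {..<n} \<rightarrow> OF"
  shows "lc {..<n} (\<lambda>i. \<pi> ^ j * c i) (\<lambda>i. B i (j + k)) = lc {..<n} c (\<lambda>i. B i k)"
  using lc_smult[OF _ pi_power_OF c B_Pi] lc_pi[OF c] by simp

text \<open>Multiplied down to level 1, a relation at level k + 1 has all its coefficients divisible
  by \<pi>; the quotients satisfy a relation at level k.\<close>

lemma indep_level:
  assumes "c \<in> {..<n} \<rightarrow> OF" "lc {..<n} c (\<lambda>i. B i k) = \<zero>\<^bsub>M\<^esub>" "i < n"
  shows "ereal (real k) \<le> v (c i)"
  using assms
proof (induction k arbitrary: c)
  case 0
  then have "c i \<in> OF" by (simp add: Pi_iff)
  then show ?case by (simp add: R_iff zero_ereal_def[symmetric])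
next
  case (Suc k)
  have "lc {..<n} c (\<lambda>i. B i 1) = \<zero>\<^bsub>M\<^esub>"
    using lc_pi[OF Suc.prems(1), of k 1] Suc.prems(2) smult_zero[OF pi_power_OF[of k]] by simp
  then have "\<forall>i<n. c i \<in> \<mm>" using greedy_indep[OF B_greedy] Suc.prems(1) by (simp add: indep_def)
  then have "\<forall>i. \<exists>y. i < n \<longrightarrow> y \<in> OF \<and> c i = \<pi> * y"
    using F_unif Suc.prems(1) by (metis IntD1 Pi_iff lessThan_iff)
  then obtain c' where c': "\<And>i. i < n \<Longrightarrow> c' i \<in> OF" "\<And>i. i < n \<Longrightarrow> c i = \<pi> * c' i" by metis
  have c'Pi: "c' \<in> {..<n} \<rightarrow> OF" using c'(1) by blast
  have "lc {..<n} c (\<lambda>i. B i (Suc k)) = lc {..<n} (\<lambda>i. \<pi> ^ 1 * c' i) (\<lambda>i. B i (1 + k))"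
    using c' OF_mult[OF pi_OF] B_Pi by (intro lc_cong) (simp_all add: Pi_iff B_M del: Int_iff)
  then have "lc {..<n} c' (\<lambda>i. B i k) = \<zero>\<^bsub>M\<^esub>" using lc_pi_coeff[OF c'Pi, of 1 k] Suc.prems(2) by simp
  then have "ereal (real k) \<le> v (c' i)" by (rule Suc.IH[OF c'Pi _ Suc.prems(3)])
  then have "1 + ereal (real k) \<le> 1 + v (c' i)" by (rule add_left_mono)
  then show ?case using c'(2)[OF Suc.prems(3)] by (simp add: v_mult one_ereal_def add.commute)
qed

text \<open>The multiple of x by \<open>\<pi> ^ k\<close> is \<pi>-torsion, hence a combination at
  level 1. The same coefficients at level k + 1 give a point whose difference from x is killed by
  \<open>\<pi> ^ k\<close> and is left to the induction.\<close>

lemma span_level: "x \<in> Mk k \<Longrightarrow> \<exists>c\<in>{..<n} \<rightarrow> OF. x = lc {..<n} c (\<lambda>i. B i k)"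
proof (induction k arbitrary: x)
  case 0
  have "lc {..<n} (\<lambda>_. 0) (\<lambda>i. B i 0) = \<zero>\<^bsub>M\<^esub>" by (intro lc_zero) (simp add: B_0)
  then show ?case using 0 by (intro bexI[of _ "\<lambda>_. 0"]) (auto simp: Mk_0)
next
  case (Suc k)
  have xM: "x \<in> carrier M" using Suc.prems by (rule Mk_M)
  have "\<pi> ^ k \<odot>\<^bsub>M\<^esub> x \<in> Mk 1"
  proof -
    have "\<pi> ^ 1 \<odot>\<^bsub>M\<^esub> (\<pi> ^ k \<odot>\<^bsub>M\<^esub> x) = \<pi> ^ Suc k \<odot>\<^bsub>M\<^esub> x"
      using smult_mult[OF pi_power_OF pi_power_OF xM, of 1 k] by simp
    then show ?thesis using Suc.prems xM smult_M[OF pi_power_OF xM] by (simp add: Mk_def del: Int_iff)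
  qed
  then have "\<pi> ^ k \<odot>\<^bsub>M\<^esub> x \<in> lspan n (\<lambda>i. B i 1)" by (simp only: greedy_span[OF B_greedy])
  then obtain c where c: "\<pi> ^ k \<odot>\<^bsub>M\<^esub> x = lc {..<n} c (\<lambda>i. B i 1)" "c \<in> {..<n} \<rightarrow> OF"
    unfolding lspan_def by blast
  let ?y = "lc {..<n} c (\<lambda>i. B i (k + 1))"
  have yM: "?y \<in> carrier M" by (rule lc_closed[OF c(2) B_Pi])
  have "x \<ominus>\<^bsub>M\<^esub> ?y \<in> Mk k"
  proof -
    have "\<pi> ^ k \<odot>\<^bsub>M\<^esub> (x \<ominus>\<^bsub>M\<^esub> ?y) = \<pi> ^ k \<odot>\<^bsub>M\<^esub> x \<ominus>\<^bsub>M\<^esub> \<pi> ^ k \<odot>\<^bsub>M\<^esub> ?y"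
      using smult_add_right[OF pi_power_OF xM, of "\<ominus>\<^bsub>M\<^esub> ?y"] M.smult_r_minus[of "\<pi> ^ k" ?y] pi_power_OF yM
      by (simp add: a_minus_def del: Int_iff)
    also have "\<dots> = \<zero>\<^bsub>M\<^esub>"
      unfolding lc_pi[OF c(2)] c(1) using lc_closed[OF c(2) B_Pi, of 1] by (simp add: a_minus_def M.M.r_neg)
    finally show ?thesis using xM yM by (simp add: Mk_def a_minus_def)
  qed
  from Suc.IH[OF this] obtain c' where c': "c' \<in> {..<n} \<rightarrow> OF" "x \<ominus>\<^bsub>M\<^esub> ?y = lc {..<n} c' (\<lambda>i. B i k)" by blast
  have pc': "(\<lambda>i. \<pi> ^ 1 * c' i) \<in> {..<n} \<rightarrow> OF" using c'(1) OF_mult[OF pi_power_OF] by blast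
  have "x = (x \<ominus>\<^bsub>M\<^esub> ?y) \<oplus>\<^bsub>M\<^esub> ?y" using xM yM by (simp add: a_minus_def M.M.a_assoc M.M.l_neg)
  also have "\<dots> = lc {..<n} (\<lambda>i. \<pi> ^ 1 * c' i) (\<lambda>i. B i (Suc k)) \<oplus>\<^bsub>M\<^esub> ?y"
    using c'(2) lc_pi_coeff[OF c'(1), of 1 k] by simp
  also have "\<dots> = lc {..<n} (\<lambda>i. \<pi> ^ 1 * c' i + c i) (\<lambda>i. B i (Suc k))"
    using lc_add[OF pc' c(2) B_Pi[of "Suc k"]] by simp
  finally have "x = lc {..<n} (\<lambda>i. \<pi> ^ 1 * c' i + c i) (\<lambda>i. B i (Suc k))" .
  moreover have "(\<lambda>i. \<pi> ^ 1 * c' i + c i) \<in> {..<n} \<rightarrow> OF"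
    using pc' c(2) OF_add unfolding Pi_iff by blast
  ultimately show ?case by blast
qed

lemma w_unit: assumes u: "u \<in> OF" "v u = 0" and x: "x \<in> carrier M" shows "w (u \<odot>\<^bsub>M\<^esub> x) = w x"
proof (rule antisym)
  show "w x \<le> w (u \<odot>\<^bsub>M\<^esub> x)" by (rule w_smult[OF u(1) x])
  have "inverse u \<odot>\<^bsub>M\<^esub> (u \<odot>\<^bsub>M\<^esub> x) = x"
    using smult_mult[OF OF_unit(2)[OF u] u(1) x] OF_unit(1)[OF u] x by simp
  then show "w (u \<odot>\<^bsub>M\<^esub> x) \<le> w x"
    using w_smult[OF OF_unit(2)[OF u] smult_M[OF u(1) x]] by simp
qed

text \<open>Up to a unit c is a power of \<pi>, which moves j places down the chain. Truncated
  subtraction is right here: for j \<ge> k the multiple is zero, and so is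
  \<open>B i 0\<close>.\<close>

lemma smult_B:
  assumes c: "c \<in> OF" "v c = ereal (real j)" and i: "i < n"
  shows "\<exists>u\<in>OF. v u = 0 \<and> c \<odot>\<^bsub>M\<^esub> B i k = u \<odot>\<^bsub>M\<^esub> B i (k - j)"
proof -
  define u where "u = c / \<pi> ^ j"
  have vp: "v (\<pi> ^ j) = ereal (real j)" by (simp add: v_power)
  have vu: "v u = 0" using c(2) vp by (simp add: u_def v_divide)
  have u: "u \<in> OF" using c(1) vu pi_power_OF[of j]
    by (simp add: R_iff u_def divide_inverse F_mult F_inverse)
  have cu: "c = u * \<pi> ^ j" by (simp add: u_def)
  have "\<pi> ^ j \<odot>\<^bsub>M\<^esub> B i k = B i (k - j)"
  proof (cases "j \<le> k")
    case True
    then show ?thesis using B_pi_power[OF i, of j "k - j"] by simp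
  next
    case False
    then have "B i k \<in> Mk j" using B_Mk[OF i, of k] Mk_mono'[of k j] by auto
    then show ?thesis using False by (simp add: Mk_def B_0)
  qed
  then have "c \<odot>\<^bsub>M\<^esub> B i k = u \<odot>\<^bsub>M\<^esub> B i (k - j)"
    unfolding cu using smult_mult[OF u pi_power_OF B_M[OF i]] by simp
  then show ?thesis using u vu by blast
qed

lemma w_smult_B: "c \<in> OF \<Longrightarrow> v c = ereal (real j) \<Longrightarrow> i < n \<Longrightarrow> w (c \<odot>\<^bsub>M\<^esub> B i k) = W i (k - j)"
  using smult_B[of c j i k] w_unit B_M by auto

text \<open>
  In the induction step the terms not killed by \<open>\<pi>\<close> are preimages of maximal valuation, hence so
  is their sum, and the remaining terms lie in the \<open>\<pi>\<close>-torsion, whose basis is adapted.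
\<close>

lemma w_lc_split:
  assumes "c \<in> {..<n} \<rightarrow> OF" "r \<le> w (lc {..<n} c (\<lambda>i. B i k))" "i < n"
  shows "r \<le> w (c i \<odot>\<^bsub>M\<^esub> B i k)"
  using assms
proof (induction k arbitrary: r c i)
  case 0
  then show ?case using smult_zero[of "c i"] by (simp add: B_0 Pi_iff del: Int_iff)
next
  case (Suc k)
  let ?f = "\<lambda>i. c i \<odot>\<^bsub>M\<^esub> B i (Suc k)"
  let ?e = "\<lambda>i. B i (Suc k)"
  define D where "D = {i. i < n \<and> \<pi> \<odot>\<^bsub>M\<^esub> ?f i \<noteq> \<zero>\<^bsub>M\<^esub>}"
  define D' where "D' = {i. i < n \<and> \<pi> \<odot>\<^bsub>M\<^esub> ?f i = \<zero>\<^bsub>M\<^esub>}"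
  have c: "c l \<in> OF" if "l < n" for l using Suc.prems(1) that by (simp add: Pi_iff)
  have fin: "finite D" "finite D'" "D \<inter> D' = {}" "D \<union> D' = {..<n}" by (auto simp: D_def D'_def)
  have sub: "D \<subseteq> {..<n}" "D' \<subseteq> {..<n}" by (auto simp: D_def D'_def)
  have cD: "c \<in> D \<rightarrow> OF" "c \<in> D' \<rightarrow> OF" "?e \<in> D \<rightarrow> carrier M" "?e \<in> D' \<rightarrow> carrier M"
    using Suc.prems(1) B_Pi[of "Suc k"] sub by blast+
  let ?y = "lc D c ?e" and ?t = "lc D' c ?e"
  have yM: "?y \<in> carrier M" and tM: "?t \<in> carrier M" using lc_closed cD by blast+
  have fM: "?f l \<in> carrier M" if "l < n" for l using c[OF that] B_M[OF that] by (rule smult_M)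
  have sum: "lc {..<n} c ?e = ?y \<oplus>\<^bsub>M\<^esub> ?t"
    using lc_union[OF fin(1-3), of c ?e] Suc.prems(1) B_Pi[of "Suc k"] by (simp only: fin(4))
  have pif: "\<pi> \<odot>\<^bsub>M\<^esub> ?f l = c l \<odot>\<^bsub>M\<^esub> B l k" if "l < n" for l
    using smult_mult[OF pi_OF c[OF that] B_M[OF that]] smult_mult[OF c[OF that] pi_OF B_M[OF that]] B_pi[OF that]
    by (simp add: mult.commute)
  have good: "g (w (?f l)) = w (\<pi> \<odot>\<^bsub>M\<^esub> ?f l)" if l: "l \<in> D" for l
  proof -
    have ln: "l < n" using l by (simp add: D_def)
    have "c l \<odot>\<^bsub>M\<^esub> B l k \<noteq> \<zero>\<^bsub>M\<^esub>" using l pif[OF ln] by (simp add: D_def)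
    then have "c l \<noteq> 0" using B_M[OF ln] by auto
    then obtain j where j: "v (c l) = ereal (real j)" using OF_unif[OF c[OF ln]] by blast
    have w1: "w (c l \<odot>\<^bsub>M\<^esub> B l k) = W l (k - j)" by (rule w_smult_B[OF c[OF ln] j ln])
    then have "j < k" using \<open>c l \<odot>\<^bsub>M\<^esub> B l k \<noteq> \<zero>\<^bsub>M\<^esub>\<close> w_eq_infty_iff[OF smult_M[OF c[OF ln] B_M[OF ln]]]
      by (metis W_0 diff_is_0_eq not_le)
    then have "W l (k - j) = g (W l (Suc k - j))" using B_good[OF ln, of "k - j"] by (simp add: Suc_diff_le)
    then show ?thesis using w1 pif[OF ln] w_smult_B[OF c[OF ln] j ln] by simp
  qed
  \<comment> \<open>Setting the coefficients outside D to zero makes ?y a combination over all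
    indices, so the induction hypothesis splits its multiple by \<pi>, which is a combination at
    level k.\<close>
  have wpi: "w (\<pi> \<odot>\<^bsub>M\<^esub> ?y) \<le> g (w (?f l))" if l: "l \<in> D" for l
  proof -
    have ln: "l < n" using l by (simp add: D_def)
    define b where "b i = (if i \<in> D then c i else 0)" for i
    have b: "b \<in> {..<n} \<rightarrow> OF" using c by (auto simp: b_def simp del: Int_iff)
    have "lc D' b ?e = \<zero>\<^bsub>M\<^esub>" using fin(3) sub B_M by (intro lc_zero) (auto simp: b_def)
    moreover have "lc D b ?e = ?y" using cD by (intro lc_cong) (auto simp: b_def)
    moreover have "lc {..<n} b ?e = lc D b ?e \<oplus>\<^bsub>M\<^esub> lc D' b ?e"
      using lc_union[OF fin(1-3), of b ?e] b B_Pi[of "Suc k"] by (simp only: fin(4))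
    ultimately have "?y = lc {..<n} b ?e" using yM by simp
    then have "\<pi> \<odot>\<^bsub>M\<^esub> ?y = lc {..<n} b (\<lambda>i. B i k)" using lc_pi[OF b, of 1 k] by simp
    then have "w (\<pi> \<odot>\<^bsub>M\<^esub> ?y) \<le> w (b l \<odot>\<^bsub>M\<^esub> B l k)"
      using Suc.IH[OF b _ ln, of "w (\<pi> \<odot>\<^bsub>M\<^esub> ?y)"] by simp
    also have "\<dots> = g (w (?f l))" using good[OF l] pif[OF ln] l by (simp add: b_def)
    finally show ?thesis .
  qed
  have wle: "w ?y \<le> w (?f l)" if l: "l \<in> D" for l
  proof -
    have "g (w ?y) \<le> g (w (?f l))" using g_le_w_pi[OF yM] wpi[OF l] by simp
    moreover have "l < n" using l by (simp add: D_def)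
    ultimately show ?thesis using g_le_iff w_pos yM fM by (simp add: less_imp_le)
  qed
  \<comment> \<open>The valuation of ?y is the least among its terms. At a term where it is reached,
    \<open>wpi\<close> gives the inequality opposite to \<open>g_le_w_pi\<close>.\<close>
  have goody: "g (w ?y) = w (\<pi> \<odot>\<^bsub>M\<^esub> ?y)"
  proof (cases "D = {}")
    case True
    then have "?y = \<zero>\<^bsub>M\<^esub>" by (simp add: lc_def)
    then show ?thesis using smult_zero[OF pi_OF] by (simp add: g_eq)
  next
    case False
    then have "Min ((\<lambda>l. w (?f l)) ` D) \<in> (\<lambda>l. w (?f l)) ` D" using fin by (intro Min_in) auto
    then obtain l where l: "Min ((\<lambda>l. w (?f l)) ` D) = w (?f l)" "l \<in> D" by (rule imageE)
    have "w (?f l) \<le> w (?f m)" if "m \<in> D" for m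
      unfolding l(1)[symmetric] using fin that by (intro Min_le) auto
    then have "w (?f l) \<le> w ?y" by (intro w_lc_ge fin cD) 
    then have eq: "w ?y = w (?f l)" using wle[OF l(2)] by simp
    show ?thesis using g_le_w_pi[OF yM] wpi[OF l(2)] eq by (simp add: antisym)
  qed
  have fMk: "?f l \<in> Mk 1" if "l \<in> D'" for l
    using that fM by (simp add: Mk_def D'_def)
  have tMk: "?t \<in> Mk 1"
  proof -
    have "\<pi> \<odot>\<^bsub>M\<^esub> ?t = lc D' c (\<lambda>l. \<pi> \<odot>\<^bsub>M\<^esub> ?e l)" using lc_smult'[OF fin(2) pi_OF cD(2,4)] by simp
    also have "\<dots> = \<zero>\<^bsub>M\<^esub>" using pif B_pi by (intro lc_zero) (auto simp: D'_def)
    finally show ?thesis using tM by (simp add: Mk_def)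
  qed
  have r: "r \<le> w ?y" "r \<le> w ?t"
    using good_split[OF yM goody tMk] Suc.prems(2) unfolding sum by blast+
  show ?case
  proof (cases "i \<in> D")
    case True
    then show ?thesis using r(1) wle by (meson order_trans)
  next
    case False
    then have iD: "i \<in> D'" using fin(4) Suc.prems(3) by blast
    \<comment> \<open>A term killed by \<pi> has a coefficient divisible by
      \<open>\<pi> ^ k\<close>, or is zero; rewriting it as a multiple of \<open>B l 1\<close> makes
      the greedy basis applicable.\<close>
    have "\<forall>l. \<exists>b. l \<in> D' \<longrightarrow> b \<in> OF \<and> ?f l = b \<odot>\<^bsub>M\<^esub> B l 1"
    proof (intro allI)
      fix l
      show "\<exists>b. l \<in> D' \<longrightarrow> b \<in> OF \<and> ?f l = b \<odot>\<^bsub>M\<^esub> B l 1"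
      proof (cases "l \<in> D' \<and> c l \<noteq> 0")
        case False
        then show ?thesis using sub B_M by (intro exI[of _ 0]) auto
      next
        case True
        then have ln: "l < n" and lD: "l \<in> D'" using sub by auto
        obtain j where j: "v (c l) = ereal (real j)" using OF_unif[OF c[OF ln]] True by blast
        have "w (c l \<odot>\<^bsub>M\<^esub> B l k) = \<infinity>" using lD pif[OF ln] by (simp add: D'_def)
        then have "B l (k - j) = \<zero>\<^bsub>M\<^esub>" using w_smult_B[OF c[OF ln] j ln] w_eq_infty_iff[OF B_M[OF ln]] by simp
        then have "k \<le> j" using B_Suc_nonzero[OF ln, of "k - j - 1"] by (cases "k - j") auto
        define b where "b = c l / \<pi> ^ k"
        have "0 \<le> v b" unfolding b_def using j \<open>k \<le> j\<close> by (intro v_div_ge_0) (simp_all add: v_power)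
        moreover have "b \<in> F" using c[OF ln] pi_power_OF[of k] by (simp add: b_def divide_inverse F_mult F_inverse)
        ultimately have b: "b \<in> OF" by (simp add: R_iff)
        have "?f l = (b * \<pi> ^ k) \<odot>\<^bsub>M\<^esub> B l (k + 1)" by (simp add: b_def)
        also have "\<dots> = b \<odot>\<^bsub>M\<^esub> B l 1"
          using smult_mult[OF b pi_power_OF B_M[OF ln]] B_pi_power[OF ln, of k 1] by simp
        finally show ?thesis using b by blast
      qed
    qed
    then obtain b0 where b0: "\<And>l. l \<in> D' \<Longrightarrow> b0 l \<in> OF" "\<And>l. l \<in> D' \<Longrightarrow> ?f l = b0 l \<odot>\<^bsub>M\<^esub> B l 1" by metis
    define b where "b l = (if l \<in> D' then b0 l else 0)" for l
    have b: "b \<in> {..<n} \<rightarrow> OF" using b0(1) by (auto simp: b_def simp del: Int_iff)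
    have e1: "(\<lambda>i. B i 1) \<in> D' \<rightarrow> carrier M" using B_M sub by blast
    have "lc {..<n} b (\<lambda>i. B i 1) = lc D b (\<lambda>i. B i 1) \<oplus>\<^bsub>M\<^esub> lc D' b (\<lambda>i. B i 1)"
      using lc_union[OF fin(1-3), of b "\<lambda>i. B i 1"] b B_Pi[of 1] by (simp only: fin(4))
    moreover have "lc D b (\<lambda>i. B i 1) = \<zero>\<^bsub>M\<^esub>" using fin(3) sub B_M by (intro lc_zero) (auto simp: b_def)
    moreover have "lc D' b (\<lambda>i. B i 1) = ?t"
      by (rule lc_cong[symmetric]) (use b0 b e1 sub in \<open>auto simp: b_def simp del: Int_iff\<close>)
    ultimately have "?t = lc {..<n} b (\<lambda>i. B i 1)" using tM by simp
    then have "r \<le> w (b i \<odot>\<^bsub>M\<^esub> B i 1)"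
      using greedy_adapted[OF B_greedy b _ Suc.prems(3)] r(2) by simp
    then show ?thesis using b0(2)[OF iD] iD by (simp add: b_def)
  qed
qed

lemma le_w_lc_iff:
  assumes c: "c \<in> {..<n} \<rightarrow> OF"
  shows "r \<le> w (lc {..<n} c (\<lambda>i. B i k)) \<longleftrightarrow> (\<forall>i<n. r \<le> w (c i \<odot>\<^bsub>M\<^esub> B i k))"
  using w_lc_split[OF c] w_lc_ge[OF _ c B_Pi] by auto


subsection \<open>Coordinates on the rational Tate module\<close>

text \<open>\<open>nat\<close> sends every index up to 0 to the vanishing entry
  \<open>B i 0\<close>. In particular \<open>e i\<close> has entry 0 at the index 0, so it lies in
  the integral Tate module.\<close>

definition e :: "nat \<Rightarrow> int \<Rightarrow> 'k fpoint" where "e i = (\<lambda>j. B i (nat j))"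

lemma e_V: assumes i: "i < n" shows "e i \<in> carrier V"
proof (rule V_carrierI[of _ 0])
  fix j
  show "e i j \<in> carrier M" using B_M[OF i] by (simp add: e_def)
  show "\<pi> \<odot>\<^bsub>M\<^esub> e i (j + 1) = e i j"
  proof (cases "0 \<le> j")
    case True
    then show ?thesis using B_pi[OF i, of "nat j"] by (simp add: e_def nat_add_distrib)
  next
    case False
    then show ?thesis using smult_zero[OF pi_OF] by (simp add: e_def B_0)
  qed
  show "j \<le> 0 \<Longrightarrow> e i j = \<zero>\<^bsub>M\<^esub>" by (simp add: e_def B_0)
qed

definition lcV :: "(nat \<Rightarrow> 'k) \<Rightarrow> int \<Rightarrow> 'k fpoint" where
  "lcV c = (\<Oplus>\<^bsub>V\<^esub>i\<in>{..<n}. c i \<odot>\<^bsub>V\<^esub> e i)"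

lemma lcV_closed: "c \<in> {..<n} \<rightarrow> F \<Longrightarrow> lcV c \<in> carrier V"
  unfolding lcV_def by (intro V.M.finsum_closed) (auto intro!: V_smult_closed e_V)

lemma lcV_cong: "c \<in> {..<n} \<rightarrow> F \<Longrightarrow> (\<And>i. i < n \<Longrightarrow> c i = c' i) \<Longrightarrow> lcV c' = lcV c"
  unfolding lcV_def by (intro V.M.finsum_cong') (auto intro!: V_smult_closed e_V)

lemma lcV_apply:
  assumes c: "c \<in> {..<n} \<rightarrow> F" and m: "\<And>i. i < n \<Longrightarrow> \<pi> ^ m * c i \<in> OF"
  shows "lcV c j = lc {..<n} (\<lambda>i. \<pi> ^ m * c i) (\<lambda>i. B i (nat (j + int m)))"
proof -
  have "lcV c j = (\<Oplus>\<^bsub>M\<^esub>i\<in>{..<n}. (c i \<odot>\<^bsub>V\<^esub> e i) j)"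
    unfolding lcV_def using c by (intro V_finsum_apply) (auto intro!: V_smult_closed e_V)
  also have "\<dots> = (\<Oplus>\<^bsub>M\<^esub>i\<in>{..<n}. (\<pi> ^ m * c i) \<odot>\<^bsub>M\<^esub> B i (nat (j + int m)))"
  proof (rule M.M.finsum_cong')
    show "(\<lambda>i. (\<pi> ^ m * c i) \<odot>\<^bsub>M\<^esub> B i (nat (j + int m))) \<in> {..<n} \<rightarrow> carrier M"
      using m B_M by (intro Pi_I smult_M) auto
    fix i assume "i \<in> {..<n}"
    then have i: "i < n" by simp
    have "c i \<in> F" using c i by auto
    then show "(c i \<odot>\<^bsub>V\<^esub> e i) j = (\<pi> ^ m * c i) \<odot>\<^bsub>M\<^esub> B i (nat (j + int m))"
      using V_smult[OF _ e_V[OF i], of "c i" m j] m[OF i] by (simp add: e_def)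
  qed simp
  finally show ?thesis by (simp add: lc_def)
qed

lemma ex_denominators: assumes c: "c \<in> {..<n} \<rightarrow> F" shows "\<exists>m0. \<forall>m\<ge>m0. \<forall>i<n. \<pi> ^ m * c i \<in> OF"
proof -
  have "c ` {..<n} \<subseteq> F" using c by blast
  from ex_common_denominator[OF _ this] obtain m0 where "\<forall>m\<ge>m0. \<forall>x\<in>c ` {..<n}. \<pi> ^ m * x \<in> OF" by auto
  then show ?thesis by blast
qed

text \<open>After clearing denominators, equality of the entries makes the difference of the
  coefficients divisible by \<open>\<pi> ^ k\<close> for every k, by
  \<open>indep_level\<close>.\<close>

lemma lcV_inj:
  assumes c: "c \<in> {..<n} \<rightarrow> F" and c': "c' \<in> {..<n} \<rightarrow> F" and eq: "lcV c = lcV c'" and i: "i < n"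
  shows "c i = c' i"
proof -
  obtain m0 m1 where m01: "\<forall>m\<ge>m0. \<forall>i<n. \<pi> ^ m * c i \<in> OF" "\<forall>m\<ge>m1. \<forall>i<n. \<pi> ^ m * c' i \<in> OF"
    using ex_denominators[OF c] ex_denominators[OF c'] by blast
  define m where "m = max m0 m1"
  have m: "\<pi> ^ m * c i \<in> OF" "\<pi> ^ m * c' i \<in> OF" if "i < n" for i
    using m01 that max.cobounded1[of m0 m1] max.cobounded2[of m1 m0] unfolding m_def by blast+
  let ?a = "\<lambda>i. \<pi> ^ m * c i" and ?a' = "\<lambda>i. \<pi> ^ m * c' i"
  have Pi: "?a \<in> {..<n} \<rightarrow> OF" "?a' \<in> {..<n} \<rightarrow> OF" using m by auto
  have "?a i - ?a' i = 0"
  proof (rule v_ge_all_imp_0)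
    fix k :: nat
    have "lc {..<n} ?a (\<lambda>i. B i k) = lc {..<n} ?a' (\<lambda>i. B i k)"
      using lcV_apply[OF c m(1), of "int k - int m"] lcV_apply[OF c' m(2), of "int k - int m"] eq by simp
    then have "lc {..<n} (\<lambda>i. ?a i - ?a' i) (\<lambda>i. B i k) = \<zero>\<^bsub>M\<^esub>"
      using lc_diff[OF _ Pi B_Pi, of k] lc_closed[OF Pi(2) B_Pi] by (simp add: a_minus_def M.M.r_neg)
    then show "ereal (real k) \<le> v (?a i - ?a' i)" by (rule indep_level[OF OF_diff_Pi[OF Pi] _ i])
  qed
  then show ?thesis by simp
qed

lemma smult_B_eq_0: assumes c: "c \<in> OF" "ereal (real k) \<le> v c" and i: "i < n"
  shows "c \<odot>\<^bsub>M\<^esub> B i k = \<zero>\<^bsub>M\<^esub>"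
proof (cases "c = 0")
  case False
  then obtain j where j: "v c = ereal (real j)" using OF_unif[OF c(1)] by blast
  then have "k - j = 0" using c(2) by simp
  obtain u where u: "u \<in> OF" "c \<odot>\<^bsub>M\<^esub> B i k = u \<odot>\<^bsub>M\<^esub> B i (k - j)" using smult_B[OF c(1) j i, of k] by blast
  show ?thesis unfolding u(2) \<open>k - j = 0\<close> B_0 by (rule smult_zero[OF u(1)])
qed (simp add: B_M i)

text \<open>Shift x until it vanishes up to the index 0. Its k-th entry is then a combination at
  level k whose coefficients are determined modulo \<open>\<pi> ^ k\<close>, so they converge, with
  limits in F as F is closed; replacing them by the limits changes no entry.\<close>

lemma lcV_surj: assumes x: "x \<in> carrier V" shows "\<exists>c\<in>{..<n} \<rightarrow> F. x = lcV c"
proof -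
  obtain N0 where N0: "\<forall>i\<le>N0. x i = \<zero>\<^bsub>M\<^esub>" using V_vanish[OF x] by blast
  define N where "N = nat (- N0)"
  have N: "x i = \<zero>\<^bsub>M\<^esub>" if "i \<le> - int N" for i
  proof -
    have "i \<le> N0" using that unfolding N_def by linarith
    then show ?thesis using N0 by blast
  qed
  define y where "y k = x (int k - int N)" for k
  have yMk: "y k \<in> Mk k" for k
    using V_pi_power[OF x, of k "- int N"] V_M[OF x] N[of "- int N"] by (simp add: Mk_def y_def add.commute)
  have ypi: "\<pi> \<odot>\<^bsub>M\<^esub> y (Suc k) = y k" for k
    using V_pi[OF x, of "int k - int N"] by (simp add: y_def algebra_simps)
  have "\<forall>k. \<exists>c. c \<in> {..<n} \<rightarrow> OF \<and> y k = lc {..<n} c (\<lambda>i. B i k)" using span_level[OF yMk] by blast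
  then obtain a where a: "\<And>k. a k \<in> {..<n} \<rightarrow> OF" "\<And>k. y k = lc {..<n} (a k) (\<lambda>i. B i k)" by metis
  have step: "ereal (real k * 1) \<le> v (a (Suc k) i - a k i)" if i: "i < n" for i k
  proof -
    have "lc {..<n} (a (Suc k)) (\<lambda>i. B i k) = \<pi> ^ 1 \<odot>\<^bsub>M\<^esub> lc {..<n} (a (Suc k)) (\<lambda>i. B i (1 + k))"
      by (rule lc_pi[OF a(1), symmetric])
    also have "\<dots> = lc {..<n} (a k) (\<lambda>i. B i k)" using a(2)[of "Suc k"] ypi[of k] a(2)[of k] by simp
    finally have "lc {..<n} (\<lambda>i. a (Suc k) i - a k i) (\<lambda>i. B i k) = \<zero>\<^bsub>M\<^esub>"
      using lc_diff[OF _ a(1)[of "Suc k"] a(1)[of k] B_Pi, of k] lc_closed[OF a(1) B_Pi]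
      by (simp add: a_minus_def M.M.r_neg)
    from indep_level[OF OF_diff_Pi[OF a(1) a(1)] this i] show ?thesis by simp
  qed
  have "\<exists>l. val_lim v (\<lambda>k. a k i) l" if i: "i < n" for i
  proof -
    have "val_Cauchy v (\<lambda>k. a k i)" by (rule val_CauchyI_Suc[of 1]) (use step[OF i] in auto)
    then show ?thesis using complete unfolding val_complete_def by blast
  qed
  then obtain l where l: "\<And>i. i < n \<Longrightarrow> val_lim v (\<lambda>k. a k i) (l i)" by metis
  have aOF: "a k i \<in> OF" if "i < n" for k i using a(1)[of k] that by (simp add: Pi_iff)
  have lOF: "l i \<in> OF" if i: "i < n" for i
  proof -
    have "range (\<lambda>k. a k i) \<subseteq> F" using aOF[OF i] by blast
    then have "l i \<in> F" using p_adic_subfield_closed[OF subfield] l[OF i] unfolding lim_closed_def by blast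
    moreover have "l i \<in> R" using R_closed[OF l[OF i]] aOF[OF i] by blast
    ultimately show ?thesis by simp
  qed
  have lPi: "l \<in> {..<n} \<rightarrow> OF" using lOF by blast
  have yl: "y k = lc {..<n} l (\<lambda>i. B i k)" for k
    unfolding a(2)[of k]
  proof (rule lc_cong[OF _ lPi B_Pi])
    fix i assume "i \<in> {..<n}"
    then have i: "i < n" by simp
    have diff: "a k i - l i \<in> OF" by (rule OF_diff[OF aOF[OF i] lOF[OF i]])
    have "ereal (real k) \<le> v (a k i - l i)"
      using val_lim_telescope[OF step[OF i] _ l[OF i], of k] by (simp add: v_diff_commute)
    then have "(a k i - l i) \<odot>\<^bsub>M\<^esub> B i k = \<zero>\<^bsub>M\<^esub>" by (rule smult_B_eq_0[OF diff _ i])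
    then show "a k i \<odot>\<^bsub>M\<^esub> B i k = l i \<odot>\<^bsub>M\<^esub> B i k"
      using smult_add[OF diff lOF[OF i] B_M[OF i, of k]] smult_M[OF lOF[OF i] B_M[OF i, of k]] by simp
  qed
  define c where "c i = l i / \<pi> ^ N" for i
  have c: "c \<in> {..<n} \<rightarrow> F" unfolding c_def divide_inverse using lOF pi_power_OF[of N] by (intro Pi_I F_mult F_inverse) auto
  have cl: "\<pi> ^ N * c i = l i" for i by (simp add: c_def)
  have "x j = lcV c j" for j
  proof -
    have "lcV c j = y (nat (j + int N))" using lcV_apply[OF c, of N j] lOF yl by (simp add: cl del: Int_iff)
    also have "\<dots> = x j"
    proof (cases "0 \<le> j + int N")
      case False
      then show ?thesis using N[of j] N[of "- int N"] by (simp add: y_def)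
    qed (simp add: y_def)
    finally show ?thesis by simp
  qed
  then show ?thesis using c by blast
qed

section \<open>Lattices spanned by multiples of the vectors \<open>e i\<close> by powers of
  \<pi>\<close>

definition Lat :: "(nat \<Rightarrow> int) \<Rightarrow> (int \<Rightarrow> 'k fpoint) set" where
  "Lat a = {lcV c | c. c \<in> {..<n} \<rightarrow> F \<and> (\<forall>i<n. ereal (of_int (a i)) \<le> v (c i))}"

lemma Lat_cong: "(\<And>i. i < n \<Longrightarrow> a i = b i) \<Longrightarrow> Lat a = Lat b"
  unfolding Lat_def by auto

lemma Lat_carrier: "Lat a \<subseteq> carrier V"
  unfolding Lat_def using lcV_closed by blast

lemma lcV_Lat_iff: "c \<in> {..<n} \<rightarrow> F \<Longrightarrow> lcV c \<in> Lat a \<longleftrightarrow> (\<forall>i<n. ereal (of_int (a i)) \<le> v (c i))"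
  unfolding Lat_def using lcV_inj by auto metis

lemma pi_powi: "\<pi> powi z \<in> F" "\<pi> powi z \<noteq> 0" "v (\<pi> powi z) = ereal (of_int z)"
proof -
  show "\<pi> powi z \<noteq> 0" by simp
  have F: "\<pi> ^ k \<in> F" for k using pi_power_OF[of k] by simp
  show "\<pi> powi z \<in> F" using F by (auto simp: power_int_def power_inverse intro: F_inverse)
  show "v (\<pi> powi z) = ereal (of_int z)"
    by (auto simp: power_int_def v_power power_inverse v_inverse)
qed

lemma Lat_subset: "(\<And>i. i < n \<Longrightarrow> b i \<le> a i) \<Longrightarrow> Lat a \<subseteq> Lat b"
proof
  fix x assume le: "\<And>i. i < n \<Longrightarrow> b i \<le> a i" and "x \<in> Lat a"
  then obtain c where c: "x = lcV c" "c \<in> {..<n} \<rightarrow> F" "\<forall>i<n. ereal (of_int (a i)) \<le> v (c i)"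
    unfolding Lat_def by blast
  have "ereal (of_int (b i)) \<le> v (c i)" if "i < n" for i
    using le[OF that] c(3) that by (meson ereal_less_eq(3) of_int_le_iff order_trans)
  then show "x \<in> Lat b" using c lcV_Lat_iff by blast
qed

lemma Lat_subset_iff: "Lat a \<subseteq> Lat b \<longleftrightarrow> (\<forall>i<n. b i \<le> a i)"
proof
  assume sub: "Lat a \<subseteq> Lat b"
  have c: "(\<lambda>i. \<pi> powi a i) \<in> {..<n} \<rightarrow> F" using pi_powi(1) by blast
  then have "lcV (\<lambda>i. \<pi> powi a i) \<in> Lat a" by (simp add: lcV_Lat_iff pi_powi(3))
  then have "lcV (\<lambda>i. \<pi> powi a i) \<in> Lat b" using sub by blast
  then show "\<forall>i<n. b i \<le> a i" using lcV_Lat_iff[OF c] by (simp add: pi_powi(3))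
qed (use Lat_subset in blast)

text \<open>The family f is prescribed only below n, so that \<open>e\<close> itself is covered with
  exponents 0 although its values from n on are arbitrary.\<close>

lemma lcV_scaled:
  assumes c: "c \<in> {..<n} \<rightarrow> F" and f: "\<And>i. i < n \<Longrightarrow> f i = (\<pi> powi a i) \<odot>\<^bsub>V\<^esub> e i"
  shows "(\<Oplus>\<^bsub>V\<^esub>i\<in>{..<n}. c i \<odot>\<^bsub>V\<^esub> f i) = lcV (\<lambda>i. c i * \<pi> powi a i)"
  unfolding lcV_def
proof (rule V.M.finsum_cong')
  show "(\<lambda>i. (c i * \<pi> powi a i) \<odot>\<^bsub>V\<^esub> e i) \<in> {..<n} \<rightarrow> carrier V"
    using c pi_powi(1) by (auto intro!: V_smult_closed e_V F_mult)
  fix i assume "i \<in> {..<n}"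
  then have i: "i < n" "c i \<in> F" using c by auto
  show "c i \<odot>\<^bsub>V\<^esub> f i = (c i * \<pi> powi a i) \<odot>\<^bsub>V\<^esub> e i"
    unfolding f[OF i(1)] using V.smult_assoc1[of "c i" "\<pi> powi a i" "e i"] i(2) pi_powi(1) e_V[OF i(1)] by simp
qed simp

lemma scaled_coeff: "c \<in> {..<n} \<rightarrow> F \<Longrightarrow> (\<lambda>i. c i * \<pi> powi a i) \<in> {..<n} \<rightarrow> F"
  using pi_powi(1) by (auto intro!: F_mult)

lemma vs_basis_scaled:
  assumes f: "\<And>i. i < n \<Longrightarrow> f i = (\<pi> powi a i) \<odot>\<^bsub>V\<^esub> e i"
  shows "vs_basis F V n f"
  unfolding vs_basis_def
proof (intro conjI ballI)
  show "f \<in> {..<n} \<rightarrow> carrier V" using f pi_powi(1) by (auto intro!: V_smult_closed e_V)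
  fix x assume "x \<in> carrier V"
  then obtain c0 where c0: "c0 \<in> {..<n} \<rightarrow> F" "x = lcV c0" using lcV_surj by blast
  define c where "c = restrict (\<lambda>i. c0 i * inverse (\<pi> powi a i)) {..<n}"
  have c: "c \<in> {..<n} \<rightarrow>\<^sub>E F" using c0(1) pi_powi(1) by (auto simp: c_def intro!: F_mult F_inverse)
  then have cF: "c \<in> {..<n} \<rightarrow> F" by (auto simp: PiE_iff)
  have "lcV (\<lambda>i. c i * \<pi> powi a i) = lcV c0"
    by (rule lcV_cong[OF c0(1)]) (simp add: c_def pi_powi(2) mult.assoc)
  then have xc: "x = (\<Oplus>\<^bsub>V\<^esub>i\<in>{..<n}. c i \<odot>\<^bsub>V\<^esub> f i)" using lcV_scaled[OF cF, of f a, OF f] c0(2) by simp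
  show "\<exists>!c. c \<in> {..<n} \<rightarrow>\<^sub>E F \<and> x = (\<Oplus>\<^bsub>V\<^esub>i\<in>{..<n}. c i \<odot>\<^bsub>V\<^esub> f i)"
  proof (rule ex1I)
    show "c \<in> {..<n} \<rightarrow>\<^sub>E F \<and> x = (\<Oplus>\<^bsub>V\<^esub>i\<in>{..<n}. c i \<odot>\<^bsub>V\<^esub> f i)" using c xc by blast
    fix c' assume c': "c' \<in> {..<n} \<rightarrow>\<^sub>E F \<and> x = (\<Oplus>\<^bsub>V\<^esub>i\<in>{..<n}. c' i \<odot>\<^bsub>V\<^esub> f i)"
    then have c'F: "c' \<in> {..<n} \<rightarrow> F" by (auto simp: PiE_iff)
    have "lcV (\<lambda>i. c' i * \<pi> powi a i) = lcV (\<lambda>i. c i * \<pi> powi a i)"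
      using c' xc lcV_scaled[OF cF, of f a, OF f] lcV_scaled[OF c'F, of f a, OF f] by simp
    then have "c' i * \<pi> powi a i = c i * \<pi> powi a i" if "i < n" for i
      using lcV_inj[OF scaled_coeff[OF c'F] scaled_coeff[OF cF] _ that] by blast
    then have "c' i = c i" if "i < n" for i using that by simp
    then show "c' = c" using c c' by (intro PiE_ext[of c' "{..<n}" "\<lambda>_. F"]) auto
  qed
qed

lemma int_span_scaled:
  assumes f: "\<And>i. i < n \<Longrightarrow> f i = (\<pi> powi a i) \<odot>\<^bsub>V\<^esub> e i"
  shows "int_span OF V n f = Lat a"
proof (intro equalityI subsetI)
  fix x assume "x \<in> int_span OF V n f"
  then obtain c where c: "c \<in> {..<n} \<rightarrow> OF" "x = (\<Oplus>\<^bsub>V\<^esub>i\<in>{..<n}. c i \<odot>\<^bsub>V\<^esub> f i)"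
    unfolding int_span_def by blast
  have cF: "c \<in> {..<n} \<rightarrow> F" using c(1) by blast
  have "ereal (of_int (a i)) \<le> v (c i * \<pi> powi a i)" if "i < n" for i
  proof (rule v_mult_ge')
    have "c i \<in> OF" using c(1) that by (simp add: Pi_iff)
    then show "0 \<le> v (c i)" by (simp add: R_iff)
  qed (simp add: pi_powi(3))
  then have "lcV (\<lambda>i. c i * \<pi> powi a i) \<in> Lat a" using lcV_Lat_iff[OF scaled_coeff[OF cF]] by blast
  then show "x \<in> Lat a" using lcV_scaled[OF cF, of f a, OF f] c(2) by simp
next
  fix x assume "x \<in> Lat a"
  then obtain c where c: "x = lcV c" "c \<in> {..<n} \<rightarrow> F" "\<forall>i<n. ereal (of_int (a i)) \<le> v (c i)"
    unfolding Lat_def by blast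
  define b where "b i = c i / \<pi> powi a i" for i
  have bOF: "b i \<in> OF" if i: "i < n" for i
  proof -
    have "0 \<le> v (b i)" unfolding b_def using c(3) i pi_powi(2) by (intro v_div_ge_0) (simp_all add: pi_powi(3))
    moreover have "b i \<in> F" using c(2) i pi_powi(1) by (auto simp: b_def divide_inverse intro!: F_mult F_inverse)
    ultimately show ?thesis by (simp add: R_iff)
  qed
  then have bF: "b \<in> {..<n} \<rightarrow> F" by blast
  have "lcV (\<lambda>i. b i * \<pi> powi a i) = lcV c" by (rule lcV_cong[OF c(2)]) (simp add: b_def pi_powi(2))
  then have "x = (\<Oplus>\<^bsub>V\<^esub>i\<in>{..<n}. b i \<odot>\<^bsub>V\<^esub> f i)" using lcV_scaled[OF bF, of f a, OF f] c(1) by simp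
  moreover have "b \<in> {..<n} \<rightarrow> OF" using bOF by blast
  ultimately show "x \<in> int_span OF V n f" unfolding int_span_def by blast
qed

lemma lattice_Lat: "is_lattice F OF V n (Lat a)"
  unfolding is_lattice_def lattice_basis_def
  using vs_basis_scaled[of "\<lambda>i. (\<pi> powi a i) \<odot>\<^bsub>V\<^esub> e i" a] int_span_scaled[of "\<lambda>i. (\<pi> powi a i) \<odot>\<^bsub>V\<^esub> e i" a]
  by (intro exI[of _ "\<lambda>i. (\<pi> powi a i) \<odot>\<^bsub>V\<^esub> e i"]) simp

lemma e_scaled: "i < n \<Longrightarrow> e i = (\<pi> powi 0) \<odot>\<^bsub>V\<^esub> e i"
  using V.smult_one[OF e_V] by simp

lemma lattice_basis_e: "lattice_basis F OF V n (Lat (\<lambda>_. 0)) e"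
  unfolding lattice_basis_def
  using vs_basis_scaled[of e "\<lambda>_. 0"] int_span_scaled[of e "\<lambda>_. 0"] e_scaled by blast

lemma basis_vertex_e: "basis_vertex F OF \<pi> V n e a = homothety_class F V (Lat a)"
  unfolding basis_vertex_def by (rule arg_cong[OF int_span_scaled]) simp

lemma smult_Lat: "(\<lambda>x. \<pi> \<odot>\<^bsub>V\<^esub> x) ` Lat a = Lat (\<lambda>i. a i + 1)"
proof -
  have sm: "\<pi> \<odot>\<^bsub>V\<^esub> lcV c = lcV (\<lambda>i. \<pi> * c i)" if c: "c \<in> {..<n} \<rightarrow> F" for c
  proof -
    have "\<pi> \<odot>\<^bsub>V\<^esub> lcV c = (\<Oplus>\<^bsub>V\<^esub>i\<in>{..<n}. \<pi> \<odot>\<^bsub>V\<^esub> (c i \<odot>\<^bsub>V\<^esub> e i))"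
      unfolding lcV_def using c pi_F by (intro V.finsum_smult_ldistr) (auto intro!: V_smult_closed e_V)
    also have "\<dots> = lcV (\<lambda>i. \<pi> * c i)"
      unfolding lcV_def
    proof (rule V.M.finsum_cong')
      show "(\<lambda>i. (\<pi> * c i) \<odot>\<^bsub>V\<^esub> e i) \<in> {..<n} \<rightarrow> carrier V"
        using c pi_F by (auto intro!: V_smult_closed e_V F_mult)
      fix i assume "i \<in> {..<n}"
      then have "i < n" "c i \<in> F" using c by auto
      then show "\<pi> \<odot>\<^bsub>V\<^esub> (c i \<odot>\<^bsub>V\<^esub> e i) = (\<pi> * c i) \<odot>\<^bsub>V\<^esub> e i"
        using V.smult_assoc1[of \<pi> "c i" "e i"] pi_F e_V[of i] by simp
    qed simp
    finally show ?thesis .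
  qed
  have shift: "ereal (of_int (z + 1)) \<le> v (\<pi> * c) \<longleftrightarrow> ereal (of_int z) \<le> v c" for c z
    by (cases "v c") (auto simp: v_mult one_ereal_def)
  have piF: "(\<lambda>i. \<pi> * c i) \<in> {..<n} \<rightarrow> F" if "c \<in> {..<n} \<rightarrow> F" for c using that pi_F by auto
  show ?thesis
  proof (intro equalityI subsetI)
    fix x assume "x \<in> (\<lambda>x. \<pi> \<odot>\<^bsub>V\<^esub> x) ` Lat a"
    then obtain c where c: "x = \<pi> \<odot>\<^bsub>V\<^esub> lcV c" "c \<in> {..<n} \<rightarrow> F" "\<forall>i<n. ereal (of_int (a i)) \<le> v (c i)"
      unfolding Lat_def by blast
    then show "x \<in> Lat (\<lambda>i. a i + 1)" using sm[OF c(2)] lcV_Lat_iff[OF piF[OF c(2)]] shift by simp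
  next
    fix x assume "x \<in> Lat (\<lambda>i. a i + 1)"
    then obtain c where c: "x = lcV c" "c \<in> {..<n} \<rightarrow> F" "\<forall>i<n. ereal (of_int (a i + 1)) \<le> v (c i)"
      unfolding Lat_def by blast
    define b where "b i = c i / \<pi>" for i
    have b: "b \<in> {..<n} \<rightarrow> F" unfolding b_def divide_inverse using c(2) pi_F by (intro Pi_I F_mult F_inverse) auto
    have cb: "c = (\<lambda>i. \<pi> * b i)" by (auto simp: b_def)
    have "\<forall>i<n. ereal (of_int (a i)) \<le> v (b i)" using c(3) shift unfolding cb by blast
    then have "lcV b \<in> Lat a" using lcV_Lat_iff[OF b] by blast
    moreover have "x = \<pi> \<odot>\<^bsub>V\<^esub> lcV b" using sm[OF b] c(1) cb by simp
    ultimately show "x \<in> (\<lambda>x. \<pi> \<odot>\<^bsub>V\<^esub> x) ` Lat a" by blast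
  qed
qed

lemma homothety_class_smult:
  assumes c: "c \<in> F" "c \<noteq> 0" and \<Lambda>: "\<Lambda> \<subseteq> carrier V"
  shows "homothety_class F V ((\<lambda>x. c \<odot>\<^bsub>V\<^esub> x) ` \<Lambda>) = homothety_class F V \<Lambda>"
proof -
  have eq: "(\<lambda>x. d \<odot>\<^bsub>V\<^esub> x) ` (\<lambda>x. c \<odot>\<^bsub>V\<^esub> x) ` \<Lambda> = (\<lambda>x. (d * c) \<odot>\<^bsub>V\<^esub> x) ` \<Lambda>" if d: "d \<in> F" for d
    unfolding image_image using V.smult_assoc1[of d c] c d \<Lambda> by (intro image_cong) auto
  show ?thesis
  proof (intro equalityI subsetI)
    fix S assume "S \<in> homothety_class F V ((\<lambda>x. c \<odot>\<^bsub>V\<^esub> x) ` \<Lambda>)"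
    then obtain d where d: "d \<in> F" "d \<noteq> 0" "S = (\<lambda>x. d \<odot>\<^bsub>V\<^esub> x) ` (\<lambda>x. c \<odot>\<^bsub>V\<^esub> x) ` \<Lambda>"
      unfolding homothety_class_def by blast
    then have "S = (\<lambda>x. (d * c) \<odot>\<^bsub>V\<^esub> x) ` \<Lambda>" using eq by simp
    moreover have "d * c \<in> F" "d * c \<noteq> 0" using c d by auto
    ultimately show "S \<in> homothety_class F V \<Lambda>" unfolding homothety_class_def by blast
  next
    fix S assume "S \<in> homothety_class F V \<Lambda>"
    then obtain d where d: "d \<in> F" "d \<noteq> 0" "S = (\<lambda>x. d \<odot>\<^bsub>V\<^esub> x) ` \<Lambda>"
      unfolding homothety_class_def by blast
    have dF: "d * inverse c \<in> F" "d * inverse c \<noteq> 0" using c d by (auto intro!: F_mult F_inverse)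
    have "S = (\<lambda>x. (d * inverse c) \<odot>\<^bsub>V\<^esub> x) ` (\<lambda>x. c \<odot>\<^bsub>V\<^esub> x) ` \<Lambda>"
      using eq[OF dF(1)] c(2) d(3) by (simp add: mult.assoc)
    then show "S \<in> homothety_class F V ((\<lambda>x. c \<odot>\<^bsub>V\<^esub> x) ` \<Lambda>)"
      unfolding homothety_class_def using dF by blast
  qed
qed

lemma class_shift: "homothety_class F V (Lat (\<lambda>i. a i + 1)) = homothety_class F V (Lat a)"
  using homothety_class_smult[OF pi_F pi_0 Lat_carrier[of a]] smult_Lat by simp

subsection \<open>The filtration\<close>

abbreviation Fil :: "ereal \<Rightarrow> (int \<Rightarrow> 'k fpoint) set" where "Fil \<equiv> Tate_fil v \<pi> H \<phi>"

text \<open>By \<open>le_w_lc_iff\<close> the condition splits into one for each coordinate. If v (c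
  i) = z, the entry of c i times \<open>e i\<close> at the index 0 is, up to a unit, the division
  point of index -z, or zero if z \<ge> 0; so the condition reads -z \<le>
  \<open>A i r\<close>.\<close>

lemma Fil_eq: assumes r: "0 < r" shows "Fil r = Lat (\<lambda>i. - int (A i r))"
proof -
  have "r \<le> w (lcV c 0) \<longleftrightarrow> (\<forall>i<n. ereal (of_int (- int (A i r))) \<le> v (c i))" if c: "c \<in> {..<n} \<rightarrow> F" for c
  proof -
    obtain m where m: "\<And>i. i < n \<Longrightarrow> \<pi> ^ m * c i \<in> OF" using ex_denominators[OF c] by blast
    have "r \<le> w (lcV c 0) \<longleftrightarrow> (\<forall>i<n. r \<le> w ((\<pi> ^ m * c i) \<odot>\<^bsub>M\<^esub> B i m))"
      using lcV_apply[OF c m, of 0] le_w_lc_iff[of "\<lambda>i. \<pi> ^ m * c i" r m] m by (simp add: Pi_iff del: Int_iff)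
    also have "\<dots> \<longleftrightarrow> (\<forall>i<n. ereal (of_int (- int (A i r))) \<le> v (c i))"
    proof (intro all_cong)
      fix i assume i: "i < n"
      show "r \<le> w ((\<pi> ^ m * c i) \<odot>\<^bsub>M\<^esub> B i m) \<longleftrightarrow> ereal (of_int (- int (A i r))) \<le> v (c i)"
      proof (cases "c i = 0")
        case True
        then show ?thesis using B_M[OF i] by simp
      next
        case False
        have "c i \<in> F" using c i by auto
        then obtain z :: int where z: "v (c i) = ereal (of_int z)" using v_F_int False by blast
        have vm: "v (\<pi> ^ m * c i) = ereal (of_int (int m + z))" by (simp add: v_mult v_power z)
        then have pos: "0 \<le> int m + z" using m[OF i] by (simp add: R_iff)
        then have "v (\<pi> ^ m * c i) = ereal (real (nat (int m + z)))" using vm by simp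
        then have "w ((\<pi> ^ m * c i) \<odot>\<^bsub>M\<^esub> B i m) = W i (m - nat (int m + z))" by (rule w_smult_B[OF m[OF i] _ i])
        then have "r \<le> w ((\<pi> ^ m * c i) \<odot>\<^bsub>M\<^esub> B i m) \<longleftrightarrow> m - nat (int m + z) \<le> A i r"
          using le_W_iff[OF i r] by simp
        also have "\<dots> \<longleftrightarrow> - int (A i r) \<le> z" using pos by linarith
        finally show ?thesis by (simp add: z del: of_int_minus)
      qed
    qed
    finally show ?thesis .
  qed
  note iff = this
  show ?thesis
  proof (intro equalityI subsetI)
    fix x assume "x \<in> Fil r"
    then have x: "x \<in> carrier V" "r \<le> w (x 0)" by (auto simp: Tate_fil_def)
    then obtain c where c: "c \<in> {..<n} \<rightarrow> F" "x = lcV c" using lcV_surj by blast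
    then show "x \<in> Lat (\<lambda>i. - int (A i r))" using x(2) iff[OF c(1)] lcV_Lat_iff[OF c(1)] by simp
  next
    fix x assume "x \<in> Lat (\<lambda>i. - int (A i r))"
    then obtain c where c: "c \<in> {..<n} \<rightarrow> F" "x = lcV c" unfolding Lat_def by blast
    then show "x \<in> Fil r"
      using \<open>x \<in> Lat _\<close> iff[OF c(1)] lcV_Lat_iff[OF c(1)] lcV_closed[OF c(1)] by (simp add: Tate_fil_def)
  qed
qed

lemma A_infty: assumes i: "i < n" shows "A i \<infinity> = 0"
proof -
  have "\<not> \<infinity> \<le> W i 1" using w_eq_infty_iff[OF B_M[OF i, of 1]] B_1_nonzero[OF i] by simp
  then show ?thesis using le_W_iff[OF i, of \<infinity> 1] by simp
qed

lemma Fil_infty: "Fil \<infinity> = Lat (\<lambda>_. 0)"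
  unfolding Fil_eq[of \<infinity>, simplified] by (rule Lat_cong) (simp add: A_infty)

lemma A_antimono: assumes i: "i < n" and r: "0 < r" "r \<le> r'" shows "A i r' \<le> A i r"
proof -
  have "r' \<le> W i (A i r')" using le_W_iff[OF i, of r'] r by simp
  then show ?thesis using le_W_iff[OF i r(1)] r(2) order_trans by blast
qed

lemma A_order: assumes "i \<le> j" "j < n" and r: "0 < r" shows "A j r \<le> A i r"
proof -
  have "r \<le> W j (A j r)" using le_W_iff[OF assms(2) r] by simp
  also have "\<dots> \<le> W i (A j r)" by (rule W_order[OF assms(1,2)])
  finally show ?thesis using le_W_iff[of i r] assms by simp
qed

text \<open>For k > 0, \<open>B_good\<close> and strictness of \<open>g\<close> turn g r \<le>
  \<open>W i k\<close> into r \<le> \<open>W i (Suc k)\<close>. The chain does not obey this rule at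
  k = 0, and r \<le> \<open>W i 1\<close> settles that case.\<close>

lemma A_g: assumes i: "i < n" and r: "0 < r" "r \<le> W i 1" shows "A i r = Suc (A i (g r))"
proof -
  have "k \<le> A i (g r) \<longleftrightarrow> Suc k \<le> A i r" for k
  proof (cases "k = 0")
    case True
    then show ?thesis using le_W_iff[OF i r(1), of 1] r(2) by simp
  next
    case False
    then have "g r \<le> W i k \<longleftrightarrow> r \<le> W i (Suc k)"
      using g_le_iff[of r "W i (Suc k)"] B_good[OF i, of k] r(1) W_pos[OF i, of "Suc k"] by (simp add: less_imp_le)
    then show ?thesis using le_W_iff[OF i r(1)] le_W_iff[OF i g_pos[OF r(1)]] by simp
  qed
  from this[of "A i (g r)"] this[of "A i r - 1"] show ?thesis by linarith
qed

section \<open>The set of vertices: finiteness, quarter and connectedness\<close>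

definition S :: "(int \<Rightarrow> 'k fpoint) set set set" where
  "S = {homothety_class F V (Fil r) | r. 0 < r}"

text \<open>
  If \<open>r\<close> is at most the valuation of all nonzero \<open>\<pi>\<close>-torsion points, then division by \<open>\<pi>\<close>
  identifies \<open>Fil (g r)\<close> with \<open>Fil r\<close>.
\<close>

lemma class_reduce: "0 < r \<Longrightarrow> \<exists>r'>0. homothety_class F V (Fil r) = homothety_class F V (Fil r') \<and> A (n - 1) r' = 0"
proof (induction "A (n - 1) r" arbitrary: r rule: less_induct)
  case less
  have n1: "n - 1 < n" using n_pos by simp
  show ?case
  proof (cases "A (n - 1) r = 0")
    case False
    then have r1: "r \<le> W (n - 1) 1" using le_W_iff[OF n1 less.prems, of 1] by simp
    have Ag: "A i r = Suc (A i (g r))" if "i < n" for i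
    proof (rule A_g[OF that less.prems])
      have "W (n - 1) 1 \<le> W i 1" using W_order[of i "n - 1"] that n1 by simp
      then show "r \<le> W i 1" using r1 by simp
    qed
    have Fg: "Fil (g r) = Lat (\<lambda>i. - int (A i r) + 1)"
      unfolding Fil_eq[OF g_pos[OF less.prems]] by (rule Lat_cong) (simp add: Ag)
    have "homothety_class F V (Fil r) = homothety_class F V (Fil (g r))"
      unfolding Fg Fil_eq[OF less.prems] by (rule class_shift[symmetric])
    moreover have "A (n - 1) (g r) < A (n - 1) r" using Ag[OF n1] by simp
    ultimately show ?thesis using less.hyps[of "g r"] g_pos[OF less.prems] by metis
  qed (use less.prems in blast)
qed

text \<open>By \<open>class_reduce\<close> only r with \<open>A (n - 1) r = 0\<close> matter. Such r
  exceed r0, the valuation of the last vector of the greedy basis, so every \<open>A i r\<close> is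
  at most \<open>A i r0\<close> and only finitely many exponents occur.\<close>

lemma finite_S: "finite S"
proof (rule finite_subset)
  have n1: "n - 1 < n" using n_pos by simp
  define r0 where "r0 = W (n - 1) 1"
  have r0: "0 < r0" unfolding r0_def by (rule W_pos[OF n1])
  let ?P = "PiE {..<n} (\<lambda>i. {..A i r0})"
  let ?f = "\<lambda>a. homothety_class F V (Lat (\<lambda>i. - int (a i)))"
  show "S \<subseteq> ?f ` ?P"
  proof
    fix s assume "s \<in> S"
    then obtain r where "0 < r" "s = homothety_class F V (Fil r)" unfolding S_def by blast
    then obtain r' where r': "0 < r'" "s = homothety_class F V (Fil r')" "A (n - 1) r' = 0"
      using class_reduce by metis
    have "r0 \<le> r'" using le_W_iff[OF n1 r'(1), of 1] r'(3) by (simp add: r0_def)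
    then have mem: "restrict (\<lambda>i. A i r') {..<n} \<in> ?P" using A_antimono[OF _ r0] by auto
    have "s = ?f (restrict (\<lambda>i. A i r') {..<n})"
      unfolding r'(2) Fil_eq[OF r'(1)] by (rule arg_cong[OF Lat_cong]) simp
    then show "s \<in> ?f ` ?P" using mem by (rule image_eqI)
  qed
  show "finite (?f ` ?P)" by (intro finite_imageI finite_PiE) auto
qed

lemma S_vertices: "S \<subseteq> building_vertices F OF V n"
proof
  fix s assume "s \<in> S"
  then obtain r where r: "0 < r" "s = homothety_class F V (Fil r)" unfolding S_def by blast
  show "s \<in> building_vertices F OF V n"
    unfolding building_vertices_def r(2) Fil_eq[OF r(1)] using lattice_Lat by blast
qed

lemma S_quarter:
  "S \<subseteq> {basis_vertex F OF \<pi> V n e a | a. \<forall>i j. i \<le> j \<and> j < n \<longrightarrow> a i \<le> a j}"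
proof
  fix s assume "s \<in> S"
  then obtain r where r: "0 < r" "s = homothety_class F V (Fil r)" unfolding S_def by blast
  have "\<forall>i j. i \<le> j \<and> j < n \<longrightarrow> - int (A i r) \<le> - int (A j r)" using A_order r(1) by simp
  moreover have "s = basis_vertex F OF \<pi> V n e (\<lambda>i. - int (A i r))"
    unfolding basis_vertex_e r(2) Fil_eq[OF r(1)] ..
  ultimately show "s \<in> {basis_vertex F OF \<pi> V n e a | a. \<forall>i j. i \<le> j \<and> j < n \<longrightarrow> a i \<le> a j}" by blast
qed

abbreviation edges where
  "edges \<equiv> {(a, b). a \<in> S \<and> b \<in> S \<and> building_simplex F OF \<pi> V n {a, b}}"

text \<open>
  Multiplication by \<open>\<pi>\<close> strictly increases finite valuations, so it maps each step of the
  filtration into the next one.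
\<close>

lemma S_connected_to_infty:
  "0 < r \<Longrightarrow> (homothety_class F V (Fil r), homothety_class F V (Fil \<infinity>)) \<in> edges\<^sup>*"
proof (induction "\<Sum>i<n. A i r" arbitrary: r rule: less_induct)
  case less
  note r = less.prems
  show ?case
  proof (cases "\<forall>i<n. A i r = 0")
    case True
    then have "Fil r = Fil \<infinity>" unfolding Fil_infty Fil_eq[OF r] by (intro Lat_cong) simp
    then show ?thesis by simp
  next
    case False
    then obtain i0 where i0: "i0 < n" "0 < A i0 r" by auto
    \<comment> \<open>X consists of the values \<open>W i k\<close> that are at least r, the places
      from r on where the filtration can jump. Its least element \<mu> is finite, and
      \<open>W i0 0\<close> is infinite, so there is a next value r'.\<close>
    define X where "X = (\<lambda>(i, k). W i k) ` (SIGMA i:{..<n}. {..A i r})"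
    have XI: "W i k \<in> X" if "i < n" "k \<le> A i r" for i k using that by (force simp: X_def)
    have X: "finite X" "X \<noteq> {}" using XI[OF i0(1), of 0] by (auto simp: X_def)
    define \<mu> where "\<mu> = Min X"
    have \<mu>_le: "\<mu> \<le> W i k" if "i < n" "k \<le> A i r" for i k
      unfolding \<mu>_def using XI[OF that] X(1) by simp
    obtain i1 k1 where i1: "i1 < n" "k1 \<le> A i1 r" "\<mu> = W i1 k1"
      using Min_in[OF X] unfolding \<mu>_def X_def by auto
    have r\<mu>: "r \<le> \<mu>" unfolding i1(3) using le_W_iff[OF i1(1) r] i1(2) by simp
    have "W i0 (A i0 r) \<noteq> \<infinity>"
      using B_Suc_nonzero[OF i0(1), of "A i0 r - 1"] i0(2) w_eq_infty_iff[OF B_M[OF i0(1)]] by simp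
    then have \<mu>_fin: "\<mu> < \<infinity>" using \<mu>_le[OF i0(1) order_refl] by (cases \<mu>) auto
    let ?Y = "{x \<in> X. \<mu> < x}"
    have Y: "finite ?Y" "\<infinity> \<in> ?Y" using X(1) XI[OF i0(1), of 0] \<mu>_fin by (auto simp: W_0)
    define r' where "r' = Min ?Y"
    have "r' \<in> ?Y" unfolding r'_def using Y by (intro Min_in) auto
    then have \<mu>r': "\<mu> < r'" by simp
    then have r': "0 < r'" using r r\<mu> by simp
    have r'_le: "r' \<le> x" if "x \<in> X" "\<mu> < x" for x unfolding r'_def using that Y(1) by simp
    have le: "A i r' \<le> A i r" if "i < n" for i using r\<mu> \<mu>r' by (intro A_antimono that r) simp
    have ge: "A i r \<le> A i r' + 1" if i: "i < n" for i
    proof (cases "A i r")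
      case (Suc k)
      have "\<mu> \<le> W i (Suc k)" using \<mu>_le[OF i, of "Suc k"] Suc by simp
      also have "\<dots> < W i k" by (rule W_Suc_less[OF i])
      finally have "r' \<le> W i k" using r'_le[OF XI[OF i, of k]] Suc by simp
      then show ?thesis using le_W_iff[OF i r'] Suc by simp
    qed simp
    have less1: "A i1 r' < A i1 r"
    proof -
      have "\<not> k1 \<le> A i1 r'" using le_W_iff[OF i1(1) r', of k1] \<mu>r' unfolding i1(3) by (simp add: not_le[symmetric])
      then show ?thesis using i1(2) by simp
    qed
    have "(\<Sum>i<n. A i r') < (\<Sum>i<n. A i r)" using le less1 i1(1) by (intro sum_strict_mono_ex1) auto
    then have IH: "(homothety_class F V (Fil r'), homothety_class F V (Fil \<infinity>)) \<in> edges\<^sup>*"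
      using less.hyps r' by blast
    have sub: "Fil r' \<subset> Fil r"
    proof -
      have "\<not> Fil r \<subseteq> Fil r'"
        unfolding Fil_eq[OF r] Fil_eq[OF r'] Lat_subset_iff using less1 i1(1) by (auto simp: not_le)
      moreover have "Fil r' \<subseteq> Fil r" unfolding Fil_eq[OF r] Fil_eq[OF r'] Lat_subset_iff using le by simp
      ultimately show ?thesis by blast
    qed
    have pi: "(\<lambda>x. \<pi> \<odot>\<^bsub>V\<^esub> x) ` Fil r \<subseteq> Fil r'"
      unfolding Fil_eq[OF r] Fil_eq[OF r'] smult_Lat Lat_subset_iff using ge by force
    show ?thesis
    \<comment> \<open>If \<pi> times the larger lattice is the smaller one, both have the same
      class: there is no strict chain giving an edge, and none is needed.\<close>
    proof (cases "(\<lambda>x. \<pi> \<odot>\<^bsub>V\<^esub> x) ` Fil r = Fil r'")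
      case True
      have "homothety_class F V (Fil r') = homothety_class F V (Fil r)"
        unfolding True[symmetric] using Lat_carrier by (intro homothety_class_smult pi_F pi_0) (simp add: Fil_eq r)
      then show ?thesis using IH by simp
    next
      case False
      let ?\<Lambda> = "\<lambda>i::nat. if i = 1 then Fil r else Fil r'"
      have "building_simplex F OF \<pi> V n {homothety_class F V (Fil r), homothety_class F V (Fil r')}"
        unfolding building_simplex_def
      proof (intro exI[of _ 2] conjI exI[of _ ?\<Lambda>])
        show "\<forall>i\<in>{1..2}. is_lattice F OF V n (?\<Lambda> i)" using lattice_Lat Fil_eq r r' by simp
        show "\<forall>i\<in>{1..<2}. ?\<Lambda> (Suc i) \<subset> ?\<Lambda> i" using sub by auto
        show "(\<lambda>x. \<pi> \<odot>\<^bsub>V\<^esub> x) ` ?\<Lambda> 1 \<subset> ?\<Lambda> 2" using pi False by auto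
        have "{1..2::nat} = {1, 2}" by auto
        then show "{homothety_class F V (Fil r), homothety_class F V (Fil r')} =
          (\<lambda>i. homothety_class F V (?\<Lambda> i)) ` {1..2}" by simp
      qed simp
      then have "(homothety_class F V (Fil r), homothety_class F V (Fil r')) \<in> edges"
        using r r' unfolding S_def by blast
      then show ?thesis using IH by (rule converse_rtrancl_into_rtrancl)
    qed
  qed
qed

lemma S_connected: "connected_vertices F OF \<pi> V n S"
  unfolding connected_vertices_def
proof (intro ballI)
  fix s t assume "s \<in> S" "t \<in> S"
  then have st: "(s, homothety_class F V (Fil \<infinity>)) \<in> edges\<^sup>*" "(t, homothety_class F V (Fil \<infinity>)) \<in> edges\<^sup>*"
    using S_connected_to_infty unfolding S_def by blast+
  have "sym edges" by (auto simp: sym_def insert_commute)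
  then have "sym (edges\<^sup>*)" by (rule sym_rtrancl)
  then have "(homothety_class F V (Fil \<infinity>), t) \<in> edges\<^sup>*" using st(2) by (rule symD)
  then show "(s, t) \<in> edges\<^sup>*" by (rule rtrancl_trans[OF st(1)])
qed

lemma main:
  "finite S \<and> S \<subseteq> building_vertices F OF V n \<and>
   (\<exists>\<A>. is_apartment F OF \<pi> V n \<A> \<and> S \<subseteq> \<A>) \<and>
   (\<exists>\<A> Q. is_apartment F OF \<pi> V n \<A> \<and> Q \<subseteq> \<A> \<and>
      is_quarter F OF \<pi> V n (homothety_class F V (Fil \<infinity>)) Q \<and> S \<subseteq> Q) \<and>
   connected_vertices F OF \<pi> V n S"
proof -
  let ?\<A> = "{basis_vertex F OF \<pi> V n e a | a. True}"
  let ?Q = "{basis_vertex F OF \<pi> V n e a | a. \<forall>i j. i \<le> j \<and> j < n \<longrightarrow> a i \<le> a j}"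
  have "is_apartment F OF \<pi> V n ?\<A>"
    unfolding is_apartment_def using lattice_basis_e unfolding lattice_basis_def by blast
  moreover have "?Q \<subseteq> ?\<A>" by blast
  moreover have "is_quarter F OF \<pi> V n (homothety_class F V (Fil \<infinity>)) ?Q"
    unfolding is_quarter_def Fil_infty using lattice_basis_e by blast
  ultimately show ?thesis using finite_S S_vertices S_quarter S_connected by blast
qed

end

theorem mainTheorem2:
  fixes v :: "'k::{alg_closed_field, field_char_0} \<Rightarrow> ereal"
    and F :: "'k set" and \<pi> :: 'k and p n :: nat
    and H :: "'k pi_div"
    and \<phi> :: "'k fps \<Rightarrow> nat \<Rightarrow> 'k coords"
  assumes "valuation v" and "val_complete v"
    and "p_adic_subfield p v F" and "normalized_uniformizer v F \<pi>"
    and "pi_divisible_module v F \<pi> n H" and "pi_div_dimension v H 1"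
    and "natural_Lie_action v F H" and "formal_special_fibre v H"
    and "formal_coordinate v H \<phi>"
  shows "let OF = F \<inter> val_ring v;
             V = rational_Tate_module v \<pi> H;
             Fil = Tate_fil v \<pi> H \<phi>;
             S = {homothety_class F V (Fil r) | r. 0 < r}
         in finite S \<and> S \<subseteq> building_vertices F OF V n \<and>
            (\<exists>\<A>. is_apartment F OF \<pi> V n \<A> \<and> S \<subseteq> \<A>) \<and>
            (\<exists>\<A> Q. is_apartment F OF \<pi> V n \<A> \<and> Q \<subseteq> \<A> \<and>
               is_quarter F OF \<pi> V n (homothety_class F V (Fil \<infinity>)) Q \<and> S \<subseteq> Q) \<and>
            connected_vertices F OF \<pi> V n S"
proof -
  interpret formal_module v F \<pi> p n H \<phi>
    using assms by unfold_locales
  obtain B where "adapted_basis v F \<pi> p n H \<phi> B" using ex_adapted_basis by blast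
  then interpret adapted_basis v F \<pi> p n H \<phi> B .
  show ?thesis unfolding Let_def using main unfolding S_def .
qed

end
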